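(* Let $\mathfrak{s}=(s_1,\ldots,s_r)\in\mathbb{N}^r$ and $\mathbf{u}=(u_1,\ldots,u_r)\in(\overline{k}^\times)^r\cap\mathbb{D}_{\mathfrak{s}}$ with $\mathrm{Li}_{\mathfrak{s}}(\mathbf{u})\ne0$. Let $M$ and $M'$ be the Frobenius modules defined by the matrices $\Phi$ and $\Phi'$ of the context. For $1\le i\le j\le r$ put $\mathrm{Li}_{\mathfrak{s}_{ij}}(\mathbf{u}_{ij}):=\mathrm{Li}_{(s_i,\ldots,s_j)}(u_i,\ldots,u_j)$, assumed to be convergent. Suppose that $\mathrm{Li}_{\mathfrak{s}_{ij}}(\mathbf{u}_{ij})$ is nonzero for all $1\le i<j\le r$. Then: (a) $\mathrm{Li}_{\mathfrak{s}}(\mathbf{u})$ is Eulerian if and only if $M$ represents a torsion element in the $\mathbb{F}_q[t]$-module $\mathrm{Ext}^1_{\mathcal{F}}(\mathbf{1},M')$. (b) If $\mathrm{Li}_{\mathfrak{s}}(\mathbf{u})$ is Eulerian, then each of $\mathrm{Li}_{(s_2,\ldots,s_r)}(u_2,\ldots,u_r),\ldots,\mathrm{Li}_{s_r}(u_r)$ is also Eulerian.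
   Context: Notation. $\mathbb{N}$ is the set of positive integers; $q$ is a power of a prime; $\theta,t$ independent variables; $A=\mathbb{F}_q[\theta]$, $k=\mathbb{F}_q(\theta)$, $k_\infty=\mathbb{F}_q((1/\theta))$, $\overline{k_\infty}$ an algebraic closure, $\overline{k}$ the algebraic closure of $k$ in it, $\mathbb{C}_\infty$ the completion of $\overline{k_\infty}$, $|\cdot|_\infty$ its absolute value with $|\theta|_\infty=q$. Carlitz multiple polylogarithms. $L_0=1$, $L_i=(\theta-\theta^q)\cdots(\theta-\theta^{q^i})$. $\mathrm{Li}_{\mathfrak{s}}(z_1,\ldots,z_r)=\sum_{i_1>\cdots>i_r\ge0}\frac{z_1^{q^{i_1}}\cdots z_r^{q^{i_r}}}{L_{i_1}^{s_1}\cdots L_{i_r}^{s_r}}$. Its convergence domain $\mathbb{D}_{\mathfrak{s}}\subset\mathbb{C}_\infty^r$ is the set of $\mathbf{u}$ such that $|u_1/\theta^{qs_1/(q-1)}|_\infty^{q^{i_1}}\cdots|u_r/\theta^{qs_r/(q-1)}|_\infty^{q^{i_r}}\to0$ as $0\le i_r<\cdots<i_1\to\infty$. $\tilde\pi$ is a fixed fundamental period of the Carlitz module (a generator over $A$ of the kernel of $\exp_{\mathbf{C}}(z)=\sum_{i\ge0}z^{q^i}/D_i$, $D_0=1$, $D_i=\prod_{j=0}^{i-1}(\theta^{q^i}-\theta^{q^j})$). A nonzero value $\mathrm{Li}_{\mathfrak{s}}(\mathbf{u})$ at an algebraic point is called Eulerian if $\mathrm{Li}_{\mathfrak{s}}(\mathbf{u})/\tilde\pi^{s_1+\cdots+s_r}\in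 k$. Frobenius modules. For $f=\sum a_it^i$, $f^{(-1)}=\sum a_i^{1/q}t^i$. $\overline{k}[t,\sigma]$ is the noncommutative $\overline{k}[t]$-algebra generated by $\sigma$ with $\sigma f=f^{(-1)}\sigma$. A Frobenius module is a left $\overline{k}[t,\sigma]$-module free of finite rank over $\overline{k}[t]$; with left $\overline{k}[t,\sigma]$-linear maps these form the category $\mathcal{F}$. A Frobenius module is defined by $\Phi\in\mathrm{Mat}_n(\overline{k}[t])$ if it has a $\overline{k}[t]$-basis, written as a column $\mathbf{m}$, with $\sigma\mathbf{m}=\Phi\mathbf{m}$. $\mathbf{1}$ is $\overline{k}[t]$ with $\sigma f=f^{(-1)}$. If $M'$ is defined by $\Phi'$, then a module defined by $\begin{pmatrix}\Phi'&0\\ \mathbf{v}&1\end{pmatrix}$ is an extension $0\to M'\to M\to\mathbf{1}\to0$ and represents a class in $\mathrm{Ext}^1_{\mathcal{F}}(\mathbf{1},M')$. This group is an $\mathbb{F}_q[t]$-module: Baer sum corresponds to adding the rows $\mathbf{v}$, and multiplication by $a\in\mathbb{F}_q[t]$ (pushout along multiplication by $a$ on $M'$) to replacing $\mathbf{v}$ by $a\mathbf{v}$. Matrices. $\Phi\in\mathrm{Mat}_{r+1}(\overline{k}[t])$ is lower bidiagonal with $\Phi_{ii}=(t-\theta)^{s_i+\cdots+s_r}$ for $1\le i\le r$, $\Phi_{r+1,r+1}=1$, $\Phi_{i+1,i}=u_i^{(-1)}(t-\theta)^{s_i+\cdots+s_r}$ for $1\le i\le r$ (here $u_i^{(-1)}=u_i^{1/q}$),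 and zeros elsewhere; $\Phi'$ is its upper left $r\times r$ block. *)

theory Defs
  imports
    "HOL-Algebra.Algebraic_Closure_Type"
    "HOL-Algebra.Module"
    "HOL-Library.Cardinality"
    "HOL-Analysis.Infinite_Sum"
    "Jordan_Normal_Form.Matrix"
begin

section \<open>The field \<open>\<complex>\<^sub>\<infinity>\<close>\<close>

text \<open>
  The topology of a nonarchimedean valued field is carried by the type class \<open>metric_space\<close>;
  the absolute value of \<open>x\<close> is the distance from \<open>x\<close> to \<open>0\<close>.
  (\<open>real_normed_field\<close> is not available in positive characteristic.)
\<close>

class nonarchimedean_field = field + metric_space +
  assumes dist_eq_diff: "dist x y = dist (x - y) 0"
    and dist_mult_0: "dist (x * y) 0 = dist x 0 * dist y 0"
    and dist_ultrametric: "dist x z \<le> max (dist x y) (dist y z)"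

abbreviation absv :: "'c::nonarchimedean_field \<Rightarrow> real"
  where "absv x \<equiv> dist x 0"

text \<open>
  The finite field \<open>\<bbbF>\<^sub>q\<close> is a type \<open>'f\<close>, so \<open>q = CARD('f)\<close>. The field \<open>k\<^sub>\<infinity> = \<bbbF>\<^sub>q((1/\<theta>))\<close> is
  \<^typ>\<open>'f fls\<close>, whose variable \<open>X\<close> plays the role of \<open>1/\<theta>\<close>, and \<^typ>\<open>'f fls alg_closure\<close>
  is its algebraic closure. The locale says that \<open>\<iota>\<close> exhibits the complete field \<open>'c\<close> as the completion
  of that algebraic closure, with the absolute value normalised by \<open>\<bar>\<theta>\<bar> = q\<close>.
\<close>

locale C_infinity =
  fixes \<iota> :: "'f::{finite,field} fls alg_closure \<Rightarrow> 'c::{nonarchimedean_field,complete_space}"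
  assumes emb_add: "\<iota> (x + y) = \<iota> x + \<iota> y"
    and emb_mult: "\<iota> (x * y) = \<iota> x * \<iota> y"
    and emb_one: "\<iota> 1 = 1"
    and emb_absv: "f \<noteq> 0 \<Longrightarrow> absv (\<iota> (to_ac f)) = real CARD('f) powi (- fls_subdegree f)"
    and emb_dense: "closure (range \<iota>) = UNIV"

type_synonym ('f, 'c) emb = "'f fls alg_closure \<Rightarrow> 'c"

definition theta :: "('f::{finite,field}, 'c::field) emb \<Rightarrow> 'c"
  where "theta \<iota> = \<iota> (to_ac fls_X_inv)"

definition Fq :: "('f::{finite,field}, 'c::field) emb \<Rightarrow> 'c set"
  where "Fq \<iota> = range (\<lambda>a. \<iota> (to_ac (fls_const a)))"

definition polys_over :: "'c::comm_ring_1 set \<Rightarrow> 'c poly set"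
  where "polys_over K = {f. \<forall>i. Polynomial.coeff f i \<in> K}"

definition ring_A :: "('f::{finite,field}, 'c::field) emb \<Rightarrow> 'c set"
  where "ring_A \<iota> = (\<lambda>f. poly f (theta \<iota>)) ` polys_over (Fq \<iota>)"

definition field_k :: "('f::{finite,field}, 'c::field) emb \<Rightarrow> 'c set"
  where "field_k \<iota> = {a / b | a b. a \<in> ring_A \<iota> \<and> b \<in> ring_A \<iota> \<and> b \<noteq> 0}"

definition kbar :: "('f::{finite,field}, 'c::field) emb \<Rightarrow> 'c set"
  where "kbar \<iota> = {x \<in> range \<iota>. \<exists>f \<in> polys_over (field_k \<iota>). f \<noteq> 0 \<and> poly f x = 0}"

section \<open>Carlitz multiple polylogarithms\<close>

definition carlitz_L :: "('f::{finite,field}, 'c::field) emb \<Rightarrow> nat \<Rightarrow> 'c"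
  where "carlitz_L \<iota> i = (\<Prod>j=1..i. theta \<iota> - theta \<iota> ^ (CARD('f) ^ j))"

definition carlitz_D :: "('f::{finite,field}, 'c::field) emb \<Rightarrow> nat \<Rightarrow> 'c"
  where "carlitz_D \<iota> i = (\<Prod>j<i. theta \<iota> ^ (CARD('f) ^ i) - theta \<iota> ^ (CARD('f) ^ j))"

definition carlitz_exp :: "('f::{finite,field}, 'c::nonarchimedean_field) emb \<Rightarrow> 'c \<Rightarrow> 'c"
  where "carlitz_exp \<iota> z = (\<Sum>i. z ^ (CARD('f) ^ i) / carlitz_D \<iota> i)"

definition fundamental_period :: "('f::{finite,field}, 'c::nonarchimedean_field) emb \<Rightarrow> 'c \<Rightarrow> bool"
  where "fundamental_period \<iota> \<pi> \<longleftrightarrow> {z. carlitz_exp \<iota> z = 0} = (\<lambda>a. a * \<pi>) ` ring_A \<iota>"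

text \<open>Tuples are lists; the head of an index list is the largest index \<open>i\<^sub>1\<close>.\<close>

definition Li_indices :: "nat \<Rightarrow> nat list set"
  where "Li_indices r = {is. length is = r \<and> sorted_wrt (>) is}"

text \<open>In a complete nonarchimedean field, the series converges iff it converges unconditionally,
  so the sum is taken over the index set without choosing an order.\<close>

definition Li :: "('f::{finite,field}, 'c::nonarchimedean_field) emb \<Rightarrow> nat list \<Rightarrow> 'c list \<Rightarrow> 'c"
  where "Li \<iota> ss zs = (\<Sum>\<^sub>\<infinity>is\<in>Li_indices (length ss).
           \<Prod>j<length ss. (zs ! j) ^ (CARD('f) ^ (is ! j)) / carlitz_L \<iota> (is ! j) ^ (ss ! j))"

text \<open>The absolute value of the (only up to a root of unity defined) fractional power
  \<open>\<theta>\<^bsup>qs/(q-1)\<^esup>\<close> is \<open>\<bar>\<theta>\<bar>\<^bsup>qs/(q-1)\<^esup>\<close>; the limit is for \<open>i\<^sub>1 \<rightarrow> \<infinity>\<close>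
  within the set of index lists.\<close>

definition Li_domain :: "('f::{finite,field}, 'c::nonarchimedean_field) emb \<Rightarrow> nat list \<Rightarrow> 'c list set"
  where "Li_domain \<iota> ss = {us. length us = length ss \<and>
    ((\<lambda>is. \<Prod>j<length ss.
        (absv (us ! j) / absv (theta \<iota>) powr (real (CARD('f) * ss ! j) / real (CARD('f) - 1)))
          ^ (CARD('f) ^ (is ! j))) \<longlongrightarrow> 0)
      (inf (filtercomap hd at_top) (principal (Li_indices (length ss))))}"

definition eulerian ::
  "('f::{finite,field}, 'c::nonarchimedean_field) emb \<Rightarrow> 'c \<Rightarrow> nat list \<Rightarrow> 'c list \<Rightarrow> bool"
  where "eulerian \<iota> \<pi> ss us \<longleftrightarrow>
    set us \<subseteq> kbar \<iota> \<and> us \<in> Li_domain \<iota> ss \<and> Li \<iota> ss us \<noteq> 0 \<and>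
    Li \<iota> ss us / \<pi> ^ sum_list ss \<in> field_k \<iota>"

section \<open>Frobenius modules\<close>

definition kbar_t :: "('f::{finite,field}, 'c::field) emb \<Rightarrow> 'c poly ring"
  where "kbar_t \<iota> = ring_of_type_algebra \<lparr>carrier := polys_over (kbar \<iota>)\<rparr>"

definition Fq_t :: "('f::{finite,field}, 'c::field) emb \<Rightarrow> 'c poly ring"
  where "Fq_t \<iota> = ring_of_type_algebra \<lparr>carrier := polys_over (Fq \<iota>)\<rparr>"

definition qroot :: "('f::{finite,field}, 'c::field) emb \<Rightarrow> 'c \<Rightarrow> 'c"
  where "qroot \<iota> x = (THE y. y ^ CARD('f) = x)"

definition twist :: "('f::{finite,field}, 'c::field) emb \<Rightarrow> 'c poly \<Rightarrow> 'c poly"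
  where "twist \<iota> f = map_poly (qroot \<iota>) f"

record ('a, 'm) frob_module = "('a, 'm) module" +
  frob :: "'m \<Rightarrow> 'm"

definition lin_comb :: "('a, 'm, 'z) module_scheme \<Rightarrow> nat \<Rightarrow> (nat \<Rightarrow> 'm) \<Rightarrow> (nat \<Rightarrow> 'a) \<Rightarrow> 'm"
  where "lin_comb M n b c = (\<Oplus>\<^bsub>M\<^esub>i\<in>{..<n}. c i \<odot>\<^bsub>M\<^esub> b i)"

definition is_basis ::
  "('a, 'y) ring_scheme \<Rightarrow> ('a, 'm, 'z) module_scheme \<Rightarrow> nat \<Rightarrow> (nat \<Rightarrow> 'm) \<Rightarrow> bool"
  where "is_basis R M n b \<longleftrightarrow> b ` {..<n} \<subseteq> carrier M \<and>
    (\<forall>x\<in>carrier M. \<exists>!c. c \<in> {..<n} \<rightarrow>\<^sub>E carrier R \<and> x = lin_comb M n b c)"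

definition coords ::
  "('a, 'y) ring_scheme \<Rightarrow> ('a, 'm, 'z) module_scheme \<Rightarrow> nat \<Rightarrow> (nat \<Rightarrow> 'm) \<Rightarrow> 'm \<Rightarrow> nat \<Rightarrow> 'a"
  where "coords R M n b x = (THE c. c \<in> {..<n} \<rightarrow>\<^sub>E carrier R \<and> x = lin_comb M n b c)"

text \<open>
  By the presentation of the noncommutative algebra, a left module over it is a module over the
  polynomial ring together with an additive map \<open>\<sigma>\<close> (the field \<^const>\<open>frob\<close>) satisfying
  \<open>\<sigma> (f x) = f\<^bsup>(-1)\<^esup> \<sigma> x\<close>.
\<close>

definition frobenius_module ::
  "('f::{finite,field}, 'c::field) emb \<Rightarrow> ('c poly, 'm) frob_module \<Rightarrow> bool"
  where "frobenius_module \<iota> M \<longleftrightarrow> module (kbar_t \<iota>) M \<and>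
    frob M \<in> carrier M \<rightarrow> carrier M \<and>
    (\<forall>x\<in>carrier M. \<forall>y\<in>carrier M. frob M (x \<oplus>\<^bsub>M\<^esub> y) = frob M x \<oplus>\<^bsub>M\<^esub> frob M y) \<and>
    (\<forall>f\<in>carrier (kbar_t \<iota>). \<forall>x\<in>carrier M. frob M (f \<odot>\<^bsub>M\<^esub> x) = twist \<iota> f \<odot>\<^bsub>M\<^esub> frob M x) \<and>
    (\<exists>n b. is_basis (kbar_t \<iota>) M n b)"

definition frob_hom ::
  "('f::{finite,field}, 'c::field) emb \<Rightarrow> ('c poly, 'm) frob_module \<Rightarrow> ('c poly, 'n) frob_module
    \<Rightarrow> ('m \<Rightarrow> 'n) \<Rightarrow> bool"
  where "frob_hom \<iota> M N \<phi> \<longleftrightarrow> \<phi> \<in> carrier M \<rightarrow> carrier N \<and>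
    (\<forall>x\<in>carrier M. \<forall>y\<in>carrier M. \<phi> (x \<oplus>\<^bsub>M\<^esub> y) = \<phi> x \<oplus>\<^bsub>N\<^esub> \<phi> y) \<and>
    (\<forall>f\<in>carrier (kbar_t \<iota>). \<forall>x\<in>carrier M. \<phi> (f \<odot>\<^bsub>M\<^esub> x) = f \<odot>\<^bsub>N\<^esub> \<phi> x) \<and>
    (\<forall>x\<in>carrier M. \<phi> (frob M x) = frob N (\<phi> x))"

text \<open>The basis \<open>b\<close>, seen as a column, satisfies \<open>\<sigma> b = \<Phi> b\<close>.\<close>

definition defined_by ::
  "('f::{finite,field}, 'c::field) emb \<Rightarrow> ('c poly, 'm) frob_module \<Rightarrow> (nat \<Rightarrow> 'm) \<Rightarrow> 'c poly mat \<Rightarrow> bool"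
  where "defined_by \<iota> M b \<Phi> \<longleftrightarrow> frobenius_module \<iota> M \<and>
    (\<exists>n. \<Phi> \<in> carrier_mat n n \<and> elements_mat \<Phi> \<subseteq> carrier (kbar_t \<iota>) \<and> is_basis (kbar_t \<iota>) M n b \<and>
      (\<forall>i<n. frob M (b i) = lin_comb M n b (\<lambda>j. index_mat \<Phi> (i, j))))"

definition unit_module :: "('f::{finite,field}, 'c::field) emb \<Rightarrow> ('c poly, 'c poly) frob_module"
  where "unit_module \<iota> = \<lparr>carrier = carrier (kbar_t \<iota>), monoid.mult = (*), one = 1,
    ring.zero = 0, add = (+), module.smult = (*), frob = twist \<iota>\<rparr>"

section \<open>Extensions of the unit module\<close>

text \<open>An extension \<open>0 \<rightarrow> M' \<rightarrow> E \<rightarrow> \<one> \<rightarrow> 0\<close> consists of the middle term and the two maps.\<close>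

record ('a, 'n, 'm) extension =
  middle :: "('a, 'm) frob_module"
  incl :: "'n \<Rightarrow> 'm"
  proj :: "'m \<Rightarrow> 'a"

definition is_extension ::
  "('f::{finite,field}, 'c::field) emb \<Rightarrow> ('c poly, 'n) frob_module \<Rightarrow> ('c poly, 'n, 'm) extension \<Rightarrow> bool"
  where "is_extension \<iota> M' E \<longleftrightarrow>
    frobenius_module \<iota> M' \<and> frobenius_module \<iota> (middle E) \<and>
    frob_hom \<iota> M' (middle E) (incl E) \<and> frob_hom \<iota> (middle E) (unit_module \<iota>) (proj E) \<and>
    inj_on (incl E) (carrier M') \<and>
    incl E ` carrier M' = {x \<in> carrier (middle E). proj E x = 0} \<and>
    proj E ` carrier (middle E) = carrier (unit_module \<iota>)"

text \<open>\<open>\<phi>\<close> is the middle map of a morphism \<open>(\<alpha>, \<phi>, id)\<close> of extensions, where \<open>\<alpha>\<close> is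
  defined on the set \<open>N\<close>.\<close>

definition ext_morphism ::
  "('f::{finite,field}, 'c::field) emb \<Rightarrow> 'n1 set \<Rightarrow> ('n1 \<Rightarrow> 'n2) \<Rightarrow>
    ('c poly, 'n1, 'm1) extension \<Rightarrow> ('c poly, 'n2, 'm2) extension \<Rightarrow> ('m1 \<Rightarrow> 'm2) \<Rightarrow> bool"
  where "ext_morphism \<iota> N \<alpha> E1 E2 \<phi> \<longleftrightarrow>
    frob_hom \<iota> (middle E1) (middle E2) \<phi> \<and>
    (\<forall>x\<in>N. \<phi> (incl E1 x) = incl E2 (\<alpha> x)) \<and>
    (\<forall>y\<in>carrier (middle E1). proj E2 (\<phi> y) = proj E1 y)"

definition ext_equiv ::
  "('f::{finite,field}, 'c::field) emb \<Rightarrow> ('c poly, 'n) frob_module \<Rightarrow>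
    ('c poly, 'n, 'm1) extension \<Rightarrow> ('c poly, 'n, 'm2) extension \<Rightarrow> bool"
  where "ext_equiv \<iota> M' E1 E2 \<longleftrightarrow>
    (\<exists>\<phi>. ext_morphism \<iota> (carrier M') (\<lambda>x. x) E1 E2 \<phi> \<and>
         bij_betw \<phi> (carrier (middle E1)) (carrier (middle E2)))"

text \<open>
  Classes of extensions are formed inside the type \<^typ>\<open>nat \<Rightarrow> 'c poly\<close> of middle terms. It contains
  a copy of every free module of finite rank, hence a representative of every extension.
  The extension whose class is taken may live in any type.
\<close>

definition ext_class ::
  "('f::{finite,field}, 'c::field) emb \<Rightarrow> ('c poly, 'n) frob_module \<Rightarrow> ('c poly, 'n, 'm) extension
    \<Rightarrow> ('c poly, 'n, nat \<Rightarrow> 'c poly) extension set"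
  where "ext_class \<iota> M' E = {E2. is_extension \<iota> M' E2 \<and> ext_equiv \<iota> M' E E2}"

text \<open>
  The pushout of \<open>E\<close> along \<open>\<alpha> : M' \<rightarrow> M'\<close> is the extension \<open>E2\<close>, unique up to equivalence, that
  admits a morphism \<open>(\<alpha>, \<phi>, id) : E \<rightarrow> E2\<close>.
\<close>

definition ext_smult ::
  "('f::{finite,field}, 'c::field) emb \<Rightarrow> ('c poly, 'n) frob_module \<Rightarrow> 'c poly
    \<Rightarrow> ('c poly, 'n, nat \<Rightarrow> 'c poly) extension set \<Rightarrow> ('c poly, 'n, nat \<Rightarrow> 'c poly) extension set"
  where "ext_smult \<iota> M' a C = {E2. is_extension \<iota> M' E2 \<and>
    (\<exists>E\<in>C. \<exists>\<phi>. ext_morphism \<iota> (carrier M') (\<lambda>x. a \<odot>\<^bsub>M'\<^esub> x) E E2 \<phi>)}"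

text \<open>
  The Baer sum is the pushout, along the addition \<open>M' \<oplus> M' \<rightarrow> M'\<close>, of the extension of \<open>\<one>\<close> by
  \<open>M' \<oplus> M'\<close> whose middle term is the fibre product over \<open>\<one>\<close>. The multiplicative operations of a
  module record carry no meaning.
\<close>

definition fibre_product ::
  "('c::field poly, 'n1, 'm1) extension \<Rightarrow> ('c poly, 'n2, 'm2) extension
    \<Rightarrow> ('c poly, 'n1 \<times> 'n2, 'm1 \<times> 'm2) extension"
  where "fibre_product E1 E2 = \<lparr>
    middle = \<lparr>carrier = {(x, y). x \<in> carrier (middle E1) \<and> y \<in> carrier (middle E2) \<and> proj E1 x = proj E2 y},
      monoid.mult = undefined, one = undefined,
      ring.zero = (\<zero>\<^bsub>middle E1\<^esub>, \<zero>\<^bsub>middle E2\<^esub>),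
      add = (\<lambda>(x, y) (x', y'). (x \<oplus>\<^bsub>middle E1\<^esub> x', y \<oplus>\<^bsub>middle E2\<^esub> y')),
      module.smult = (\<lambda>f (x, y). (f \<odot>\<^bsub>middle E1\<^esub> x, f \<odot>\<^bsub>middle E2\<^esub> y)),
      frob = (\<lambda>(x, y). (frob (middle E1) x, frob (middle E2) y))\<rparr>,
    incl = (\<lambda>(x, y). (incl E1 x, incl E2 y)),
    proj = (\<lambda>(x, y). proj E1 x)\<rparr>"

definition ext_add ::
  "('f::{finite,field}, 'c::field) emb \<Rightarrow> ('c poly, 'n) frob_module
    \<Rightarrow> ('c poly, 'n, nat \<Rightarrow> 'c poly) extension set \<Rightarrow> ('c poly, 'n, nat \<Rightarrow> 'c poly) extension set
    \<Rightarrow> ('c poly, 'n, nat \<Rightarrow> 'c poly) extension set"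
  where "ext_add \<iota> M' C C' = {E3. is_extension \<iota> M' E3 \<and>
    (\<exists>E1\<in>C. \<exists>E2\<in>C'. \<exists>\<phi>. ext_morphism \<iota> (carrier M' \<times> carrier M') (\<lambda>(x, y). x \<oplus>\<^bsub>M'\<^esub> y)
       (fibre_product E1 E2) E3 \<phi>)}"

definition ext_split ::
  "('f::{finite,field}, 'c::field) emb \<Rightarrow> ('c poly, 'n, 'm) extension \<Rightarrow> bool"
  where "ext_split \<iota> E \<longleftrightarrow> (\<exists>\<psi>. frob_hom \<iota> (unit_module \<iota>) (middle E) \<psi> \<and>
    (\<forall>f\<in>carrier (unit_module \<iota>). proj E (\<psi> f) = f))"

definition Ext1 ::
  "('f::{finite,field}, 'c::field) emb \<Rightarrow> ('c poly, 'n) frob_module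
    \<Rightarrow> ('c poly, ('c poly, 'n, nat \<Rightarrow> 'c poly) extension set) module"
  where "Ext1 \<iota> M' = \<lparr>
    carrier = ext_class \<iota> M' ` {E :: ('c poly, 'n, nat \<Rightarrow> 'c poly) extension. is_extension \<iota> M' E},
    monoid.mult = undefined, one = undefined,
    ring.zero = {E. is_extension \<iota> M' E \<and> ext_split \<iota> E},
    add = ext_add \<iota> M', module.smult = ext_smult \<iota> M'\<rparr>"

definition torsion_element ::
  "('a, 'y) ring_scheme \<Rightarrow> ('a, 'x, 'z) module_scheme \<Rightarrow> 'x \<Rightarrow> bool"
  where "torsion_element R C x \<longleftrightarrow>
    x \<in> carrier C \<and> (\<exists>a\<in>carrier R. a \<noteq> \<zero>\<^bsub>R\<^esub> \<and> a \<odot>\<^bsub>C\<^esub> x = \<zero>\<^bsub>C\<^esub>)"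

text \<open>
  The extension carried by a module \<open>M\<close> with basis \<open>m\<^sub>0, \<dots>, m\<^sub>r\<close> whose defining matrix is
  block lower triangular: the map \<open>M' \<rightarrow> M\<close> sends \<open>m'\<^sub>i\<close> to \<open>m\<^sub>i\<close>, and \<open>M \<rightarrow> \<one>\<close> takes the coordinate
  at \<open>m\<^sub>r\<close>.
\<close>

definition block_extension ::
  "('f::{finite,field}, 'c::field) emb \<Rightarrow> nat \<Rightarrow> ('c poly, 'n) frob_module \<Rightarrow> (nat \<Rightarrow> 'n)
    \<Rightarrow> ('c poly, 'm) frob_module \<Rightarrow> (nat \<Rightarrow> 'm) \<Rightarrow> ('c poly, 'n, 'm) extension"
  where "block_extension \<iota> r M' m' M m = \<lparr>
    middle = M,
    incl = (\<lambda>x. lin_comb M r m (coords (kbar_t \<iota>) M' r m' x)),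
    proj = (\<lambda>y. coords (kbar_t \<iota>) M (Suc r) m y r)\<rparr>"

section \<open>The matrices\<close>

text \<open>Entries are given for row and column numbers counted from \<open>1\<close>; \<^typ>\<open>'a mat\<close> counts from \<open>0\<close>.\<close>

definition Phi_entry ::
  "('f::{finite,field}, 'c::field) emb \<Rightarrow> nat \<Rightarrow> (nat \<Rightarrow> nat) \<Rightarrow> (nat \<Rightarrow> 'c) \<Rightarrow> nat \<Rightarrow> nat \<Rightarrow> 'c poly"
  where "Phi_entry \<iota> r s u i j =
    (if i = Suc r \<and> j = Suc r then 1
     else if i = j then [:- theta \<iota>, 1:] ^ (\<Sum>l=j..r. s l)
     else if i = Suc j then [:qroot \<iota> (u j):] * [:- theta \<iota>, 1:] ^ (\<Sum>l=j..r. s l)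
     else 0)"

definition Phi ::
  "('f::{finite,field}, 'c::field) emb \<Rightarrow> nat \<Rightarrow> (nat \<Rightarrow> nat) \<Rightarrow> (nat \<Rightarrow> 'c) \<Rightarrow> 'c poly mat"
  where "Phi \<iota> r s u = mat (Suc r) (Suc r) (\<lambda>(i, j). Phi_entry \<iota> r s u (Suc i) (Suc j))"

definition Phi' ::
  "('f::{finite,field}, 'c::field) emb \<Rightarrow> nat \<Rightarrow> (nat \<Rightarrow> nat) \<Rightarrow> (nat \<Rightarrow> 'c) \<Rightarrow> 'c poly mat"
  where "Phi' \<iota> r s u = mat r r (\<lambda>(i, j). Phi_entry \<iota> r s u (Suc i) (Suc j))"

text \<open>The segment \<open>(x\<^sub>i, \<dots>, x\<^sub>j)\<close> of a tuple indexed from \<open>1\<close>.\<close>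

definition seg :: "(nat \<Rightarrow> 'a) \<Rightarrow> nat \<Rightarrow> nat \<Rightarrow> 'a list"
  where "seg x i j = map x [i..<Suc j]"

end

theory Submission
  imports Defs "Jordan_Normal_Form.Char_Poly"
begin

text \<open>
  Let \<open>\<Omega>\<close> be the entire solution of \<open>\<Omega> = (t - \<theta>\<^sup>q) \<Omega>\<^sup>(\<^sup>1\<^sup>)\<close>, where \<open>f\<^sup>(\<^sup>n\<^sup>)\<close> raises coefficients to the \<open>q\<^sup>n\<close>-th power,
  and let \<open>T\<^sub>0 = 1\<close>, \<open>T\<^sub>j = T\<^sub>j\<^sup>(\<^sup>1\<^sup>) + u\<^sub>j \<Omega>\<^bsup>s\<^sub>j\<^esup> T\<^sub>j\<^sub>-\<^sub>1\<^sup>(\<^sup>1\<^sup>)\<close>. Then \<open>T\<^sub>r(\<theta>)\<close> is \<open>\<Omega>(\<theta>)\<^bsup>s\<^sub>1+...+s\<^sub>r\<^esup>\<close> times the polylogarithm,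
  and \<open>\<pi> \<Omega>(\<theta>)\<close> is a nonzero element of \<open>\<bbbF>\<^sub>q[\<theta>]\<close>, so the polylogarithm is Eulerian iff \<open>T\<^sub>r(\<theta>) \<in> k\<close>.
  With \<open>w\<^sub>c = s\<^sub>c + ... + s\<^sub>r\<close>, both this and the torsion condition amount to the solvability of the system
  \<open>\<delta>\<^sub>c\<^sup>(\<^sup>1\<^sup>) = (t - \<theta>\<^sup>q)\<^bsup>w\<^sub>c\<^esup> (\<delta>\<^sub>c + u\<^sub>c \<delta>\<^sub>c\<^sub>+\<^sub>1)\<close>, \<open>\<delta>\<^sub>r\<^sub>+\<^sub>1 = a\<close>, with \<open>\<delta>\<^sub>c\<close> polynomials over the algebraic closure of \<open>k\<close>
  and \<open>0 \<noteq> a \<in> \<bbbF>\<^sub>q[t]\<close>; dropping the first equations of a solution gives (b). A solution makes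
  \<open>\<Sum> \<delta>\<^sub>c \<Omega>\<^bsup>w\<^sub>c\<^esup> T\<^sub>c\<^sub>-\<^sub>1\<close> invariant under the twist, hence a polynomial over \<open>\<bbbF>\<^sub>q\<close>, and evaluation at \<open>\<theta>\<^sup>q\<close>, a zero of \<open>\<Omega>\<close>,
  puts \<open>T\<^sub>r(\<theta>)\<close> in \<open>k\<close>. Conversely, if \<open>b(\<theta>) T\<^sub>r(\<theta>) = c(\<theta>)\<close>, the case needed of the
  Anderson-Brownawell-Papanikolas criterion, proved here from Siegel's lemma, a Schwarz lemma and Liouville's
  inequality, makes \<open>b T\<^sub>r - c\<close> and the \<open>\<Omega>\<^bsup>w\<^sub>c\<^esup> T\<^sub>c\<^sub>-\<^sub>1\<close> linearly dependent over the polynomials, and a dependence with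
  monic last coefficient of least degree is invariant under the twist and solves the system.
\<close>

text \<open>The criterion needs one relation at \<theta> to act at many points: invertible values
  A^(n)(\<theta>) carry it from \<psi>^(n) to \<psi>^(n+1), and a form \<Sum> g_i \<psi>_i^(V) whose
  coefficient vector is proportional to the transported relation at \<theta>^(q^j) vanishes there.
  The obstacle is that the forms derived from one such form may span fewer than l dimensions, so
  that no determinant is available to bound from below. They then satisfy a companion system of
  smaller size with a new relation. This is why \<open>abp_data\<close> admits an arbitrary matrix,
  a factor s0 and a starting level n0, and why the criterion is proved by induction on l. Untwisting
  takes q-th roots of coefficients, which leave every fixed order; all estimates are therefore made
  after twisting back to a common level, and the root is extracted from the final inequality. Sizes
  are degrees of multiplication matrices over F_q[\<theta>], so neither conjugates nor separability
  of algebraic elements enter.\<close>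

lemma finite_bound:
  fixes P :: "nat \<Rightarrow> 'b::linorder \<Rightarrow> bool"
  assumes "\<And>i. i < l \<Longrightarrow> \<exists>B. P i B" "\<And>i B B'. P i B \<Longrightarrow> B \<le> B' \<Longrightarrow> P i B'"
  shows "\<exists>B. B \<ge> B0 \<and> (\<forall>i<l. P i B)" using assms(1)
proof (induction l)
  case (Suc l)
  obtain B where B: "B \<ge> B0" "\<forall>i<l. P i B" using Suc.IH Suc.prems by (meson less_SucI)
  obtain B' where "P l B'" using Suc.prems by blast
  hence "P i (max B B')" if "i < Suc l" for i
    using B(2) that assms(2)[of i B "max B B'"] assms(2)[of l B' "max B B'"] by (cases "i = l") auto
  thus ?case using B(1) by (intro exI[of _ "max B B'"]) (auto simp: le_max_iff_disj)
qed auto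

section \<open>Nonarchimedean absolute values and convergence\<close>

lemma absv_mult: "absv (x * y) = absv x * absv (y::'c::nonarchimedean_field)" by (rule dist_mult_0)

lemma absv_1 [simp]: "absv (1::'c::nonarchimedean_field) = 1"
proof -
  have "absv (1::'c) * absv (1::'c) = absv (1::'c)" by (simp flip: absv_mult)
  moreover have "absv (1::'c) \<noteq> 0" by simp
  ultimately show ?thesis by simp
qed

lemma absv_minus [simp]: "absv (- x) = absv (x::'c::nonarchimedean_field)"
  using dist_eq_diff[of 0 x] by (simp add: dist_commute)

lemma absv_add_le: "absv (x + y) \<le> max (absv x) (absv (y::'c::nonarchimedean_field))"
proof -
  have "dist (x + y) 0 \<le> max (dist (x + y) y) (dist y 0)" by (rule dist_ultrametric)
  also have "dist (x + y) y = absv x" using dist_eq_diff[of "x + y" y] by simp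
  finally show ?thesis .
qed

lemma absv_add_leI:
  "absv x \<le> B \<Longrightarrow> absv y \<le> B \<Longrightarrow> absv (x + y :: 'c::nonarchimedean_field) \<le> B"
  using absv_add_le[of x y] by linarith

lemma absv_add_lessI:
  "absv x < B \<Longrightarrow> absv y < B \<Longrightarrow> absv (x + y :: 'c::nonarchimedean_field) < B"
  using absv_add_le[of x y] by linarith

lemma absv_diff_commute: "absv (x - y) = absv (y - x :: 'c::nonarchimedean_field)"
  using absv_minus[of "x - y"] by simp

text \<open>The isosceles principle. Exact absolute values, such as those of polynomials in
  \<theta>, of \<Omega>(\<theta>) and of the Carlitz factorials, are computed with it.\<close>

lemma absv_add_dominant:
  assumes "absv y < absv (x::'c::nonarchimedean_field)"
  shows "absv (x + y) = absv x"
proof (rule antisym)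
  show "absv (x + y) \<le> absv x" using assms by (intro absv_add_leI) auto
  have "absv ((x + y) + (- y)) \<le> max (absv (x + y)) (absv (- y))" by (rule absv_add_le)
  thus "absv x \<le> absv (x + y)" using assms by (auto simp: max_def split: if_splits)
qed

lemma absv_power: "absv (x ^ n) = absv (x::'c::nonarchimedean_field) ^ n" by (induction n) (auto simp: absv_mult)

lemma absv_prod: "absv (prod f A) = (\<Prod>i\<in>A. absv (f i :: 'c::nonarchimedean_field))"
  by (induction A rule: infinite_finite_induct) (auto simp: absv_mult)

lemma absv_inverse: "absv (inverse x) = inverse (absv (x::'c::nonarchimedean_field))"
proof (cases "x = 0")
  case False
  hence "absv x * absv (inverse x) = 1" by (simp flip: absv_mult)
  thus ?thesis using False by (simp add: field_simps)
qed auto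

lemma absv_divide: "absv (x / y) = absv x / absv (y::'c::nonarchimedean_field)"
  by (simp add: divide_inverse absv_mult absv_inverse)

lemma absv_sum_le:
  assumes "\<And>i. i \<in> A \<Longrightarrow> absv (f i :: 'c::nonarchimedean_field) \<le> B" "B \<ge> 0"
  shows "absv (sum f A) \<le> B" using assms by (induction A rule: infinite_finite_induct) (auto intro: absv_add_leI)

lemma absv_sum_less:
  assumes "\<And>i. i \<in> A \<Longrightarrow> absv (f i :: 'c::nonarchimedean_field) < B" "B > 0"
  shows "absv (sum f A) < B" using assms by (induction A rule: infinite_finite_induct) (auto intro: absv_add_lessI)

lemma dist_absv: "NO_MATCH 0 y \<Longrightarrow> dist x y = absv (x - y :: 'c::nonarchimedean_field)"
  by (rule dist_eq_diff)

lemma absv_diff: "absv (x - y :: 'c::nonarchimedean_field) = dist x y" by (rule dist_eq_diff[symmetric])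

lemma tendsto_absv_iff:
  "(f \<longlongrightarrow> (l::'c::nonarchimedean_field)) F \<longleftrightarrow> ((\<lambda>x. absv (f x - l)) \<longlongrightarrow> 0) F"
proof -
  have "(f \<longlongrightarrow> l) F \<longleftrightarrow> ((\<lambda>x. dist (f x) l) \<longlongrightarrow> 0) F" by (rule tendsto_dist_iff)
  thus ?thesis by (simp add: absv_diff)
qed

text \<open>The class itself only carries a metric; this instance and the next one open it to the
  general calculus of limits and sums.\<close>

instance nonarchimedean_field \<subseteq> topological_ab_group_add
proof
  fix a b :: 'a
  show "((\<lambda>x. fst x + snd x) \<longlongrightarrow> a + b) (nhds a \<times>\<^sub>F nhds b)"
  proof (rule tendstoI)
    fix e :: real assume "e > 0"
    hence "\<forall>\<^sub>F x in nhds a. dist x a < e" "\<forall>\<^sub>F x in nhds b. dist x b < e"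
      by (auto simp: eventually_nhds_metric)
    hence "\<forall>\<^sub>F x in nhds a \<times>\<^sub>F nhds b. dist (fst x) a < e \<and> dist (snd x) b < e"
      by (rule eventually_prodI)
    thus "\<forall>\<^sub>F x in nhds a \<times>\<^sub>F nhds b. dist (fst x + snd x) (a + b) < e"
    proof eventually_elim
      case (elim x)
      have "absv ((fst x - a) + (snd x - b)) < e" using elim by (intro absv_add_lessI) (auto simp: absv_diff)
      thus ?case by (simp add: dist_absv algebra_simps)
    qed
  qed
  show "(uminus \<longlongrightarrow> - a) (nhds a)"
  proof (rule tendstoI)
    fix e :: real assume "e > 0"
    hence "\<forall>\<^sub>F x in nhds a. dist x a < e" by (auto simp: eventually_nhds_metric)
    thus "\<forall>\<^sub>F x in nhds a. dist (- x) (- a) < e"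
    proof eventually_elim
      case (elim x)
      have "dist (- x) (- a) = absv (- (x - a))" by (simp add: dist_absv algebra_simps)
      also have "\<dots> = dist x a" by (metis absv_diff absv_minus)
      finally show ?case using elim by simp
    qed
  qed
qed

instance nonarchimedean_field \<subseteq> topological_semigroup_mult
proof
  fix a b :: 'a
  show "((\<lambda>x. fst x * snd x) \<longlongrightarrow> a * b) (nhds a \<times>\<^sub>F nhds b)"
  proof (rule tendstoI)
    fix e :: real assume e: "e > 0"
    define C where "C = 1 + absv a + absv b"
    have C: "C > 0" "absv a < C" "absv b < C" by (auto simp: C_def add_pos_nonneg add.commute add_strict_increasing2)
    define d where "d = min C (e / C)"
    have d: "d > 0" using e C by (auto simp: d_def)
    hence "\<forall>\<^sub>F x in nhds a. dist x a < d" "\<forall>\<^sub>F x in nhds b. dist x b < d"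
      by (auto simp: eventually_nhds_metric)
    hence "\<forall>\<^sub>F x in nhds a \<times>\<^sub>F nhds b. dist (fst x) a < d \<and> dist (snd x) b < d"
      by (rule eventually_prodI)
    thus "\<forall>\<^sub>F x in nhds a \<times>\<^sub>F nhds b. dist (fst x * snd x) (a * b) < e"
    proof eventually_elim
      case (elim x)
      have 1: "absv (fst x - a) < d" "absv (snd x - b) < d" using elim by (auto simp: absv_diff)
      have "absv (snd x) < C" using absv_add_lessI[of "snd x - b" C b] 1 C by (auto simp: d_def)
      hence "absv ((fst x - a) * snd x) < d * C"  using 1 C d by (auto simp: absv_mult intro!: mult_strict_mono)
      moreover have "absv (a * (snd x - b)) < C * d" using 1 C d by (auto simp: absv_mult intro!: mult_strict_mono)
      ultimately have "absv ((fst x - a) * snd x + a * (snd x - b)) < d * C"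
        by (intro absv_add_lessI) (auto simp: mult.commute)
      also have "d * C \<le> e" using C e by (auto simp: d_def min_def field_simps)
      finally show ?case by (simp add: dist_absv algebra_simps)
    qed
  qed
qed

lemma tendsto_absv: "(f \<longlongrightarrow> (l::'c::nonarchimedean_field)) F \<Longrightarrow> ((\<lambda>x. absv (f x)) \<longlongrightarrow> absv l) F"
  by (intro tendsto_intros)

lemma absv_limit_le:
  fixes l :: "'c::nonarchimedean_field"
  assumes "Y \<longlonglongrightarrow> l" "\<And>n. n \<ge> N \<Longrightarrow> absv (Y n) \<le> B"
  shows "absv l \<le> B" by (rule LIMSEQ_le_const2[OF tendsto_absv[OF assms(1)]]) (use assms(2) in blast)

text \<open>A block of the series is no larger than its largest term, so terms tending to 0
  suffice.\<close>

lemma sums_limit_diff: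
  fixes f :: "nat \<Rightarrow> 'c::nonarchimedean_field"
  assumes "f \<longlonglongrightarrow> 0"
  shows "Cauchy (\<lambda>n. sum f {..<n})"
proof (rule metric_CauchyI)
  fix e :: real assume e: "e > 0"
  then obtain N where N: "\<And>n. n \<ge> N \<Longrightarrow> dist (f n) 0 < e" using assms metric_LIMSEQ_D by blast
  have *: "dist (sum f {..<m}) (sum f {..<n}) < e" if "m \<ge> N" "m \<le> n" for m n
  proof -
    have "sum f {..<n} - sum f {..<m} = sum f {m..<n}"
      using that sum_diff_nat_ivl[of 0 m n f] by (simp add: atLeast0LessThan)
    moreover have "absv (sum f {m..<n}) < e" using that N e by (intro absv_sum_less) auto
    ultimately show ?thesis by (metis absv_diff dist_commute)
  qed
  show "\<exists>M. \<forall>m\<ge>M. \<forall>n\<ge>M. dist (sum f {..<m}) (sum f {..<n}) < e"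
  proof (intro exI allI impI)
    fix m n assume "N \<le> m" "N \<le> n"
    thus "dist (sum f {..<m}) (sum f {..<n}) < e"
      using *[of m n] *[of n m] by (cases "m \<le> n") (auto simp: dist_commute)
  qed
qed

lemma summable_tendsto_0:
  fixes f :: "nat \<Rightarrow> 'c::{nonarchimedean_field,complete_space}"
  assumes "f \<longlonglongrightarrow> 0"
  shows "summable f" using Cauchy_convergent[OF sums_limit_diff[OF assms]]
  by (auto simp: summable_def sums_def convergent_def)

lemma absv_suminf_le:
  fixes f :: "nat \<Rightarrow> 'c::{nonarchimedean_field,complete_space}"
  assumes "summable f" "\<And>n. absv (f n) \<le> B" "B \<ge> 0"
  shows "absv (suminf f) \<le> B" by (rule absv_limit_le[OF summable_LIMSEQ[OF assms(1)], where N = 0])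
    (use assms(2,3) in \<open>auto intro: absv_sum_le\<close>)

text \<open>The finite sets \<open>F n\<close> of terms of size at least 1/(n+1) take the role of
  initial segments: adding further terms to \<open>F n\<close> changes the sum by less than
  1/(n+1).\<close>

lemma nonarch_summable_on:
  fixes f :: "'i \<Rightarrow> 'c::{nonarchimedean_field,complete_space}"
  assumes "\<And>e. e > 0 \<Longrightarrow> finite {x \<in> A. absv (f x) \<ge> e}"
  shows "f summable_on A"
proof -
  define F where "F n = {x \<in> A. absv (f x) \<ge> 1 / real (Suc n)}" for n
  have F: "finite (F n)" "F n \<subseteq> A" for n using assms[of "1 / real (Suc n)"] by (auto simp: F_def)
  have key: "absv (sum f Y - sum f (F n)) < 1 / real (Suc n)" if "finite Y" "F n \<subseteq> Y" "Y \<subseteq> A" for Y n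
  proof -
    have "sum f Y - sum f (F n) = sum f (Y - F n)" using that by (simp add: sum_diff)
    also have "absv \<dots> < 1 / real (Suc n)" using that by (intro absv_sum_less) (auto simp: F_def)
    finally show ?thesis .
  qed
  have mono: "F m \<subseteq> F n" if "m \<le> n" for m n
  proof -
    have "1 / real (Suc n) \<le> 1 / real (Suc m)" using that by (intro divide_left_mono) auto
    thus ?thesis by (auto simp: F_def)
  qed
  have "Cauchy (\<lambda>n. sum f (F n))"
  proof (rule metric_CauchyI)
    fix e :: real assume "e > 0"
    then obtain N where N: "1 / real (Suc N) < e" using nat_approx_posE by blast
    show "\<exists>M. \<forall>m\<ge>M. \<forall>n\<ge>M. dist (sum f (F m)) (sum f (F n)) < e"
    proof (intro exI allI impI)
      fix m n assume mn: "N \<le> m" "N \<le> n"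
      have "absv ((sum f (F m) - sum f (F N)) + (sum f (F N) - sum f (F n))) < 1 / real (Suc N)"
        using key[OF F(1) mono[OF mn(1)] F(2)] key[OF F(1) mono[OF mn(2)] F(2)]
        by (intro absv_add_lessI) (auto simp: absv_diff_commute)
      thus "dist (sum f (F m)) (sum f (F n)) < e" using N by (simp add: dist_absv)
    qed
  qed
  then obtain S where S: "(\<lambda>n. sum f (F n)) \<longlonglongrightarrow> S"
    using Cauchy_convergent convergent_def by blast
  have "(f has_sum S) A" unfolding has_sum_def
  proof (rule tendstoI)
    fix e :: real assume "e > 0"
    then obtain N where N: "1 / real (Suc N) < e" using nat_approx_posE by blast
    have le: "absv (sum f (F n) - S) \<le> 1 / real (Suc n)" for n
    proof (rule absv_limit_le[where N = n])
      show "(\<lambda>k. sum f (F n) - sum f (F k)) \<longlonglongrightarrow> sum f (F n) - S"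
        by (intro tendsto_intros S)
      show "absv (sum f (F n) - sum f (F k)) \<le> 1 / real (Suc n)" if "n \<le> k" for k
        using key[OF F(1) mono[OF that] F(2)] by (simp add: absv_diff_commute)
    qed
    have "dist (sum f Y) S < e" if "finite Y" "F N \<subseteq> Y" "Y \<subseteq> A" for Y
    proof -
      have "absv ((sum f Y - sum f (F N)) + (sum f (F N) - S)) \<le> 1 / real (Suc N)"
        using key[OF that] le[of N] by (intro absv_add_leI) auto
      thus ?thesis using N by (simp add: dist_absv)
    qed
    thus "\<forall>\<^sub>F Y in finite_subsets_at_top A. dist (sum f Y) S < e"
      unfolding eventually_finite_subsets_at_top by (intro exI[of _ "F N"]) (use F in auto)
  qed
  thus ?thesis by (auto simp: summable_on_def)
qed

section \<open>The finite base field and the q-power map\<close>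

lemma finite_field_pow_card:
  fixes x :: "'a :: {finite,field}"
  shows "x ^ CARD('a) = x"
proof (cases "x = 0")
  case False
  have "x * (\<Prod>y\<in>UNIV-{0}. x * y) = x * x ^ (CARD('a) - 1) * \<Prod>(UNIV-{0})"
    by (simp add: prod.distrib mult_ac)
  also have "x * x ^ (CARD('a) - 1) = x ^ Suc (CARD('a) - 1)" by (rule power_Suc[symmetric])
  also have "Suc (CARD('a) - 1) = CARD('a)" using finite_UNIV_card_ge_0[where ?'a = 'a] by simp
  \<comment> \<open>Multiplication by \<open>x\<close> permutes the nonzero elements. The extra
    factor \<open>x\<close> turns the exponent q - 1 into q.\<close>
  also have "(\<Prod>y\<in>UNIV-{0}. x * y) = (\<Prod>y\<in>UNIV-{0}. y)"
    by (rule prod.reindex_bij_witness[of _ "\<lambda>y. y / x" "\<lambda>y. x * y"]) (use False in auto)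
  finally show ?thesis by simp
qed (use finite_UNIV_card_ge_0[where ?'a = 'a] in auto)

lemma card_ge_2: "CARD('a :: {finite,field}) \<ge> 2"
proof -
  have "card {0, 1 :: 'a} \<le> CARD('a)" by (intro card_mono) auto
  thus ?thesis by simp
qed

text \<open>The argument serves only to fix the type \<open>'f\<close>.\<close>

definition q_of :: "('f::{finite,field}, 'c) emb \<Rightarrow> nat" where "q_of \<iota> = CARD('f)"

context C_infinity
begin

abbreviation q :: nat where "q \<equiv> q_of \<iota>"
abbreviation \<theta> :: 'c where "\<theta> \<equiv> theta \<iota>"

lemma card_eq_q: "CARD('f) = q" by (simp add: q_of_def)
lemma q_ge_2: "q \<ge> 2" unfolding q_of_def by (rule card_ge_2)
lemma q_gt_0 [simp]: "q > 0" using q_ge_2 by linarith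
lemma q_neq_0 [simp]: "q \<noteq> 0" using q_ge_2 by linarith
lemma q_gt_1: "q > 1" using q_ge_2 by linarith

lemma emb_0 [simp]: "\<iota> 0 = 0" using emb_add[of 0 0] by (metis add_cancel_right_right add_0)

lemma emb_1 [simp]: "\<iota> 1 = 1" by (rule emb_one)

lemma emb_power: "\<iota> (x ^ n) = \<iota> x ^ n" by (induction n) (auto simp: emb_mult)

lemma emb_minus: "\<iota> (- x) = - \<iota> x"
  using emb_add[of x "- x"] by (simp add: eq_neg_iff_add_eq_0 add.commute)

lemma emb_diff: "\<iota> (x - y) = \<iota> x - \<iota> y" using emb_add[of x "- y"] by (simp add: emb_minus)

lemma emb_inverse: "\<iota> (inverse x) = inverse (\<iota> x)"
proof (cases "x = 0")
  case False
  hence "\<iota> x * \<iota> (inverse x) = 1" by (simp flip: emb_mult)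
  thus ?thesis by (metis inverse_unique)
qed auto

lemma emb_divide: "\<iota> (x / y) = \<iota> x / \<iota> y" by (simp add: divide_inverse emb_mult emb_inverse)

lemma emb_eq_0_iff [simp]: "\<iota> x = 0 \<longleftrightarrow> x = 0"
proof
  assume "\<iota> x = 0"
  show "x = 0"
  proof (rule ccontr)
    assume "x \<noteq> 0"
    hence "\<iota> x * \<iota> (inverse x) = 1" by (simp flip: emb_mult)
    with \<open>\<iota> x = 0\<close> show False by simp
  qed
qed auto

lemma emb_eq_iff [simp]: "\<iota> x = \<iota> y \<longleftrightarrow> x = y"
  using emb_eq_0_iff[of "x - y"] by (simp add: emb_diff del: emb_eq_0_iff)

definition cst :: "'f \<Rightarrow> 'c" where "cst a = \<iota> (to_ac (fls_const a))"

lemma cst_0 [simp]: "cst 0 = 0" and cst_1 [simp]: "cst 1 = 1" by (simp_all add: cst_def)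
lemma cst_add: "cst (x + y) = cst x + cst y" by (simp add: cst_def emb_add flip: fls_plus_const to_ac_add emb_add)
lemma cst_mult: "cst (x * y) = cst x * cst y" by (simp add: cst_def emb_mult flip: fls_const_mult_const)
lemma cst_eq_0_iff [simp]: "cst x = 0 \<longleftrightarrow> x = 0"
proof -
  have "to_ac (fls_const x :: 'f fls) = 0 \<longleftrightarrow> (fls_const x :: 'f fls) = 0"
    by (metis to_ac_0 to_ac_eq_iff)
  thus ?thesis by (simp add: cst_def)
qed
lemma cst_power: "cst (x ^ n) = cst x ^ n" by (induction n) (auto simp: cst_mult)
lemma cst_minus: "cst (- x) = - cst x" using cst_add[of x "- x"] by (simp add: eq_neg_iff_add_eq_0 add.commute)
lemma cst_diff: "cst (x - y) = cst x - cst y" using cst_add[of x "- y"] by (simp add: cst_minus)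
lemma cst_eq_iff [simp]: "cst x = cst y \<longleftrightarrow> x = y"
  using cst_eq_0_iff[of "x - y"] by (simp add: cst_diff del: cst_eq_0_iff)

lemma Fq_eq: "Fq \<iota> = range cst" by (auto simp: Fq_def cst_def)

lemma cst_pow_q: "cst a ^ q = cst a" by (simp add: q_of_def finite_field_pow_card flip: cst_power)

lemma absv_cst: "absv (cst a) = (if a = 0 then 0 else 1)"
  using emb_absv[of "fls_const a"] by (auto simp: cst_def emb_eq_0_iff[of 0])

lemma absv_theta: "absv \<theta> = real q" using emb_absv[of "fls_X_inv"] by (simp add: theta_def q_of_def)

lemma theta_neq_0 [simp]: "\<theta> \<noteq> 0" using absv_theta q_gt_0 by force

text \<open>For \<open>y \<noteq> 0\<close> the polynomial \<open>(T + y)\<^sup>q - T\<^sup>q - y\<^sup>q\<close> in \<open>T\<close> has degree less than \<open>q\<close> and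
  vanishes at the \<open>q\<close> points \<open>a y\<close> with \<open>a\<close> in the finite field.\<close>

lemma add_pow_q: "(x + y) ^ q = x ^ q + (y :: 'c) ^ q"
proof (cases "y = 0")
  case True
  thus ?thesis by simp
next
  case False
  define P where "P = [:y, 1:] ^ q - monom 1 q - [:y ^ q:]"
  have "P = 0"
  proof (rule ccontr)
    assume "P \<noteq> 0"
    have "degree P \<le> q" unfolding P_def by (intro degree_diff_le) (auto simp: degree_linear_power degree_monom_le)
    moreover have "coeff P q = 0" using q_gt_1 coeff_linear_power[of y q]
      by (simp add: P_def coeff_pCons split: nat.split)
    ultimately have deg: "degree P < q"
      using \<open>P \<noteq> 0\<close> by (metis le_neq_implies_less leading_coeff_0_iff)
    have "inj (\<lambda>a. cst a * y)" using False by (auto simp: inj_def)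
    hence "q = card (range (\<lambda>a. cst a * y))" by (simp add: card_image q_of_def)
    also have "\<dots> \<le> card {z. poly P z = 0}"
    proof (intro card_mono poly_roots_finite[OF \<open>P \<noteq> 0\<close>] subsetI)
      fix z assume "z \<in> range (\<lambda>a. cst a * y)"
      then obtain a where z: "z = cst a * y" by auto
      have "(y + cst a * y) = cst (1 + a) * y" by (simp add: cst_add algebra_simps)
      hence "(y + cst a * y) ^ q = cst (1 + a) ^ q * y ^ q" by (simp only: power_mult_distrib)
      hence "(y + cst a * y) ^ q = y ^ q + cst a * y ^ q" unfolding cst_pow_q by (simp add: cst_add algebra_simps)
      thus "z \<in> {z. poly P z = 0}" by (simp add: P_def poly_monom z power_mult_distrib cst_pow_q)
    qed
    also have "\<dots> \<le> degree P" by (rule card_poly_roots_bound[OF \<open>P \<noteq> 0\<close>])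
    finally show False using deg by simp
  qed
  hence "poly P x = 0" by simp
  thus ?thesis by (simp add: P_def poly_monom algebra_simps)
qed

lemma add_pow_qn: "(x + y) ^ (q ^ n) = x ^ (q ^ n) + (y :: 'c) ^ (q ^ n)"
  by (induction n arbitrary: x y) (simp_all add: power_mult add_pow_q)

lemma minus_pow_qn: "(- x) ^ (q ^ n) = - ((x :: 'c) ^ (q ^ n))"
  using add_pow_qn[of x "- x" n] by (simp add: eq_neg_iff_add_eq_0 add.commute power_0_left)

lemma diff_pow_qn: "(x - y) ^ (q ^ n) = x ^ (q ^ n) - (y :: 'c) ^ (q ^ n)"
  using add_pow_qn[of x "- y" n] by (simp add: minus_pow_qn)

lemma sum_pow_qn: "(sum f A :: 'c) ^ (q ^ n) = (\<Sum>i\<in>A. f i ^ (q ^ n))"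
  by (induction A rule: infinite_finite_induct) (auto simp: add_pow_qn)

lemma pow_qn_eq_iff [simp]: "(x :: 'c) ^ (q ^ n) = y ^ (q ^ n) \<longleftrightarrow> x = y"
proof
  assume "x ^ (q ^ n) = y ^ (q ^ n)"
  hence "(x - y) ^ (q ^ n) = 0" by (simp add: diff_pow_qn)
  thus "x = y" by simp
qed auto

lemma diff_pow_q: "(x - y) ^ q = x ^ q - (y :: 'c) ^ q" using diff_pow_qn[of x y 1] by simp
lemma pow_q_eq_iff [simp]: "(x :: 'c) ^ q = y ^ q \<longleftrightarrow> x = y"
  using pow_qn_eq_iff[of x 1 y] by (simp del: pow_qn_eq_iff)

lemma cst_pow_qn: "cst a ^ (q ^ n) = cst a" by (induction n) (auto simp: power_mult cst_pow_q)

text \<open>The q constants already exhaust the roots of T^q - T; a further fixed point would be one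
  root too many.\<close>

lemma Fq_iff: "x \<in> Fq \<iota> \<longleftrightarrow> x ^ q = x"
proof
  show "x \<in> Fq \<iota> \<Longrightarrow> x ^ q = x" by (auto simp: Fq_eq cst_pow_q)
next
  assume x: "x ^ q = x"
  define P where "P = (monom 1 q - [:0, 1:] :: 'c poly)"
  have cq: "coeff P q = 1" using q_gt_1 by (simp add: P_def coeff_pCons split: nat.split)
  hence "P \<noteq> 0" by auto
  have "degree P \<le> q" unfolding P_def using q_gt_1 by (intro degree_diff_le) (auto simp: degree_monom_le)
  show "x \<in> Fq \<iota>"
  proof (rule ccontr)
    assume "x \<notin> Fq \<iota>"
    moreover have "inj cst" by (auto simp: inj_def)
    ultimately have "Suc q = card (insert x (range cst))" by (simp add: Fq_eq card_image q_of_def)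
    also have "\<dots> \<le> card {z. poly P z = 0}"
      using x by (intro card_mono poly_roots_finite[OF \<open>P \<noteq> 0\<close>])
        (auto simp: P_def poly_monom cst_pow_q)
    also have "\<dots> \<le> degree P" by (rule card_poly_roots_bound[OF \<open>P \<noteq> 0\<close>])
    also have "\<dots> \<le> q" by fact
    finally show False by simp
  qed
qed

subsection \<open>Polynomials in theta\<close>

interpretation cst_hom: comm_ring_hom cst by unfold_locales (auto simp: cst_add cst_mult)

interpretation cst_poly_hom: map_poly_comm_ring_hom cst ..

text \<open>Identifies polynomials over F_q with the ring A. Injectivity, the transcendence of
  \<theta>, comes from the absolute value in \<open>absv_evA\<close>.\<close>

definition evA :: "'f poly \<Rightarrow> 'c" where "evA p = poly (map_poly cst p) \<theta>"

lemma map_poly_cst_pCons [simp]: "map_poly cst (pCons a p) = pCons (cst a) (map_poly cst p)"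
  by (cases "a = 0 \<and> p = 0") (auto intro: map_poly_pCons)

lemma evA_0 [simp]: "evA 0 = 0" and evA_1 [simp]: "evA 1 = 1" by (auto simp: evA_def)
lemma evA_add: "evA (x + y) = evA x + evA y" by (simp add: evA_def cst_poly_hom.hom_add)
lemma evA_mult: "evA (x * y) = evA x * evA y" by (simp add: evA_def cst_poly_hom.hom_mult)
lemma evA_minus: "evA (- x) = - evA x" by (simp add: evA_def cst_poly_hom.hom_uminus)
lemma evA_diff: "evA (x - y) = evA x - evA y" by (simp add: evA_def cst_poly_hom.hom_minus)
lemma evA_sum: "evA (sum f A) = (\<Sum>i\<in>A. evA (f i))"
  by (induction A rule: infinite_finite_induct) (auto simp: evA_add)
lemma evA_const [simp]: "evA [:a:] = cst a" by (simp add: evA_def)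
lemma evA_T [simp]: "evA [:0, 1:] = \<theta>" by (simp add: evA_def)

lemma evA_pCons: "evA (pCons a p) = cst a + \<theta> * evA p" by (simp add: evA_def)

lemma absv_evA: "p \<noteq> 0 \<Longrightarrow> absv (evA p) = real q ^ degree p"
proof (induction p)
  case (pCons a p)
  show ?case
  proof (cases "p = 0")
    case True
    thus ?thesis using pCons by (simp add: absv_cst)
  next
    case False
    hence *: "absv (\<theta> * evA p) = real q ^ Suc (degree p)" using pCons by (simp add: absv_mult absv_theta)
    have "absv (cst a) < absv (\<theta> * evA p)"
    proof -
      have "absv (cst a) \<le> 1" by (simp add: absv_cst)
      also have "1 < real q ^ Suc (degree p)" using q_gt_1 by (intro one_less_power) auto
      finally show ?thesis using * by simp
    qed
    hence "absv (\<theta> * evA p + cst a) = absv (\<theta> * evA p)" by (rule absv_add_dominant)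
    thus ?thesis using False * by (simp add: evA_pCons add.commute)
  qed
qed auto

lemma evA_eq_0_iff [simp]: "evA p = 0 \<longleftrightarrow> p = 0"
  using absv_evA[of p] q_gt_0 by (cases "p = 0") force+

text \<open>The discreteness of A, on which Liouville's inequality rests.\<close>

lemma absv_evA_ge_1: "p \<noteq> 0 \<Longrightarrow> absv (evA p) \<ge> 1" using q_gt_1 by (simp add: absv_evA)

lemma absv_evA_le: "degree p \<le> n \<Longrightarrow> absv (evA p) \<le> real q ^ n"
  using q_gt_1 by (cases "p = 0") (auto simp: absv_evA intro!: power_increasing)

lemma polys_over_Fq: "polys_over (Fq \<iota>) = range (map_poly cst)"
proof (intro equalityI subsetI)
  fix f assume f: "f \<in> polys_over (Fq \<iota>)"
  define g where "g = map_poly (inv_into UNIV cst) f"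
  have i: "inv_into UNIV cst 0 = 0" using inv_f_f[of cst 0] by (simp add: inj_def)
  have "map_poly cst g = f" using f by (intro poly_eqI)
      (auto simp: g_def coeff_map_poly i polys_over_def Fq_eq f_inv_into_f)
  thus "f \<in> range (map_poly cst)" by blast
qed (auto simp: polys_over_def coeff_map_poly Fq_eq)

lemma ring_A_eq: "ring_A \<iota> = range evA" by (auto simp: ring_A_def polys_over_Fq evA_def)

lemma field_k_iff: "x \<in> field_k \<iota> \<longleftrightarrow> (\<exists>a b. b \<noteq> 0 \<and> x = evA a / evA b)"
  unfolding field_k_def ring_A_eq by (simp add: image_iff Bex_def) (metis evA_eq_0_iff)

lemma field_k_iff': "x \<in> field_k \<iota> \<longleftrightarrow> (\<exists>a b. b \<noteq> 0 \<and> evA b * x = evA a)"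
  unfolding field_k_iff by (rule ex_cong1, rule ex_cong1) (auto simp: field_simps)

end

section \<open>Power series over a nonarchimedean field\<close>

text \<open>Membership in the Tate algebra of the closed disc of radius R.\<close>

definition conv :: "real \<Rightarrow> 'c::nonarchimedean_field fps \<Rightarrow> bool"
  where "conv R f \<longleftrightarrow> (\<lambda>i. absv (fps_nth f i) * R ^ i) \<longlonglongrightarrow> 0"

text \<open>A bound for the Gauss norm of radius R.\<close>

definition bnd :: "real \<Rightarrow> 'c::nonarchimedean_field fps \<Rightarrow> real \<Rightarrow> bool"
  where "bnd R f B \<longleftrightarrow> (\<forall>i. absv (fps_nth f i) * R ^ i \<le> B)"

definition fev :: "'c::nonarchimedean_field fps \<Rightarrow> 'c \<Rightarrow> 'c"
  where "fev f x = (\<Sum>i. fps_nth f i * x ^ i)"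

lemma bndD: "bnd R f B \<Longrightarrow> absv (fps_nth f i) * R ^ i \<le> B" by (auto simp: bnd_def)

lemma bnd_nonneg: "bnd R f B \<Longrightarrow> B \<ge> 0"
  using bndD[of R f B 0] by (simp add: order_trans[OF zero_le_dist])

lemma bnd_mono: "bnd R f B \<Longrightarrow> B \<le> C \<Longrightarrow> bnd R f C"
  by (auto simp: bnd_def intro: order_trans)

lemma bnd_mono_radius:
  assumes "bnd R f B" "0 \<le> r" "r \<le> R" shows "bnd r f B" unfolding bnd_def
proof
  fix i
  have "absv (fps_nth f i) * r ^ i \<le> absv (fps_nth f i) * R ^ i"
    using assms by (intro mult_left_mono power_mono) auto
  thus "absv (fps_nth f i) * r ^ i \<le> B" using bndD[OF assms(1), of i] by linarith
qed

lemma bnd_add: "bnd R f B \<Longrightarrow> bnd R g B \<Longrightarrow> R \<ge> 0 \<Longrightarrow> bnd R (f + g) B"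
  unfolding bnd_def
proof
  fix i assume *: "\<forall>i. absv (fps_nth f i) * R ^ i \<le> B" "\<forall>i. absv (fps_nth g i) * R ^ i \<le> B" "R \<ge> 0"
  have "absv (fps_nth (f + g) i) * R ^ i \<le> max (absv (fps_nth f i)) (absv (fps_nth g i)) * R ^ i"
    using * absv_add_le by (intro mult_right_mono) auto
  also have "\<dots> \<le> B" using * by (auto simp: max_def)
  finally show "absv (fps_nth (f + g) i) * R ^ i \<le> B" .
qed

lemma bnd_0 [simp]: "bnd R 0 B \<longleftrightarrow> B \<ge> 0" by (simp add: bnd_def)

lemma bnd_const: "absv c \<le> B \<Longrightarrow> bnd R (fps_const c) B" unfolding bnd_def
proof
  fix i assume "absv c \<le> B"
  thus "absv (fps_nth (fps_const c) i) * R ^ i \<le> B" using order_trans[OF zero_le_dist] by (cases i) auto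
qed

lemma bnd_1 [simp]: "bnd R 1 1" using bnd_const[of 1 1 R] by simp

lemma bnd_sum: "(\<And>i. i \<in> A \<Longrightarrow> bnd R (f i) B) \<Longrightarrow> R \<ge> 0 \<Longrightarrow> B \<ge> 0 \<Longrightarrow> bnd R (sum f A) B"
  by (induction A rule: infinite_finite_induct) (auto intro: bnd_add)

lemma bnd_mult:
  assumes "bnd R f B" "bnd R g C" "R \<ge> 0"
  shows "bnd R (f * g) (B * C)" unfolding bnd_def
proof
  fix n
  have nn: "B \<ge> 0" "C \<ge> 0" using bnd_nonneg assms by auto
  show "absv (fps_nth (f * g) n) * R ^ n \<le> B * C"
  proof (cases "R = 0")
    case True
    have "absv (fps_nth f 0) \<le> B" "absv (fps_nth g 0) \<le> C"
      using bndD[OF assms(1), of 0] bndD[OF assms(2), of 0] by auto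
    hence "absv (fps_nth f 0 * fps_nth g 0) \<le> B * C" using nn by (auto simp: absv_mult intro: mult_mono)
    thus ?thesis using True nn by (cases n) (auto simp: fps_mult_nth)
  next
    case False
    hence R: "R ^ n > 0" using assms by auto
    have "absv (fps_nth (f * g) n) \<le> B * C / R ^ n" unfolding fps_mult_nth
    proof (rule absv_sum_le)
      fix i assume i: "i \<in> {0..n}"
      have "absv (fps_nth f i * fps_nth g (n - i)) * R ^ n
          = (absv (fps_nth f i) * R ^ i) * (absv (fps_nth g (n - i)) * R ^ (n - i))"
        using i by (simp add: absv_mult flip: power_add)
      also have "\<dots> \<le> B * C" using bndD[OF assms(1)] bndD[OF assms(2)] nn assms(3) by (intro mult_mono) auto
      finally show "absv (fps_nth f i * fps_nth g (n - i)) \<le> B * C / R ^ n" using R by (simp add: field_simps)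
    qed (use nn R in auto)
    thus ?thesis using R by (simp add: field_simps)
  qed
qed

lemma bnd_prod:
  assumes "\<And>i. i \<in> A \<Longrightarrow> bnd R (f i) (B i)" "R \<ge> 0"
  shows "bnd R (prod f A) (prod B A)" using assms by (induction A rule: infinite_finite_induct) (auto intro: bnd_mult)

lemma bnd_power: "bnd R f B \<Longrightarrow> R \<ge> 0 \<Longrightarrow> bnd R (f ^ n) (B ^ n)"
  by (induction n) (auto intro: bnd_mult)

lemma bnd_linear: "absv x \<le> R \<Longrightarrow> bnd R (fps_X - fps_const x) R" unfolding bnd_def
proof
  fix i assume x: "absv x \<le> R"
  hence "R \<ge> 0" using order_trans[OF zero_le_dist] by blast
  thus "absv (fps_nth (fps_X - fps_const x) i) * R ^ i \<le> R" using x by (cases i) (auto simp: fps_X_def)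
qed

lemma convD: "conv R f \<Longrightarrow> e > 0 \<Longrightarrow> \<exists>N. \<forall>n\<ge>N. absv (fps_nth f n) * R ^ n < e"
  using LIMSEQ_D[of "\<lambda>i. absv (fps_nth f i) * R ^ i" 0 e] unfolding conv_def
  by (metis abs_ge_self diff_zero order_le_less_trans real_norm_def)

lemma convI:
  assumes "R \<ge> 0" "\<And>e. e > 0 \<Longrightarrow> \<exists>N. \<forall>n\<ge>N. absv (fps_nth f n) * R ^ n \<le> e"
  shows "conv R f" unfolding conv_def
proof (rule LIMSEQ_I)
  fix e :: real assume "e > 0"
  then obtain N where "\<forall>n\<ge>N. absv (fps_nth f n) * R ^ n \<le> e / 2" using assms(2)[of "e / 2"] by auto
  hence "\<forall>n\<ge>N. norm (absv (fps_nth f n) * R ^ n - 0) < e" using \<open>e > 0\<close> assms(1) by force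
  thus "\<exists>no. \<forall>n\<ge>no. norm (absv (fps_nth f n) * R ^ n - 0) < e" by blast
qed

lemma conv_imp_bnd:
  assumes "conv R f" shows "\<exists>B. bnd R f B"
proof -
  have "Bseq (\<lambda>i. absv (fps_nth f i) * R ^ i)"
    using assms unfolding conv_def by (intro convergent_imp_Bseq) (auto simp: convergent_def)
  then obtain B where "\<And>i. norm (absv (fps_nth f i) * R ^ i) \<le> B" by (auto simp: Bseq_def)
  hence "bnd R f B" unfolding bnd_def by (metis abs_le_D1 real_norm_def)
  thus ?thesis by blast
qed

lemma conv_0 [simp]: "conv R 0" by (simp add: conv_def)

lemma conv_uminus [simp]: "conv R (- f) \<longleftrightarrow> conv R f" by (simp add: conv_def)

lemma conv_add:
  assumes "conv R f" "conv R g" "R \<ge> 0" shows "conv R (f + g)"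
proof (rule convI)
  fix e :: real assume e: "e > 0"
  obtain N M where *: "\<And>n. n \<ge> N \<Longrightarrow> absv (fps_nth f n) * R ^ n < e" "\<And>n. n \<ge> M \<Longrightarrow> absv (fps_nth g n) * R ^ n < e"
    using convD[OF assms(1) e] convD[OF assms(2) e] by auto
  have "absv (fps_nth (f + g) n) * R ^ n \<le> e" if "n \<ge> max N M" for n
  proof -
    have "absv (fps_nth (f + g) n) * R ^ n \<le> max (absv (fps_nth f n)) (absv (fps_nth g n)) * R ^ n"
      using assms absv_add_le by (intro mult_right_mono) auto
    also have "\<dots> \<le> e" using *(1)[of n] *(2)[of n] that by (cases "absv (fps_nth f n) \<le> absv (fps_nth g n)") (simp_all add: max_def less_imp_le split: if_splits)
    finally show ?thesis .
  qed
  thus "\<exists>N. \<forall>n\<ge>N. absv (fps_nth (f + g) n) * R ^ n \<le> e" by blast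
qed (rule assms(3))

lemma conv_diff: "conv R f \<Longrightarrow> conv R g \<Longrightarrow> R \<ge> 0 \<Longrightarrow> conv R (f - g)"
  using conv_add[of R f "- g"] by simp

lemma conv_sum: "(\<And>i. i \<in> A \<Longrightarrow> conv R (f i)) \<Longrightarrow> R \<ge> 0 \<Longrightarrow> conv R (sum f A)"
  by (induction A rule: infinite_finite_induct) (auto intro: conv_add)

lemma conv_mono:
  assumes "conv R f" "0 \<le> r" "r \<le> R" shows "conv r f"
proof (rule convI)
  fix e :: real assume "e > 0"
  then obtain N where N: "\<And>n. n \<ge> N \<Longrightarrow> absv (fps_nth f n) * R ^ n < e" using convD[OF assms(1)] by blast
  have "absv (fps_nth f n) * r ^ n \<le> e" if "n \<ge> N" for n
  proof -
    have "absv (fps_nth f n) * r ^ n \<le> absv (fps_nth f n) * R ^ n"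
      using assms by (intro mult_left_mono power_mono) auto
    thus ?thesis using N[OF that] by linarith
  qed
  thus "\<exists>N. \<forall>n\<ge>N. absv (fps_nth f n) * r ^ n \<le> e" by blast
qed (rule assms(2))

lemma conv_poly [simp]: "conv R (fps_of_poly p)" unfolding conv_def
proof (rule Lim_transform_eventually[OF tendsto_const])
  have "eventually (\<lambda>i. i > degree p) sequentially" by (rule eventually_gt_at_top)
  thus "\<forall>\<^sub>F i in sequentially. 0 = absv (fps_nth (fps_of_poly p) i) * R ^ i"
    by eventually_elim (simp add: coeff_eq_0)
qed

lemma conv_const [simp]: "conv R (fps_const c)" using conv_poly[of R "[:c:]"] by (simp add: fps_of_poly_const)

lemma conv_1 [simp]: "conv R 1" using conv_const[of R 1] by simp

lemma conv_X [simp]: "conv R fps_X" using conv_poly[of R "[:0, 1:]"] by (simp add: fps_of_poly_linear)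

lemma conv_mult:
  assumes "conv R f" "conv R g" "R \<ge> 0" shows "conv R (f * g)"
proof (rule convI)
  fix e :: real assume e: "e > 0"
  obtain B where B: "bnd R f B" using conv_imp_bnd[OF assms(1)] by blast
  obtain C where C: "bnd R g C" using conv_imp_bnd[OF assms(2)] by blast
  note BC = B C
  define D where "D = 1 + B + C"
  have D: "D > 0" "B \<le> D" "C \<le> D" "B \<ge> 0" "C \<ge> 0"
    using bnd_nonneg[OF BC(1)] bnd_nonneg[OF BC(2)] by (auto simp: D_def)
  hence "e / D > 0" using e by simp
  then obtain N M where *: "\<And>n. n \<ge> N \<Longrightarrow> absv (fps_nth f n) * R ^ n < e / D"
      "\<And>n. n \<ge> M \<Longrightarrow> absv (fps_nth g n) * R ^ n < e / D"
    using convD[OF assms(1) \<open>e / D > 0\<close>] convD[OF assms(2) \<open>e / D > 0\<close>] by blast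
  \<comment> \<open>For n \<ge> N + M, one of the indices i and n - i lies in its tail, and D bounds
    the other factor.\<close>
  have "absv (fps_nth (f * g) n) * R ^ n \<le> e" if n: "n \<ge> N + M" for n
  proof (cases "R ^ n = 0")
    case True
    thus ?thesis using e by (simp only: mult_zero_right less_imp_le)
  next
    case False
    hence R: "R ^ n > 0" using zero_le_power[OF assms(3), of n] by linarith
    have "absv (fps_nth (f * g) n) \<le> e / R ^ n" unfolding fps_mult_nth
    proof (rule absv_sum_le)
      fix i assume i: "i \<in> {0..n}"
      define a b where "a = absv (fps_nth f i) * R ^ i" and "b = absv (fps_nth g (n - i)) * R ^ (n - i)"
      have ab: "a \<ge> 0" "b \<ge> 0" "a \<le> D" "b \<le> D"
        using assms(3) order_trans[OF bndD[OF BC(1), of i] D(2)] order_trans[OF bndD[OF BC(2), of "n - i"] D(3)]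
        by (simp_all add: a_def b_def)
      have "a * b \<le> e / D * D"
      proof (cases "i \<ge> N")
        case True
        have "a \<le> e / D" using *(1)[OF True] by (simp add: a_def)
        thus ?thesis using ab \<open>e / D > 0\<close> by (intro mult_mono) (simp_all add: less_imp_le)
      next
        case False
        hence "n - i \<ge> M" using n by auto
        hence "b \<le> e / D" using *(2)[of "n - i"] by (simp add: b_def)
        hence "b * a \<le> e / D * D" using ab \<open>e / D > 0\<close> by (intro mult_mono) (simp_all add: less_imp_le)
        thus ?thesis by (simp add: mult.commute)
      qed
      also have "\<dots> = e" using D by simp
      also have "a * b = absv (fps_nth f i * fps_nth g (n - i)) * R ^ n"
        using i by (simp add: a_def b_def absv_mult flip: power_add)
      finally show "absv (fps_nth f i * fps_nth g (n - i)) \<le> e / R ^ n" using R by (simp add: field_simps)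
    qed (use e R in auto)
    thus ?thesis using R by (simp add: field_simps)
  qed
  thus "\<exists>N. \<forall>n\<ge>N. absv (fps_nth (f * g) n) * R ^ n \<le> e" by (intro exI[of _ "N + M"] allI impI)
qed (rule assms(3))

lemma conv_power: "conv R f \<Longrightarrow> R \<ge> 0 \<Longrightarrow> conv R (f ^ n)"
  by (induction n) (auto intro: conv_mult)

lemma conv_term_tendsto_0:
  assumes "conv (absv x) f"
  shows "(\<lambda>i. fps_nth f i * x ^ i) \<longlonglongrightarrow> 0"
  using assms unfolding conv_def by (subst tendsto_absv_iff) (simp add: absv_mult absv_power)

lemma fev_summable:
  assumes "conv (absv x) (f :: 'c::{nonarchimedean_field,complete_space} fps)"
  shows "summable (\<lambda>i. fps_nth f i * x ^ i)" by (rule summable_tendsto_0[OF conv_term_tendsto_0[OF assms]])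

lemma fev_sums:
  assumes "conv (absv x) (f :: 'c::{nonarchimedean_field,complete_space} fps)"
  shows "(\<lambda>i. fps_nth f i * x ^ i) sums fev f x"
  using fev_summable[OF assms] unfolding fev_def by (rule summable_sums)

lemma fev_add:
  assumes "conv (absv x) f" "conv (absv x) (g :: 'c::{nonarchimedean_field,complete_space} fps)"
  shows "fev (f + g) x = fev f x + fev g x" using sums_add[OF fev_sums[OF assms(1)] fev_sums[OF assms(2)]]
  by (subst fev_def) (simp add: sums_iff algebra_simps)

lemma fev_uminus:
  assumes "conv (absv x) (f :: 'c::{nonarchimedean_field,complete_space} fps)"
  shows "fev (- f) x = - fev f x"
proof -
  have "fev (f + (- f)) x = fev f x + fev (- f) x" using assms by (intro fev_add) auto
  moreover have "fev (f + (- f)) x = 0" by (simp add: fev_def)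
  ultimately show ?thesis by (simp add: eq_neg_iff_add_eq_0 add.commute)
qed

lemma fev_diff:
  assumes "conv (absv x) f" "conv (absv x) (g :: 'c::{nonarchimedean_field,complete_space} fps)"
  shows "fev (f - g) x = fev f x - fev g x" using fev_add[of x f "- g"] assms by (simp add: fev_uminus)

lemma fev_poly [simp]:
  "fev (fps_of_poly p) x = poly (p :: 'c::{nonarchimedean_field,complete_space} poly) x"
proof -
  have "fev (fps_of_poly p) x = (\<Sum>i\<le>degree p. coeff p i * x ^ i)"
    unfolding fev_def by (subst suminf_finite[of "{..degree p}"]) (auto simp: coeff_eq_0)
  thus ?thesis by (simp add: poly_altdef)
qed

lemma fev_0 [simp]: "fev 0 x = 0" by (simp add: fev_def)

lemma fev_const [simp]: "fev (fps_const c) x = (c :: 'c::{nonarchimedean_field,complete_space})"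
  using fev_poly[of "[:c:]" x] by (simp add: fps_of_poly_const)

lemma fev_1 [simp]: "fev 1 x = (1 :: 'c::{nonarchimedean_field,complete_space})" using fev_const[of 1 x] by simp

lemma fev_X [simp]: "fev fps_X x = (x :: 'c::{nonarchimedean_field,complete_space})"
  using fev_poly[of "[:0, 1:]" x] by (simp add: fps_of_poly_linear)

lemma fev_sum:
  assumes "\<And>i. i \<in> A \<Longrightarrow> conv (absv x) (f i :: 'c::{nonarchimedean_field,complete_space} fps)"
  shows "fev (sum f A) x = (\<Sum>i\<in>A. fev (f i) x)"
  using assms by (induction A rule: infinite_finite_induct) (auto simp: fev_add conv_sum)

text \<open>Ultrametric Cauchy product: the product of the partial sums and the triangle of the
  product series differ by the pairs with i + j \<ge> N, and in each such pair one factor lies in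
  its tail.\<close>

lemma fev_mult:
  fixes f g :: "'c::{nonarchimedean_field,complete_space} fps"
  assumes f: "conv (absv x) f" and g: "conv (absv x) g"
  shows "fev (f * g) x = fev f x * fev g x"
proof -
  define a b where "a i = fps_nth f i * x ^ i" and "b i = fps_nth g i * x ^ i" for i
  have a: "a sums fev f x" and b: "b sums fev g x"
    using fev_sums[OF f] fev_sums[OF g] unfolding a_def[abs_def] b_def[abs_def] by blast+
  have c: "(\<lambda>n. \<Sum>i\<le>n. a i * b (n - i)) sums fev (f * g) x"
  proof -
    have "fps_nth (f * g) n * x ^ n = (\<Sum>i\<le>n. a i * b (n - i))" for n
    proof -
      have "fps_nth (f * g) n * x ^ n = (\<Sum>i=0..n. fps_nth f i * fps_nth g (n - i) * x ^ n)"
        by (simp add: fps_mult_nth sum_distrib_right)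
      also have "\<dots> = (\<Sum>i\<le>n. a i * b (n - i))"
        by (intro sum.cong) (auto simp: a_def b_def atLeast0AtMost mult_ac simp flip: power_add)
      finally show ?thesis .
    qed
    thus ?thesis using fev_sums[OF conv_mult[OF f g]] by simp
  qed
  obtain B where B: "bnd (absv x) f B" using conv_imp_bnd[OF f] by blast
  obtain C where C: "bnd (absv x) g C" using conv_imp_bnd[OF g] by blast
  note BC = B C
  define D where "D = 1 + B + C"
  have D: "D > 0" "B \<le> D" "C \<le> D" "B \<ge> 0" "C \<ge> 0"
    using bnd_nonneg[OF BC(1)] bnd_nonneg[OF BC(2)] by (auto simp: D_def)
  have aD: "absv (a i) \<le> D" and bD: "absv (b i) \<le> D" for i
    using bndD[OF BC(1), of i] bndD[OF BC(2), of i] D by (auto simp: a_def b_def absv_mult absv_power)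
  have L0: "(\<lambda>N. (\<Sum>i<N. a i) * (\<Sum>i<N. b i) - (\<Sum>n<N. \<Sum>i\<le>n. a i * b (n - i))) \<longlonglongrightarrow> 0"
  proof (rule metric_LIMSEQ_I)
    fix e :: real assume e: "e > 0"
    hence "e / D > 0" using D by auto
    then obtain N M where *: "\<And>n. n \<ge> N \<Longrightarrow> absv (a n) < e / D" "\<And>n. n \<ge> M \<Longrightarrow> absv (b n) < e / D"
      using convD[OF f \<open>e / D > 0\<close>] convD[OF g \<open>e / D > 0\<close>]
      unfolding a_def b_def absv_mult absv_power by blast
    have "absv ((\<Sum>i<n. a i) * (\<Sum>i<n. b i) - (\<Sum>k<n. \<Sum>i\<le>k. a i * b (k - i))) < e" if n: "n \<ge> N + M" for n
    proof -
      have "(\<Sum>i<n. a i) * (\<Sum>i<n. b i) = (\<Sum>(i,j)\<in>{..<n}\<times>{..<n}. a i * b j)"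
        by (simp add: sum_product sum.cartesian_product)
      moreover have "(\<Sum>k<n. \<Sum>i\<le>k. a i * b (k - i)) = (\<Sum>(i,j)\<in>{(i,j). i + j < n}. a i * b j)"
        by (rule sum.triangle_reindex[symmetric])
      moreover have "(\<Sum>(i,j)\<in>{..<n}\<times>{..<n}. a i * b j) - (\<Sum>(i,j)\<in>{(i,j). i + j < n}. a i * b j)
          = (\<Sum>(i,j)\<in>{..<n}\<times>{..<n} - {(i,j). i + j < n}. a i * b j)" by (rule sum_diff[symmetric]) auto
      moreover have "absv \<dots> < e"
      proof (rule absv_sum_less[OF _ e])
        fix p assume "p \<in> {..<n} \<times> {..<n} - {(i, j). i + j < n}"
        then obtain i j where p: "p = (i, j)" "i + j \<ge> n" by auto
        have "absv (a i * b j) < e / D * D"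
        proof (cases "i \<ge> N")
          case True
          have "absv (a i) * absv (b j) \<le> absv (a i) * D" using bD by (intro mult_left_mono) auto
          also have "\<dots> < e / D * D" using *(1)[OF True] D by (intro mult_strict_right_mono) auto
          finally show ?thesis by (simp add: absv_mult)
        next
          case False
          hence "j \<ge> M" using p n by auto
          have "absv (b j) * absv (a i) \<le> absv (b j) * D" using aD by (intro mult_left_mono) auto
          also have "\<dots> < e / D * D" using *(2)[OF \<open>j \<ge> M\<close>] D by (intro mult_strict_right_mono) auto
          finally show ?thesis by (simp add: absv_mult mult.commute)
        qed
        thus "absv (case p of (i, j) \<Rightarrow> a i * b j) < e" using D p by simp
      qed
      ultimately show ?thesis by simp
    qed
    thus "\<exists>no. \<forall>n\<ge>no. dist ((\<Sum>i<n. a i) * (\<Sum>i<n. b i) - (\<Sum>n<n. \<Sum>i\<le>n. a i * b (n - i))) 0 < e"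
      by blast
  qed
  have L1: "(\<lambda>N. (\<Sum>i<N. a i) * (\<Sum>i<N. b i) - (\<Sum>n<N. \<Sum>i\<le>n. a i * b (n - i)))
      \<longlonglongrightarrow> fev f x * fev g x - fev (f * g) x"
    using a b c unfolding sums_def by (intro tendsto_diff tendsto_mult)
  from LIMSEQ_unique[OF L1 L0] show ?thesis by simp
qed

lemma fev_power:
  fixes f :: "'c::{nonarchimedean_field,complete_space} fps"
  assumes "conv (absv x) f"
  shows "fev (f ^ n) x = fev f x ^ n" using assms by (induction n) (auto simp: fev_mult conv_power)

lemma absv_fev_le:
  fixes f :: "'c::{nonarchimedean_field,complete_space} fps"
  assumes "conv (absv x) f" "bnd (absv x) f B"
  shows "absv (fev f x) \<le> B" unfolding fev_def by (rule absv_suminf_le[OF fev_summable[OF assms(1)]])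
    (use bndD[OF assms(2)] bnd_nonneg[OF assms(2)] in \<open>auto simp: absv_mult absv_power\<close>)

text \<open>Formal division by X - x has the coefficients g_i = \<Sum> f_(i+1+j) x^j; the vanishing
  of f at x is what makes the constant coefficient match. Because |x| \<le> Z, each summand of g_i
  costs at most B / Z^(i+1), which lowers the Gauss norm by the factor Z.\<close>

lemma fps_divide_zero:
  fixes f :: "'c::{nonarchimedean_field,complete_space} fps"
  assumes f: "conv Z f" "bnd Z f B" and x: "absv x \<le> Z" "fev f x = 0" and Z: "Z > 0"
  shows "\<exists>g. f = (fps_X - fps_const x) * g \<and> conv Z g \<and> bnd Z g (B / Z)"
proof -
  define g where "g = Abs_fps (\<lambda>i. \<Sum>j. fps_nth f (i + 1 + j) * x ^ j)"
  have cx: "conv (absv x) f" using conv_mono[OF f(1)] x by auto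
  have le: "absv (fps_nth f (i + 1 + j) * x ^ j) * Z ^ i \<le> absv (fps_nth f (i + 1 + j)) * Z ^ (i + 1 + j) / Z" for i j
  proof -
    have "absv (fps_nth f (i + 1 + j) * x ^ j) * Z ^ i = (absv (fps_nth f (i + 1 + j)) * Z ^ i) * absv x ^ j"
      by (simp add: absv_mult absv_power)
    also have "\<dots> \<le> (absv (fps_nth f (i + 1 + j)) * Z ^ i) * Z ^ j"
      using x Z by (intro mult_left_mono power_mono) auto
    also have "\<dots> = absv (fps_nth f (i + 1 + j)) * Z ^ (i + 1 + j) / Z"
      using Z by (simp add: power_add field_simps)
    finally show ?thesis .
  qed
  have summ: "summable (\<lambda>j. fps_nth f (i + 1 + j) * x ^ j)" for i
  proof (rule summable_tendsto_0, subst tendsto_absv_iff, simp)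
    have "(\<lambda>j. absv (fps_nth f (j + (i + 1))) * Z ^ (j + (i + 1))) \<longlonglongrightarrow> 0"
      using f(1) unfolding conv_def by (rule LIMSEQ_ignore_initial_segment)
    hence "(\<lambda>j. absv (fps_nth f (i + 1 + j)) * Z ^ (i + 1 + j)) \<longlonglongrightarrow> 0" by (simp add: add_ac)
    hence lim: "(\<lambda>j. absv (fps_nth f (i + 1 + j)) * Z ^ (i + 1 + j) / (Z * Z ^ i)) \<longlonglongrightarrow> 0"
      by (rule tendsto_divide_zero)
    show "(\<lambda>j. absv (fps_nth f (Suc (i + j)) * x ^ j)) \<longlonglongrightarrow> 0"
    proof (rule tendsto_sandwich[OF _ _ tendsto_const lim])
      show "\<forall>\<^sub>F j in sequentially. absv (fps_nth f (Suc (i + j)) * x ^ j)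
          \<le> absv (fps_nth f (i + 1 + j)) * Z ^ (i + 1 + j) / (Z * Z ^ i)"
        using le[of i] Z by (intro always_eventually allI) (simp add: field_simps)
    qed auto
  qed
  have bound: "absv (fps_nth g i) * Z ^ i \<le> C / Z"
    if "\<And>j. absv (fps_nth f (i + 1 + j)) * Z ^ (i + 1 + j) \<le> C" "C \<ge> 0" for i C
  proof -
    have "absv (fps_nth g i) \<le> C / Z / Z ^ i" unfolding g_def fps_nth_Abs_fps
    proof (rule absv_suminf_le[OF summ])
      fix j
      have "absv (fps_nth f (i + 1 + j) * x ^ j) * Z ^ i \<le> C / Z"
        using le[of i j] divide_right_mono[OF that(1)[of j], of Z] Z by linarith
      thus "absv (fps_nth f (i + 1 + j) * x ^ j) \<le> C / Z / Z ^ i" using Z by (simp add: field_simps)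
    qed (use Z that(2) in auto)
    thus ?thesis using Z by (simp add: field_simps)
  qed
  have "f = (fps_X - fps_const x) * g"
  proof (rule fps_ext)
    fix n
    have step: "(\<lambda>j. fps_nth f (k + j) * x ^ j) sums (x * fps_nth g k + fps_nth f k)" for k
    proof -
      have "(\<lambda>j. fps_nth f (k + 1 + j) * x ^ j) sums fps_nth g k"
        using summable_sums[OF summ[of k]] by (simp add: g_def)
      hence "(\<lambda>j. x * (fps_nth f (k + 1 + j) * x ^ j)) sums (x * fps_nth g k)"
        unfolding sums_def by (simp only: sum_distrib_left[symmetric]) (intro tendsto_mult tendsto_const)
      hence "(\<lambda>j. fps_nth f (k + Suc j) * x ^ Suc j) sums (x * fps_nth g k)" by (simp add: mult_ac)
      from sums_Suc[OF this] show ?thesis by simp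
    qed
    show "fps_nth f n = fps_nth ((fps_X - fps_const x) * g) n"
    proof (cases n)
      case 0
      have "fps_nth f 0 = fev f x - x * fps_nth g 0" using step[of 0] by (simp add: sums_iff fev_def)
      thus ?thesis using x(2) by (simp add: 0 left_diff_distrib)
    next
      case (Suc m)
      have "fps_nth f n = fps_nth g m - x * fps_nth g n" using step[of n] by (simp add: Suc g_def sums_iff)
      thus ?thesis by (simp add: Suc left_diff_distrib)
    qed
  qed
  moreover have "bnd Z g (B / Z)" unfolding bnd_def using bound bndD[OF f(2)] bnd_nonneg[OF f(2)] by blast
  moreover have "conv Z g"
  proof (rule convI)
    fix e :: real assume e: "e > 0"
    then obtain N where N: "\<And>n. n \<ge> N \<Longrightarrow> absv (fps_nth f n) * Z ^ n < e * Z"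
      using convD[OF f(1), of "e * Z"] Z by auto
    have "absv (fps_nth g n) * Z ^ n \<le> e * Z / Z" if "n \<ge> N" for n
    proof (rule bound)
      show "absv (fps_nth f (n + 1 + j)) * Z ^ (n + 1 + j) \<le> e * Z" for j using N[of "n + 1 + j"] that by linarith
    qed (use e Z in auto)
    thus "\<exists>N. \<forall>n\<ge>N. absv (fps_nth g n) * Z ^ n \<le> e" using Z by auto
  qed (use Z in auto)
  ultimately show ?thesis by blast
qed

lemma fps_divide_zeros:
  fixes f :: "'c::{nonarchimedean_field,complete_space} fps"
  assumes "finite S" "conv Z f" "bnd Z f B" "\<And>x. x \<in> S \<Longrightarrow> absv x \<le> Z \<and> fev f x = 0" "Z > 0"
  shows "\<exists>g. f = (\<Prod>x\<in>S. fps_X - fps_const x) * g \<and> conv Z g \<and> bnd Z g (B / Z ^ card S)"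
  using assms
proof (induction S rule: finite_induct)
  case empty
  show ?case by (rule exI[of _ f]) (use empty in simp)
next
  case (insert y S)
  have "\<exists>g. f = (\<Prod>x\<in>S. fps_X - fps_const x) * g \<and> conv Z g \<and> bnd Z g (B / Z ^ card S)"
    using insert.prems by (intro insert.IH) blast+
  then obtain g where g: "f = (\<Prod>x\<in>S. fps_X - fps_const x) * g" "conv Z g" "bnd Z g (B / Z ^ card S)"
    by blast
  have y: "absv y \<le> Z" "fev f y = 0" using insert by auto
  have cy: "conv (absv y) (fps_X - fps_const x)" for x :: 'c by (intro conv_diff) auto
  have "fev (\<Prod>x\<in>S'. fps_X - fps_const x) y = (\<Prod>x\<in>S'. y - x) \<and> conv (absv y) (\<Prod>x\<in>S'. fps_X - fps_const x)"
    if "finite S'" for S' using that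
    by (induction S' rule: finite_induct) (auto simp: fev_mult fev_diff cy intro!: conv_mult)
  hence "fev f y = (\<Prod>x\<in>S. y - x) * fev g y"
    using g(1) fev_mult[of y "\<Prod>x\<in>S. fps_X - fps_const x" g] conv_mono[OF g(2)] y insert(1) by simp
  hence "fev g y = 0" using y insert(1,2) by auto
  then obtain h where h: "g = (fps_X - fps_const y) * h" "conv Z h" "bnd Z h (B / Z ^ card S / Z)"
    using fps_divide_zero[OF g(2,3) y(1) _ insert.prems(4)] by blast
  show ?case
  proof (intro exI[of _ h] conjI)
    show "f = (\<Prod>x\<in>insert y S. fps_X - fps_const x) * h" using insert g(1) h(1) by (simp add: mult_ac)
    show "bnd Z h (B / Z ^ card (insert y S))" using h(3) insert by (simp add: mult_ac)
  qed fact
qed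

text \<open>Dividing out the zeros on the large disc gains Z for each of them, while multiplying the
  linear factors back on the small disc costs only Y.\<close>

lemma schwarz:
  fixes f :: "'c::{nonarchimedean_field,complete_space} fps"
  assumes "finite S" "conv Z f" "bnd Z f B" "\<And>x. x \<in> S \<Longrightarrow> absv x \<le> Y \<and> fev f x = 0" "0 < Y" "Y \<le> Z"
  shows "bnd Y f ((Y / Z) ^ card S * B)"
proof -
  have Z: "Z > 0" using assms by linarith
  have zs: "absv x \<le> Z \<and> fev f x = 0" if "x \<in> S" for x using assms(4)[OF that] assms(6) by linarith
  obtain g where g: "f = (\<Prod>x\<in>S. fps_X - fps_const x) * g" "conv Z g" "bnd Z g (B / Z ^ card S)"
    using fps_divide_zeros[OF assms(1-3) zs Z] by blast
  have "bnd Y (\<Prod>x\<in>S. fps_X - fps_const x) (\<Prod>x\<in>S. Y)"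
    using assms by (intro bnd_prod bnd_linear) auto
  moreover have "bnd Y g (B / Z ^ card S)" using g(3) assms by (intro bnd_mono_radius[OF g(3)]) auto
  ultimately have "bnd Y ((\<Prod>x\<in>S. fps_X - fps_const x) * g) ((\<Prod>x\<in>S. Y) * (B / Z ^ card S))"
    using assms(5) by (intro bnd_mult) auto
  hence "bnd Y f ((\<Prod>x\<in>S. Y) * (B / Z ^ card S))" unfolding g(1)[symmetric] .
  thus ?thesis by (simp add: power_divide field_simps)
qed

context C_infinity
begin

subsection \<open>Frobenius twists\<close>

text \<open>Only nonnegative twists are defined on arbitrary series. Roots of coefficients are taken
  for polynomials over kbar alone (\<open>untw\<close>, \<open>twist\<close>).\<close>

definition tw :: "nat \<Rightarrow> 'c fps \<Rightarrow> 'c fps"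
  where "tw n f = Abs_fps (\<lambda>i. fps_nth f i ^ (q ^ n))"

definition twp :: "nat \<Rightarrow> 'c poly \<Rightarrow> 'c poly"
  where "twp n p = map_poly (\<lambda>x. x ^ (q ^ n)) p"

definition entire :: "'c fps \<Rightarrow> bool"
  where "entire f \<longleftrightarrow> (\<forall>R\<ge>0. conv R f)"

lemma zero_pow_qn [simp]: "(0 :: 'c) ^ (q ^ n) = 0" by (simp add: power_0_left)

lemma tw_nth [simp]: "fps_nth (tw n f) i = fps_nth f i ^ (q ^ n)" by (simp add: tw_def)

lemma tw_id [simp]: "tw 0 f = f" by (rule fps_ext) simp

lemma tw_tw: "tw m (tw n f) = tw (m + n) f" by (rule fps_ext) (simp add: power_add mult.commute flip: power_mult)

lemma tw_add: "tw n (f + g) = tw n f + tw n g" by (rule fps_ext) (simp add: add_pow_qn)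

lemma tw_0 [simp]: "tw n 0 = 0" by (rule fps_ext) simp

lemma tw_diff: "tw n (f - g) = tw n f - tw n g" by (rule fps_ext) (simp add: diff_pow_qn)

lemma tw_mult: "tw n (f * g) = tw n f * tw n g"
  by (rule fps_ext) (simp add: fps_mult_nth sum_pow_qn power_mult_distrib)

lemma tw_const [simp]: "tw n (fps_const c) = fps_const (c ^ (q ^ n))" by (rule fps_ext) simp

lemma tw_1 [simp]: "tw n 1 = 1" using tw_const[of n 1] by simp

lemma tw_X [simp]: "tw n fps_X = fps_X" by (rule fps_ext) (simp add: fps_X_def)

lemma tw_power: "tw n (f ^ k) = tw n f ^ k" by (induction k) (auto simp: tw_mult)

lemma tw_sum: "tw n (sum f A) = (\<Sum>i\<in>A. tw n (f i))"
  by (induction A rule: infinite_finite_induct) (auto simp: tw_add)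

lemma tw_eq_iff [simp]: "tw n f = tw n g \<longleftrightarrow> f = g" by (auto simp: fps_eq_iff)

lemma tw_eq_0_iff [simp]: "tw n f = 0 \<longleftrightarrow> f = 0" using tw_eq_iff[of n f 0] by (simp del: tw_eq_iff)

lemma twp_coeff [simp]: "coeff (twp n p) i = coeff p i ^ (q ^ n)" by (simp add: twp_def coeff_map_poly)

lemma fps_of_twp: "fps_of_poly (twp n p) = tw n (fps_of_poly p)" by (rule fps_ext) simp

lemma twp_twp: "twp m (twp n p) = twp (m + n) p"
  by (rule poly_eqI) (simp add: power_add mult.commute flip: power_mult)

lemma twp_add: "twp n (f + g) = twp n f + twp n g" by (rule poly_eqI) (simp add: add_pow_qn)

lemma twp_0 [simp]: "twp n 0 = 0" by (rule poly_eqI) simp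

lemma twp_uminus: "twp n (- f) = - twp n f" by (rule poly_eqI) (simp add: minus_pow_qn)

lemma twp_mult: "twp n (f * g) = twp n f * twp n g"
  by (rule poly_eqI) (simp add: coeff_mult sum_pow_qn power_mult_distrib)

lemma twp_pCons: "twp n (pCons c p) = pCons (c ^ (q ^ n)) (twp n p)"
  by (rule poly_eqI) (simp add: coeff_pCons split: nat.split)

lemma twp_1 [simp]: "twp n 1 = 1" by (rule poly_eqI) (simp add: one_pCons coeff_pCons split: nat.split)

lemma twp_sum: "twp n (sum f A) = (\<Sum>i\<in>A. twp n (f i))"
  by (induction A rule: infinite_finite_induct) (auto simp: twp_add)

lemma twp_power: "twp n (f ^ k) = twp n f ^ k" by (induction k) (auto simp: twp_mult)

lemma twp_smult: "twp n (Polynomial.smult c p) = Polynomial.smult (c ^ (q ^ n)) (twp n p)"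
  by (rule poly_eqI) (simp add: power_mult_distrib)

lemma twp_eq_iff [simp]: "twp n f = twp n g \<longleftrightarrow> f = g" by (auto simp: poly_eq_iff)

lemma twp_eq_0_iff [simp]: "twp n f = 0 \<longleftrightarrow> f = 0"
  using twp_eq_iff[of n f 0] by (simp del: twp_eq_iff)

lemma degree_twp [simp]: "degree (twp n p) = degree p"
proof -
  have "{i. \<forall>j>i. coeff (twp n p) j = 0} = {i. \<forall>j>i. coeff p j = 0}" by simp
  thus ?thesis unfolding Polynomial.degree_def by (metis (no_types, lifting) twp_coeff power_eq_0_iff zero_pow_qn)
qed

lemma poly_twp: "poly (twp n p) (x ^ (q ^ n)) = poly p x ^ (q ^ n)"
  by (simp add: poly_altdef sum_pow_qn power_mult_distrib mult.commute flip: power_mult)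

lemma twp_const_cst: "twp n (map_poly cst p) = map_poly cst p"
  by (rule poly_eqI) (simp add: coeff_map_poly cst_pow_qn)

lemma bnd_tw:
  assumes "bnd R f B" "R \<ge> 0"
  shows "bnd (R ^ (q ^ n)) (tw n f) (B ^ (q ^ n))" unfolding bnd_def
proof
  fix i
  have "absv (fps_nth (tw n f) i) * (R ^ (q ^ n)) ^ i = (absv (fps_nth f i) * R ^ i) ^ (q ^ n)"
    by (simp add: absv_power power_mult_distrib mult.commute flip: power_mult)
  also have "\<dots> \<le> B ^ (q ^ n)" using bndD[OF assms(1)] assms(2) by (intro power_mono) auto
  finally show "absv (fps_nth (tw n f) i) * (R ^ (q ^ n)) ^ i \<le> B ^ (q ^ n)" .
qed

lemma conv_tw:
  assumes "conv R f"
  shows "conv (R ^ (q ^ n)) (tw n f)"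
proof -
  have "(\<lambda>i. (absv (fps_nth f i) * R ^ i) ^ (q ^ n)) \<longlonglongrightarrow> 0 ^ (q ^ n)"
    using assms unfolding conv_def by (rule tendsto_power)
  moreover have "absv (fps_nth (tw n f) i) * (R ^ (q ^ n)) ^ i = (absv (fps_nth f i) * R ^ i) ^ (q ^ n)" for i
    by (simp add: absv_power power_mult_distrib mult.commute flip: power_mult)
  ultimately show ?thesis unfolding conv_def by (simp add: power_0_left)
qed

lemma entireD: "entire f \<Longrightarrow> R \<ge> 0 \<Longrightarrow> conv R f" by (auto simp: entire_def)

lemma entire_tw: assumes "entire f" shows "entire (tw n f)" unfolding entire_def
proof (intro allI impI)
  fix R :: real assume R: "R \<ge> 0"
  have "q ^ n > 0" by simp
  hence "root (q ^ n) R ^ (q ^ n) = R" using R by (rule real_root_pow_pos2)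
  moreover have "conv (root (q ^ n) R) f" using R by (intro entireD[OF assms]) auto
  ultimately show "conv R (tw n f)" using conv_tw by metis
qed

lemma entire_diff: "entire f \<Longrightarrow> entire g \<Longrightarrow> entire (f - g)"
  by (auto simp: entire_def intro: conv_diff)
lemma entire_mult: "entire f \<Longrightarrow> entire g \<Longrightarrow> entire (f * g)"
  by (auto simp: entire_def intro: conv_mult)
lemma entire_power: "entire f \<Longrightarrow> entire (f ^ n)" by (auto simp: entire_def intro: conv_power)
lemma entire_sum: "(\<And>i. i \<in> A \<Longrightarrow> entire (f i)) \<Longrightarrow> entire (sum f A)"
  by (auto simp: entire_def intro: conv_sum)
lemma entire_poly [simp]: "entire (fps_of_poly p)" by (auto simp: entire_def)
lemma entire_const [simp]: "entire (fps_const p)" by (auto simp: entire_def)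
lemma entire_1 [simp]: "entire 1" by (auto simp: entire_def)
lemma entire_0 [simp]: "entire 0" by (auto simp: entire_def)

lemma efev_add: "entire f \<Longrightarrow> entire g \<Longrightarrow> fev (f + g) x = fev f x + fev g x"
  by (intro fev_add entireD) auto
lemma efev_diff: "entire f \<Longrightarrow> entire g \<Longrightarrow> fev (f - g) x = fev f x - fev g x"
  by (intro fev_diff entireD) auto
lemma efev_mult: "entire f \<Longrightarrow> entire g \<Longrightarrow> fev (f * g) x = fev f x * fev g x"
  by (intro fev_mult entireD) auto
lemma efev_power: "entire f \<Longrightarrow> fev (f ^ n) x = fev f x ^ n" by (intro fev_power entireD) auto
lemma efev_sum: "(\<And>i. i \<in> A \<Longrightarrow> entire (f i)) \<Longrightarrow> fev (sum f A) x = (\<Sum>i\<in>A. fev (f i) x)"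
  by (intro fev_sum entireD) auto

lemma tendsto_pow_qn:
  assumes "(f \<longlongrightarrow> (l :: 'c)) F" shows "((\<lambda>x. f x ^ (q ^ n)) \<longlongrightarrow> l ^ (q ^ n)) F"
proof -
  have "((\<lambda>x. absv (f x - l) ^ (q ^ n)) \<longlongrightarrow> 0 ^ (q ^ n)) F"
    using assms by (intro tendsto_power) (simp add: tendsto_absv_iff[symmetric])
  thus ?thesis by (subst tendsto_absv_iff) (simp add: diff_pow_qn[symmetric] absv_power power_0_left)
qed

lemma fev_tw:
  assumes "conv (absv x) f"
  shows "fev (tw n f) (x ^ (q ^ n)) = fev f x ^ (q ^ n)"
proof -
  have "(\<lambda>N. (\<Sum>i<N. fps_nth f i * x ^ i) ^ (q ^ n)) \<longlonglongrightarrow> fev f x ^ (q ^ n)"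
    using fev_sums[OF assms] unfolding sums_def by (rule tendsto_pow_qn)
  hence "(\<lambda>i. fps_nth (tw n f) i * (x ^ (q ^ n)) ^ i) sums (fev f x ^ (q ^ n))"
    unfolding sums_def by (simp add: sum_pow_qn power_mult_distrib mult.commute flip: power_mult)
  thus ?thesis unfolding fev_def by (simp add: sums_iff)
qed

lemma efev_tw: "entire f \<Longrightarrow> fev (tw n f) (x ^ (q ^ n)) = fev f x ^ (q ^ n)"
  by (intro fev_tw entireD) auto

text \<open>Coefficients fixed by the q-power map lie in F_q, where nonzero means absolute value 1;
  convergence at radius 1 then leaves finitely many of them.\<close>

lemma tw_fixed_imp_poly:
  assumes "tw 1 f = f" "conv 1 f"
  shows "\<exists>p. f = fps_of_poly (map_poly cst p)"
proof -
  have "\<exists>a. fps_nth f i = cst a" for i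
  proof -
    have "fps_nth f i ^ q = fps_nth f i" using arg_cong[OF assms(1), of "\<lambda>g. fps_nth g i"] by simp
    thus ?thesis using Fq_iff[of "fps_nth f i"] by (auto simp: Fq_eq)
  qed
  then obtain c where c: "\<And>i. fps_nth f i = cst (c i)" by metis
  obtain N where N: "\<And>n. n \<ge> N \<Longrightarrow> absv (fps_nth f n) * 1 ^ n < 1"
    using convD[OF assms(2), of 1] by auto
  have z: "c n = 0" if "n \<ge> N" for n using N[OF that] by (auto simp: c absv_cst split: if_splits)
  have "f = fps_of_poly (map_poly cst (\<Sum>i<N. monom (c i) i))"
  proof (rule fps_ext)
    fix n
    have "(\<Sum>i<N. if i = n then c i else 0) = (if n < N then c n else 0)" by (subst sum.delta) auto
    thus "fps_nth f n = fps_nth (fps_of_poly (map_poly cst (\<Sum>i<N. monom (c i) i))) n"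
      using z[of n] by (auto simp: c coeff_map_poly coeff_sum)
  qed
  thus ?thesis by blast
qed

subsection \<open>The function Omega\<close>

text \<open>Iterates y \<mapsto> c - a y^q from c. Additivity of the q-power gives the exact
  recursion -a d^q for successive differences d, and the hypothesis makes them shrink geometrically
  with ratio \<open>\<rho>\<close>.\<close>

lemma additive_equation_solvable:
  fixes a c :: 'c
  assumes "absv a * absv c ^ (q - 1) < 1"
  shows "\<exists>x. x + a * x ^ q = c \<and> absv x \<le> absv c"
proof -
  define \<rho> where "\<rho> = absv a * absv c ^ (q - 1)"
  have \<rho>: "0 \<le> \<rho>" "\<rho> < 1" using assms by (auto simp: \<rho>_def)
  define d where "d = rec_nat (- a * c ^ q) (\<lambda>_ y. - a * y ^ q)"
  have d0: "d 0 = - a * c ^ q" and dS: "d (Suc k) = - a * d k ^ q" for k by (simp_all add: d_def)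
  have qS: "y ^ q = y * y ^ (q - 1)" for y :: real using q_gt_0 by (metis Suc_diff_1 power_Suc)
  have dle: "absv (d k) \<le> absv c * \<rho> ^ Suc k" for k
  proof (induction k)
    case 0
    show ?case by (simp add: d0 absv_mult absv_power qS \<rho>_def mult_ac)
  next
    case (Suc k)
    have "\<rho> ^ Suc k \<le> 1" using \<rho> by (intro power_le_one) auto
    hence le: "absv (d k) \<le> absv c" using Suc mult_left_le[of "\<rho> ^ Suc k" "absv c"] by simp
    have "absv (d (Suc k)) = absv (d k) * (absv a * absv (d k) ^ (q - 1))"
      by (simp add: dS absv_mult absv_power qS mult_ac)
    also have "\<dots> \<le> (absv c * \<rho> ^ Suc k) * \<rho>"
      unfolding \<rho>_def using Suc le \<rho> by (intro mult_mono power_mono mult_left_mono) (auto simp: \<rho>_def)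
    finally show ?case by (simp add: mult_ac)
  qed
  define y where "y n = c + sum d {..<n}" for n
  have yS: "y (Suc n) = c - a * y n ^ q" for n
  proof (induction n)
    case 0
    show ?case by (simp add: y_def d0)
  next
    case (Suc n)
    have "y (Suc (Suc n)) = y (Suc n) + d (Suc n)" by (simp add: y_def)
    also have "\<dots> = c - a * (y n ^ q + d n ^ q)" by (simp add: Suc dS algebra_simps)
    also have "y n ^ q + d n ^ q = (y n + d n) ^ q" by (simp add: add_pow_q)
    also have "y n + d n = y (Suc n)" by (simp add: y_def)
    finally show ?case .
  qed
  have "(\<lambda>k. absv c * \<rho> ^ Suc k) \<longlonglongrightarrow> absv c * 0"
    using \<rho> by (intro tendsto_mult tendsto_const LIMSEQ_Suc[OF LIMSEQ_realpow_zero]) auto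
  hence "(\<lambda>k. absv (d k)) \<longlonglongrightarrow> 0"
    using tendsto_sandwich[of "\<lambda>_. 0" "\<lambda>k. absv (d k)" sequentially "\<lambda>k. absv c * \<rho> ^ Suc k" 0] dle by simp
  hence "d \<longlonglongrightarrow> 0" by (subst tendsto_absv_iff) simp
  then obtain S where S: "d sums S" using summable_tendsto_0 by (auto simp: summable_def)
  hence ylim: "y \<longlonglongrightarrow> c + S" unfolding sums_def y_def[abs_def] by (intro tendsto_intros)
  have "(\<lambda>n. c - a * y n ^ q) \<longlonglongrightarrow> c - a * (c + S) ^ q"
    using tendsto_pow_qn[OF ylim, of 1] by (intro tendsto_intros) simp
  moreover have "(\<lambda>n. c - a * y n ^ q) \<longlonglongrightarrow> c + S"
    using LIMSEQ_Suc[OF ylim] by (simp add: yS)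
  ultimately have "c + S = c - a * (c + S) ^ q" using LIMSEQ_unique by blast
  moreover have "absv (c + S) \<le> absv c"
  proof (rule absv_limit_le[OF ylim, of 0])
    fix n
    have "absv (d k) \<le> absv c" for k
    proof -
      have "\<rho> ^ Suc k \<le> 1" using \<rho> by (intro power_le_one) auto
      thus ?thesis using dle[of k] mult_left_le[of "\<rho> ^ Suc k" "absv c"] by simp
    qed
    thus "absv (y n) \<le> absv c" unfolding y_def by (intro absv_add_leI absv_sum_le) auto
  qed
  ultimately show ?thesis by (intro exI[of _ "c + S"]) (simp add: algebra_simps)
qed

lemma q_pow_ge_1 [simp]: "Suc 0 \<le> q ^ n" using zero_less_power[OF q_gt_0, of n] by linarith

lemma entire_linear [simp]: "entire (fps_X - fps_const c)" by (intro entire_diff) (auto simp: entire_def)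

lemma one_add_mult_le_pow: "1 + a * i \<le> (1 + a) ^ (i::nat)" for a :: nat
proof (induction i)
  case (Suc i)
  show ?case using mult_le_mono2[OF Suc, of "1 + a"] by (simp add: algebra_simps)
qed auto

lemma root_exists: "n > 0 \<Longrightarrow> \<exists>y \<in> range \<iota>. y ^ n = \<iota> x"
proof -
  assume "n > 0"
  then obtain y where "y ^ n = x" using nth_root_exists by blast
  thus ?thesis by (intro bexI[of _ "\<iota> y"]) (auto simp: emb_power[symmetric])
qed

lemma real_pow_q: "(y::real) ^ q = y * y ^ (q - 1)" using q_gt_0 by (metis Suc_diff_1 power_Suc)

lemma c_pow_q: "(y::'c) ^ q = y * y ^ (q - 1)" using q_gt_0 by (metis Suc_diff_1 power_Suc)

text \<open>The functional equation is solved coefficient by coefficient. The constant coefficient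
  must satisfy w^(q-1) = -1 / \<theta>^q, and c_(n+1) is chosen as a solution of y + \<theta>^q y^q
  = c_n^q no larger than c_n^q, which yields the doubly exponential decay.\<close>

lemma Omega_exists:
  "\<exists>f :: 'c fps. f = (fps_X - fps_const (\<theta> ^ q)) * tw 1 f \<and>
     real q ^ q * absv (fps_nth f 0) ^ (q - 1) = 1 \<and>
     (\<forall>i. absv (fps_nth f i) \<le> absv (fps_nth f 0) ^ (q ^ i))"
proof -
  have "q - 1 > 0" using q_gt_1 by simp
  then obtain w where w: "w ^ (q - 1) = \<iota> (- (1 / to_ac fls_X_inv ^ q))" using root_exists by blast
  hence w': "w ^ (q - 1) = - (1 / \<theta> ^ q)" by (simp add: emb_minus emb_divide emb_power theta_def)
  define b where "b = absv w"
  have b: "real q ^ q * b ^ (q - 1) = 1"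
    using arg_cong[OF w', of absv] by (simp add: b_def absv_power absv_divide absv_theta)
  have b0: "b > 0" using b \<open>q - 1 > 0\<close> by (cases "b = 0") (auto simp: b_def power_0_left)
  have b1: "b < 1"
  proof (rule ccontr)
    assume "\<not> b < 1"
    hence "b ^ (q - 1) \<ge> 1" by (intro one_le_power) auto
    moreover have "real q ^ q > 1" using q_gt_1 by (intro one_less_power) auto
    ultimately have "real q ^ q * b ^ (q - 1) > 1 * 1" by (intro mult_less_le_imp_less) auto
    thus False using b by simp
  qed
  define P where "P n x \<longleftrightarrow> absv x \<le> b ^ (q ^ n) \<and> (n = 0 \<longrightarrow> x = w)" for n and x :: 'c
  have "\<exists>f. \<forall>n. P n (f n) \<and> f (Suc n) + \<theta> ^ q * f (Suc n) ^ q = f n ^ q"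
  proof (rule dependent_nat_choice)
    show "\<exists>x. P 0 x" by (auto simp: P_def b_def)
  next
    fix x n assume "P n x"
    hence x: "absv x \<le> b ^ (q ^ n)" by (simp add: P_def)
    have "b ^ (q ^ n) \<le> b ^ 1" using b0 b1 by (intro power_decreasing) auto
    hence xb: "absv x \<le> b" using x by simp
    \<comment> \<open>By the normalisation q^q b^(q-1) = 1, the solvability condition reduces to
      b^((q-1)^2) < 1.\<close>
    have "absv (\<theta> ^ q) * absv (x ^ q) ^ (q - 1) \<le> real q ^ q * (b ^ q) ^ (q - 1)"
      using xb by (auto simp: absv_power absv_theta intro!: mult_left_mono power_mono)
    also have "(b ^ q) ^ (q - 1) = b ^ (q - 1) * b ^ ((q - 1) * (q - 1))"
      by (simp only: real_pow_q[of b] power_mult_distrib power_mult)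
    also have "real q ^ q * (b ^ (q - 1) * b ^ ((q - 1) * (q - 1))) = b ^ ((q - 1) * (q - 1))"
      by (simp only: mult.assoc[symmetric] b mult_1_left)
    also have "\<dots> < 1" using b0 b1 \<open>q - 1 > 0\<close> by (intro power_strict_decreasing[of 0 _ b, simplified]) auto
    finally obtain y where y: "y + \<theta> ^ q * y ^ q = x ^ q" "absv y \<le> absv (x ^ q)"
      using additive_equation_solvable by blast
    have "absv (x ^ q) \<le> (b ^ (q ^ n)) ^ q" using x unfolding absv_power by (intro power_mono) auto
    hence "P (Suc n) y" using y(2) by (simp add: P_def mult.commute flip: power_mult)
    thus "\<exists>y. P (Suc n) y \<and> y + \<theta> ^ q * y ^ q = x ^ q" using y by blast
  qed
  then obtain c where c: "\<And>n. P n (c n)" "\<And>n. c (Suc n) + \<theta> ^ q * c (Suc n) ^ q = c n ^ q" by blast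
  have c0: "c 0 = w" using c(1)[of 0] by (simp add: P_def)
  have w'': "w = - (\<theta> ^ q * w ^ q)" using w' by (simp add: c_pow_q[of w])
  have "Abs_fps c = (fps_X - fps_const (\<theta> ^ q)) * tw 1 (Abs_fps c)"
  proof (rule fps_ext)
    fix n
    show "fps_nth (Abs_fps c) n = fps_nth ((fps_X - fps_const (\<theta> ^ q)) * tw 1 (Abs_fps c)) n"
    proof (cases n)
      case 0
      thus ?thesis using w'' by (simp add: left_diff_distrib c0)
    next
      case (Suc m)
      thus ?thesis using c(2)[of m] by (simp add: left_diff_distrib eq_diff_eq)
    qed
  qed
  moreover have "absv (c i) \<le> b ^ (q ^ i)" for i using c(1)[of i] by (simp add: P_def)
  ultimately show ?thesis using b by (intro exI[of _ "Abs_fps c"]) (auto simp: c0 b_def[symmetric])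
qed

definition Omega :: "'c fps" where
  "Omega = (SOME f :: 'c fps. f = (fps_X - fps_const (\<theta> ^ q)) * tw 1 f \<and>
     real q ^ q * absv (fps_nth f 0) ^ (q - 1) = 1 \<and>
     (\<forall>i. absv (fps_nth f i) \<le> absv (fps_nth f 0) ^ (q ^ i)))"

text \<open>This number is q^(-q/(q-1)), so |u| \<open>b\<Omega>\<close>^s < 1 says |u| <
  |\<theta>|^(qs/(q-1)), the convergence condition in depth one.\<close>

definition b\<Omega> :: real where "b\<Omega> = absv (fps_nth Omega 0)"

lemma Omega_eq: "Omega = (fps_X - fps_const (\<theta> ^ q)) * tw 1 Omega"
  and b\<Omega>_eq: "real q ^ q * b\<Omega> ^ (q - 1) = 1"
  and Omega_coeff_le: "absv (fps_nth Omega i) \<le> b\<Omega> ^ (q ^ i)"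
  using someI_ex[OF Omega_exists, folded Omega_def] by (auto simp: b\<Omega>_def)

lemma b\<Omega>_pos: "b\<Omega> > 0"
  using b\<Omega>_eq q_gt_1 by (cases "b\<Omega> = 0") (auto simp: b\<Omega>_def power_0_left)

lemma b\<Omega>_less_1: "b\<Omega> < 1"
proof (rule ccontr)
  assume "\<not> b\<Omega> < 1"
  hence "b\<Omega> ^ (q - 1) \<ge> 1" by (intro one_le_power) auto
  moreover have "real q ^ q > 1" using q_gt_1 by (intro one_less_power) auto
  ultimately have "real q ^ q * b\<Omega> ^ (q - 1) > 1 * 1" by (intro mult_less_le_imp_less) auto
  thus False using b\<Omega>_eq by simp
qed

lemma Omega_term_le: 
  assumes "R \<ge> 0"
  shows "absv (fps_nth Omega i) * R ^ i \<le> b\<Omega> * (b\<Omega> ^ (q - 1) * R) ^ i"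
proof -
  have "1 + (q - 1) * i \<le> (1 + (q - 1)) ^ i" by (rule one_add_mult_le_pow)
  hence "1 + (q - 1) * i \<le> q ^ i" using q_gt_0 by simp
  hence "b\<Omega> ^ (q ^ i) \<le> b\<Omega> ^ (1 + (q - 1) * i)"
    using b\<Omega>_pos b\<Omega>_less_1 by (intro power_decreasing) auto
  hence "absv (fps_nth Omega i) * R ^ i \<le> b\<Omega> ^ (1 + (q - 1) * i) * R ^ i"
    using Omega_coeff_le[of i] assms by (intro mult_right_mono) auto
  also have "\<dots> = b\<Omega> * (b\<Omega> ^ (q - 1) * R) ^ i" by (simp add: power_mult_distrib flip: power_mult)
  finally show ?thesis .
qed

text \<open>The constant coefficient carries the Gauss norm up to the radius |\<theta>^q| of the
  first zero of \<Omega>.\<close>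

lemma bnd_Omega:
  assumes "0 \<le> R" "R \<le> real q ^ q" shows "bnd R Omega b\<Omega>" unfolding bnd_def
proof
  fix i
  have "b\<Omega> ^ (q - 1) * R \<le> b\<Omega> ^ (q - 1) * real q ^ q"
    using assms b\<Omega>_pos by (intro mult_left_mono) auto
  also have "\<dots> = 1" using b\<Omega>_eq by (subst mult.commute)
  finally have "(b\<Omega> ^ (q - 1) * R) ^ i \<le> 1"  using b\<Omega>_pos assms by (intro power_le_one) auto
  hence "b\<Omega> * (b\<Omega> ^ (q - 1) * R) ^ i \<le> b\<Omega> * 1" using b\<Omega>_pos by (intro mult_left_mono) auto
  thus "absv (fps_nth Omega i) * R ^ i \<le> b\<Omega>" using Omega_term_le[OF assms(1), of i] by linarith
qed

lemma entire_Omega: "entire Omega" unfolding entire_def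
proof (intro allI impI)
  fix R :: real assume R: "R \<ge> 0"
  show "conv R Omega"
  proof (rule convI)
    fix e :: real assume e: "e > 0"
    \<comment> \<open>Since q^n eventually exceeds m n, this m forces the n-th term below (b^m
      (R+1))^n \<le> 2^(-n).\<close>
    obtain m where m: "b\<Omega> ^ m * (R + 1) < 1 / 2"
    proof -
      have "1 / 2 / (R + 1) > 0" using R by simp
      then obtain m where "b\<Omega> ^ m < 1 / 2 / (R + 1)" using real_arch_pow_inv b\<Omega>_less_1 by blast
      hence "b\<Omega> ^ m * (R + 1) < 1 / 2" using R by (simp add: field_simps)
      thus ?thesis using that by blast
    qed
    have "(\<lambda>n. real m * (real n / real q ^ n)) \<longlonglongrightarrow> real m * 0"
      using q_gt_1 by (intro tendsto_intros lim_n_over_pown) auto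
    hence "\<forall>\<^sub>F n in sequentially. real m * (real n / real q ^ n) < 1" by (rule order_tendstoD(2)) simp
    hence ev1: "\<forall>\<^sub>F n in sequentially. m * n \<le> q ^ n"
    proof eventually_elim
      case (elim n)
      hence "real (m * n) < real (q ^ n)" using q_gt_0 by (simp add: field_simps)
      thus ?case by linarith
    qed
    have "(\<lambda>n. (1/2::real) ^ n) \<longlonglongrightarrow> 0" by (rule LIMSEQ_realpow_zero) auto
    hence ev2: "\<forall>\<^sub>F n in sequentially. (1/2::real) ^ n < e" by (rule order_tendstoD(2)) fact
    have "\<forall>\<^sub>F n in sequentially. absv (fps_nth Omega n) * R ^ n \<le> e" using ev1 ev2
    proof eventually_elim
      case (elim n)
      have "absv (fps_nth Omega n) * R ^ n \<le> b\<Omega> ^ (q ^ n) * (R + 1) ^ n"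
        using Omega_coeff_le[of n] R b\<Omega>_pos by (intro mult_mono power_mono) auto
      also have "\<dots> \<le> b\<Omega> ^ (m * n) * (R + 1) ^ n"
        using elim b\<Omega>_pos b\<Omega>_less_1 R by (intro mult_right_mono power_decreasing) auto
      also have "\<dots> = (b\<Omega> ^ m * (R + 1)) ^ n" by (simp add: power_mult power_mult_distrib)
      also have "\<dots> \<le> (1/2) ^ n" using m R b\<Omega>_pos by (intro power_mono) auto
      finally show ?case using elim by linarith
    qed
    thus "\<exists>N. \<forall>n\<ge>N. absv (fps_nth Omega n) * R ^ n \<le> e" by (simp add: eventually_sequentially)
  qed fact
qed

text \<open>At radius q the nonconstant part has Gauss norm at most \<open>b\<Omega>\<close> / q,
  strictly below the constant coefficient. In particular \<Omega> does not vanish at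
  \<theta>.\<close>

lemma absv_Omega_theta: "absv (fev Omega \<theta>) = b\<Omega>"
proof -
  define f where "f = Omega - fps_const (fps_nth Omega 0)"
  have qb: "real q * b\<Omega> ^ (q - 1) \<le> 1 / real q"
  proof -
    have "real q ^ 2 \<le> real q ^ q" using q_ge_2 by (intro power_increasing) auto
    hence "b\<Omega> ^ (q - 1) * real q ^ 2 \<le> b\<Omega> ^ (q - 1) * real q ^ q"
      using b\<Omega>_pos by (intro mult_left_mono) auto
    hence "b\<Omega> ^ (q - 1) * real q ^ 2 \<le> 1" using b\<Omega>_eq by (simp add: mult.commute)
    thus ?thesis using q_gt_0 by (simp add: field_simps power2_eq_square)
  qed
  have "bnd (real q) f (b\<Omega> / real q)" unfolding bnd_def
  proof
    fix i
    show "absv (fps_nth f i) * real q ^ i \<le> b\<Omega> / real q"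
    proof (cases i)
      case 0
      thus ?thesis using b\<Omega>_pos by (simp add: f_def)
    next
      case (Suc j)
      have r: "0 \<le> b\<Omega> ^ (q - 1) * real q" "b\<Omega> ^ (q - 1) * real q \<le> 1"
        using qb b\<Omega>_pos q_gt_1 by (auto simp: mult.commute elim!: order_trans)
      have "absv (fps_nth f i) * real q ^ i \<le> b\<Omega> * (b\<Omega> ^ (q - 1) * real q) ^ i"
        using Omega_term_le[of "real q" i] by (simp add: f_def Suc)
      also have "\<dots> \<le> b\<Omega> * (b\<Omega> ^ (q - 1) * real q) ^ 1"
        using r b\<Omega>_pos by (intro mult_left_mono power_decreasing) (auto simp: Suc)
      also have "\<dots> \<le> b\<Omega> * (1 / real q)"
        using qb b\<Omega>_pos by (intro mult_left_mono) (auto simp: mult.commute)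
      finally show ?thesis by simp
    qed
  qed
  moreover have ef: "entire f" by (simp add: f_def entire_diff entire_Omega)
  ultimately have "absv (fev f \<theta>) \<le> b\<Omega> / real q"
    by (intro absv_fev_le entireD) (auto simp: absv_theta)
  also have "\<dots> < b\<Omega>" using b\<Omega>_pos q_gt_1 by (simp add: field_simps)
  finally have "absv (fps_nth Omega 0 + fev f \<theta>) = absv (fps_nth Omega 0)"
    unfolding b\<Omega>_def by (intro absv_add_dominant)
  thus ?thesis by (simp add: f_def efev_diff entire_Omega b\<Omega>_def)
qed

lemma Omega_theta_nonzero: "fev Omega \<theta> \<noteq> 0" using absv_Omega_theta b\<Omega>_pos by force

lemma fev_Omega_eq: "fev Omega x = (x - \<theta> ^ q) * fev (tw 1 Omega) x"
proof -
  have "fev Omega x = fev ((fps_X - fps_const (\<theta> ^ q)) * tw 1 Omega) x" using Omega_eq by metis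
  also have "\<dots> = fev (fps_X - fps_const (\<theta> ^ q)) x * fev (tw 1 Omega) x"
    by (intro efev_mult entire_tw entire_Omega entire_linear)
  finally show ?thesis by (simp add: fev_diff)
qed

text \<open>The factor t - \<theta>^q gives the first zero, and the functional equation transports
  it along the q-power map.\<close>

lemma Omega_zero: "fev Omega (\<theta> ^ (q ^ Suc n)) = 0"
proof (induction n)
  case 0
  show ?case by (subst fev_Omega_eq) simp
next
  case (Suc n)
  have "fev (tw 1 Omega) ((\<theta> ^ (q ^ Suc n)) ^ (q ^ 1)) = fev Omega (\<theta> ^ (q ^ Suc n)) ^ (q ^ 1)"
    by (intro efev_tw entire_Omega)
  also have "\<dots> = 0" by (simp only: Suc zero_pow_qn)
  also have "(\<theta> ^ (q ^ Suc n)) ^ (q ^ 1) = \<theta> ^ (q ^ Suc (Suc n))"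
    unfolding power_mult[symmetric] power_add[symmetric] by simp
  finally show ?case by (subst fev_Omega_eq) (simp only: mult_zero_right)
qed

text \<open>The origin of the denominators L_k: unrolling the functional equation k times at
  \<theta> collects the factors \<theta> - \<theta>^(q^j).\<close>

lemma fev_tw_Omega_theta: "carlitz_L \<iota> k * fev (tw k Omega) \<theta> = fev Omega \<theta>"
proof (induction k)
  case 0
  show ?case by (simp add: carlitz_L_def)
next
  case (Suc k)
  have "tw k Omega = tw k (fps_X - fps_const (\<theta> ^ q)) * tw k (tw 1 Omega)"
    by (subst Omega_eq) (simp add: tw_mult)
  also have "\<dots> = (fps_X - fps_const (\<theta> ^ (q ^ Suc k))) * tw (Suc k) Omega"
    by (simp add: tw_diff tw_tw flip: power_mult)
  finally have "fev (tw k Omega) \<theta> = (\<theta> - \<theta> ^ (q ^ Suc k)) * fev (tw (Suc k) Omega) \<theta>"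
    using entire_Omega by (simp add: efev_mult entire_tw fev_diff)
  thus ?case using Suc by (simp add: carlitz_L_def card_eq_q mult_ac)
qed

end

text \<open>A premise of \<open>has_sum_Sigma\<close>, which splits the sum over index lists by
  their last entry.\<close>

lemma nonarch_plus_uniformly_continuous:
  "uniformly_continuous_on UNIV (\<lambda>(x :: 'c::nonarchimedean_field, y). x + y)"
  unfolding uniformly_continuous_on_def
proof (intro allI impI)
  fix e :: real assume e: "e > 0"
  show "\<exists>d>0. \<forall>x\<in>UNIV. \<forall>x'\<in>UNIV. dist x' x < d \<longrightarrow>
      dist (case x' of (x, y) \<Rightarrow> x + y) (case x of (x, y) \<Rightarrow> x + (y::'c)) < e"
  proof (intro exI[of _ e] conjI ballI impI)
    fix x x' :: "'c \<times> 'c" assume d: "dist x' x < e"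
    obtain a b where x: "x = (a, b)" by (cases x)
    obtain a' b' where x': "x' = (a', b')" by (cases x')
    have "dist a' a < e" "dist b' b < e" using d dist_fst_le[of x' x] dist_snd_le[of x' x] by (auto simp: x x')
    hence "absv ((a' - a) + (b' - b)) < e" by (intro absv_add_lessI) (simp_all add: absv_diff)
    hence "absv ((a' + b') - (a + b)) < e" by (simp add: algebra_simps)
    thus "dist (case x' of (x, y) \<Rightarrow> x + y) (case x of (x, y) \<Rightarrow> x + y) < e"
      by (simp add: x x' absv_diff)
  qed fact
qed

context C_infinity
begin

subsection \<open>Deformation series\<close>

text \<open>The solution \<Sum> F^(n) of X = F + X^(1), formed coefficientwise. It converges once
  all coefficients of F are smaller than 1.\<close>

definition asolve :: "'c fps \<Rightarrow> 'c fps"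
  where "asolve F = Abs_fps (\<lambda>i. \<Sum>n. fps_nth F i ^ (q ^ n))"

lemma pow_qn_tendsto_0:
  assumes "absv (a :: 'c) < 1" shows "(\<lambda>n. a ^ (q ^ n)) \<longlonglongrightarrow> 0"
proof (subst tendsto_absv_iff, simp add: absv_power)
  have "filterlim (\<lambda>n. q ^ n) at_top sequentially"
  proof (rule filterlim_at_top_mono[OF filterlim_ident])
    have "n \<le> q ^ n" for n using q_gt_1 less_exp[of n] by (meson less_imp_le_nat q_ge_2 power_mono le_trans zero_le)
    thus "\<forall>\<^sub>F n in sequentially. n \<le> q ^ n" by simp
  qed
  moreover have "(\<lambda>n. absv a ^ n) \<longlonglongrightarrow> 0" using assms by (intro LIMSEQ_realpow_zero) auto
  ultimately show "(\<lambda>n. absv a ^ (q ^ n)) \<longlonglongrightarrow> 0" by (rule filterlim_compose[rotated])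
qed

lemma asolve_eq:
  assumes "\<And>i. absv (fps_nth F i) < 1"
  shows "asolve F = F + tw 1 (asolve F)"
proof (rule fps_ext)
  fix i
  define a where "a = fps_nth F i"
  have s: "(\<lambda>n. a ^ (q ^ n)) sums fps_nth (asolve F) i"
    using summable_tendsto_0[OF pow_qn_tendsto_0[of a]] assms[of i] by (simp add: asolve_def a_def summable_sums)
  have "(\<lambda>N. (\<Sum>n<N. a ^ (q ^ n)) ^ (q ^ 1)) \<longlonglongrightarrow> fps_nth (asolve F) i ^ (q ^ 1)"
    using s unfolding sums_def by (rule tendsto_pow_qn)
  hence "(\<lambda>n. a ^ (q ^ Suc n)) sums (fps_nth (asolve F) i ^ q)"
    unfolding sums_def sum_pow_qn by (simp add: mult.commute flip: power_mult)
  hence "(\<lambda>n. a ^ (q ^ n)) sums (fps_nth (asolve F) i ^ q + a ^ (q ^ 0))" by (rule sums_Suc)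
  hence "fps_nth (asolve F) i = fps_nth (asolve F) i ^ q + a ^ (q ^ 0)" using s sums_unique2 by blast
  thus "fps_nth (asolve F) i = fps_nth (F + tw 1 (asolve F)) i" by (simp add: a_def add.commute)
qed

lemma absv_asolve_le:
  assumes "\<And>i. absv (fps_nth F i) < 1"
  shows "absv (fps_nth (asolve F) i) \<le> absv (fps_nth F i)"
proof -
  have s: "summable (\<lambda>n. fps_nth F i ^ (q ^ n))"
    using summable_tendsto_0[OF pow_qn_tendsto_0[OF assms[of i]]] .
  have "absv (fps_nth F i ^ (q ^ n)) \<le> absv (fps_nth F i)" for n
    using power_decreasing[of 1 "q ^ n" "absv (fps_nth F i)"] assms[of i] by (simp add: absv_power)
  thus ?thesis unfolding asolve_def fps_nth_Abs_fps by (intro absv_suminf_le[OF s]) auto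
qed

lemma bnd_asolve:
  assumes "\<And>i. absv (fps_nth F i) < 1" "bnd R F B" "R \<ge> 0"
  shows "bnd R (asolve F) B" unfolding bnd_def
proof
  fix i
  have "absv (fps_nth (asolve F) i) * R ^ i \<le> absv (fps_nth F i) * R ^ i"
    using absv_asolve_le[OF assms(1)] assms(3) by (intro mult_right_mono) auto
  thus "absv (fps_nth (asolve F) i) * R ^ i \<le> B" using bndD[OF assms(2), of i] by linarith
qed

lemma entire_asolve:
  assumes "\<And>i. absv (fps_nth F i) < 1" "entire F"
  shows "entire (asolve F)" unfolding entire_def
proof (intro allI impI)
  fix R :: real assume R: "R \<ge> 0"
  have "(\<lambda>i. absv (fps_nth F i) * R ^ i) \<longlonglongrightarrow> 0" using entireD[OF assms(2) R] by (simp add: conv_def)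
  moreover have "absv (fps_nth (asolve F) i) * R ^ i \<le> absv (fps_nth F i) * R ^ i" for i
    using absv_asolve_le[OF assms(1)] R by (intro mult_right_mono) auto
  ultimately show "conv R (asolve F)" unfolding conv_def
    by (intro tendsto_sandwich[of "\<lambda>_. 0" "\<lambda>i. absv (fps_nth (asolve F) i) * R ^ i" sequentially
          "\<lambda>i. absv (fps_nth F i) * R ^ i"] tendsto_const) (use R in auto)
qed

fun Tser :: "(nat \<Rightarrow> nat) \<Rightarrow> (nat \<Rightarrow> 'c) \<Rightarrow> nat \<Rightarrow> 'c fps" where
  "Tser s u 0 = 1"
| "Tser s u (Suc j) = asolve (fps_const (u (Suc j)) * Omega ^ s (Suc j) * tw 1 (Tser s u j))"

text \<open>Makes the inhomogeneous term in \<open>Tser\<close> have Gauss norm below 1 on the disc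
  of radius q, so that \<open>asolve\<close> applies at every stage.\<close>

definition small :: "(nat \<Rightarrow> nat) \<Rightarrow> (nat \<Rightarrow> 'c) \<Rightarrow> nat \<Rightarrow> bool"
  where "small s u r \<longleftrightarrow> (\<forall>i. 1 \<le> i \<and> i \<le> r \<longrightarrow> absv (u i) * b\<Omega> ^ s i < 1)"

lemma smallD: "small s u r \<Longrightarrow> 1 \<le> i \<Longrightarrow> i \<le> r \<Longrightarrow> absv (u i) * b\<Omega> ^ s i < 1"
  by (auto simp: small_def)

lemma small_mono: "small s u r \<Longrightarrow> j \<le> r \<Longrightarrow> small s u j" by (auto simp: small_def)

lemma q_le_qq: "real q \<le> real q ^ q" using power_increasing[of 1 q "real q"] q_gt_1 by simp

lemma bnd_step:
  assumes "bnd (real q) f 1"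
  shows "bnd (real q) (fps_const c * Omega ^ k * tw 1 f) (absv c * b\<Omega> ^ k)"
proof -
  have "bnd (real q ^ (q ^ 1)) (tw 1 f) (1 ^ (q ^ 1))" by (intro bnd_tw assms) auto
  hence "bnd (real q) (tw 1 f) 1" using q_le_qq by (auto elim: bnd_mono_radius)
  moreover have "bnd (real q) (fps_const c) (absv c)" by (intro bnd_const) auto
  moreover have "bnd (real q) (Omega ^ k) (b\<Omega> ^ k)" by (intro bnd_power bnd_Omega q_le_qq) auto
  ultimately have "bnd (real q) (fps_const c * Omega ^ k * tw 1 f) (absv c * b\<Omega> ^ k * 1)"
    by (intro bnd_mult) auto
  thus ?thesis by simp
qed

lemma bnd_imp_coeff_less_1: "bnd (real q) f B \<Longrightarrow> B < 1 \<Longrightarrow> absv (fps_nth f i) < 1"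
proof -
  assume *: "bnd (real q) f B" "B < 1"
  have "absv (fps_nth f i) * 1 \<le> absv (fps_nth f i) * real q ^ i"
    using q_gt_1 by (intro mult_left_mono one_le_power) auto
  thus ?thesis using bndD[OF *(1), of i] *(2) by linarith
qed

lemma bnd_Tser_and_Suc:
  "small s u j \<Longrightarrow> bnd (real q) (Tser s u j) 1"
  "small s u (Suc j) \<Longrightarrow> bnd (real q) (Tser s u (Suc j)) (absv (u (Suc j)) * b\<Omega> ^ s (Suc j))"
proof -
  have *: "bnd (real q) (Tser s u (Suc j)) (absv (u (Suc j)) * b\<Omega> ^ s (Suc j))"
    if "small s u (Suc j)" "bnd (real q) (Tser s u j) 1" for j unfolding Tser.simps
  proof (intro bnd_asolve bnd_step that(2))
    show "absv (fps_nth (fps_const (u (Suc j)) * Omega ^ s (Suc j) * tw 1 (Tser s u j)) i) < 1" for i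
      using smallD[OF that(1), of "Suc j"] by (intro bnd_imp_coeff_less_1[OF bnd_step[OF that(2)]]) simp
  qed auto
  have **: "small s u j \<Longrightarrow> bnd (real q) (Tser s u j) 1" for j
  proof (induction j)
    case 0
    show ?case by simp
  next
    case (Suc j)
    have "bnd (real q) (Tser s u j) 1" by (rule Suc.IH[OF small_mono[OF Suc.prems]]) simp
    from *[OF Suc.prems this] show ?case using smallD[OF Suc.prems, of "Suc j"] by (auto elim!: bnd_mono)
  qed
  show "small s u j \<Longrightarrow> bnd (real q) (Tser s u j) 1" by (rule **)
  show "small s u (Suc j) \<Longrightarrow> bnd (real q) (Tser s u (Suc j)) (absv (u (Suc j)) * b\<Omega> ^ s (Suc j))"
    using * ** small_mono[of s u "Suc j" j] by simp
qed

lemma Tser_F_less_1: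
  assumes "small s u (Suc j)"
  shows "absv (fps_nth (fps_const (u (Suc j)) * Omega ^ s (Suc j) * tw 1 (Tser s u j)) i) < 1"
  using bnd_imp_coeff_less_1[OF bnd_step[OF bnd_Tser_and_Suc(1)[OF small_mono[OF assms]]]]
    smallD[OF assms, of "Suc j"] by auto

lemma Tser_eq:
  assumes "small s u (Suc j)"
  shows "Tser s u (Suc j) = fps_const (u (Suc j)) * Omega ^ s (Suc j) * tw 1 (Tser s u j) + tw 1 (Tser s u (Suc j))"
  using asolve_eq[OF Tser_F_less_1[OF assms]] by simp

lemma entire_Tser: "small s u j \<Longrightarrow> entire (Tser s u j)"
proof (induction j)
  case (Suc j)
  have "entire (Tser s u j)" by (rule Suc.IH[OF small_mono[OF Suc.prems]]) simp
  hence "entire (fps_const (u (Suc j)) * Omega ^ s (Suc j) * tw 1 (Tser s u j))"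
    by (intro entire_mult entire_tw entire_power entire_Omega) auto
  thus ?case using entire_asolve[OF Tser_F_less_1[OF Suc.prems]] by simp
qed auto

text \<open>At these points \<Omega> vanishes, and s_j \<ge> 1 removes the inhomogeneous term. What
  is left is T_j = T_j^(1), whose value at the next point is the q-th power of the previous
  value.\<close>

lemma Tser_theta_qN:
  assumes "small s u j" "\<And>i. 1 \<le> i \<Longrightarrow> i \<le> j \<Longrightarrow> s i \<ge> 1"
  shows "fev (Tser s u j) (\<theta> ^ (q ^ N)) = fev (Tser s u j) \<theta> ^ (q ^ N)"
proof (cases j)
  case 0
  thus ?thesis by simp
next
  case (Suc k)
  have e: "entire (Tser s u j)" "entire (Tser s u k)"
    using assms small_mono[of s u j k] by (auto intro!: entire_Tser simp: Suc simp del: Tser.simps)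
  show ?thesis
  proof (induction N)
    case 0
    show ?case by simp
  next
    case (Suc N)
    let ?x = "\<theta> ^ (q ^ Suc N)"
    have "fev (Tser s u j) ?x = fev (fps_const (u j) * Omega ^ s j * tw 1 (Tser s u k) + tw 1 (Tser s u j)) ?x"
      using Tser_eq[of s u k] assms(1) \<open>j = Suc k\<close> by metis
    also have "\<dots> = u j * fev Omega ?x ^ s j * fev (tw 1 (Tser s u k)) ?x + fev (tw 1 (Tser s u j)) ?x"
      using e by (simp only: efev_add efev_mult efev_power entire_mult entire_power entire_tw
          entire_const entire_Omega fev_const)
    also have "fev Omega ?x ^ s j = 0"
      using Omega_zero assms(2)[of j] \<open>j = Suc k\<close> by (simp only: Omega_zero) (simp add: power_0_left)
    also have "fev (tw 1 (Tser s u j)) ?x = fev (Tser s u j) (\<theta> ^ (q ^ N)) ^ (q ^ 1)"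
      using efev_tw[OF e(1), of 1 "\<theta> ^ (q ^ N)"] by (simp add: mult.commute flip: power_mult)
    finally show ?case using Suc by (simp add: mult.commute flip: power_mult)
  qed
qed

subsection \<open>Values at theta\<close>

text \<open>By \<open>term_has_sum\<close>, this is the part of the nested series in which all
  indices are at least n.\<close>

definition Bval :: "(nat \<Rightarrow> nat) \<Rightarrow> (nat \<Rightarrow> 'c) \<Rightarrow> nat \<Rightarrow> nat \<Rightarrow> 'c"
  where "Bval s u j n = fev (tw n (Tser s u j)) \<theta>"

text \<open>The contribution of index m in position j, namely \<Omega>(\<theta>)^(s_j) times
  u_j^(q^m) / L_m^(s_j).\<close>

definition Cval :: "(nat \<Rightarrow> nat) \<Rightarrow> (nat \<Rightarrow> 'c) \<Rightarrow> nat \<Rightarrow> nat \<Rightarrow> 'c"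
  where "Cval s u j m = u j ^ (q ^ m) * fev (tw m Omega) \<theta> ^ s j"

lemma Bval_0 [simp]: "Bval s u 0 n = 1" by (simp add: Bval_def)

lemma Bval_rec:
  assumes "small s u (Suc j)"
  shows "Bval s u (Suc j) n = Cval s u (Suc j) n * Bval s u j (Suc n) + Bval s u (Suc j) (Suc n)"
proof -
  have e: "entire (Tser s u (Suc j))" "entire (Tser s u j)"
    using assms small_mono[of s u "Suc j" j] by (auto intro: entire_Tser simp del: Tser.simps)
  have "tw n (Tser s u (Suc j)) = tw n (fps_const (u (Suc j)) * Omega ^ s (Suc j) * tw 1 (Tser s u j) + tw 1 (Tser s u (Suc j)))"
    using Tser_eq[OF assms] by metis
  also have "\<dots> = fps_const (u (Suc j) ^ (q ^ n)) * tw n Omega ^ s (Suc j) * tw (Suc n) (Tser s u j) + tw (Suc n) (Tser s u (Suc j))"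
    by (simp del: Tser.simps add: tw_add tw_mult tw_power tw_tw)
  finally show ?thesis using e unfolding Bval_def Cval_def
    by (simp only: efev_add efev_mult efev_power entire_mult entire_power entire_tw
          entire_const entire_Omega fev_const)
qed

lemma q_le_q_pow_qn: "real q \<le> real q ^ (q ^ n)" using power_increasing[of 1 "q ^ n" "real q"] q_gt_1 by simp

lemma absv_Bval_le:
  assumes "small s u (Suc j)"
  shows "absv (Bval s u (Suc j) n) \<le> (absv (u (Suc j)) * b\<Omega> ^ s (Suc j)) ^ (q ^ n)"
proof -
  have "bnd (real q ^ (q ^ n)) (tw n (Tser s u (Suc j))) ((absv (u (Suc j)) * b\<Omega> ^ s (Suc j)) ^ (q ^ n))"
    by (intro bnd_tw bnd_Tser_and_Suc(2) assms) auto
  hence "bnd (real q) (tw n (Tser s u (Suc j))) ((absv (u (Suc j)) * b\<Omega> ^ s (Suc j)) ^ (q ^ n))"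
    using q_le_q_pow_qn by (auto elim!: bnd_mono_radius simp del: Tser.simps)
  thus ?thesis unfolding Bval_def
    by (intro absv_fev_le) (auto simp: absv_theta simp del: Tser.simps intro!: entireD entire_tw entire_Tser assms)
qed

lemma absv_fev_tw_Omega_le: "absv (fev (tw n Omega) \<theta>) \<le> b\<Omega> ^ (q ^ n)"
proof -
  have "bnd (real q ^ (q ^ n)) (tw n Omega) (b\<Omega> ^ (q ^ n))" by (intro bnd_tw bnd_Omega q_le_qq) auto
  hence "bnd (real q) (tw n Omega) (b\<Omega> ^ (q ^ n))" using q_le_q_pow_qn by (auto elim!: bnd_mono_radius)
  thus ?thesis by (intro absv_fev_le) (auto simp: absv_theta intro!: entireD entire_tw entire_Omega)
qed

lemma absv_Cval_le: "absv (Cval s u j m) \<le> (absv (u j) * b\<Omega> ^ s j) ^ (q ^ m)"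
proof -
  have "absv (Cval s u j m) = absv (u j) ^ (q ^ m) * absv (fev (tw m Omega) \<theta>) ^ s j"
    by (simp add: Cval_def absv_mult absv_power)
  also have "\<dots> \<le> absv (u j) ^ (q ^ m) * (b\<Omega> ^ (q ^ m)) ^ s j"
    using absv_fev_tw_Omega_le by (intro mult_left_mono power_mono) auto
  finally show ?thesis by (simp add: power_mult_distrib mult.commute flip: power_mult)
qed

lemma real_pow_qn_tendsto_0:
  assumes "0 \<le> x" "x < 1" shows "(\<lambda>n. (x::real) ^ (q ^ n)) \<longlonglongrightarrow> 0"
proof -
  have "filterlim (\<lambda>n. q ^ n) at_top sequentially"
  proof (rule filterlim_at_top_mono[OF filterlim_ident])
    have "n \<le> q ^ n" for n using q_gt_1 less_exp[of n] by (meson less_imp_le_nat q_ge_2 power_mono le_trans zero_le)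
    thus "\<forall>\<^sub>F n in sequentially. n \<le> q ^ n" by simp
  qed
  moreover have "(\<lambda>n. x ^ n) \<longlonglongrightarrow> 0" using assms by (intro LIMSEQ_realpow_zero) auto
  ultimately show ?thesis by (rule filterlim_compose[rotated])
qed

text \<open>Telescopes \<open>Bval_rec\<close>; the remainder is at most x^(q^n) for some x <
  1.\<close>

lemma Bval_sums:
  assumes "small s u (Suc j)"
  shows "(\<lambda>k. Cval s u (Suc j) (n + k) * Bval s u j (Suc (n + k))) sums Bval s u (Suc j) n"
proof -
  have part: "(\<Sum>k<N. Cval s u (Suc j) (n + k) * Bval s u j (Suc (n + k)))
      = Bval s u (Suc j) n - Bval s u (Suc j) (n + N)" for N
  proof (induction N)
    case (Suc N)
    show ?case using Bval_rec[OF assms, of "n + N"] unfolding sum.lessThan_Suc Suc by (simp add: algebra_simps)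
  qed auto
  have "(\<lambda>N. Bval s u (Suc j) N) \<longlonglongrightarrow> 0"
  proof (subst tendsto_absv_iff, rule tendsto_sandwich[OF _ _ tendsto_const real_pow_qn_tendsto_0])
    show "\<forall>\<^sub>F n in sequentially. absv (Bval s u (Suc j) n - 0) \<le> (absv (u (Suc j)) * b\<Omega> ^ s (Suc j)) ^ (q ^ n)"
      using absv_Bval_le[OF assms] by simp
    show "absv (u (Suc j)) * b\<Omega> ^ s (Suc j) < 1" using smallD[OF assms, of "Suc j"] by simp
  qed (use b\<Omega>_pos in auto)
  hence "(\<lambda>N. Bval s u (Suc j) (n + N)) \<longlonglongrightarrow> 0"
    using LIMSEQ_ignore_initial_segment[of "Bval s u (Suc j)" 0 n] by (simp add: add.commute)
  hence "(\<lambda>N. Bval s u (Suc j) n - Bval s u (Suc j) (n + N)) \<longlonglongrightarrow> Bval s u (Suc j) n - 0"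
    by (intro tendsto_intros)
  thus ?thesis unfolding sums_def part by simp
qed

text \<open>The theorem's nonvanishing hypothesis on segments concerns length at least two. In depth
  one the term of index 0 is strictly larger than the rest of the series, x against x^q.\<close>

lemma Tser_1_theta_nonzero:
  assumes "small s u 1" "u 1 \<noteq> 0"
  shows "fev (Tser s u 1) \<theta> \<noteq> 0"
proof
  assume z: "fev (Tser s u 1) \<theta> = 0"
  define x where "x = absv (u 1) * b\<Omega> ^ s 1"
  have x: "0 < x" "x < 1" using assms smallD[OF assms(1), of 1] b\<Omega>_pos by (auto simp: x_def)
  have sm: "small s u (Suc 0)" using assms by simp
  have "0 = Cval s u 1 0 + Bval s u 1 1"
  proof -
    have "Bval s u (Suc 0) 0 = 0" using z by (simp only: Bval_def tw_id One_nat_def)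
    thus ?thesis using Bval_rec[OF sm, of 0] unfolding Bval_0 by simp
  qed
  hence "Bval s u 1 1 = - Cval s u 1 0" by (simp add: eq_neg_iff_add_eq_0 add.commute)
  moreover have "absv (Cval s u 1 0) = x" by (simp add: Cval_def absv_mult absv_power absv_Omega_theta x_def)
  moreover have "absv (Bval s u 1 1) \<le> x ^ (q ^ 1)" using absv_Bval_le[OF sm, of 1] by (simp add: x_def)
  moreover have "x ^ (q ^ 1) < x ^ 1" using x q_gt_1 by (intro power_strict_decreasing) auto
  ultimately show False by simp
qed

subsection \<open>Comparison with the multiple polylogarithm\<close>

definition idx :: "nat \<Rightarrow> nat \<Rightarrow> nat list set"
  where "idx j n = {is. length is = j \<and> sorted_wrt (>) is \<and> (\<forall>i\<in>set is. n \<le> i)}"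

definition Lterm :: "(nat \<Rightarrow> nat) \<Rightarrow> (nat \<Rightarrow> 'c) \<Rightarrow> nat \<Rightarrow> nat list \<Rightarrow> 'c"
  where "Lterm s u j is = (\<Prod>l<j. Cval s u (Suc l) (is ! l))"

lemma idx_0: "idx 0 n = {[]}" by (auto simp: idx_def)

text \<open>Bounding the head, the largest index, bounds the whole list: its factor is at most
  x^(q^i) and all other factors are at most 1.\<close>

lemma finite_term_ge:
  assumes "small s u (Suc j)" "e > 0"
  shows "finite {is \<in> idx (Suc j) n. absv (Lterm s u (Suc j) is) \<ge> e}"
proof -
  define x where "x = absv (u 1) * b\<Omega> ^ s 1"
  have x: "0 \<le> x" "x < 1" using smallD[OF assms(1), of 1] b\<Omega>_pos by (auto simp: x_def)
  have "\<forall>\<^sub>F n in sequentially. x ^ (q ^ n) < e"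
    using real_pow_qn_tendsto_0[OF x] assms(2) by (rule order_tendstoD(2))
  then obtain N where N: "\<And>n. n \<ge> N \<Longrightarrow> x ^ (q ^ n) < e" by (auto simp: eventually_sequentially)
  have "{is \<in> idx (Suc j) n. absv (Lterm s u (Suc j) is) \<ge> e} \<subseteq> {is. set is \<subseteq> {..<N} \<and> length is = Suc j}"
  proof safe
    fix "is" i assume i: "is \<in> idx (Suc j) n" "absv (Lterm s u (Suc j) is) \<ge> e" "i \<in> set is"
    obtain i0 js where isq: "is = i0 # js" using i(1) by (cases "is") (auto simp: idx_def)
    have "absv (Lterm s u (Suc j) is) = absv (Cval s u 1 i0) * (\<Prod>l<j. absv (Cval s u (Suc (Suc l)) (js ! l)))"
      unfolding Lterm_def absv_prod by (subst prod.lessThan_Suc_shift) (simp add: isq)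
    also have "\<dots> \<le> x ^ (q ^ i0) * 1"
    proof (intro mult_mono)
      show "absv (Cval s u 1 i0) \<le> x ^ (q ^ i0)" unfolding x_def by (rule absv_Cval_le)
      show "(\<Prod>l<j. absv (Cval s u (Suc (Suc l)) (js ! l))) \<le> 1"
      proof (intro prod_le_1 conjI)
        fix l assume "l \<in> {..<j}"
        hence "absv (u (Suc (Suc l))) * b\<Omega> ^ s (Suc (Suc l)) < 1" using smallD[OF assms(1), of "Suc (Suc l)"] by simp
        hence "(absv (u (Suc (Suc l))) * b\<Omega> ^ s (Suc (Suc l))) ^ (q ^ (js ! l)) \<le> 1"
          using b\<Omega>_pos by (intro power_le_one) auto
        thus "absv (Cval s u (Suc (Suc l)) (js ! l)) \<le> 1" using absv_Cval_le order_trans by blast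
      qed auto
    qed (use x in \<open>auto intro: prod_nonneg\<close>)
    finally have "e \<le> x ^ (q ^ i0)" using i(2) by simp
    hence "i0 < N" using N[of i0] by (meson not_le)
    moreover have "i \<le> i0" using i(1,3) by (auto simp: idx_def isq)
    ultimately show "i < N" by simp
  qed (auto simp: idx_def)
  thus ?thesis using finite_lists_length_eq[of "{..<N}" "Suc j"] finite_subset by blast
qed

text \<open>Splits off the smallest index, which stands last and over which the outermost sum of
  \<open>Tser\<close> runs.\<close>

lemma bij_idx: "bij_betw (\<lambda>(m, is). is @ [m]) (Sigma {n..} (\<lambda>m. idx j (Suc m))) (idx (Suc j) n)"
proof (rule bij_betwI[where g = "\<lambda>is. (last is, butlast is)"])
  show "(\<lambda>(m, is). is @ [m]) \<in> Sigma {n..} (\<lambda>m. idx j (Suc m)) \<rightarrow> idx (Suc j) n"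
    by (force simp: idx_def sorted_wrt_append)
  show "(\<lambda>is. (last is, butlast is)) \<in> idx (Suc j) n \<rightarrow> Sigma {n..} (\<lambda>m. idx j (Suc m))"
  proof
    fix "is" assume i: "is \<in> idx (Suc j) n"
    hence "is \<noteq> []" by (auto simp: idx_def)
    then obtain js m where "is = js @ [m]" by (metis append_butlast_last_id)
    thus "(last is, butlast is) \<in> Sigma {n..} (\<lambda>m. idx j (Suc m))"
      using i by (auto simp: idx_def sorted_wrt_append)
  qed
  show "(\<lambda>is. (last is, butlast is)) ((\<lambda>(m, is). is @ [m]) x) = x" for x by (cases x) auto
  show "(\<lambda>(m, is). is @ [m]) ((\<lambda>is. (last is, butlast is)) y) = y" if "y \<in> idx (Suc j) n" for y
    using that append_butlast_last_id[of y] by (cases "y = []") (auto simp: idx_def)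
qed

lemma term_append: "length is = j \<Longrightarrow> Lterm s u (Suc j) (is @ [m]) = Cval s u (Suc j) m * Lterm s u j is"
  unfolding Lterm_def by (simp add: nth_append mult.commute)

lemma term_has_sum:
  "small s u j \<Longrightarrow> (Lterm s u j has_sum Bval s u j n) (idx j n)"
proof (induction j arbitrary: n)
  case 0
  show ?case by (simp add: idx_0 has_sum_finite_iff Lterm_def)
next
  case (Suc j)
  have sm: "small s u j" using small_mono[OF Suc.prems] by simp
  have "Lterm s u (Suc j) summable_on idx (Suc j) n" by (intro nonarch_summable_on finite_term_ge Suc.prems)
  then obtain S where S: "(Lterm s u (Suc j) has_sum S) (idx (Suc j) n)" by (auto simp: summable_on_def)
  have S': "((\<lambda>(m, is). Lterm s u (Suc j) (is @ [m])) has_sum S) (Sigma {n..} (\<lambda>m. idx j (Suc m)))"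
    using S has_sum_reindex_bij_betw[OF bij_idx[of n j], where f = "Lterm s u (Suc j)" and S = S] by (simp add: case_prod_unfold)
  have "((\<lambda>m. Cval s u (Suc j) m * Bval s u j (Suc m)) has_sum S) {n..}"
  proof (rule has_sum_Sigma[OF nonarch_plus_uniformly_continuous S'])
    fix m assume "m \<in> {n..}"
    have "((\<lambda>is. Cval s u (Suc j) m * Lterm s u j is) has_sum Cval s u (Suc j) m * Bval s u j (Suc m)) (idx j (Suc m))"
      by (intro has_sum_cmult_right Suc.IH sm)
    thus "((\<lambda>is. case (m, is) of (m, is) \<Rightarrow> Lterm s u (Suc j) (is @ [m])) has_sum Cval s u (Suc j) m * Bval s u j (Suc m)) (idx j (Suc m))"
      by (subst has_sum_cong[where g = "\<lambda>is. Cval s u (Suc j) m * Lterm s u j is"])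
        (auto simp: idx_def term_append)
  qed
  moreover have "bij_betw (\<lambda>k. n + k) UNIV {n..}" by (rule bij_betwI[where g = "\<lambda>k. k - n"]) auto
  ultimately have "((\<lambda>k. Cval s u (Suc j) (n + k) * Bval s u j (Suc (n + k))) has_sum S) UNIV"
    using has_sum_reindex_bij_betw[of "\<lambda>k. n + k" UNIV "{n..}" "\<lambda>m. Cval s u (Suc j) m * Bval s u j (Suc m)" S] by simp
  hence "(\<lambda>k. Cval s u (Suc j) (n + k) * Bval s u j (Suc (n + k))) sums S" by (rule has_sum_imp_sums)
  hence "S = Bval s u (Suc j) n" using Bval_sums[OF Suc.prems] sums_unique2 by blast
  thus ?case using S by simp
qed

lemma carlitz_L_nonzero: "carlitz_L \<iota> i \<noteq> 0" using fev_tw_Omega_theta[of i] Omega_theta_nonzero by force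

lemma Li_eq:
  assumes "small s u r"
  shows "fev (Tser s u r) \<theta> = fev Omega \<theta> ^ (\<Sum>l<r. s (Suc l)) * Li \<iota> (seg s 1 r) (seg u 1 r)"
proof -
  let ?w = "fev Omega \<theta>"
  have nth: "seg x 1 r ! l = x (Suc l)" if "l < r" for x :: "nat \<Rightarrow> 'z" and l
    using that by (simp add: seg_def del: upt_Suc)
  have Cv: "Cval s u (Suc l) m = ?w ^ s (Suc l) * (u (Suc l) ^ (q ^ m) / carlitz_L \<iota> m ^ s (Suc l))" for l m
  proof -
    have "fev (tw m Omega) \<theta> = ?w / carlitz_L \<iota> m"
      using fev_tw_Omega_theta[of m] carlitz_L_nonzero[of m] by (simp add: field_simps)
    thus ?thesis by (simp add: Cval_def power_divide)
  qed
  have "idx r 0 = Li_indices r" by (auto simp: idx_def Li_indices_def)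
  hence "(Lterm s u r has_sum fev (Tser s u r) \<theta>) (Li_indices r)"
    using term_has_sum[OF assms, of 0] by (simp add: Bval_def)
  hence "((\<lambda>is. inverse (?w ^ (\<Sum>l<r. s (Suc l))) * Lterm s u r is) has_sum
      inverse (?w ^ (\<Sum>l<r. s (Suc l))) * fev (Tser s u r) \<theta>) (Li_indices r)" by (rule has_sum_cmult_right)
  hence "((\<lambda>is. \<Prod>l<r. u (Suc l) ^ (q ^ (is ! l)) / carlitz_L \<iota> (is ! l) ^ s (Suc l)) has_sum
      inverse (?w ^ (\<Sum>l<r. s (Suc l))) * fev (Tser s u r) \<theta>) (Li_indices r)"
  proof (rule has_sum_cong[THEN iffD1, rotated])
    fix "is" :: "nat list"
    have "Lterm s u r is = ?w ^ (\<Sum>l<r. s (Suc l)) * (\<Prod>l<r. u (Suc l) ^ (q ^ (is ! l)) / carlitz_L \<iota> (is ! l) ^ s (Suc l))"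
      unfolding Lterm_def Cv prod.distrib power_sum ..
    thus "inverse (?w ^ (\<Sum>l<r. s (Suc l))) * Lterm s u r is
        = (\<Prod>l<r. u (Suc l) ^ (q ^ (is ! l)) / carlitz_L \<iota> (is ! l) ^ s (Suc l))"
      using Omega_theta_nonzero by (simp add: mult.assoc[symmetric])
  qed
  moreover have "length (seg s 1 r) = r" by (simp add: seg_def)
  ultimately have "Li \<iota> (seg s 1 r) (seg u 1 r) = inverse (?w ^ (\<Sum>l<r. s (Suc l))) * fev (Tser s u r) \<theta>"
    unfolding Li_def card_eq_q by (intro infsumI) (simp add: nth del: One_nat_def)
  thus ?thesis using Omega_theta_nonzero by (simp add: field_simps)
qed

text \<open>The quotient in \<open>Li_domain\<close> equals |v| \<open>b\<Omega>\<close>^k. If it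
  were at least 1, its powers with exponent q^n, taken along the singleton lists, could not tend to
  0.\<close>

lemma Li_domain_small:
  assumes "[v] \<in> Li_domain \<iota> [k]"
  shows "absv v * b\<Omega> ^ k < 1"
proof (rule ccontr)
  assume neg: "\<not> absv v * b\<Omega> ^ k < 1"
  have q1: "real q - 1 > 0" using q_gt_1 by simp
  have "(b\<Omega> powr (real q - 1)) = 1 / real q ^ q"
    using b\<Omega>_eq b\<Omega>_pos q_gt_1 by (simp add: powr_realpow[symmetric] of_nat_diff field_simps)
  hence "b\<Omega> powr (real q - 1) = real q powr (- real q)"
    using q_gt_0 by (simp add: powr_minus_divide powr_realpow)
  hence "(b\<Omega> powr (real q - 1)) powr (1 / (real q - 1)) = (real q powr (- real q)) powr (1 / (real q - 1))" by simp
  hence bq: "b\<Omega> = real q powr (- (real q / (real q - 1)))" using q1 b\<Omega>_pos by (simp add: powr_powr)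
  have "b\<Omega> ^ k = 1 / real q powr (real (q * k) / real (q - 1))"
  proof -
    have "b\<Omega> ^ k = b\<Omega> powr real k" using b\<Omega>_pos by (simp add: powr_realpow)
    also have "\<dots> = real q powr (- (real (q * k) / real (q - 1)))"
      by (subst bq) (use q_gt_1 in \<open>simp add: powr_powr of_nat_diff\<close>)
    finally show ?thesis by (simp add: powr_minus_divide)
  qed
  hence y: "absv v / absv \<theta> powr (real (q * k) / real (q - 1)) \<ge> 1" using neg by (simp add: absv_theta)
  have "((\<lambda>is. (absv v / absv \<theta> powr (real (q * k) / real (q - 1))) ^ (q ^ (is ! 0))) \<longlongrightarrow> 0)
      (inf (filtercomap hd at_top) (principal (Li_indices 1)))" using assms by (simp add: Li_domain_def card_eq_q)
  moreover have "filterlim (\<lambda>n. [n]) (inf (filtercomap hd at_top) (principal (Li_indices 1))) sequentially"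
  proof -
    have "filterlim (\<lambda>n. [n]) (filtercomap hd at_top) (sequentially :: nat filter)"
      unfolding filterlim_filtercomap_iff by (simp add: o_def filterlim_ident)
    moreover have "filterlim (\<lambda>n. [n]) (principal (Li_indices 1)) (sequentially :: nat filter)"
      by (auto simp: filterlim_principal Li_indices_def)
    ultimately show ?thesis by (simp add: filterlim_inf)
  qed
  ultimately have "(\<lambda>n. (absv v / absv \<theta> powr (real (q * k) / real (q - 1))) ^ (q ^ ([n] ! 0))) \<longlonglongrightarrow> 0"
    by (rule filterlim_compose)
  hence "\<forall>\<^sub>F n in sequentially. (absv v / absv \<theta> powr (real (q * k) / real (q - 1))) ^ (q ^ ([n] ! 0)) < 1"
    by (rule order_tendstoD(2)) simp
  then obtain n where "(absv v / absv \<theta> powr (real (q * k) / real (q - 1))) ^ (q ^ n) < 1"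
    by (auto simp: eventually_sequentially)
  moreover have "(absv v / absv \<theta> powr (real (q * k) / real (q - 1))) ^ (q ^ n) \<ge> 1"
    using y by (rule one_le_power)
  ultimately show False by simp
qed

end

text \<open>If the constant coefficient carries the Gauss norm, the recursion for the coefficients
  of the inverse keeps every product within a * (1 / a), so the inverse has the reciprocal
  norm.\<close>

lemma bnd_fps_inverse:
  assumes "bnd R f (absv (fps_nth f 0))" "fps_nth f 0 \<noteq> 0" "f * W = 1" "R > 0"
  shows "bnd R W (1 / absv (fps_nth f 0))" unfolding bnd_def
proof
  fix n
  define a where "a = absv (fps_nth f 0)"
  have a: "a > 0" using assms(2) by (simp add: a_def)
  show "absv (fps_nth W n) * R ^ n \<le> 1 / a"
  proof (induction n rule: less_induct)
    case (less n)
    have eq: "fps_nth f 0 * fps_nth W n + (\<Sum>i=1..n. fps_nth f i * fps_nth W (n - i)) = fps_nth 1 n"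
      using arg_cong[OF assms(3), of "\<lambda>h. fps_nth h n"] unfolding fps_mult_nth
      by (subst (asm) sum.atLeast_Suc_atMost) auto
    have S: "absv (\<Sum>i=1..n. fps_nth f i * fps_nth W (n - i)) \<le> 1 / R ^ n"
    proof (rule absv_sum_le)
      fix i assume i: "i \<in> {1..n}"
      have "absv (fps_nth f i * fps_nth W (n - i)) * R ^ n
          = (absv (fps_nth f i) * R ^ i) * (absv (fps_nth W (n - i)) * R ^ (n - i))"
        using i by (simp add: absv_mult flip: power_add)
      also have "\<dots> \<le> a * (1 / a)"
        using bndD[OF assms(1), of i] less[of "n - i"] i a assms(4) by (intro mult_mono) (auto simp: a_def)
      finally show "absv (fps_nth f i * fps_nth W (n - i)) \<le> 1 / R ^ n" using a assms(4) by (simp add: field_simps)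
    qed (use assms in auto)
    have "fps_nth f 0 * fps_nth W n = fps_nth 1 n - (\<Sum>i=1..n. fps_nth f i * fps_nth W (n - i))"
      using eq by (simp add: eq_diff_eq)
    moreover have "absv (fps_nth (1 :: 'a fps) n) \<le> 1 / R ^ n" using assms(4) by (cases n) auto
    ultimately have "absv (fps_nth f 0 * fps_nth W n) \<le> 1 / R ^ n" using S by (simp only: diff_conv_add_uminus) (intro absv_add_leI, simp_all)
    thus ?case using a assms(4) by (simp add: absv_mult a_def field_simps)
  qed
qed

context C_infinity
begin

subsection \<open>The Carlitz exponential\<close>

lemma carlitz_D_0 [simp]: "carlitz_D \<iota> 0 = 1" by (simp add: carlitz_D_def)

lemma carlitz_D_Suc: "carlitz_D \<iota> (Suc i) = (\<theta> ^ (q ^ Suc i) - \<theta>) * carlitz_D \<iota> i ^ q"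
proof -
  have "carlitz_D \<iota> (Suc i) = (\<theta> ^ (q ^ Suc i) - \<theta>) * (\<Prod>j<i. \<theta> ^ (q ^ Suc i) - \<theta> ^ (q ^ Suc j))"
    unfolding carlitz_D_def card_eq_q by (subst prod.lessThan_Suc_shift) simp
  also have "(\<Prod>j<i. \<theta> ^ (q ^ Suc i) - \<theta> ^ (q ^ Suc j)) = (\<Prod>j<i. (\<theta> ^ (q ^ i) - \<theta> ^ (q ^ j)) ^ q)"
    by (intro prod.cong) (auto simp: diff_pow_q mult.commute simp flip: power_mult)
  also have "\<dots> = carlitz_D \<iota> i ^ q" by (simp add: carlitz_D_def card_eq_q prod_power_distrib)
  finally show ?thesis .
qed

lemma absv_theta_diff: "j < i \<Longrightarrow> absv (\<theta> ^ (q ^ i) - \<theta> ^ (q ^ j)) = real q ^ (q ^ i)"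
proof -
  assume "j < i"
  hence "q ^ j < q ^ i" using q_gt_1 by (intro power_strict_increasing)
  hence "real q ^ (q ^ j) < real q ^ (q ^ i)" using q_gt_1 by (intro power_strict_increasing) auto
  hence "absv (\<theta> ^ (q ^ i) + (- (\<theta> ^ (q ^ j)))) = absv (\<theta> ^ (q ^ i))"
    by (intro absv_add_dominant) (simp add: absv_power absv_theta)
  thus ?thesis by (simp add: absv_power absv_theta)
qed

lemma absv_carlitz_D: "absv (carlitz_D \<iota> i) = (real q ^ i) ^ (q ^ i)"
proof -
  have "absv (carlitz_D \<iota> i) = (\<Prod>j<i. real q ^ (q ^ i))"
    unfolding carlitz_D_def card_eq_q absv_prod by (intro prod.cong) (auto simp: absv_theta_diff)
  thus ?thesis by (simp add: mult.commute flip: power_mult)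
qed

lemma carlitz_D_nonzero [simp]: "carlitz_D \<iota> i \<noteq> 0"
proof -
  have "absv (carlitz_D \<iota> i) > 0" by (simp add: absv_carlitz_D)
  thus ?thesis by auto
qed

definition eterm :: "'c \<Rightarrow> nat \<Rightarrow> 'c" where "eterm z i = z ^ (q ^ i) / carlitz_D \<iota> i"

lemma absv_eterm: "absv (eterm z i) = (absv z / real q ^ i) ^ (q ^ i)"
  by (simp add: eterm_def absv_divide absv_power absv_carlitz_D power_divide)

lemma eterm_tendsto_0: "eterm z \<longlonglongrightarrow> 0"
proof (subst tendsto_absv_iff)
  have "(\<lambda>i. absv z * (1 / real q) ^ i) \<longlonglongrightarrow> absv z * 0"
    using q_gt_1 by (intro tendsto_intros LIMSEQ_realpow_zero) auto
  hence "\<forall>\<^sub>F i in sequentially. absv z * (1 / real q) ^ i < 1/2" by (rule order_tendstoD(2)) simp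
  hence "\<forall>\<^sub>F i in sequentially. absv (eterm z i - 0) \<le> (1/2) ^ (q ^ i)"
  proof eventually_elim
    case (elim i)
    have "(absv z / real q ^ i) ^ (q ^ i) \<le> (1/2) ^ (q ^ i)"
      using elim by (intro power_mono) (auto simp: power_divide)
    thus ?case by (simp add: absv_eterm)
  qed
  thus "(\<lambda>x. absv (eterm z x - 0)) \<longlonglongrightarrow> 0"
    by (intro tendsto_sandwich[OF _ _ tendsto_const real_pow_qn_tendsto_0[of "1/2"]]) auto
qed

lemma eterm_sums: "eterm z sums carlitz_exp \<iota> z"
  using summable_sums[OF summable_tendsto_0[OF eterm_tendsto_0[of z]]]
  by (simp add: carlitz_exp_def eterm_def[abs_def] card_eq_q)

lemma carlitz_exp_add: "carlitz_exp \<iota> (x + y) = carlitz_exp \<iota> x + carlitz_exp \<iota> y"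
proof -
  have "(\<lambda>i. eterm x i + eterm y i) sums (carlitz_exp \<iota> x + carlitz_exp \<iota> y)"
    by (intro sums_add eterm_sums)
  moreover have "(\<lambda>i. eterm x i + eterm y i) = eterm (x + y)"
    by (rule ext) (simp add: eterm_def add_pow_qn add_divide_distrib)
  ultimately show ?thesis using eterm_sums[of "x + y"] sums_unique2 by metis
qed

text \<open>The Carlitz action of \<theta>; term by term it is the recursion
  \<open>carlitz_D_Suc\<close>.\<close>

lemma carlitz_exp_theta: "carlitz_exp \<iota> (\<theta> * z) = \<theta> * carlitz_exp \<iota> z + carlitz_exp \<iota> z ^ q"
proof -
  have "(\<lambda>N. (\<Sum>i<N. eterm z i) ^ (q ^ 1)) \<longlonglongrightarrow> carlitz_exp \<iota> z ^ (q ^ 1)"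
    using eterm_sums[of z] unfolding sums_def by (rule tendsto_pow_qn)
  hence "(\<lambda>i. eterm z i ^ (q ^ 1)) sums (carlitz_exp \<iota> z ^ (q ^ 1))" unfolding sums_def sum_pow_qn .
  moreover have "eterm z i ^ (q ^ 1) = eterm (\<theta> * z) (Suc i) - \<theta> * eterm z (Suc i)" for i
  proof -
    have "\<theta> ^ (q ^ Suc i) - \<theta> \<noteq> 0" using carlitz_D_nonzero[of "Suc i"] by (auto simp: carlitz_D_Suc)
    have "eterm (\<theta> * z) (Suc i) - \<theta> * eterm z (Suc i)
        = (\<theta> ^ (q ^ Suc i) - \<theta>) * z ^ (q ^ Suc i) / ((\<theta> ^ (q ^ Suc i) - \<theta>) * carlitz_D \<iota> i ^ q)"
      by (simp only: eterm_def carlitz_D_Suc power_mult_distrib) (simp add: field_simps diff_divide_distrib)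
    also have "\<dots> = z ^ (q ^ Suc i) / carlitz_D \<iota> i ^ q"
      using \<open>\<theta> ^ (q ^ Suc i) - \<theta> \<noteq> 0\<close> by (rule mult_divide_mult_cancel_left)
    finally show ?thesis by (simp add: eterm_def power_divide mult.commute flip: power_mult)
  qed
  ultimately have "(\<lambda>i. eterm (\<theta> * z) (Suc i) - \<theta> * eterm z (Suc i)) sums (carlitz_exp \<iota> z ^ (q ^ 1))" by simp
  hence "(\<lambda>i. eterm (\<theta> * z) i - \<theta> * eterm z i) sums (carlitz_exp \<iota> z ^ (q ^ 1) + (eterm (\<theta> * z) 0 - \<theta> * eterm z 0))"
    by (rule sums_Suc)
  moreover have "(\<lambda>i. \<theta> * eterm z i) sums (\<theta> * carlitz_exp \<iota> z)"
    using eterm_sums[of z] unfolding sums_def sum_distrib_left[symmetric] by (intro tendsto_intros)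
  ultimately have "(\<lambda>i. (eterm (\<theta> * z) i - \<theta> * eterm z i) + \<theta> * eterm z i) sums
      (carlitz_exp \<iota> z ^ (q ^ 1) + (eterm (\<theta> * z) 0 - \<theta> * eterm z 0) + \<theta> * carlitz_exp \<iota> z)"
    by (rule sums_add)
  hence "eterm (\<theta> * z) sums (carlitz_exp \<iota> z ^ q + \<theta> * carlitz_exp \<iota> z)"
    by (simp add: eterm_def[of _ 0])
  thus ?thesis using eterm_sums[of "\<theta> * z"] sums_unique2 by (metis add.commute)
qed

lemma absv_carlitz_exp_diff: 
  assumes "absv z \<le> 1" shows "absv (carlitz_exp \<iota> z - z) \<le> absv z ^ q"
proof -
  have "(\<lambda>i. eterm z (Suc i)) sums (carlitz_exp \<iota> z - z)"
  proof -
    have "(\<lambda>N. (\<Sum>i<Suc N. eterm z i) - z) \<longlonglongrightarrow> carlitz_exp \<iota> z - z"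
      using eterm_sums[of z] unfolding sums_def by (intro tendsto_intros LIMSEQ_Suc)
    moreover have "(\<Sum>i<Suc N. eterm z i) - z = (\<Sum>i<N. eterm z (Suc i))" for N
      by (subst sum.lessThan_Suc_shift) (simp add: eterm_def)
    ultimately show ?thesis by (simp add: sums_def)
  qed
  hence "summable (\<lambda>i. eterm z (Suc i))" and e: "carlitz_exp \<iota> z - z = (\<Sum>i. eterm z (Suc i))"
    by (auto simp: sums_iff)
  moreover have "absv (eterm z (Suc i)) \<le> absv z ^ q" for i
  proof -
    have "absv z / real q ^ Suc i \<le> absv z / 1" using q_gt_1 by (intro divide_left_mono one_le_power) auto
    hence "absv (eterm z (Suc i)) \<le> absv z ^ (q ^ Suc i)" unfolding absv_eterm by (intro power_mono) auto
    also have "\<dots> \<le> absv z ^ (q ^ 1)" using assms q_gt_1 by (intro power_decreasing power_increasing) auto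
    finally show ?thesis by simp
  qed
  ultimately show ?thesis unfolding e by (intro absv_suminf_le) auto
qed

lemma absv_carlitz_exp_le: 
  assumes "absv z \<le> 1" shows "absv (carlitz_exp \<iota> z) \<le> absv z"
proof -
  have "absv z ^ q \<le> absv z" using power_decreasing[of 1 q "absv z"] assms q_gt_1 by simp
  hence "absv ((carlitz_exp \<iota> z - z) + z) \<le> absv z"
    using absv_carlitz_exp_diff[OF assms] by (intro absv_add_leI) auto
  thus ?thesis by simp
qed

subsection \<open>Division towers of the Carlitz module\<close>

text \<open>A division tower is a power series with \<open>\<omega>\<^sup>(\<^sup>1\<^sup>) = (t - \<theta>) \<omega>\<close>, such as the Anderson-Thakur function.\<close>

lemma tower_coeffs:
  assumes "tw 1 w = (fps_X - fps_const \<theta>) * w"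
  shows "\<theta> * fps_nth w 0 + fps_nth w 0 ^ q = 0"
    and "\<theta> * fps_nth w (Suc n) + fps_nth w (Suc n) ^ q = fps_nth w n"
proof -
  have "fps_nth w 0 ^ q = - (\<theta> * fps_nth w 0)"
    using arg_cong[OF assms, of "\<lambda>h. fps_nth h 0"] by (simp add: left_diff_distrib)
  thus "\<theta> * fps_nth w 0 + fps_nth w 0 ^ q = 0" by simp
  have "fps_nth w (Suc n) ^ q = fps_nth w n - \<theta> * fps_nth w (Suc n)"
    using arg_cong[OF assms, of "\<lambda>h. fps_nth h (Suc n)"] by (simp add: left_diff_distrib)
  thus "\<theta> * fps_nth w (Suc n) + fps_nth w (Suc n) ^ q = fps_nth w n" by simp
qed

text \<open>The coefficients of w^(1) are w_(n-1) - \<theta> w_n, so evaluation at \<theta>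
  telescopes. Its limit turns the value of w^(1) at \<theta> into a limit of rescaled division
  points.\<close>

lemma tower_partial_sum:
  assumes "tw 1 w = (fps_X - fps_const \<theta>) * w"
  shows "(\<Sum>i<Suc N. fps_nth (tw 1 w) i * \<theta> ^ i) = - (\<theta> ^ Suc N * fps_nth w N)"
proof (induction N)
  case 0
  show ?case using tower_coeffs(1)[OF assms] by (simp add: eq_neg_iff_add_eq_0 add.commute)
next
  case (Suc N)
  have "fps_nth w (Suc N) ^ q = fps_nth w N - \<theta> * fps_nth w (Suc N)"
    using tower_coeffs(2)[OF assms, of N] by (simp add: eq_diff_eq add.commute)
  hence "fps_nth (tw 1 w) (Suc N) = fps_nth w N - \<theta> * fps_nth w (Suc N)" by simp
  thus ?case unfolding sum.lessThan_Suc[of _ "Suc N"] Suc by (simp only:) (simp add: algebra_simps)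
qed

lemma conv_tower:
  assumes "\<And>i. absv (fps_nth w i) \<le> C / real q ^ i" "C \<ge> 0"
  shows "conv (real q) (tw 1 w)" unfolding conv_def
proof (rule tendsto_sandwich[OF _ _ tendsto_const])
  have le: "absv (fps_nth (tw 1 w) i) * real q ^ i \<le> C ^ q * (1 / real q) ^ i" for i
  proof -
    have "absv (fps_nth (tw 1 w) i) * real q ^ i \<le> (C / real q ^ i) ^ q * real q ^ i"
      using assms by (simp add: absv_power mult_right_mono power_mono)
    also have "\<dots> = C ^ q * (real q ^ i / (real q ^ i) ^ q)" by (simp add: power_divide)
    also have "\<dots> \<le> C ^ q * (real q ^ i / (real q ^ i) ^ 2)" using assms q_ge_2 q_gt_1 
      by (intro mult_left_mono divide_left_mono power_increasing one_le_power) auto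
    also have "\<dots> = C ^ q * (1 / real q) ^ i" by (simp add: power2_eq_square power_divide)
    finally show ?thesis .
  qed
  show "\<forall>\<^sub>F n in sequentially. absv (fps_nth (tw 1 w) n) * real q ^ n \<le> C ^ q * (1 / real q) ^ n"
    using le by simp
  have "(\<lambda>i. C ^ q * (1 / real q) ^ i) \<longlonglongrightarrow> C ^ q * 0"
    using q_gt_1 by (intro tendsto_intros LIMSEQ_realpow_zero) auto
  thus "(\<lambda>i. C ^ q * (1 / real q) ^ i) \<longlonglongrightarrow> 0" by simp
qed auto

lemma tower_limit:
  assumes "tw 1 w = (fps_X - fps_const \<theta>) * w" "\<And>i. absv (fps_nth w i) \<le> C / real q ^ i" "C \<ge> 0"
  shows "(\<lambda>N. \<theta> ^ Suc N * fps_nth w N) \<longlonglongrightarrow> - fev (tw 1 w) \<theta>"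
proof -
  have "(\<lambda>i. fps_nth (tw 1 w) i * \<theta> ^ i) sums fev (tw 1 w) \<theta>"
    using conv_tower[OF assms(2,3)] by (intro fev_sums) (simp add: absv_theta)
  hence "(\<lambda>N. \<Sum>i<Suc N. fps_nth (tw 1 w) i * \<theta> ^ i) \<longlonglongrightarrow> fev (tw 1 w) \<theta>"
    unfolding sums_def by (rule LIMSEQ_Suc)
  from tendsto_minus[OF this] show ?thesis unfolding tower_partial_sum[OF assms(1)] by simp
qed

lemma funpow_carlitz_small:
  assumes "real q ^ N * absv x \<le> 1" "n \<le> N"
  shows "absv (((\<lambda>x. \<theta> * x + x ^ q) ^^ n) x) \<le> real q ^ n * absv x" using assms(2)
proof (induction n)
  case (Suc n)
  define y where "y = ((\<lambda>x. \<theta> * x + x ^ q) ^^ n) x"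
  have y: "absv y \<le> real q ^ n * absv x" using Suc by (simp add: y_def)
  have "real q ^ n * absv x \<le> real q ^ N * absv x" using Suc q_gt_1 by (intro mult_right_mono power_increasing) auto
  hence y1: "absv y \<le> 1" using y assms(1) by linarith
  have "absv y ^ q \<le> absv y ^ 1" using y1 q_gt_1 by (intro power_decreasing) auto
  also have "\<dots> \<le> real q * absv y" using q_gt_1 mult_right_mono[of 1 "real q" "absv y"] by simp
  finally have "absv (\<theta> * y + y ^ q) \<le> real q * absv y"
    by (intro absv_add_leI) (auto simp: absv_mult absv_theta absv_power)
  also have "\<dots> \<le> real q * (real q ^ n * absv x)" using y by (intro mult_left_mono) auto
  finally show ?case by (simp add: y_def)
qed auto

lemma carlitz_exp_theta_pow: "carlitz_exp \<iota> (\<theta> ^ n * z) = ((\<lambda>x. \<theta> * x + x ^ q) ^^ n) (carlitz_exp \<iota> z)"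
  by (induction n) (auto simp: carlitz_exp_theta mult.assoc)

lemma funpow_carlitz_diff:
  "((\<lambda>x. \<theta> * x + x ^ q) ^^ n) (x - y) = ((\<lambda>x. \<theta> * x + x ^ q) ^^ n) x - ((\<lambda>x. \<theta> * x + x ^ q) ^^ n) y"
  by (induction n) (simp_all add: diff_pow_q right_diff_distrib)

text \<open>w_N is killed by N+1 applications of the Carlitz action of \<theta>. Hence
  exp(\<theta>^(N+1) w_N) is the (N+1)-fold action on exp(w_N) - w_N, which is so small that the
  action enlarges it by at most q^(N+1) and it still tends to 0.\<close>

lemma exp_kernel_tower:
  assumes "tw 1 w = (fps_X - fps_const \<theta>) * w" "\<And>i. absv (fps_nth w i) \<le> C / real q ^ i" "C \<ge> 0"
  shows "carlitz_exp \<iota> (- fev (tw 1 w) \<theta>) = 0"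
proof -
  define z where "z = - fev (tw 1 w) \<theta>"
  define a where "a N = \<theta> ^ Suc N * fps_nth w N" for N
  have lim: "a \<longlonglongrightarrow> z" using tower_limit[OF assms] by (simp add: a_def[abs_def] z_def)
  have kill: "((\<lambda>x. \<theta> * x + x ^ q) ^^ Suc N) (fps_nth w N) = 0" for N
  proof (induction N)
    case 0
    show ?case using tower_coeffs(1)[OF assms(1)] by simp
  next
    case (Suc N)
    show ?case using Suc tower_coeffs(2)[OF assms(1), of N] by (simp only: funpow_Suc_right[of "Suc N"] o_apply)
  qed
  have small: "\<forall>\<^sub>F N in sequentially. absv (carlitz_exp \<iota> z) \<le> max (absv (z - a N)) (C ^ q * real q * (1 / real q) ^ N)"
  proof -
    have "(\<lambda>N. absv (z - a N)) \<longlonglongrightarrow> 0" using lim by (simp add: tendsto_absv_iff absv_diff_commute)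
    hence e1: "\<forall>\<^sub>F N in sequentially. absv (z - a N) < 1" by (rule order_tendstoD(2)) simp
    have "(\<lambda>N. C * (1 / real q) ^ N) \<longlonglongrightarrow> C * 0" using q_gt_1 by (intro tendsto_intros LIMSEQ_realpow_zero) auto
    hence e2: "\<forall>\<^sub>F N in sequentially. C * (1 / real q) ^ N < 1" by (rule order_tendstoD(2)) simp
    have "(\<lambda>N. C ^ q * real q * (1 / real q) ^ N) \<longlonglongrightarrow> C ^ q * real q * 0" using q_gt_1 by (intro tendsto_intros LIMSEQ_realpow_zero) auto
    hence e3: "\<forall>\<^sub>F N in sequentially. C ^ q * real q * (1 / real q) ^ N < 1" by (rule order_tendstoD(2)) simp
    show ?thesis using e1 e2 e3
    proof eventually_elim
      case (elim N)
      define y where "y = fps_nth w N"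
      have y: "absv y \<le> C / real q ^ N" "absv y \<le> 1"
        using assms(2)[of N] elim order_trans[OF assms(2)[of N], of 1] by (simp_all add: y_def power_divide less_imp_le)
      define x where "x = carlitz_exp \<iota> y - y"
      have "absv x \<le> absv y ^ q" unfolding x_def by (rule absv_carlitz_exp_diff[OF y(2)])
      also have "\<dots> \<le> (C / real q ^ N) ^ q" using y by (intro power_mono) auto
      finally have x: "absv x \<le> C ^ q / (real q ^ N) ^ q" by (simp add: power_divide)
      have "real q ^ Suc N * absv x \<le> real q ^ Suc N * (C ^ q / (real q ^ N) ^ q)"
        using x by (intro mult_left_mono) auto
      also have "\<dots> \<le> real q ^ Suc N * (C ^ q / (real q ^ N) ^ 2)" using assms(3) q_ge_2 q_gt_1
        by (intro mult_left_mono divide_left_mono power_increasing one_le_power) auto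
      also have "\<dots> = C ^ q * real q * (1 / real q) ^ N" by (simp add: power2_eq_square power_divide)
      finally have xq: "real q ^ Suc N * absv x \<le> C ^ q * real q * (1 / real q) ^ N" .
      hence "real q ^ Suc N * absv x \<le> 1" using elim by linarith
      from funpow_carlitz_small[OF this order.refl]
      have "absv (((\<lambda>x. \<theta> * x + x ^ q) ^^ Suc N) x) \<le> C ^ q * real q * (1 / real q) ^ N" using xq by linarith
      moreover have "((\<lambda>x. \<theta> * x + x ^ q) ^^ Suc N) x = carlitz_exp \<iota> (a N)"
        unfolding x_def funpow_carlitz_diff a_def carlitz_exp_theta_pow
        using kill[of N] by (simp only: y_def diff_zero)
      ultimately have 1: "absv (carlitz_exp \<iota> (a N)) \<le> C ^ q * real q * (1 / real q) ^ N" by simp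
      have 2: "absv (carlitz_exp \<iota> (z - a N)) \<le> absv (z - a N)"
        using elim by (intro absv_carlitz_exp_le) auto
      have "carlitz_exp \<iota> z = carlitz_exp \<iota> (z - a N) + carlitz_exp \<iota> (a N)"
        using carlitz_exp_add[of "z - a N" "a N"] by simp
      thus ?case using order_trans[OF absv_add_le max.mono[OF 2 1]] by simp
    qed
  qed
  have "(\<lambda>N. max (absv (z - a N)) (C ^ q * real q * (1 / real q) ^ N)) \<longlonglongrightarrow> max 0 (C ^ q * real q * 0)"
  proof (intro tendsto_max tendsto_intros LIMSEQ_realpow_zero)
    show "(\<lambda>N. absv (z - a N)) \<longlonglongrightarrow> 0" using lim by (simp add: tendsto_absv_iff absv_diff_commute)
  qed (use q_gt_1 in auto)
  hence "absv (carlitz_exp \<iota> z) \<le> max 0 (C ^ q * real q * 0)"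
    using small by (intro tendsto_lowerbound[OF _ small]) auto
  thus ?thesis by (simp add: z_def)
qed

text \<open>The definition of \<open>fundamental_period\<close> alone would admit \<pi> = 0 for a
  trivial kernel. The inverse of (t - \<theta>) \<Omega> is a division tower whose limit is a
  nonzero zero of the exponential.\<close>

lemma exp_kernel_nonzero: "\<exists>z. z \<noteq> 0 \<and> carlitz_exp \<iota> z = 0"
proof -
  define f where "f = (fps_X - fps_const \<theta>) * Omega"
  define W where "W = inverse f"
  have f0: "fps_nth f 0 = - (\<theta> * fps_nth Omega 0)" by (simp add: f_def left_diff_distrib)
  have O0: "fps_nth Omega 0 \<noteq> 0" using b\<Omega>_pos by (auto simp: b\<Omega>_def)
  hence nz: "fps_nth f 0 \<noteq> 0" by (simp add: f0)
  have a0: "absv (fps_nth f 0) = real q * b\<Omega>" by (simp add: f0 absv_mult absv_theta b\<Omega>_def)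
  have fW: "f * W = 1" unfolding W_def using inverse_mult_eq_1'[OF nz] .
  have "tw 1 f = Omega" unfolding f_def tw_mult tw_diff using Omega_eq by simp
  hence W1: "Omega * tw 1 W = 1" using arg_cong[OF fW, of "tw 1"] by (simp add: tw_mult)
  have "Omega * tw 1 W = Omega * ((fps_X - fps_const \<theta>) * W)" using W1 fW by (simp add: f_def mult_ac)
  moreover have "Omega \<noteq> 0" using O0 by auto
  ultimately have tower: "tw 1 W = (fps_X - fps_const \<theta>) * W" by simp
  have "bnd (real q) f (real q * b\<Omega>)"
    unfolding f_def by (intro bnd_mult bnd_linear bnd_Omega q_le_qq) (auto simp: absv_theta)
  hence bW: "bnd (real q) W (1 / (real q * b\<Omega>))" using bnd_fps_inverse[of "real q" f W] nz fW by (simp add: a0)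
  have le: "absv (fps_nth W i) \<le> (1 / (real q * b\<Omega>)) / real q ^ i" for i
    using bndD[OF bW, of i] q_gt_0 by (simp only: pos_le_divide_eq zero_less_power of_nat_0_less_iff)
  have C: "1 / (real q * b\<Omega>) \<ge> 0" using b\<Omega>_pos by simp
  have "fev (Omega * tw 1 W) \<theta> = fev Omega \<theta> * fev (tw 1 W) \<theta>"
    using conv_tower[OF le C] by (intro fev_mult) (auto simp: absv_theta intro: entireD entire_Omega)
  hence "fev (tw 1 W) \<theta> \<noteq> 0" using W1 by auto
  thus ?thesis using exp_kernel_tower[OF tower le C] by (intro exI[of _ "- fev (tw 1 W) \<theta>"]) auto
qed

lemma period_nonzero:
  assumes "fundamental_period \<iota> \<pi>" shows "\<pi> \<noteq> 0"
  using exp_kernel_nonzero assms by (auto simp: fundamental_period_def)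

text \<open>The division points exp(\<pi> / \<theta>^(i+1)) form a tower w with limit \<pi>. The
  product w^(1) \<Omega> is invariant under the twist, hence a polynomial over F_q, and it takes the
  value -\<pi> \<Omega>(\<theta>) at \<theta>. For rationality over k this polynomial need not be
  computed.\<close>

lemma period_Omega:
  assumes "fundamental_period \<iota> \<pi>"
  shows "\<exists>p. p \<noteq> 0 \<and> \<pi> * fev Omega \<theta> = evA p"
proof -
  have "1 \<in> ring_A \<iota>" unfolding ring_A_eq by (rule range_eqI[of _ _ 1]) simp
  hence E\<pi>: "carlitz_exp \<iota> \<pi> = 0" using assms by (force simp: fundamental_period_def)
  define w where "w = Abs_fps (\<lambda>i. carlitz_exp \<iota> (\<pi> / \<theta> ^ Suc i))"
  have c0: "fps_nth w 0 ^ q = - (\<theta> * fps_nth w 0)"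
    using carlitz_exp_theta[of "\<pi> / \<theta>"] E\<pi> by (simp add: w_def eq_neg_iff_add_eq_0 add.commute)
  have cS: "fps_nth w (Suc n) ^ q = fps_nth w n - \<theta> * fps_nth w (Suc n)" for n
    using carlitz_exp_theta[of "\<pi> / \<theta> ^ Suc (Suc n)"] by (simp add: w_def)
  have tower: "tw 1 w = (fps_X - fps_const \<theta>) * w"
  proof (rule fps_ext)
    fix n show "fps_nth (tw 1 w) n = fps_nth ((fps_X - fps_const \<theta>) * w) n"
      by (cases n) (simp_all add: left_diff_distrib c0 cS)
  qed
  obtain N where N: "absv \<pi> \<le> real q ^ N"
    using real_arch_pow[of "real q" "absv \<pi>"] q_gt_1 by (auto intro: less_imp_le)
  have big: "absv (fps_nth w i) \<le> absv \<pi> / real q ^ Suc i" if "i \<ge> N" for i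
  proof -
    have "real q ^ N \<le> real q ^ Suc i" using that q_gt_1 by (intro power_increasing) auto
    hence "absv (\<pi> / \<theta> ^ Suc i) \<le> 1"
      using N q_gt_0 by (simp add: absv_divide absv_power absv_theta absv_mult field_simps)
    from absv_carlitz_exp_le[OF this] show ?thesis by (simp add: w_def absv_divide absv_power absv_mult absv_theta)
  qed
  \<comment> \<open>From N on, the bound |\<pi>| / q^(i+1) holds; the finitely many earlier
    coefficients are absorbed into C.\<close>
  define C where "C = absv \<pi> + (\<Sum>i<N. absv (fps_nth w i) * real q ^ i)"
  have C: "C \<ge> 0" by (auto simp: C_def intro!: add_nonneg_nonneg sum_nonneg)
  have le: "absv (fps_nth w i) \<le> C / real q ^ i" for i
  proof (cases "i < N")
    case True
    have "absv (fps_nth w i) * real q ^ i \<le> (\<Sum>i<N. absv (fps_nth w i) * real q ^ i)"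
      using True by (intro member_le_sum) auto
    also have "\<dots> \<le> C" by (simp add: C_def)
    finally show ?thesis using q_gt_0 by (simp add: field_simps)
  next
    case False
    have "absv \<pi> / real q ^ Suc i \<le> absv \<pi> / real q ^ i"
      using q_gt_1 by (intro divide_left_mono power_increasing) auto
    also have "\<dots> \<le> C / real q ^ i" by (intro divide_right_mono) (auto simp: C_def intro!: sum_nonneg)
    finally show ?thesis using big[of i] False by simp
  qed
  have lim\<pi>: "(\<lambda>n. \<theta> ^ Suc n * fps_nth w n) \<longlonglongrightarrow> \<pi>"
  proof (subst tendsto_absv_iff, rule tendsto_sandwich[OF _ _ tendsto_const])
    show "\<forall>\<^sub>F n in sequentially. absv (\<theta> ^ Suc n * fps_nth w n - \<pi>) \<le> absv \<pi> ^ q * (1 / real q) ^ Suc n"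
    proof (rule eventually_sequentiallyI[of N])
      fix n assume n: "n \<ge> N"
      define z where "z = \<pi> / \<theta> ^ Suc n"
      have "real q ^ N \<le> real q ^ Suc n" using n q_gt_1 by (intro power_increasing) auto
      hence z1: "absv z \<le> 1"
        using N q_gt_0 by (simp add: z_def absv_divide absv_power absv_theta absv_mult field_simps)
      have az: "absv z = absv \<pi> / real q ^ Suc n" by (simp only: z_def absv_divide absv_power absv_theta)
      have "\<theta> ^ Suc n * fps_nth w n - \<pi> = \<theta> ^ Suc n * (carlitz_exp \<iota> z - z)"
        by (simp add: w_def z_def right_diff_distrib)
      hence "absv (\<theta> ^ Suc n * fps_nth w n - \<pi>) = real q ^ Suc n * absv (carlitz_exp \<iota> z - z)"
        by (simp only: absv_mult absv_power absv_theta)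
      also have "\<dots> \<le> real q ^ Suc n * (absv \<pi> / real q ^ Suc n) ^ q"
        using absv_carlitz_exp_diff[OF z1] unfolding az by (intro mult_left_mono) auto
      also have "\<dots> = real q ^ Suc n * (absv \<pi> ^ q / (real q ^ Suc n) ^ q)" by (simp only: power_divide)
      also have "\<dots> \<le> real q ^ Suc n * (absv \<pi> ^ q / (real q ^ Suc n) ^ 2)"
        using q_ge_2 q_gt_1 by (intro mult_left_mono divide_left_mono power_increasing one_le_power) auto
      also have "\<dots> = absv \<pi> ^ q * (1 / real q) ^ Suc n" by (simp add: power2_eq_square power_divide)
      finally show "absv (\<theta> ^ Suc n * fps_nth w n - \<pi>) \<le> absv \<pi> ^ q * (1 / real q) ^ Suc n" .
    qed
    have "(\<lambda>n. absv \<pi> ^ q * (1 / real q) ^ Suc n) \<longlonglongrightarrow> absv \<pi> ^ q * 0"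
      using q_gt_1 by (intro tendsto_mult tendsto_const LIMSEQ_Suc[OF LIMSEQ_realpow_zero]) auto
    thus "(\<lambda>n. absv \<pi> ^ q * (1 / real q) ^ Suc n) \<longlonglongrightarrow> 0" by simp
  qed auto
  hence val: "- fev (tw 1 w) \<theta> = \<pi>" using tower_limit[OF tower le C] LIMSEQ_unique by blast
  define \<kappa> where "\<kappa> = tw 1 w * Omega"
  have "tw 1 \<kappa> = tw 1 (tw 1 w) * tw 1 Omega" by (simp add: \<kappa>_def tw_mult)
  also have "tw 1 (tw 1 w) = (fps_X - fps_const (\<theta> ^ q)) * tw 1 w"
    using arg_cong[OF tower, of "tw 1"] by (simp add: tw_mult tw_diff)
  also have "\<dots> * tw 1 Omega = tw 1 w * ((fps_X - fps_const (\<theta> ^ q)) * tw 1 Omega)" by (simp add: mult_ac)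
  also have "\<dots> = \<kappa>" using Omega_eq by (simp add: \<kappa>_def)
  finally have fixed: "tw 1 \<kappa> = \<kappa>" .
  have cw: "conv (real q) (tw 1 w)" by (rule conv_tower[OF le C])
  have "conv (real q) \<kappa>" unfolding \<kappa>_def by (intro conv_mult cw entireD entire_Omega) auto
  hence "conv 1 \<kappa>" by (rule conv_mono) (use q_gt_1 in auto)
  then obtain p where p: "\<kappa> = fps_of_poly (map_poly cst p)" using tw_fixed_imp_poly[OF fixed] by blast
  have "fev \<kappa> \<theta> = fev (tw 1 w) \<theta> * fev Omega \<theta>"
    unfolding \<kappa>_def using cw by (intro fev_mult) (auto simp: absv_theta intro: entireD entire_Omega)
  hence "evA p = - (\<pi> * fev Omega \<theta>)" using val by (simp add: p evA_def flip: val)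
  hence eq: "\<pi> * fev Omega \<theta> = evA (- p)" by (simp add: evA_minus)
  moreover have "- p \<noteq> 0" using eq period_nonzero[OF assms] Omega_theta_nonzero by force
  ultimately show ?thesis by blast
qed

end

section \<open>Linear dependence over subrings\<close>

definition subr :: "'a::comm_ring_1 set \<Rightarrow> bool"
  where "subr R \<longleftrightarrow> 0 \<in> R \<and> 1 \<in> R \<and> (\<forall>x\<in>R. \<forall>y\<in>R. x + y \<in> R \<and> x * y \<in> R) \<and> (\<forall>x\<in>R. - x \<in> R)"

lemma subrD:
  assumes "subr R"
  shows "0 \<in> R" "1 \<in> R" "x \<in> R \<Longrightarrow> y \<in> R \<Longrightarrow> x + y \<in> R" "x \<in> R \<Longrightarrow> y \<in> R \<Longrightarrow> x * y \<in> R"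
    "x \<in> R \<Longrightarrow> - x \<in> R" "x \<in> R \<Longrightarrow> y \<in> R \<Longrightarrow> x - y \<in> R"
  using assms unfolding subr_def by (auto simp: diff_conv_add_uminus simp del: add_uminus_conv_diff)

lemma subr_UNIV [simp]: "subr UNIV" by (auto simp: subr_def)

lemma subr_sum: "subr R \<Longrightarrow> (\<And>i. i \<in> A \<Longrightarrow> f i \<in> R) \<Longrightarrow> sum f A \<in> R"
  by (induction A rule: infinite_finite_induct) (auto intro: subrD)

lemma subr_power: "subr R \<Longrightarrow> x \<in> R \<Longrightarrow> x ^ n \<in> R"
  by (induction n) (auto intro: subrD)

lemma subr_polys_over:
  assumes "subr R" shows "subr (polys_over R)" unfolding subr_def polys_over_def
  by (auto simp: coeff_mult intro!: subr_sum[OF assms] subrD[OF assms])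

text \<open>Fraction-free elimination with the pivot v k j0, so that the coefficients stay in a
  subring that need not be closed under division.\<close>

lemma subring_dependence:
  fixes v :: "'i \<Rightarrow> 'j \<Rightarrow> 'a::idom"
  assumes "subr R" "finite J" "finite I" "card J < card I" "\<And>i j. i \<in> I \<Longrightarrow> j \<in> J \<Longrightarrow> v i j \<in> R"
  shows "\<exists>c. (\<forall>i\<in>I. c i \<in> R) \<and> (\<exists>i\<in>I. c i \<noteq> 0) \<and> (\<forall>j\<in>J. (\<Sum>i\<in>I. c i * v i j) = 0)"
  using assms(2-)
proof (induction J arbitrary: I v rule: finite_induct)
  case empty
  then obtain k where "k \<in> I" by fastforce
  thus ?case using subrD[OF assms(1)] by (intro exI[of _ "\<lambda>_. 1"]) auto
next
  case (insert j0 J)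
  show ?case
  proof (cases "\<forall>i\<in>I. v i j0 = 0")
    case True
    have "\<exists>c. (\<forall>i\<in>I. c i \<in> R) \<and> (\<exists>i\<in>I. c i \<noteq> 0) \<and> (\<forall>j\<in>J. (\<Sum>i\<in>I. c i * v i j) = 0)"
      using insert.prems insert.hyps by (intro insert.IH) auto
    thus ?thesis using True by auto
  next
    case False
    then obtain k where k: "k \<in> I" "v k j0 \<noteq> 0" by auto
    define w where "w i j = v k j0 * v i j - v i j0 * v k j" for i j
    have "\<exists>c. (\<forall>i\<in>I - {k}. c i \<in> R) \<and> (\<exists>i\<in>I - {k}. c i \<noteq> 0) \<and> (\<forall>j\<in>J. (\<Sum>i\<in>I - {k}. c i * w i j) = 0)"
      using insert.prems insert.hyps k by (intro insert.IH) (auto simp: w_def intro!: subrD(4,6)[OF assms(1)])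
    then obtain c where c: "\<forall>i\<in>I - {k}. c i \<in> R" "\<exists>i\<in>I - {k}. c i \<noteq> 0"
        "\<forall>j\<in>J. (\<Sum>i\<in>I - {k}. c i * w i j) = 0" by blast
    define c' where "c' i = (if i = k then - (\<Sum>i\<in>I - {k}. c i * v i j0) else c i * v k j0)" for i
    have sum: "(\<Sum>i\<in>I. c' i * v i j) = (\<Sum>i\<in>I - {k}. c i * w i j)" for j
    proof -
      have "(\<Sum>i\<in>I. c' i * v i j) = c' k * v k j + (\<Sum>i\<in>I - {k}. c' i * v i j)"
        using k insert.prems by (intro sum.remove) auto
      also have "(\<Sum>i\<in>I - {k}. c' i * v i j) = (\<Sum>i\<in>I - {k}. c i * v k j0 * v i j)"
        by (intro sum.cong) (auto simp: c'_def)
      also have "c' k * v k j + \<dots> = (\<Sum>i\<in>I - {k}. c i * w i j)"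
        by (simp add: c'_def w_def sum_distrib_right sum_distrib_left right_diff_distrib sum_subtractf mult_ac)
      finally show ?thesis .
    qed
    have "w i j0 = 0" for i by (simp add: w_def mult.commute)
    hence "\<forall>j\<in>insert j0 J. (\<Sum>i\<in>I. c' i * v i j) = 0" using sum c(3) by auto
    moreover have "\<forall>i\<in>I. c' i \<in> R" using c(1) insert.prems k
      by (auto simp: c'_def intro!: subrD(4,5)[OF assms(1)] subr_sum[OF assms(1)])
    moreover have "\<exists>i\<in>I. c' i \<noteq> 0" using c(2) k by (auto simp: c'_def)
    ultimately show ?thesis by blast
  qed
qed

context C_infinity
begin

section \<open>Algebraic elements\<close>

definition Aspan :: "'c set \<Rightarrow> 'c set"
  where "Aspan B = {x. \<exists>a. x = (\<Sum>b\<in>B. evA (a b) * b)}"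

text \<open>The span over k, expressed through denominators in A.\<close>

definition kspan :: "'c set \<Rightarrow> 'c set"
  where "kspan B = {x. \<exists>a. a \<noteq> 0 \<and> evA a * x \<in> Aspan B}"

lemma Aspan_base: "finite B \<Longrightarrow> b \<in> B \<Longrightarrow> b \<in> Aspan B"
  unfolding Aspan_def by (rule CollectI, rule exI[of _ "\<lambda>c. if c = b then 1 else 0"])
    (simp add: if_distrib[of evA] if_distrib[of "\<lambda>x. x * _"] cong: if_cong)

lemma Aspan_0: "0 \<in> Aspan B" unfolding Aspan_def by (rule CollectI, rule exI[of _ "\<lambda>c. 0"]) simp

lemma Aspan_add: "x \<in> Aspan B \<Longrightarrow> y \<in> Aspan B \<Longrightarrow> x + y \<in> Aspan B"
proof -
  assume "x \<in> Aspan B" "y \<in> Aspan B"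
  then obtain a c where "x = (\<Sum>b\<in>B. evA (a b) * b)" "y = (\<Sum>b\<in>B. evA (c b) * b)" by (auto simp: Aspan_def)
  hence "x + y = (\<Sum>b\<in>B. evA (a b + c b) * b)" by (simp add: evA_add sum.distrib distrib_right)
  thus ?thesis unfolding Aspan_def by (intro CollectI exI[of _ "\<lambda>b. a b + c b"])
qed

lemma Aspan_scale: "x \<in> Aspan B \<Longrightarrow> evA a * x \<in> Aspan B"
proof -
  assume "x \<in> Aspan B"
  then obtain c where "x = (\<Sum>b\<in>B. evA (c b) * b)" by (auto simp: Aspan_def)
  hence "evA a * x = (\<Sum>b\<in>B. evA (a * c b) * b)" by (simp add: evA_mult sum_distrib_left mult.assoc)
  thus ?thesis unfolding Aspan_def by (intro CollectI exI[of _ "\<lambda>b. a * c b"])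
qed

lemma kspan_base: "finite B \<Longrightarrow> b \<in> B \<Longrightarrow> b \<in> kspan B"
  unfolding kspan_def by (intro CollectI exI[of _ 1]) (simp add: Aspan_base)

lemma kspan_0: "0 \<in> kspan B" unfolding kspan_def by (intro CollectI exI[of _ 1]) (simp add: Aspan_0)

lemma kspan_add: "x \<in> kspan B \<Longrightarrow> y \<in> kspan B \<Longrightarrow> x + y \<in> kspan B"
proof -
  assume "x \<in> kspan B" "y \<in> kspan B"
  then obtain a c where a: "a \<noteq> 0" "evA a * x \<in> Aspan B" and c: "c \<noteq> 0" "evA c * y \<in> Aspan B"
    by (auto simp: kspan_def)
  have "evA (a * c) * (x + y) = evA c * (evA a * x) + evA a * (evA c * y)" by (simp add: evA_mult algebra_simps)
  also have "\<dots> \<in> Aspan B" by (intro Aspan_add Aspan_scale a c)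
  finally show ?thesis using a c unfolding kspan_def by (intro CollectI exI[of _ "a * c"]) auto
qed

lemma kspan_scale: "x \<in> kspan B \<Longrightarrow> evA a * x \<in> kspan B"
proof -
  assume "x \<in> kspan B"
  then obtain c where c: "c \<noteq> 0" "evA c * x \<in> Aspan B" by (auto simp: kspan_def)
  have "evA a * (evA c * x) \<in> Aspan B" by (rule Aspan_scale[OF c(2)])
  also have "evA a * (evA c * x) = evA c * (evA a * x)" by (simp add: mult_ac)
  finally have "evA c * (evA a * x) \<in> Aspan B" .
  thus ?thesis using c(1) unfolding kspan_def by (intro CollectI exI[of _ c] conjI)
qed

lemma kspan_sum: "(\<And>i. i \<in> I \<Longrightarrow> f i \<in> kspan B) \<Longrightarrow> sum f I \<in> kspan B"
  by (induction I rule: infinite_finite_induct) (auto intro: kspan_add kspan_0)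

lemma kspan_Aspan: "(\<And>b. b \<in> B \<Longrightarrow> b \<in> kspan E) \<Longrightarrow> x \<in> Aspan B \<Longrightarrow> x \<in> kspan E"
  unfolding Aspan_def by (auto intro!: kspan_sum kspan_scale)

lemma kspan_cancel: "evA a * x \<in> kspan B \<Longrightarrow> a \<noteq> 0 \<Longrightarrow> x \<in> kspan B"
proof -
  assume "evA a * x \<in> kspan B" "a \<noteq> 0"
  then obtain c where c: "c \<noteq> 0" "evA c * (evA a * x) \<in> Aspan B" by (auto simp: kspan_def)
  hence "evA (c * a) * x \<in> Aspan B" by (simp add: evA_mult mult_ac)
  thus ?thesis using c \<open>a \<noteq> 0\<close> unfolding kspan_def by (intro CollectI exI[of _ "c * a"]) auto
qed

lemma kspan_kspan: "(\<And>b. b \<in> B \<Longrightarrow> b \<in> kspan E) \<Longrightarrow> x \<in> kspan B \<Longrightarrow> x \<in> kspan E"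
  using kspan_Aspan kspan_cancel unfolding kspan_def[of B] by blast

lemma kspan_mult:
  assumes "\<And>b c. b \<in> B \<Longrightarrow> c \<in> C \<Longrightarrow> b * c \<in> kspan E" "x \<in> kspan B" "y \<in> kspan C"
  shows "x * y \<in> kspan E"
proof -
  obtain a where a: "a \<noteq> 0" "evA a * x \<in> Aspan B" using assms(2) by (auto simp: kspan_def)
  obtain a' where a': "a' \<noteq> 0" "evA a' * y \<in> Aspan C" using assms(3) by (auto simp: kspan_def)
  obtain f g where f: "evA a * x = (\<Sum>b\<in>B. evA (f b) * b)" and g: "evA a' * y = (\<Sum>c\<in>C. evA (g c) * c)"
    using a a' by (auto simp: Aspan_def)
  have "evA (a * a') * (x * y) = (evA a * x) * (evA a' * y)" by (simp add: evA_mult mult_ac)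
  also have "\<dots> = (\<Sum>b\<in>B. \<Sum>c\<in>C. evA (f b) * (evA (g c) * (b * c)))"
    unfolding f g sum_product by (simp add: mult_ac)
  also have "\<dots> \<in> kspan E" by (intro kspan_sum kspan_scale assms(1))
  finally show ?thesis by (rule kspan_cancel) (use a a' in auto)
qed

definition alg :: "'c \<Rightarrow> bool"
  where "alg x \<longleftrightarrow> (\<exists>p \<in> polys_over (range evA). p \<noteq> 0 \<and> poly p x = 0)"

lemma subr_range_evA: "subr (range evA)" unfolding subr_def
  by (auto simp flip: evA_add evA_mult evA_minus intro: range_eqI[of _ _ 0] range_eqI[of _ _ 1])

text \<open>Says that B spans a finite-dimensional k-subalgebra containing 1; B need not be
  independent.\<close>

definition closed_base :: "'c set \<Rightarrow> bool"
  where "closed_base B \<longleftrightarrow> finite B \<and> 1 \<in> B \<and> (\<forall>b\<in>B. \<forall>c\<in>B. b * c \<in> kspan B)"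

lemma closed_base_mult: "closed_base B \<Longrightarrow> x \<in> kspan B \<Longrightarrow> y \<in> kspan B \<Longrightarrow> x * y \<in> kspan B"
  using kspan_mult[of B B B x y] by (auto simp: closed_base_def)

lemma closed_base_power: "closed_base B \<Longrightarrow> x \<in> kspan B \<Longrightarrow> x ^ n \<in> kspan B"
  by (induction n) (auto intro: closed_base_mult kspan_base simp: closed_base_def)

text \<open>The card B + 1 powers of x from 0 to card B are too many for the span of B; their
  dependence is an equation for x over A.\<close>

lemma closed_base_imp_alg:
  assumes B: "closed_base B" and x: "x \<in> kspan B"
  shows "alg x"
proof -
  have "\<forall>n. \<exists>a c. a \<noteq> 0 \<and> evA a * x ^ n = (\<Sum>b\<in>B. evA (c b) * b)"
    using closed_base_power[OF B x] unfolding kspan_def Aspan_def by fast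
  then obtain a c where ac: "\<And>n. a n \<noteq> 0" "\<And>n. evA (a n) * x ^ n = (\<Sum>b\<in>B. evA (c n b) * b)" by metis
  have fin: "finite B" using B by (simp add: closed_base_def)
  obtain g where g: "\<exists>n\<in>{..card B}. g n \<noteq> 0" "\<forall>b\<in>B. (\<Sum>n\<le>card B. g n * c n b) = 0"
    using subring_dependence[of UNIV B "{..card B}" c] fin by auto
  define p where "p = (\<Sum>n\<le>card B. monom (evA (g n * a n)) n)"
  have coeff: "coeff p i = (if i \<le> card B then evA (g i * a i) else 0)" for i by (simp add: p_def coeff_sum)
  have "poly p x = (\<Sum>n\<le>card B. evA (g n) * (evA (a n) * x ^ n))"
    by (simp add: p_def poly_sum poly_monom evA_mult mult.assoc)
  also have "\<dots> = (\<Sum>n\<le>card B. \<Sum>b\<in>B. evA (g n * c n b) * b)"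
    by (simp add: ac(2) sum_distrib_left evA_mult mult.assoc)
  also have "\<dots> = (\<Sum>b\<in>B. \<Sum>n\<le>card B. evA (g n * c n b) * b)" by (rule sum.swap)
  also have "\<dots> = (\<Sum>b\<in>B. evA (\<Sum>n\<le>card B. g n * c n b) * b)" by (simp add: evA_sum sum_distrib_right)
  also have "\<dots> = 0" using g(2) by simp
  finally have "poly p x = 0" .
  moreover have "p \<noteq> 0"
  proof -
    obtain n where "n \<le> card B" "g n \<noteq> 0" using g(1) by auto
    hence "coeff p n \<noteq> 0" using ac(1)[of n] by (simp add: coeff)
    thus ?thesis by auto
  qed
  moreover have "p \<in> polys_over (range evA)"
    using subrD(1)[OF subr_range_evA] by (auto simp: polys_over_def coeff)
  ultimately show ?thesis unfolding alg_def by blast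
qed

text \<open>Adjoining y enlarges B to the products b y^i with i below the degree of y. The set K
  follows the construction so that the base can be kept inside kbar.\<close>

lemma closed_base_exists:
  assumes "finite S" "\<And>x. x \<in> S \<Longrightarrow> alg x"
    and K: "1 \<in> K" "\<And>x y. x \<in> K \<Longrightarrow> y \<in> K \<Longrightarrow> x * y \<in> K" "S \<subseteq> K"
  shows "\<exists>B. closed_base B \<and> S \<subseteq> kspan B \<and> B \<subseteq> K" using assms(1,2) K(3)
proof (induction S rule: finite_induct)
  case empty
  have "closed_base {1}" by (auto simp: closed_base_def intro: kspan_base)
  thus ?case using K(1) by blast
next
  case (insert y S)
  obtain B where B: "closed_base B" "S \<subseteq> kspan B" "B \<subseteq> K" using insert.IH insert.prems by blast
  have fin: "finite B" "1 \<in> B" using B by (auto simp: closed_base_def)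
  obtain p where p: "p \<in> polys_over (range evA)" "p \<noteq> 0" "poly p y = 0"
    using insert.prems(1)[of y] by (auto simp: alg_def)
  define D where "D = degree p"
  have "\<forall>i. \<exists>a. coeff p i = evA a" using p(1) by (auto simp: polys_over_def)
  from choice[OF this] obtain a where "\<forall>i. coeff p i = evA (a i)" ..
  hence a: "coeff p i = evA (a i)" for i by blast
  have aD: "a D \<noteq> 0" using p(2) a[of D] by (metis D_def evA_0 leading_coeff_0_iff)
  have D: "D > 0"
  proof (rule ccontr)
    assume "\<not> D > 0"
    then obtain c where "p = [:c:]" by (metis D_def degree_eq_zeroE gr0I)
    thus False using p by simp
  qed
  have rel: "evA (a D) * y ^ D = (\<Sum>i<D. evA (- a i) * y ^ i)"
  proof -
    have "0 = (\<Sum>i\<le>D. evA (a i) * y ^ i)" using p(3) by (simp add: poly_altdef D_def a)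
    also have "\<dots> = (\<Sum>i<D. evA (a i) * y ^ i) + evA (a D) * y ^ D"
      by (simp add: lessThan_Suc_atMost[symmetric])
    finally show ?thesis by (simp add: evA_minus sum_negf eq_neg_iff_add_eq_0 add.commute)
  qed
  define B' where "B' = (\<lambda>(b, i). b * y ^ i) ` (B \<times> {..<D})"
  have fin': "finite B'" using fin by (simp add: B'_def)
  have base: "b * y ^ n \<in> kspan B'" if "b \<in> B" for b n
  proof (induction n rule: less_induct)
    case (less n)
    show ?case
    proof (cases "n < D")
      case True
      hence "b * y ^ n \<in> B'" using that by (auto simp: B'_def)
      thus ?thesis using fin' by (intro kspan_base)
    next
      case False
      have "evA (a D) * (b * y ^ n) = b * y ^ (n - D) * (evA (a D) * y ^ D)"
        using False by (simp add: mult_ac flip: power_add)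
      also have "\<dots> = (\<Sum>i<D. evA (- a i) * (b * y ^ (n - D + i)))"
        unfolding rel by (simp add: sum_distrib_left power_add mult_ac)
      also have "\<dots> \<in> kspan B'" using False by (intro kspan_sum kspan_scale less) auto
      finally show ?thesis using aD by (rule kspan_cancel)
    qed
  qed
  have "closed_base B'" unfolding closed_base_def
  proof (intro conjI ballI fin')
    show "1 \<in> B'" unfolding B'_def using fin(2) D by (intro image_eqI[of _ _ "(1, 0)"]) auto
    fix b c assume "b \<in> B'" "c \<in> B'"
    then obtain b0 i c0 j where bc: "b = b0 * y ^ i" "c = c0 * y ^ j" "b0 \<in> B" "c0 \<in> B" by (auto simp: B'_def)
    have k1: "b0 * c0 \<in> kspan B" using B bc by (auto simp: closed_base_def)
    have k2: "y ^ (i + j) \<in> kspan {y ^ (i + j)}" by (intro kspan_base) auto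
    have "(b0 * c0) * y ^ (i + j) \<in> kspan B'"
    proof (rule kspan_mult[OF _ k1 k2])
      fix b c assume "b \<in> B" "c \<in> {y ^ (i + j)}"
      thus "b * c \<in> kspan B'" using base by simp
    qed
    thus "b * c \<in> kspan B'" by (simp add: bc power_add mult_ac)
  qed
  moreover have sub: "x \<in> kspan B'" if "x \<in> kspan B" for x
  proof (rule kspan_kspan[OF _ that])
    show "b \<in> kspan B'" if "b \<in> B" for b using base[OF that, of 0] by simp
  qed
  moreover have "y \<in> kspan B'" using base[OF fin(2), of 1] by simp
  moreover have "y ^ n \<in> K" for n using insert.prems(2) by (induction n) (auto intro: K(1,2))
  hence "B' \<subseteq> K" using B(3) by (auto simp: B'_def intro!: K(2))
  ultimately show ?case using B(2) by blast
qed

lemma alg_add: assumes "alg x" "alg y" shows "alg (x + y)"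
  using closed_base_exists[of "{x, y}" UNIV] assms by (auto intro: closed_base_imp_alg kspan_add)

lemma alg_mult: assumes "alg x" "alg y" shows "alg (x * y)"
  using closed_base_exists[of "{x, y}" UNIV] assms by (auto intro: closed_base_imp_alg closed_base_mult)

lemma alg_evA: "alg (evA a)" unfolding alg_def
proof (intro bexI conjI)
  show "[:- evA a, 1:] \<in> polys_over (range evA)"
    using subrD[OF subr_range_evA] by (auto simp: polys_over_def coeff_pCons split: nat.split)
qed auto

lemma alg_uminus: "alg x \<Longrightarrow> alg (- x)" using alg_mult[OF alg_evA[of "-1"]] by (simp add: evA_minus)

lemma alg_inverse: assumes "alg x" shows "alg (inverse x)"
proof (cases "x = 0")
  case False
  obtain p where p: "p \<in> polys_over (range evA)" "p \<noteq> 0" "poly p x = 0" using assms by (auto simp: alg_def)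
  have "poly (reflect_poly p) (inverse x) = 0" using p(3) False by (simp add: poly_reflect_poly_nz)
  moreover have "reflect_poly p \<noteq> 0" using p(2) by simp
  moreover have "reflect_poly p \<in> polys_over (range evA)"
    using p(1) subrD(1)[OF subr_range_evA] by (auto simp: polys_over_def coeff_reflect_poly)
  ultimately show ?thesis unfolding alg_def by blast
qed (use assms in simp)

lemma alg_root: assumes "alg (y ^ n)" "n > 0" shows "alg y"
proof -
  obtain p where p: "p \<in> polys_over (range evA)" "p \<noteq> 0" "poly p (y ^ n) = 0" using assms by (auto simp: alg_def)
  define P where "P = (\<Sum>i\<le>degree p. monom (coeff p i) (n * i))"
  have "poly P y = 0" using p(3)[unfolded poly_altdef] by (simp add: P_def poly_sum poly_monom power_mult)
  moreover have "coeff P (n * degree p) = Polynomial.lead_coeff p" unfolding P_def coeff_sum using assms(2) by simp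
  hence "P \<noteq> 0" using p(2) by (metis coeff_0 leading_coeff_0_iff)
  moreover have "P \<in> polys_over (range evA)" using p(1) subrD(1)[OF subr_range_evA]
    by (auto simp: polys_over_def P_def coeff_sum intro!: subr_sum[OF subr_range_evA])
  ultimately show ?thesis unfolding alg_def by blast
qed

lemma kbar_iff: "x \<in> kbar \<iota> \<longleftrightarrow> x \<in> range \<iota> \<and> alg x"
proof -
  have "(\<exists>f \<in> polys_over (field_k \<iota>). f \<noteq> 0 \<and> poly f x = 0) \<longleftrightarrow> alg x"
  proof
    assume "alg x"
    then obtain p where p: "p \<in> polys_over (range evA)" "p \<noteq> 0" "poly p x = 0" by (auto simp: alg_def)
    have "p \<in> polys_over (field_k \<iota>)" unfolding polys_over_def
    proof (intro CollectI allI)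
      fix i
      obtain a where "coeff p i = evA a" using p(1) by (auto simp: polys_over_def)
      thus "coeff p i \<in> field_k \<iota>" unfolding field_k_iff by (intro exI[of _ a] exI[of _ 1]) auto
    qed
    thus "\<exists>f \<in> polys_over (field_k \<iota>). f \<noteq> 0 \<and> poly f x = 0" using p by blast
  next
    assume "\<exists>f \<in> polys_over (field_k \<iota>). f \<noteq> 0 \<and> poly f x = 0"
    then obtain f where f: "\<And>i. coeff f i \<in> field_k \<iota>" "f \<noteq> 0" "poly f x = 0"
      by (auto simp: polys_over_def)
    then obtain a b where ab: "\<And>i. b i \<noteq> 0" "\<And>i. evA (b i) * coeff f i = evA (a i)"
      unfolding field_k_iff' by metis
    define m where "m = (\<Prod>i\<le>degree f. b i)"
    have "m \<noteq> 0" using ab(1) by (simp add: m_def)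
    have "Polynomial.smult (evA m) f \<in> polys_over (range evA)" unfolding polys_over_def
    proof (intro CollectI allI)
      fix i
      show "coeff (Polynomial.smult (evA m) f) i \<in> range evA"
      proof (cases "i \<le> degree f")
        case True
        hence "m = b i * (\<Prod>j\<in>{..degree f} - {i}. b j)" unfolding m_def by (intro prod.remove) auto
        hence "evA m * coeff f i = evA (a i * (\<Prod>j\<in>{..degree f} - {i}. b j))"
          using ab(2)[of i] by (simp add: evA_mult mult_ac)
        thus ?thesis by simp
      next
        case False
        thus ?thesis using subrD(1)[OF subr_range_evA] by (simp add: coeff_eq_0)
      qed
    qed
    thus "alg x" unfolding alg_def using f \<open>m \<noteq> 0\<close> by (intro bexI[of _ "Polynomial.smult (evA m) f"]) auto
  qed
  thus ?thesis by (simp add: kbar_def)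
qed

lemma kbar_evA: "evA a \<in> kbar \<iota>"
proof -
  have "evA a \<in> range \<iota>"
  proof (induction a)
    case (pCons c p)
    then obtain y where "evA p = \<iota> y" by auto
    hence "evA (pCons c p) = \<iota> (to_ac (fls_const c) + to_ac fls_X_inv * y)"
      by (simp add: evA_pCons cst_def theta_def emb_add emb_mult)
    thus ?case by blast
  qed (auto intro: range_eqI[of _ _ 0])
  thus ?thesis by (simp add: kbar_iff alg_evA)
qed

lemma kbar_0 [simp]: "0 \<in> kbar \<iota>" and kbar_1 [simp]: "1 \<in> kbar \<iota>" and kbar_theta [simp]: "\<theta> \<in> kbar \<iota>"
  and kbar_cst [simp]: "cst c \<in> kbar \<iota>"
  using kbar_evA[of 0] kbar_evA[of 1] kbar_evA[of "[:0, 1:]"] kbar_evA[of "[:c:]"] by auto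

lemma kbar_add: "x \<in> kbar \<iota> \<Longrightarrow> y \<in> kbar \<iota> \<Longrightarrow> x + y \<in> kbar \<iota>"
  unfolding kbar_iff by (auto simp: alg_add simp flip: emb_add)
lemma kbar_mult: "x \<in> kbar \<iota> \<Longrightarrow> y \<in> kbar \<iota> \<Longrightarrow> x * y \<in> kbar \<iota>"
  unfolding kbar_iff by (auto simp: alg_mult simp flip: emb_mult)
lemma kbar_uminus: "x \<in> kbar \<iota> \<Longrightarrow> - x \<in> kbar \<iota>"
  unfolding kbar_iff by (auto simp: alg_uminus simp flip: emb_minus)
lemma kbar_inverse: "x \<in> kbar \<iota> \<Longrightarrow> inverse x \<in> kbar \<iota>"
  unfolding kbar_iff by (auto simp: alg_inverse simp flip: emb_inverse)

lemma subr_kbar: "subr (kbar \<iota>)" unfolding subr_def by (auto intro: kbar_add kbar_mult kbar_uminus)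

lemma kbar_root: "x \<in> kbar \<iota> \<Longrightarrow> \<exists>y \<in> kbar \<iota>. y ^ (q ^ n) = x"
proof -
  assume x: "x \<in> kbar \<iota>"
  then obtain z where z: "x = \<iota> z" by (auto simp: kbar_iff)
  have "q ^ n > 0" by simp
  then obtain y where y: "y \<in> range \<iota>" "y ^ (q ^ n) = x" using root_exists[of "q ^ n" z] z by blast
  moreover have "alg y" using x y alg_root[of y "q ^ n"] by (auto simp: kbar_iff)
  ultimately show ?thesis by (auto simp: kbar_iff)
qed

abbreviation Kt :: "'c poly set" where "Kt \<equiv> polys_over (kbar \<iota>)"

lemma subr_Kt: "subr Kt" by (rule subr_polys_over[OF subr_kbar])

lemmas Kt_0 [simp] = subrD(1)[OF subr_Kt] and Kt_1 [simp] = subrD(2)[OF subr_Kt]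
  and Kt_add = subrD(3)[OF subr_Kt] and Kt_mult = subrD(4)[OF subr_Kt]
  and Kt_uminus = subrD(5)[OF subr_Kt] and Kt_diff = subrD(6)[OF subr_Kt]
  and Kt_sum = subr_sum[OF subr_Kt] and Kt_power = subr_power[OF subr_Kt]

lemma Kt_coeff: "p \<in> Kt \<Longrightarrow> coeff p i \<in> kbar \<iota>" by (simp add: polys_over_def)

lemma Kt_pCons: "c \<in> kbar \<iota> \<Longrightarrow> p \<in> Kt \<Longrightarrow> pCons c p \<in> Kt"
  by (auto simp: polys_over_def coeff_pCons split: nat.split)

lemma Kt_smult: "c \<in> kbar \<iota> \<Longrightarrow> p \<in> Kt \<Longrightarrow> Polynomial.smult c p \<in> Kt"
  by (auto simp: polys_over_def kbar_mult)

lemma Kt_cst: "map_poly cst p \<in> Kt" by (auto simp: polys_over_def coeff_map_poly)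

lemma Kt_twp: "p \<in> Kt \<Longrightarrow> twp n p \<in> Kt"
  by (auto simp: polys_over_def intro: subr_power[OF subr_kbar])

lemma Kt_untwist: "p \<in> Kt \<Longrightarrow> \<exists>p'\<in>Kt. twp n p' = p"
proof -
  assume p: "p \<in> Kt"
  hence "\<forall>i. \<exists>y \<in> kbar \<iota>. y ^ (q ^ n) = coeff p i" using kbar_root by (auto simp: polys_over_def)
  then obtain f where f: "\<And>i. f i \<in> kbar \<iota>" "\<And>i. f i ^ (q ^ n) = coeff p i" by metis
  define p' where "p' = (\<Sum>i\<le>degree p. monom (f i) i)"
  have c: "coeff p' i = (if i \<le> degree p then f i else 0)" for i by (simp add: p'_def coeff_sum)
  have "p' \<in> Kt" using f(1) by (auto simp: polys_over_def c)
  moreover have "twp n p' = p" by (rule poly_eqI) (auto simp: c f(2) coeff_eq_0)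
  ultimately show ?thesis by blast
qed

subsection \<open>Orders\<close>

text \<open>\<open>order_base d e\<close>: the ring elements \<open>e 0, \<dots>, e (d - 1)\<close> form an \<open>\<bbbF>\<^sub>q[\<theta>]\<close>-basis of a module closed
  under multiplication.\<close>

definition acts :: "nat \<Rightarrow> (nat \<Rightarrow> 'c) \<Rightarrow> 'c \<Rightarrow> (nat \<Rightarrow> nat \<Rightarrow> 'f poly) \<Rightarrow> bool"
  where "acts d e x m \<longleftrightarrow> (\<forall>i<d. x * e i = (\<Sum>j<d. evA (m i j) * e j))"

definition order_base :: "nat \<Rightarrow> (nat \<Rightarrow> 'c) \<Rightarrow> bool"
  where "order_base d e \<longleftrightarrow> d > 0 \<and> (\<forall>a. (\<Sum>i<d. evA (a i) * e i) = 0 \<longrightarrow> (\<forall>i<d. a i = 0)) \<and>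
    (\<forall>k<d. \<exists>m. acts d e (e k) m)"

lemma common_multiple:
  assumes "finite I" "\<And>i. i \<in> I \<Longrightarrow> \<exists>a. a \<noteq> 0 \<and> P i a" "\<And>i a b. P i a \<Longrightarrow> P i (b * a)"
  shows "\<exists>a :: 'f poly. a \<noteq> 0 \<and> (\<forall>i\<in>I. P i a)" using assms(1,2)
proof (induction I rule: finite_induct)
  case (insert j I)
  obtain a b where "a \<noteq> 0" "\<forall>i\<in>I. P i a" "b \<noteq> 0" "P j b"
    using insert.IH insert.prems by (metis insertI1 insertI2)
  thus ?case using assms(3)[of _ a b] assms(3)[of j b a] by (intro exI[of _ "a * b"]) (auto simp: mult.commute)
qed (auto intro: exI[of _ 1])

text \<open>A maximal independent part E of a closed base is a k-basis of the algebra. Multiplying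
  it by a common denominator f of its structure constants makes it multiplicatively closed, since (f
  x)(f h) = f (f x h). The element 1 need not belong to the resulting lattice.\<close>

lemma order_exists:
  assumes "finite S" "\<And>x. x \<in> S \<Longrightarrow> x \<in> kbar \<iota>"
  shows "\<exists>d e a. order_base d e \<and> (\<forall>i<d. e i \<in> kbar \<iota>) \<and> a \<noteq> 0 \<and> (\<forall>x\<in>S. \<exists>m. acts d e (evA a * x) m)"
proof -
  have "\<exists>B. closed_base B \<and> S \<subseteq> kspan B \<and> B \<subseteq> kbar \<iota>"
  proof (rule closed_base_exists[OF assms(1)])
    show "alg x" if "x \<in> S" for x using assms(2)[OF that] kbar_iff by blast
    show "S \<subseteq> kbar \<iota>" using assms(2) by blast
  qed (auto intro: kbar_mult)
  then obtain B where B: "closed_base B" "S \<subseteq> kspan B" "B \<subseteq> kbar \<iota>" by blast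
  have fin: "finite B" "1 \<in> B" using B by (auto simp: closed_base_def)
  define indep where "indep E \<longleftrightarrow> (\<forall>a. (\<Sum>b\<in>E. evA (a b) * b) = 0 \<longrightarrow> (\<forall>b\<in>E. a b = 0))" for E
  have "\<exists>E. (E \<subseteq> B \<and> indep E) \<and> (\<forall>E'. E' \<subseteq> B \<and> indep E' \<longrightarrow> card E' \<le> card E)"
  proof (rule ex_has_greatest_nat)
    show "{} \<subseteq> B \<and> indep {}" by (simp add: indep_def)
    show "\<forall>E'. E' \<subseteq> B \<and> indep E' \<longrightarrow> card E' < Suc (card B)" using fin by (auto simp: less_Suc_eq_le intro: card_mono)
  qed
  then obtain E where E: "E \<subseteq> B" "indep E" "\<And>E'. E' \<subseteq> B \<Longrightarrow> indep E' \<Longrightarrow> card E' \<le> card E" by blast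
  have finE: "finite E" using E(1) fin(1) finite_subset by blast
  have BE: "b \<in> kspan E" if "b \<in> B" for b
  proof (cases "b \<in> E")
    case True
    thus ?thesis using finE by (intro kspan_base)
  next
    case False
    have "\<not> indep (insert b E)" using E(3)[of "insert b E"] E(1) that False finE by auto
    then obtain a where a: "(\<Sum>c\<in>insert b E. evA (a c) * c) = 0" "\<exists>c\<in>insert b E. a c \<noteq> 0" by (auto simp: indep_def)
    have "a b \<noteq> 0"
    proof
      assume "a b = 0"
      hence "(\<Sum>c\<in>E. evA (a c) * c) = 0" using a(1) False finE by simp
      hence "\<forall>c\<in>E. a c = 0" using E(2) by (auto simp: indep_def)
      thus False using a(2) \<open>a b = 0\<close> by auto
    qed
    have "evA (a b) * b = (\<Sum>c\<in>E. evA (- a c) * c)"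
      using a(1) False finE by (simp add: evA_minus sum_negf eq_neg_iff_add_eq_0)
    hence "evA (a b) * b \<in> Aspan E" unfolding Aspan_def by (intro CollectI exI[of _ "\<lambda>c. - a c"])
    thus ?thesis using \<open>a b \<noteq> 0\<close> by (auto simp: kspan_def)
  qed
  have prodE: "x * b \<in> kspan E" if "x \<in> kspan B" "b \<in> E" for x b
    using that E(1) closed_base_mult[OF B(1) that(1)] kspan_base[OF fin(1), of b] kspan_kspan[OF BE] by blast
  have "E \<subseteq> kspan B" using E(1) kspan_base[OF fin(1)] by blast
  hence "fst p * snd p \<in> kspan E" if "p \<in> (S \<union> E) \<times> E" for p
    using that B(2) by (intro prodE) auto
  hence "\<exists>a. a \<noteq> 0 \<and> evA a * (fst p * snd p) \<in> Aspan E" if "p \<in> (S \<union> E) \<times> E" for p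
    using that by (simp add: kspan_def)
  hence "\<exists>f. f \<noteq> 0 \<and> (\<forall>p\<in>(S \<union> E) \<times> E. evA f * (fst p * snd p) \<in> Aspan E)"
    using assms(1) finE by (intro common_multiple) (auto simp: evA_mult mult.assoc intro: Aspan_scale)
  then obtain f where f: "f \<noteq> 0" "\<And>x b. x \<in> S \<union> E \<Longrightarrow> b \<in> E \<Longrightarrow> evA f * (x * b) \<in> Aspan E" by auto
  define d where "d = card E"
  obtain h where h: "bij_betw h {..<d} E" using ex_bij_betw_nat_finite[OF finE] by (auto simp: d_def atLeast0LessThan)
  have hE: "h i \<in> E" if "i < d" for i using h that by (auto simp: bij_betw_def)
  have inj: "inj_on h {..<d}" using h by (simp add: bij_betw_def)
  have sumE: "(\<Sum>b\<in>E. g b) = (\<Sum>i<d. g (h i))" for g :: "'c \<Rightarrow> 'c"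
    by (rule sum.reindex_bij_betw[OF h, symmetric])
  define e where "e i = evA f * h i" for i
  have acts: "\<exists>m. acts d e (evA f * x) m" if x: "x \<in> S \<union> E" for x
  proof -
    have "\<exists>m. evA f * x * e i = (\<Sum>j<d. evA (m j) * e j)" if i: "i < d" for i
    proof -
      obtain g where "evA f * (x * h i) = (\<Sum>b\<in>E. evA (g b) * b)" using f(2)[OF x hE[OF i]] by (auto simp: Aspan_def)
      moreover have "evA f * x * e i = evA f * (evA f * (x * h i))" by (simp add: e_def mult_ac)
      ultimately have "evA f * x * e i = (\<Sum>j<d. evA (g (h j)) * e j)"
        by (simp add: sumE e_def sum_distrib_left mult_ac)
      thus ?thesis by (rule exI[of _ "\<lambda>j. g (h j)"])
    qed
    thus ?thesis unfolding acts_def by metis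
  qed
  have "order_base d e" unfolding order_base_def
  proof (intro conjI allI impI)
    show "d > 0"
    proof (rule ccontr)
      assume "\<not> d > 0"
      hence "1 \<in> kspan {}" using BE fin(2) finE by (auto simp: d_def)
      thus False by (auto simp: kspan_def Aspan_def)
    qed
    show "\<exists>m. acts d e (e k) m" if "k < d" for k using acts[of "h k"] hE[OF that] by (simp add: e_def)
    fix a i assume *: "(\<Sum>i<d. evA (a i) * e i) = 0" "i < d"
    have "evA f * (\<Sum>i<d. evA (a i) * h i) = 0" using *(1) by (simp add: e_def sum_distrib_left mult_ac)
    moreover have "(\<Sum>i<d. evA (a i) * h i) = (\<Sum>i<d. evA (a (the_inv_into {..<d} h (h i))) * h i)"
      using inj by (intro sum.cong) (auto simp: the_inv_into_f_f)
    ultimately have "(\<Sum>b\<in>E. evA (a (the_inv_into {..<d} h b)) * b) = 0" using f(1) unfolding sumE by simp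
    hence "a (the_inv_into {..<d} h (h i)) = 0"
      using E(2)[unfolded indep_def, THEN spec, of "\<lambda>b. a (the_inv_into {..<d} h b)"] hE[OF *(2)] by blast
    thus "a i = 0" using inj *(2) by (simp add: the_inv_into_f_f)
  qed
  moreover have "\<forall>i<d. e i \<in> kbar \<iota>"
    unfolding e_def using hE E(1) B(3) by (intro allI impI kbar_mult kbar_evA) auto
  ultimately show ?thesis using f(1) acts by (intro exI[of _ d] exI[of _ e] exI[of _ f]) auto
qed

subsection \<open>Sizes in an order\<close>

text \<open>Plays the role of a height: multiplication by x has a matrix with entries of degree at
  most H. Heights add under products, and sums keep the common bound.\<close>

definition sized :: "nat \<Rightarrow> (nat \<Rightarrow> 'c) \<Rightarrow> nat \<Rightarrow> 'c set"
  where "sized d e H = {x. \<exists>m. acts d e x m \<and> (\<forall>i<d. \<forall>j<d. degree (m i j) \<le> H)}"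

lemma sized_mono: "x \<in> sized d e H \<Longrightarrow> H \<le> H' \<Longrightarrow> x \<in> sized d e H'"
  unfolding sized_def by (auto intro: order_trans)

lemma sized_evA: "degree a \<le> H \<Longrightarrow> evA a \<in> sized d e H" unfolding sized_def acts_def
proof (intro CollectI exI[of _ "\<lambda>i j. if i = j then a else 0"] conjI allI impI)
  fix i assume "i < d"
  have "(\<Sum>j<d. evA (if i = j then a else 0) * e j) = (\<Sum>j<d. if i = j then evA a * e j else 0)"
    by (intro sum.cong) auto
  thus "evA a * e i = (\<Sum>j<d. evA (if i = j then a else 0) * e j)" using \<open>i < d\<close> by simp
qed auto

lemma sized_0 [simp]: "0 \<in> sized d e H" using sized_evA[of 0 H d e] by simp

lemma sized_add: assumes "x \<in> sized d e H" "y \<in> sized d e H" shows "x + y \<in> sized d e H"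
proof -
  obtain m where m: "acts d e x m" "\<And>i j. i < d \<Longrightarrow> j < d \<Longrightarrow> degree (m i j) \<le> H"
    using assms(1) by (auto simp: sized_def)
  obtain m' where m': "acts d e y m'" "\<And>i j. i < d \<Longrightarrow> j < d \<Longrightarrow> degree (m' i j) \<le> H"
    using assms(2) by (auto simp: sized_def)
  have "acts d e (x + y) (\<lambda>i j. m i j + m' i j)"
    using m(1) m'(1) unfolding acts_def by (simp add: evA_add distrib_right sum.distrib)
  thus ?thesis using m(2) m'(2) unfolding sized_def
    by (intro CollectI exI[of _ "\<lambda>i j. m i j + m' i j"] conjI allI impI degree_add_le) auto
qed

lemma sized_mult: assumes "x \<in> sized d e H" "y \<in> sized d e H'" shows "x * y \<in> sized d e (H + H')"
proof -
  obtain m where m: "acts d e x m" "\<And>i j. i < d \<Longrightarrow> j < d \<Longrightarrow> degree (m i j) \<le> H"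
    using assms(1) by (auto simp: sized_def)
  obtain m' where m': "acts d e y m'" "\<And>i j. i < d \<Longrightarrow> j < d \<Longrightarrow> degree (m' i j) \<le> H'"
    using assms(2) by (auto simp: sized_def)
  define M where "M i k = (\<Sum>j<d. m' i j * m j k)" for i k
  have "acts d e (x * y) M" unfolding acts_def
  proof (intro allI impI)
    fix i assume i: "i < d"
    have "x * y * e i = (\<Sum>j<d. evA (m' i j) * (x * e j))"
      using m'(1) i by (simp add: acts_def mult.assoc sum_distrib_left mult.left_commute)
    also have "\<dots> = (\<Sum>j<d. \<Sum>k<d. evA (m' i j * m j k) * e k)"
      using m(1) by (intro sum.cong) (simp_all add: acts_def sum_distrib_left evA_mult mult.assoc)
    also have "\<dots> = (\<Sum>k<d. evA (M i k) * e k)"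
      unfolding M_def by (subst sum.swap) (simp add: evA_sum sum_distrib_right)
    finally show "x * y * e i = (\<Sum>k<d. evA (M i k) * e k)" .
  qed
  moreover have "degree (M i k) \<le> H + H'" if "i < d" "k < d" for i k unfolding M_def
  proof (rule degree_sum_le)
    fix j assume "j \<in> {..<d}"
    thus "degree (m' i j * m j k) \<le> H + H'"
      using order_trans[OF degree_mult_le add_mono[OF m'(2) m(2)]] that by (simp add: add.commute)
  qed auto
  ultimately show ?thesis unfolding sized_def by blast
qed

lemma sized_uminus: "x \<in> sized d e H \<Longrightarrow> - x \<in> sized d e H"
  using sized_mult[OF sized_evA[of "- 1" 0]] by (simp add: evA_minus)

lemma sized_diff: "x \<in> sized d e H \<Longrightarrow> y \<in> sized d e H \<Longrightarrow> x - y \<in> sized d e H"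
  using sized_add[OF _ sized_uminus, of x d e H y] by simp

lemma sized_sum: "(\<And>i. i \<in> A \<Longrightarrow> f i \<in> sized d e H) \<Longrightarrow> sum f A \<in> sized d e H"
  by (induction A rule: infinite_finite_induct) (auto intro: sized_add)

lemma sized_1: "1 \<in> sized d e H" using sized_evA[of 1 H d e] by simp

lemma sized_power: "x \<in> sized d e H \<Longrightarrow> x ^ n \<in> sized d e (n * H)"
proof (induction n)
  case (Suc n)
  show ?case using sized_mult[OF Suc.prems Suc.IH[OF Suc.prems]] by simp
qed (auto intro: sized_1)

lemma sized_theta: "\<theta> \<in> sized d e 1" using sized_evA[of "[:0, 1:]" 1 d e] by simp

lemma order_max:
  assumes "order_base d e"
  shows "\<exists>k<d. e k \<noteq> 0 \<and> (\<forall>i<d. absv (e i) \<le> absv (e k))"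
proof -
  have d: "d > 0" using assms by (simp add: order_base_def)
  have fin: "finite ((\<lambda>i. absv (e i)) ` {..<d})" "(\<lambda>i. absv (e i)) ` {..<d} \<noteq> {}" using d by auto
  obtain k where k: "k < d" "absv (e k) = Max ((\<lambda>i. absv (e i)) ` {..<d})" using Max_in[OF fin] by auto
  have mx: "\<forall>i<d. absv (e i) \<le> absv (e k)" using fin k(2) by auto
  have "e k \<noteq> 0"
  proof
    assume "e k = 0"
    hence "\<forall>i<d. e i = 0" using mx by auto
    hence "(\<Sum>i<d. evA ((\<lambda>_. 1) i) * e i) = 0" by simp
    thus False
      using assms[unfolded order_base_def, THEN conjunct2, THEN conjunct1, THEN spec, of "\<lambda>_. 1"] d by auto
  qed
  thus ?thesis using k(1) mx by blast
qed

text \<open>Multiplies x with the largest base element, so that every entry of the corresponding row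
  is compared with the same size.\<close>

lemma absv_sized_le:
  assumes "order_base d e" "x \<in> sized d e H"
  shows "absv x \<le> real q ^ H"
proof -
  obtain k where k: "k < d" "e k \<noteq> 0" "\<And>i. i < d \<Longrightarrow> absv (e i) \<le> absv (e k)" using order_max[OF assms(1)] by blast
  obtain m where m: "acts d e x m" "\<And>i j. i < d \<Longrightarrow> j < d \<Longrightarrow> degree (m i j) \<le> H"
    using assms(2) by (auto simp: sized_def)
  have "absv x * absv (e k) = absv (\<Sum>j<d. evA (m k j) * e j)"
    using m(1) k(1) by (simp add: acts_def flip: absv_mult)
  also have "\<dots> \<le> real q ^ H * absv (e k)"
    using k m(2) by (intro absv_sum_le) (auto simp: absv_mult intro!: mult_mono absv_evA_le)
  finally show ?thesis using k(2) by (simp add: mult_le_cancel_right_pos)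
qed

text \<open>The determinant of the multiplication matrix is a nonzero polynomial, hence has size at
  least 1 at \<theta>. The adjugate exhibits its product with e_k as a multiple of x whose cofactor
  has size at most q^(H d) |e_k|.\<close>

lemma liouville:
  assumes "order_base d e" "x \<in> sized d e H" "x \<noteq> 0"
  shows "1 \<le> absv x * real q ^ (H * d)"
proof -
  obtain k where k: "k < d" "e k \<noteq> 0" "\<And>i. i < d \<Longrightarrow> absv (e i) \<le> absv (e k)" using order_max[OF assms(1)] by blast
  obtain m where m: "acts d e x m" "\<And>i j. i < d \<Longrightarrow> j < d \<Longrightarrow> degree (m i j) \<le> H"
    using assms(2) by (auto simp: sized_def)
  define M where "M = mat d d (\<lambda>(i, j). m i j)"
  have M: "M \<in> carrier_mat d d" by (simp add: M_def)
  \<comment> \<open>A vanishing combination of the rows would produce an element \<Sum> v_i e_i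
    annihilated by x \<noteq> 0, against the independence of e.\<close>
  have det0: "det M \<noteq> 0"
  proof
    assume "det M = 0"
    hence "det (transpose_mat M) = 0" using det_transpose[OF M] by simp
    then obtain v where v: "v \<in> carrier_vec d" "v \<noteq> 0\<^sub>v d" "transpose_mat M *\<^sub>v v = 0\<^sub>v d"
      using det_0_iff_vec_prod_zero[of "transpose_mat M" d] M by auto
    have col: "(\<Sum>i<d. m i j * v $ i) = 0" if "j < d" for j
    proof -
      have "(transpose_mat M *\<^sub>v v) $ j = (\<Sum>i<d. m i j * v $ i)"
        using that v(1) by (simp add: M_def scalar_prod_def atLeast0LessThan)
      thus ?thesis using v(3) that by simp
    qed
    have "x * (\<Sum>i<d. evA (v $ i) * e i) = (\<Sum>i<d. evA (v $ i) * (x * e i))"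
      by (simp add: sum_distrib_left mult.left_commute)
    also have "\<dots> = (\<Sum>i<d. \<Sum>j<d. evA (m i j * v $ i) * e j)"
      using m(1) by (intro sum.cong) (auto simp: acts_def sum_distrib_left evA_mult mult_ac)
    also have "\<dots> = (\<Sum>j<d. evA (\<Sum>i<d. m i j * v $ i) * e j)"
      by (subst sum.swap) (simp add: evA_sum sum_distrib_right)
    also have "\<dots> = 0" by (simp add: col)
    finally have "(\<Sum>i<d. evA (v $ i) * e i) = 0" using assms(3) by simp
    hence "\<forall>i<d. v $ i = 0" using assms(1) unfolding order_base_def by blast
    thus False using v(1,2) by auto
  qed
  define a where "a i j = adj_mat M $$ (i, j)" for i j
  have adjc: "adj_mat M \<in> carrier_mat d d" by (rule adj_mat(1)[OF M])
  have adeg: "degree (a i j) \<le> H * d" if "i < d" "j < d" for i j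
  proof -
    have "a i j = cofactor M j i" using that M by (simp add: a_def adj_mat_def)
    also have "\<dots> = (- 1) ^ (j + i) * det (mat_delete M j i)" by (simp add: cofactor_def)
    finally have "degree (a i j) \<le> degree (det (mat_delete M j i))" by (cases "even (j + i)") auto
    also have "\<dots> \<le> H * (d - 1)"
    proof (rule degree_det_le)
      show "mat_delete M j i \<in> carrier_mat (d - 1) (d - 1)" using M by (rule mat_delete_carrier)
      fix i' j' assume *: "i' < d - 1" "j' < d - 1"
      have "mat_delete M j i $$ (i', j') = m (if i' < j then i' else Suc i') (if j' < i then j' else Suc j')"
        using * M by (simp add: mat_delete_def M_def)
      thus "degree (mat_delete M j i $$ (i', j')) \<le> H" using * by (auto intro!: m(2))
    qed
    also have "\<dots> \<le> H * d" by simp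
    finally show ?thesis .
  qed
  have am: "(\<Sum>i<d. a k i * m i j) = (if k = j then det M else 0)" if "j < d" for j
  proof -
    have "(adj_mat M * M) $$ (k, j) = (\<Sum>i<d. a k i * m i j)"
      using that k(1) M adjc by (simp add: scalar_prod_def a_def M_def atLeast0LessThan)
    moreover have "(adj_mat M * M) $$ (k, j) = (det M \<cdot>\<^sub>m 1\<^sub>m d) $$ (k, j)" using adj_mat(3)[OF M] by simp
    moreover have "(det M \<cdot>\<^sub>m 1\<^sub>m d) $$ (k, j) = (if k = j then det M else 0)" using that k(1) by simp
    ultimately show ?thesis by simp
  qed
  have "evA (det M) * e k = (\<Sum>j<d. evA (if k = j then det M else 0) * e j)"
    using k(1) by (subst sum.mono_neutral_right[of "{..<d}" "{k}"]) auto
  also have "\<dots> = (\<Sum>j<d. evA (\<Sum>i<d. a k i * m i j) * e j)" by (intro sum.cong) (auto simp: am)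
  also have "\<dots> = (\<Sum>i<d. \<Sum>j<d. evA (a k i * m i j) * e j)"
    by (subst sum.swap) (simp add: evA_sum sum_distrib_right)
  also have "\<dots> = (\<Sum>i<d. evA (a k i) * (x * e i))"
    using m(1) by (intro sum.cong) (auto simp: acts_def sum_distrib_left evA_mult mult_ac)
  also have "\<dots> = x * (\<Sum>i<d. evA (a k i) * e i)" by (simp add: sum_distrib_left mult.left_commute)
  finally have eq: "evA (det M) * e k = x * (\<Sum>i<d. evA (a k i) * e i)" .
  have "1 * absv (e k) \<le> absv (evA (det M)) * absv (e k)"
    using absv_evA_ge_1[OF det0] by (intro mult_right_mono) auto
  also have "\<dots> = absv x * absv (\<Sum>i<d. evA (a k i) * e i)" using eq by (simp flip: absv_mult)
  also have "\<dots> \<le> absv x * (real q ^ (H * d) * absv (e k))"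
    using k adeg by (intro mult_left_mono absv_sum_le) (auto simp: absv_mult intro!: mult_mono absv_evA_le)
  finally show ?thesis using k(2) by (simp add: mult_le_cancel_right_pos mult.assoc[symmetric])
qed

subsection \<open>Counting and Siegel's lemma\<close>

lemma card_polys: "finite {p :: 'f poly. degree p \<le> H} \<and> card {p :: 'f poly. degree p \<le> H} = q ^ Suc H"
proof -
  have "bij_betw (\<lambda>p. restrict (coeff p) {..H}) {p :: 'f poly. degree p \<le> H} ({..H} \<rightarrow>\<^sub>E UNIV)"
  proof (rule bij_betwI[where g = "\<lambda>f. \<Sum>i\<le>H. monom (f i) i"])
    show "(\<lambda>f. \<Sum>i\<le>H. monom (f i) i) \<in> ({..H} \<rightarrow>\<^sub>E UNIV) \<rightarrow> {p :: 'f poly. degree p \<le> H}"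
      by (auto intro!: degree_sum_le order_trans[OF degree_monom_le])
    show "(\<Sum>i\<le>H. monom (restrict (coeff p) {..H} i) i) = p" if "p \<in> {p. degree p \<le> H}" for p :: "'f poly"
      using that by (intro poly_eqI) (auto simp: coeff_sum coeff_eq_0)
    show "restrict (coeff (\<Sum>i\<le>H. monom (f i) i)) {..H} = f" if "f \<in> {..H} \<rightarrow>\<^sub>E (UNIV :: 'f set)" for f
      using that by (intro ext) (auto simp: coeff_sum PiE_def extensional_def)
  qed auto
  hence "finite {p :: 'f poly. degree p \<le> H} \<longleftrightarrow> finite ({..H} \<rightarrow>\<^sub>E (UNIV :: 'f set))"
    "card {p :: 'f poly. degree p \<le> H} = card ({..H} \<rightarrow>\<^sub>E (UNIV :: 'f set))"
    by (auto simp: bij_betw_finite bij_betw_same_card)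
  thus ?thesis by (auto simp: card_PiE card_eq_q finite_PiE)
qed

text \<open>An element is determined by x * e k for a nonzero base element, thus by one row of its
  matrix.\<close>

lemma card_sized_le:
  assumes "order_base d e"
  shows "finite (sized d e H) \<and> card (sized d e H) \<le> (q ^ Suc H) ^ d"
proof -
  define PH where "PH = {p :: 'f poly. degree p \<le> H}"
  obtain k where k: "k < d" "e k \<noteq> 0" using order_max[OF assms] by blast
  have "\<forall>x\<in>sized d e H. \<exists>r. r \<in> {..<d} \<rightarrow>\<^sub>E PH \<and> x * e k = (\<Sum>j<d. evA (r j) * e j)"
  proof
    fix x assume "x \<in> sized d e H"
    then obtain m where m: "acts d e x m" "\<And>i j. i < d \<Longrightarrow> j < d \<Longrightarrow> degree (m i j) \<le> H"
      by (auto simp: sized_def)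
    show "\<exists>r. r \<in> {..<d} \<rightarrow>\<^sub>E PH \<and> x * e k = (\<Sum>j<d. evA (r j) * e j)"
      using m k(1) by (intro exI[of _ "restrict (m k) {..<d}"]) (auto simp: PH_def acts_def)
  qed
  then obtain r where r: "\<And>x. x \<in> sized d e H \<Longrightarrow> r x \<in> {..<d} \<rightarrow>\<^sub>E PH"
      "\<And>x. x \<in> sized d e H \<Longrightarrow> x * e k = (\<Sum>j<d. evA (r x j) * e j)" by metis
  have inj: "inj_on r (sized d e H)"
  proof (rule inj_onI)
    fix x y assume "x \<in> sized d e H" "y \<in> sized d e H" "r x = r y"
    hence "x * e k = y * e k" using r(2) by metis
    thus "x = y" using k(2) by simp
  qed
  have sub: "r ` sized d e H \<subseteq> {..<d} \<rightarrow>\<^sub>E PH" using r(1) by blast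
  have fin: "finite ({..<d} \<rightarrow>\<^sub>E PH)" using card_polys by (intro finite_PiE) (auto simp: PH_def)
  have "finite (sized d e H)" using inj sub fin by (meson finite_imageD finite_subset)
  moreover have "card (sized d e H) \<le> card ({..<d} \<rightarrow>\<^sub>E PH)"
    using card_inj_on_le[OF inj sub fin] .
  ultimately show ?thesis using card_polys[of H] by (simp add: card_PiE PH_def)
qed

lemma card_sized_ge:
  assumes "order_base d e" "\<And>i. i < d \<Longrightarrow> e i \<in> sized d e c"
  shows "(q ^ Suc H) ^ d \<le> card (sized d e (H + c))"
proof -
  define PH where "PH = {p :: 'f poly. degree p \<le> H}"
  define s where "s r = (\<Sum>j<d. evA (r j) * e j)" for r
  have inj: "inj_on s ({..<d} \<rightarrow>\<^sub>E PH)"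
  proof (rule inj_onI)
    fix r r' assume r: "r \<in> {..<d} \<rightarrow>\<^sub>E PH" "r' \<in> {..<d} \<rightarrow>\<^sub>E PH" "s r = s r'"
    have "(\<Sum>j<d. evA ((\<lambda>j. r j - r' j) j) * e j) = 0"
      using r(3) by (simp add: s_def evA_diff left_diff_distrib sum_subtractf)
    hence "\<forall>j<d. (\<lambda>j. r j - r' j) j = 0"
      using assms(1)[unfolded order_base_def, THEN conjunct2, THEN conjunct1, THEN spec, of "\<lambda>j. r j - r' j"] by blast
    hence "\<forall>j<d. r j = r' j" by simp
    thus "r = r'" using r(1,2) by (intro PiE_ext[of r "{..<d}" "\<lambda>_. PH" r']) auto
  qed
  have sub: "s ` ({..<d} \<rightarrow>\<^sub>E PH) \<subseteq> sized d e (H + c)"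
  proof safe
    fix r assume r: "r \<in> {..<d} \<rightarrow>\<^sub>E PH"
    show "s r \<in> sized d e (H + c)" unfolding s_def
    proof (rule sized_sum)
      fix j assume j: "j \<in> {..<d}"
      have "r j \<in> PH" using r j by auto
      thus "evA (r j) * e j \<in> sized d e (H + c)" using j assms(2)
        by (intro sized_mult sized_evA) (auto simp: PH_def)
    qed
  qed
  have "card ({..<d} \<rightarrow>\<^sub>E PH) \<le> card (sized d e (H + c))"
    using card_inj_on_le[OF inj sub] card_sized_le[OF assms(1)] by blast
  thus ?thesis using card_polys[of H] by (simp add: card_PiE PH_def)
qed

text \<open>Pigeonhole on exponents of q: the common factor d cancels, and c pays for the size of
  the base elements. The difference of two colliding vectors stays within the same size bound. The
  allowance \<open>h j\<close> varies with the equation because the powers of \<theta>^(q^j) grow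
  with j.\<close>

lemma siegel:
  fixes \<alpha> :: "'j \<Rightarrow> 'i \<Rightarrow> 'c"
  assumes "order_base d e" "\<And>i. i < d \<Longrightarrow> e i \<in> sized d e c"
    and "finite I" "finite J" "\<And>j i. j \<in> J \<Longrightarrow> i \<in> I \<Longrightarrow> \<alpha> j i \<in> sized d e (h j)"
    and count: "(\<Sum>j\<in>J. Suc (H + c + h j)) < Suc H * card I"
  shows "\<exists>x. (\<forall>i\<in>I. x i \<in> sized d e (H + c)) \<and> (\<exists>i\<in>I. x i \<noteq> 0) \<and> (\<forall>j\<in>J. (\<Sum>i\<in>I. \<alpha> j i * x i) = 0)"
proof -
  define U where "U = I \<rightarrow>\<^sub>E sized d e (H + c)"
  define W where "W = Pi\<^sub>E J (\<lambda>j. sized d e (h j + (H + c)))"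
  define \<phi> where "\<phi> x = (\<lambda>j\<in>J. \<Sum>i\<in>I. \<alpha> j i * x i)" for x
  have d: "d > 0" using assms(1) by (simp add: order_base_def)
  have finU: "finite U" unfolding U_def using assms(3) card_sized_le[OF assms(1)] by (intro finite_PiE) auto
  have finW: "finite W" unfolding W_def using assms(4) card_sized_le[OF assms(1)] by (intro finite_PiE) auto
  have sub: "\<phi> ` U \<subseteq> W"
  proof safe
    fix x assume x: "x \<in> U"
    have "(\<Sum>i\<in>I. \<alpha> j i * x i) \<in> sized d e (h j + (H + c))" if "j \<in> J" for j
    proof (rule sized_sum)
      fix i assume i: "i \<in> I"
      have "x i \<in> sized d e (H + c)" using x i by (auto simp: U_def)
      thus "\<alpha> j i * x i \<in> sized d e (h j + (H + c))" using assms(5)[OF that i] by (rule sized_mult[rotated])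
    qed
    thus "\<phi> x \<in> W" by (auto simp: \<phi>_def W_def)
  qed
  have "card W = (\<Prod>j\<in>J. card (sized d e (h j + (H + c))))" unfolding W_def using assms(4) by (rule card_PiE)
  also have "\<dots> \<le> (\<Prod>j\<in>J. (q ^ Suc (h j + (H + c))) ^ d)"
    using card_sized_le[OF assms(1)] by (intro prod_mono) auto
  also have "\<dots> = (q ^ (\<Sum>j\<in>J. Suc (H + c + h j))) ^ d"
    by (simp only: power_sum prod_power_distrib[symmetric]) (simp only: add_ac)
  also have "\<dots> < (q ^ (Suc H * card I)) ^ d"
    using count q_gt_1 d by (intro power_strict_mono power_strict_increasing) auto
  also have "\<dots> = ((q ^ Suc H) ^ d) ^ card I" by (simp only: power_mult[symmetric] mult_ac)
  also have "\<dots> \<le> card (sized d e (H + c)) ^ card I"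
    using card_sized_ge[OF assms(1,2)] by (intro power_mono) auto
  also have "\<dots> = card U" unfolding U_def using assms(3) by (simp add: card_PiE)
  finally have lt: "card W < card U" .
  have "\<not> inj_on \<phi> U"
  proof
    assume "inj_on \<phi> U"
    from card_inj_on_le[OF this sub finW] lt show False by simp
  qed
  then obtain x y where xy: "x \<in> U" "y \<in> U" "x \<noteq> y" "\<phi> x = \<phi> y" unfolding inj_on_def by blast
  define z where "z i = x i - y i" for i
  have "\<forall>i\<in>I. z i \<in> sized d e (H + c)" using xy(1,2) by (auto simp: z_def U_def intro!: sized_diff)
  moreover have "\<exists>i\<in>I. z i \<noteq> 0"
  proof (rule ccontr)
    assume "\<not> ?thesis"
    hence "\<forall>i\<in>I. x i = y i" by (simp add: z_def)
    hence "x = y" using xy(1,2) unfolding U_def by (intro PiE_ext[of x I _ y]) auto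
    thus False using xy(3) by simp
  qed
  moreover have "(\<Sum>i\<in>I. \<alpha> j i * z i) = 0" if "j \<in> J" for j
  proof -
    have "(\<Sum>i\<in>I. \<alpha> j i * x i) = (\<Sum>i\<in>I. \<alpha> j i * y i)"
      using fun_cong[OF xy(4), of j] that by (simp add: \<phi>_def)
    thus ?thesis by (simp add: z_def right_diff_distrib sum_subtractf)
  qed
  ultimately show ?thesis by blast
qed

lemma theta_root: "\<exists>x \<in> kbar \<iota>. x ^ (q ^ n) = \<theta>" by (rule kbar_root) simp

text \<open>p^(n) vanishes at \<theta> exactly when p vanishes at the q^n-th root of \<theta>, and
  these roots are pairwise distinct.\<close>

lemma finite_twp_zero:
  assumes "p \<noteq> 0" shows "finite {n. poly (twp n p) \<theta> = 0}"
proof -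
  obtain x where x: "\<And>n. x n ^ (q ^ n) = \<theta>" using theta_root by metis
  have inj: "inj x"
  proof (rule linorder_injI)
    fix m n :: nat assume "m < n"
    show "x m \<noteq> x n"
    proof
      assume eq: "x m = x n"
      have "\<theta> = (x m ^ (q ^ m)) ^ (q ^ (n - m))"
        using x[of n] \<open>m < n\<close> by (simp add: eq flip: power_mult power_add)
      hence "\<theta> = \<theta> ^ (q ^ (n - m))" by (simp add: x)
      from arg_cong[OF this, of absv] have "real q ^ 1 = real q ^ (q ^ (n - m))" by (simp add: absv_power absv_theta)
      moreover have "q ^ 0 < q ^ (n - m)" using q_gt_1 \<open>m < n\<close> by (intro power_strict_increasing) auto
      hence "real q ^ 1 < real q ^ (q ^ (n - m))" using q_gt_1 by (intro power_strict_increasing) auto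
      ultimately show False by simp
    qed
  qed
  have "poly (twp n p) \<theta> = poly p (x n) ^ (q ^ n)" for n using poly_twp[of n p "x n"] by (simp add: x)
  hence "x ` {n. poly (twp n p) \<theta> = 0} \<subseteq> {z. poly p z = 0}" by auto
  hence "finite (x ` {n. poly (twp n p) \<theta> = 0})" using poly_roots_finite[OF assms] finite_subset by blast
  thus ?thesis using finite_imageD inj by (metis inj_on_subset subset_UNIV)
qed

lemma Kt_poly: "p \<in> Kt \<Longrightarrow> x \<in> kbar \<iota> \<Longrightarrow> poly p x \<in> kbar \<iota>"
  unfolding poly_altdef by (intro subr_sum[OF subr_kbar] kbar_mult subr_power[OF subr_kbar] Kt_coeff)

lemma Kt_synthetic_div:
  assumes "p \<in> Kt" "x \<in> kbar \<iota>" shows "synthetic_div p x \<in> Kt" using assms(1)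
proof (induction p)
  case (pCons a p)
  have "p \<in> Kt" unfolding polys_over_def
  proof (intro CollectI allI)
    fix i show "coeff p i \<in> kbar \<iota>" using Kt_coeff[OF pCons.prems, of "Suc i"] by simp
  qed
  thus ?case using pCons.IH assms(2) by (auto intro!: Kt_pCons Kt_poly)
qed auto

lemma Kt_divide_root:
  assumes "p \<in> Kt" "x \<in> kbar \<iota>" "poly p x = 0"
  shows "\<exists>p'\<in>Kt. p = [:- x, 1:] * p'"
  using synthetic_div_correct'[of x p] assms Kt_synthetic_div[OF assms(1,2)]
  by (intro bexI[of _ "synthetic_div p x"]) auto

lemma fev_tw_poly_mult:
  "entire f \<Longrightarrow> fev (tw n (fps_of_poly p * f)) \<theta> = poly (twp n p) \<theta> * fev (tw n f) \<theta>"
  by (simp add: tw_mult efev_mult entire_tw fps_of_twp[symmetric])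

definition untw :: "'c poly \<Rightarrow> 'c poly" where "untw p = (SOME p'. p' \<in> Kt \<and> twp 1 p' = p)"

lemma untw: "p \<in> Kt \<Longrightarrow> untw p \<in> Kt" "p \<in> Kt \<Longrightarrow> twp 1 (untw p) = p"
  using someI_ex[of "\<lambda>p'. p' \<in> Kt \<and> twp 1 p' = p"] Kt_untwist[of p 1] by (auto simp: untw_def)

end

section \<open>Systems of Frobenius difference equations\<close>

text \<open>
  A vector \<open>\<psi>\<close> of entire functions, linearly independent over the polynomials with algebraic coefficients, with
  \<open>s\<^sub>0 \<psi> = A \<psi>\<^sup>(\<^sup>1\<^sup>)\<close> and a nontrivial relation \<open>P\<close> among the values of \<open>\<psi>\<^bsup>(n\<^sub>0)\<^esup>\<close> at \<open>\<theta>\<close>. Assumption \<open>ns\<close> says that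
  \<open>A\<^sup>(\<^sup>n\<^sup>)(\<theta>)\<close> is invertible for \<open>n \<ge> n\<^sub>0\<close>, which carries the relation to all later twists. The lemma
  \<open>abp_vanishing\<close> shows that no such data exist.
\<close>

locale abp_data = C_infinity \<iota>
  for \<iota> :: "'f::{finite,field} fls alg_closure \<Rightarrow> 'c::{nonarchimedean_field,complete_space}" +
  fixes l :: nat and \<psi> :: "nat \<Rightarrow> 'c fps" and s0 :: "'c poly" and A :: "nat \<Rightarrow> nat \<Rightarrow> 'c poly"
    and n0 :: nat and P :: "nat \<Rightarrow> 'c"
  assumes ent: "\<And>i. i < l \<Longrightarrow> entire (\<psi> i)"
    and ind: "\<And>p i. (\<And>i. i < l \<Longrightarrow> p i \<in> polys_over (kbar \<iota>)) \<Longrightarrow> (\<Sum>i<l. fps_of_poly (p i) * \<psi> i) = 0 \<Longrightarrow> i < l \<Longrightarrow> p i = 0"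
    and s0K: "s0 \<in> polys_over (kbar \<iota>)"
    and AK: "\<And>i j. i < l \<Longrightarrow> j < l \<Longrightarrow> A i j \<in> polys_over (kbar \<iota>)"
    and eq: "\<And>i. i < l \<Longrightarrow> fps_of_poly s0 * \<psi> i = (\<Sum>j<l. fps_of_poly (A i j) * tw 1 (\<psi> j))"
    and ns: "\<And>n v i. n \<ge> n0 \<Longrightarrow> (\<And>j. j < l \<Longrightarrow> (\<Sum>i<l. v i * poly (twp n (A i j)) (theta \<iota>)) = 0) \<Longrightarrow> i < l \<Longrightarrow> v i = 0"
    and PK: "\<And>i. i < l \<Longrightarrow> P i \<in> kbar \<iota>"
    and Pn: "\<exists>i<l. P i \<noteq> 0"
    and Pr: "(\<Sum>i<l. P i * fev (tw n0 (\<psi> i)) (theta \<iota>)) = 0"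
begin

text \<open>Carries the relation from level n0 + k to level n0 + k + 1 by substituting the twisted
  difference equation at \<theta>.\<close>

fun Q :: "nat \<Rightarrow> nat \<Rightarrow> 'c" where
  "Q 0 = P"
| "Q (Suc k) = (\<lambda>j. \<Sum>i<l. Q k i * poly (twp (n0 + k) (A i j)) \<theta>)"

lemma Q_nonzero: "\<exists>i<l. Q k i \<noteq> 0"
proof (induction k)
  case (Suc k)
  show ?case
  proof (rule ccontr)
    assume "\<not> ?thesis"
    hence "\<And>j. j < l \<Longrightarrow> (\<Sum>i<l. Q k i * poly (twp (n0 + k) (A i j)) \<theta>) = 0" by simp
    hence "\<And>i. i < l \<Longrightarrow> Q k i = 0" using ns[of "n0 + k" "Q k"] by simp
    thus False using Suc by blast
  qed
qed (use Pn in simp)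

lemma tw_eq:
  assumes "i < l"
  shows "poly (twp n s0) \<theta> * fev (tw n (\<psi> i)) \<theta> = (\<Sum>j<l. poly (twp n (A i j)) \<theta> * fev (tw (Suc n) (\<psi> j)) \<theta>)"
proof -
  have "poly (twp n s0) \<theta> * fev (tw n (\<psi> i)) \<theta> = fev (tw n (fps_of_poly s0 * \<psi> i)) \<theta>"
    using ent[OF assms] by (simp add: fev_tw_poly_mult)
  also have "\<dots> = fev (\<Sum>j<l. tw n (fps_of_poly (A i j) * tw 1 (\<psi> j))) \<theta>"
    using assms by (simp add: eq tw_sum)
  also have "\<dots> = (\<Sum>j<l. fev (tw n (fps_of_poly (A i j) * tw 1 (\<psi> j))) \<theta>)"
    using ent by (intro efev_sum) (auto intro!: entire_tw entire_mult)
  also have "\<dots> = (\<Sum>j<l. poly (twp n (A i j)) \<theta> * fev (tw (Suc n) (\<psi> j)) \<theta>)"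
    using ent by (intro sum.cong) (auto simp: fev_tw_poly_mult entire_tw tw_tw)
  finally show ?thesis .
qed

lemma Q_rel: "(\<Sum>i<l. Q k i * fev (tw (n0 + k) (\<psi> i)) \<theta>) = 0"
proof (induction k)
  case (Suc k)
  have "(\<Sum>i<l. Q (Suc k) i * fev (tw (n0 + Suc k) (\<psi> i)) \<theta>)
      = (\<Sum>j<l. \<Sum>i<l. Q k i * (poly (twp (n0 + k) (A i j)) \<theta> * fev (tw (Suc (n0 + k)) (\<psi> j)) \<theta>))"
    by (simp add: sum_distrib_right mult.assoc)
  also have "\<dots> = (\<Sum>i<l. Q k i * (\<Sum>j<l. poly (twp (n0 + k) (A i j)) \<theta> * fev (tw (Suc (n0 + k)) (\<psi> j)) \<theta>))"
    by (subst sum.swap) (simp add: sum_distrib_left)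
  also have "\<dots> = (\<Sum>i<l. Q k i * (poly (twp (n0 + k) s0) \<theta> * fev (tw (n0 + k) (\<psi> i)) \<theta>))"
    by (intro sum.cong) (auto simp: tw_eq)
  also have "\<dots> = poly (twp (n0 + k) s0) \<theta> * (\<Sum>i<l. Q k i * fev (tw (n0 + k) (\<psi> i)) \<theta>)"
    by (simp add: sum_distrib_left mult_ac)
  finally show ?case using Suc by simp
qed (use Pr in simp)

text \<open>The rows \<open>h\<^sub>k\<close> with \<open>h\<^sub>k\<^sub>+\<^sub>1\<^sup>(\<^sup>1\<^sup>) = h\<^sub>k A\<close> make \<open>\<chi>\<^sub>k = h\<^sub>k \<psi>\<close> satisfy \<open>\<chi>\<^sub>k\<^sub>+\<^sub>1\<^sup>(\<^sup>1\<^sup>) = s\<^sub>0 \<chi>\<^sub>k\<close>.\<close>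

fun hr :: "(nat \<Rightarrow> 'c poly) \<Rightarrow> nat \<Rightarrow> nat \<Rightarrow> 'c poly" where
  "hr h0 0 = h0"
| "hr h0 (Suc k) = (\<lambda>j. untw (\<Sum>i<l. hr h0 k i * A i j))"

definition chi :: "(nat \<Rightarrow> 'c poly) \<Rightarrow> nat \<Rightarrow> 'c fps"
  where "chi h0 k = (\<Sum>i<l. fps_of_poly (hr h0 k i) * \<psi> i)"

context
  fixes h0 :: "nat \<Rightarrow> 'c poly"
  assumes h0K: "\<And>i. i < l \<Longrightarrow> h0 i \<in> Kt"
begin

lemma hr_K: "i < l \<Longrightarrow> hr h0 k i \<in> Kt"
proof (induction k arbitrary: i)
  case (Suc k)
  thus ?case by (auto intro!: untw Kt_sum Kt_mult AK)
qed (use h0K in simp)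

lemma hr_Suc: "j < l \<Longrightarrow> twp 1 (hr h0 (Suc k) j) = (\<Sum>i<l. hr h0 k i * A i j)"
  unfolding hr.simps by (rule untw(2)) (auto intro!: Kt_sum Kt_mult AK hr_K)

lemma entire_chi: "entire (chi h0 k)" unfolding chi_def using ent by (auto intro!: entire_sum entire_mult)

lemma chi_Suc: "tw 1 (chi h0 (Suc k)) = fps_of_poly s0 * chi h0 k"
proof -
  have "tw 1 (chi h0 (Suc k)) = (\<Sum>j<l. fps_of_poly (twp 1 (hr h0 (Suc k) j)) * tw 1 (\<psi> j))"
    unfolding chi_def tw_sum tw_mult fps_of_twp ..
  also have "\<dots> = (\<Sum>j<l. \<Sum>i<l. fps_of_poly (hr h0 k i) * (fps_of_poly (A i j) * tw 1 (\<psi> j)))"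
    by (intro sum.cong refl, subst hr_Suc)
      (auto simp: fps_of_poly_sum fps_of_poly_mult sum_distrib_right mult.assoc)
  also have "\<dots> = (\<Sum>i<l. fps_of_poly (hr h0 k i) * (\<Sum>j<l. fps_of_poly (A i j) * tw 1 (\<psi> j)))"
    by (subst sum.swap) (simp add: sum_distrib_left)
  also have "\<dots> = (\<Sum>i<l. fps_of_poly (hr h0 k i) * (fps_of_poly s0 * \<psi> i))"
    by (intro sum.cong) (auto simp: eq)
  also have "\<dots> = fps_of_poly s0 * chi h0 k" by (simp add: chi_def sum_distrib_left mult_ac)
  finally show ?thesis .
qed

definition rel :: "nat \<Rightarrow> (nat \<Rightarrow> 'c poly) \<Rightarrow> bool"
  where "rel r c \<longleftrightarrow> (\<forall>k<r. c k \<in> Kt) \<and> (\<forall>i<l. (\<Sum>k<r. c k * hr h0 k i) = 0)"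

text \<open>\<open>ns\<close> only speaks about values of A^(n) at \<theta>. A polynomial row killed
  by A vanishes there for all n \<ge> n0, hence identically by
  \<open>finite_twp_zero\<close>.\<close>

lemma A_row_kernel:
  assumes "\<And>j. j < l \<Longrightarrow> (\<Sum>i<l. v i * A i j) = 0" "i < l"
  shows "v i = 0"
proof -
  have z: "poly (twp n (v i)) \<theta> = 0" if n: "n \<ge> n0" for n
  proof (rule ns[OF n _ assms(2), of "\<lambda>i. poly (twp n (v i)) \<theta>"])
    fix j assume "j < l"
    hence "poly (twp n (\<Sum>i<l. v i * A i j)) \<theta> = 0" using assms(1) by simp
    thus "(\<Sum>i<l. poly (twp n (v i)) \<theta> * poly (twp n (A i j)) \<theta>) = 0"
      by (simp add: twp_sum twp_mult poly_sum)
  qed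
  show ?thesis
  proof (rule ccontr)
    assume "v i \<noteq> 0"
    hence "finite {n. poly (twp n (v i)) \<theta> = 0}" by (rule finite_twp_zero)
    moreover have "{n0..} \<subseteq> {n. poly (twp n (v i)) \<theta> = 0}" using z by auto
    ultimately show False using finite_subset infinite_Ici by blast
  qed
qed

text \<open>A minimal dependence among \<open>h\<^sub>0, \<dots>, h\<^sub>r\<close> turns \<open>\<chi>\<^sub>0, \<dots>, \<chi>\<^sub>r\<^sub>-\<^sub>1\<close> into data with a companion matrix. The
  new relation comes from writing a multiple of some \<open>h\<^sub>k\<close> in terms of \<open>h\<^sub>0, \<dots>, h\<^sub>r\<^sub>-\<^sub>1\<close>; a multiplier of least
  degree ensures that its value at \<open>\<theta>\<close> is nontrivial.\<close>

lemma rank_reduction: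
  assumes n: "n \<ge> n0" "\<mu> \<noteq> 0" "\<And>i. i < l \<Longrightarrow> poly (twp n (h0 i)) \<theta> = \<mu> * Q (n - n0) i"
    and c: "rel (Suc r) c" "\<exists>k\<le>r. c k \<noteq> 0"
    and min: "\<And>c. rel r c \<Longrightarrow> \<forall>k<r. c k = 0"
  shows "\<exists>\<psi>' s0' A' n0' P'. abp_data \<iota> r \<psi>' s0' A' n0' P'"
proof -
  define h where "h = hr h0"
  have hK: "h k i \<in> Kt" if "i < l" for k i using hr_K that by (simp add: h_def)
  have hS: "twp 1 (h (Suc k) j) = (\<Sum>i<l. h k i * A i j)" if "j < l" for k j using hr_Suc that by (simp add: h_def)
  \<comment> \<open>The rows inherit the proportionality to the transported relation at every later
    level.\<close>
  have val: "poly (twp (n + k) (h k i)) \<theta> = \<mu> * Q (n - n0 + k) i" if "i < l" for k i using that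
  proof (induction k arbitrary: i)
    case 0
    thus ?case using n(3) by (simp add: h_def)
  next
    case (Suc k)
    have "twp (n + Suc k) (h (Suc k) i) = twp (n + k) (\<Sum>j<l. h k j * A j i)"
      using hS[OF Suc.prems, of k] twp_twp[of "n + k" 1 "h (Suc k) i"] by simp
    hence "poly (twp (n + Suc k) (h (Suc k) i)) \<theta> = (\<Sum>j<l. poly (twp (n + k) (h k j)) \<theta> * poly (twp (n + k) (A j i)) \<theta>)"
      by (simp add: twp_sum twp_mult poly_sum)
    also have "\<dots> = (\<Sum>j<l. \<mu> * Q (n - n0 + k) j * poly (twp (n + k) (A j i)) \<theta>)"
      using Suc.IH by (intro sum.cong) auto
    also have "\<dots> = \<mu> * Q (n - n0 + Suc k) i" using n(1) by (simp add: sum_distrib_left mult.assoc)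
    finally show ?case .
  qed
  have cK: "c k \<in> Kt" if "k \<le> r" for k using c(1) that by (auto simp: rel_def)
  have crel: "(\<Sum>k<Suc r. c k * h k i) = 0" if "i < l" for i using c(1) that by (auto simp: rel_def h_def)
  have cr: "c r \<noteq> 0"
  proof
    assume z: "c r = 0"
    hence "rel r c" using c(1) by (auto simp: rel_def)
    hence "\<forall>k<r. c k = 0" by (rule min)
    thus False using c(2) z by (metis le_neq_implies_less)
  qed
  have r0: "r > 0"
  proof (rule ccontr)
    assume "\<not> r > 0"
    hence "c 0 * h 0 i = 0" if "i < l" for i using crel[OF that] by simp
    hence "\<forall>i<l. h 0 i = 0" using cr \<open>\<not> r > 0\<close> by auto
    hence "\<forall>i<l. \<mu> * Q (n - n0) i = 0" using val[of _ 0] by simp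
    thus False using Q_nonzero[of "n - n0"] n(2) by auto
  qed
  \<comment> \<open>A relation starting at h_1 can be twisted and freed of A, which shifts it to
    h_0, ..., h_(r-1) and contradicts minimality.\<close>
  have c0: "c 0 \<noteq> 0"
  proof
    assume z: "c 0 = 0"
    have s: "(\<Sum>i<l. (\<Sum>k<r. twp 1 (c (Suc k)) * h k i) * A i j) = 0" if j: "j < l" for j
    proof -
      have "0 = twp 1 (\<Sum>k<Suc r. c k * h k j)" using crel[OF j] by simp
      also have "(\<Sum>k<Suc r. c k * h k j) = (\<Sum>k<r. c (Suc k) * h (Suc k) j)"
        by (subst sum.lessThan_Suc_shift) (simp add: z)
      also have "twp 1 \<dots> = (\<Sum>k<r. twp 1 (c (Suc k)) * (\<Sum>i<l. h k i * A i j))"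
        using j by (simp add: twp_sum twp_mult hS[unfolded One_nat_def])
      also have "\<dots> = (\<Sum>i<l. (\<Sum>k<r. twp 1 (c (Suc k)) * h k i) * A i j)"
        by (simp add: sum_distrib_left sum_distrib_right mult.assoc) (rule sum.swap)
      finally show ?thesis by simp
    qed
    have "rel r (\<lambda>k. twp 1 (c (Suc k)))"
      unfolding rel_def using A_row_kernel[OF s] cK by (auto intro!: Kt_twp simp: h_def)
    hence "\<forall>k<r. twp 1 (c (Suc k)) = 0" by (rule min)
    from this[rule_format, of "r - 1"] r0 have "twp 1 (c (Suc (r - 1))) = 0" by simp
    thus False using cr r0 by simp
  qed
  \<comment> \<open>Over the fraction field all rows stay in the span of h_0, ..., h_(r-1): the
    expression for h_k is shifted, and the h_r that then appears is eliminated by means of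
    c.\<close>
  have span: "\<exists>\<kappa> L. \<kappa> \<in> Kt \<and> \<kappa> \<noteq> 0 \<and> (\<forall>m<r. L m \<in> Kt) \<and> (\<forall>i<l. \<kappa> * h k i = (\<Sum>m<r. L m * h m i))" for k
  proof (induction k)
    case 0
    have "(\<Sum>m<r. (if m = 0 then 1 else 0) * h m i) = h 0 i" for i
      using r0 by (subst sum.mono_neutral_right[of _ "{0}"]) auto
    thus ?case by (intro exI[of _ 1] exI[of _ "\<lambda>m. if m = 0 then 1 else 0"]) auto
  next
    case (Suc k)
    then obtain \<kappa> L where \<kappa>: "\<kappa> \<in> Kt" "\<kappa> \<noteq> 0" "\<And>m. m < r \<Longrightarrow> L m \<in> Kt" "\<And>i. i < l \<Longrightarrow> \<kappa> * h k i = (\<Sum>m<r. L m * h m i)" by blast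
    have shift: "untw \<kappa> * h (Suc k) j = (\<Sum>m<r. untw (L m) * h (Suc m) j)" if j: "j < l" for j
    proof -
      have "twp 1 (untw \<kappa> * h (Suc k) j) = (\<Sum>i<l. (\<kappa> * h k i) * A i j)"
        using hS[OF j, of k] untw(2)[OF \<kappa>(1)] by (simp add: twp_mult sum_distrib_left mult.assoc)
      also have "\<dots> = (\<Sum>i<l. (\<Sum>m<r. L m * h m i) * A i j)" using \<kappa>(4) by (intro sum.cong) auto
      also have "\<dots> = (\<Sum>m<r. L m * (\<Sum>i<l. h m i * A i j))"
        by (simp add: sum_distrib_left sum_distrib_right mult.assoc) (rule sum.swap)
      also have "\<dots> = (\<Sum>m<r. twp 1 (untw (L m)) * twp 1 (h (Suc m) j))"
        using untw(2)[OF \<kappa>(3)] hS[OF j] by (intro sum.cong) auto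
      also have "\<dots> = twp 1 (\<Sum>m<r. untw (L m) * h (Suc m) j)" by (simp add: twp_sum twp_mult)
      finally show ?thesis by (simp only: twp_eq_iff)
    qed
    define L' where "L' m = (if m = 0 then 0 else c r * untw (L (m - 1))) - untw (L (r - 1)) * c m" for m
    have "c r * untw \<kappa> * h (Suc k) j = (\<Sum>m<r. L' m * h m j)" if j: "j < l" for j
    proof -
      obtain r' where r': "r = Suc r'" using r0 by (cases r) auto
      have last: "c r * h r j = - (\<Sum>m<r. c m * h m j)"
        using crel[OF j] by (simp add: eq_neg_iff_add_eq_0 add.commute)
      have "c r * untw \<kappa> * h (Suc k) j = c r * (\<Sum>m<r. untw (L m) * h (Suc m) j)"
        using shift[OF j] by (simp add: mult.assoc)
      also have "(\<Sum>m<r. untw (L m) * h (Suc m) j) = (\<Sum>m<r'. untw (L m) * h (Suc m) j) + untw (L r') * h r j"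
        by (simp add: r')
      also have "c r * \<dots> = (\<Sum>m<r'. c r * untw (L m) * h (Suc m) j) + untw (L r') * (c r * h r j)"
        by (simp add: distrib_left sum_distrib_left mult_ac)
      also have "(\<Sum>m<r'. c r * untw (L m) * h (Suc m) j) = (\<Sum>m<r. (if m = 0 then 0 else c r * untw (L (m - 1))) * h m j)"
        unfolding r' by (subst sum.lessThan_Suc_shift) simp
      also have "untw (L r') * (c r * h r j) = - (\<Sum>m<r. untw (L (r - 1)) * c m * h m j)"
        unfolding last mult_minus_right sum_distrib_left by (simp add: r' mult.assoc)
      finally show ?thesis by (simp add: L'_def left_diff_distrib sum_subtractf)
    qed
    moreover have "untw \<kappa> \<noteq> 0" using untw(2)[OF \<kappa>(1)] \<kappa>(2) by force
    moreover have "L' m \<in> Kt" if "m < r" for m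
      using that untw(1)[OF \<kappa>(3)] cK r0 by (auto simp: L'_def intro!: Kt_diff Kt_mult Kt_uminus)
    moreover have "c r * untw \<kappa> \<in> Kt" using cK untw(1)[OF \<kappa>(1)] by (intro Kt_mult) auto
    ultimately show ?case using cr by (intro exI[of _ "c r * untw \<kappa>"] exI[of _ L']) auto
  qed
  \<comment> \<open>From N on, the relevant twists of c_0 and c_r do not vanish at \<theta>; this
    makes the companion matrix invertible there.\<close>
  obtain N where N: "\<And>n. n \<ge> N \<Longrightarrow> poly (twp (Suc n) (c 0)) \<theta> \<noteq> 0 \<and> poly (twp (Suc n) (c r)) \<theta> \<noteq> 0"
  proof -
    have "finite ({n. poly (twp n (c 0)) \<theta> = 0} \<union> {n. poly (twp n (c r)) \<theta> = 0})"
      using finite_twp_zero c0 cr by blast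
    then obtain N where N: "\<forall>n \<in> {n. poly (twp n (c 0)) \<theta> = 0} \<union> {n. poly (twp n (c r)) \<theta> = 0}. n < N"
      using finite_nat_set_iff_bounded by blast
    have "poly (twp (Suc n) (c 0)) \<theta> \<noteq> 0 \<and> poly (twp (Suc n) (c r)) \<theta> \<noteq> 0" if "n \<ge> N" for n
      using N[THEN bspec, of "Suc n"] that by auto
    thus ?thesis by (rule that)
  qed
  define k where "k = N"
  define M where "M = n + k"
  define good where "good \<kappa> L \<longleftrightarrow> \<kappa> \<in> Kt \<and> \<kappa> \<noteq> 0 \<and> (\<forall>m<r. L m \<in> Kt) \<and> (\<forall>i<l. \<kappa> * h k i = (\<Sum>m<r. L m * h m i))" for \<kappa> L
  obtain \<kappa> L where good: "good \<kappa> L" and least: "\<And>\<kappa>' L'. good \<kappa>' L' \<Longrightarrow> degree \<kappa> \<le> degree \<kappa>'"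
  proof -
    have ex: "\<exists>x. good (fst x) (snd x)" using span[of k] by (auto simp: good_def)
    have "\<exists>x. good (fst x) (snd x) \<and> (\<forall>y. good (fst y) (snd y) \<longrightarrow> degree (fst x) \<le> degree (fst y))"
      using ex_has_least_nat[of "\<lambda>x. good (fst x) (snd x)" _ "\<lambda>x. degree (fst x)"] ex by blast
    then obtain x where x: "good (fst x) (snd x)" "\<And>y. good (fst y) (snd y) \<Longrightarrow> degree (fst x) \<le> degree (fst y)" by blast
    show ?thesis by (rule that[OF x(1)]) (use x(2)[of "(_, _)"] in simp)
  qed
  \<comment> \<open>If all L_m vanished there, so would the multiplier, because the value of h_k is
    a nonzero multiple of a nonzero relation. The common factor t - x, with x the q^M-th root of
    \<theta>, could then be cancelled, against the least degree.\<close>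
  have Lnz: "\<exists>m<r. poly (twp M (L m)) \<theta> \<noteq> 0"
  proof (rule ccontr)
    assume "\<not> ?thesis"
    hence z: "\<And>m. m < r \<Longrightarrow> poly (twp M (L m)) \<theta> = 0" by blast
    obtain x where x: "x \<in> kbar \<iota>" "x ^ (q ^ M) = \<theta>" using theta_root by blast
    have ev: "poly (twp M p) \<theta> = poly p x ^ (q ^ M)" for p using poly_twp[of M p x] x by simp
    obtain i where i: "i < l" "Q (n - n0 + k) i \<noteq> 0" using Q_nonzero by blast
    have "poly (twp M \<kappa>) \<theta> * poly (twp M (h k i)) \<theta> = poly (twp M (\<kappa> * h k i)) \<theta>" by (simp add: twp_mult)
    also have "\<dots> = poly (twp M (\<Sum>m<r. L m * h m i)) \<theta>" using good i(1) by (simp add: good_def)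
    also have "\<dots> = 0" using z by (simp add: twp_sum twp_mult poly_sum)
    finally have "poly (twp M \<kappa>) \<theta> = 0" using val[OF i(1), of k] i(2) n(2) by (simp add: M_def)
    hence "poly \<kappa> x = 0" unfolding ev by simp
    then obtain \<kappa>' where \<kappa>': "\<kappa>' \<in> Kt" "\<kappa> = [:- x, 1:] * \<kappa>'" using Kt_divide_root good x(1) unfolding good_def by blast
    have "\<forall>m. \<exists>p. m < r \<longrightarrow> p \<in> Kt \<and> L m = [:- x, 1:] * p"
    proof
      fix m
      show "\<exists>p. m < r \<longrightarrow> p \<in> Kt \<and> L m = [:- x, 1:] * p"
      proof (cases "m < r")
        case True
        hence "poly (L m) x = 0" using z[OF True] unfolding ev by simp
        thus ?thesis using Kt_divide_root[of "L m" x] good True x(1) unfolding good_def by blast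
      qed auto
    qed
    from choice[OF this] obtain L' where "\<forall>m. m < r \<longrightarrow> L' m \<in> Kt \<and> L m = [:- x, 1:] * L' m" ..
    hence L': "L' m \<in> Kt" "L m = [:- x, 1:] * L' m" if "m < r" for m using that by blast+
    have "\<kappa>' * h k i = (\<Sum>m<r. L' m * h m i)" if "i < l" for i
    proof -
      have "[:- x, 1:] * (\<kappa>' * h k i) = \<kappa> * h k i" by (simp only: \<kappa>'(2) mult.assoc)
      also have "\<dots> = (\<Sum>m<r. L m * h m i)" using good that by (simp add: good_def)
      also have "\<dots> = (\<Sum>m<r. [:- x, 1:] * (L' m * h m i))"
        by (intro sum.cong refl) (simp only: L'(2) lessThan_iff mult.assoc)
      also have "\<dots> = [:- x, 1:] * (\<Sum>m<r. L' m * h m i)" by (simp only: sum_distrib_left)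
      finally show ?thesis by (subst (asm) mult_cancel_left) auto
    qed
    moreover have "\<kappa>' \<noteq> 0" using \<kappa>'(2) good by (auto simp: good_def)
    ultimately have "good \<kappa>' L'" using \<kappa>'(1) L'(1) by (auto simp: good_def)
    hence "degree \<kappa> \<le> degree \<kappa>'" by (rule least)
    moreover have "degree \<kappa> = Suc (degree \<kappa>')"
      unfolding \<kappa>'(2) using \<open>\<kappa>' \<noteq> 0\<close> by (subst degree_mult_eq) auto
    ultimately show False by simp
  qed
  define \<chi> where "\<chi> = chi h0"
  have \<chi>: "\<chi> m = (\<Sum>i<l. fps_of_poly (h m i) * \<psi> i)" for m by (simp add: \<chi>_def chi_def h_def)
  have \<chi>ent: "entire (\<chi> m)" for m using entire_chi by (simp add: \<chi>_def)
  have comb: "(\<Sum>m<R. fps_of_poly (p m) * \<chi> m) = (\<Sum>i<l. fps_of_poly (\<Sum>m<R. p m * h m i) * \<psi> i)" for p R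
  proof -
    have "(\<Sum>m<R. fps_of_poly (p m) * \<chi> m) = (\<Sum>m<R. \<Sum>i<l. fps_of_poly (p m * h m i) * \<psi> i)"
      by (simp add: \<chi> sum_distrib_left fps_of_poly_mult mult.assoc)
    also have "\<dots> = (\<Sum>i<l. fps_of_poly (\<Sum>m<R. p m * h m i) * \<psi> i)"
      by (subst sum.swap) (simp add: fps_of_poly_sum sum_distrib_right)
    finally show ?thesis .
  qed
  \<comment> \<open>The companion matrix of the relation c, multiplied by the twist of c_r so that
    its entries are polynomials; s0 takes the same factor.\<close>
  define A' where "A' a b = (if Suc a < r then (if b = Suc a then twp 1 (c r) else 0) else - twp 1 (c b))" for a b
  have "abp_data \<iota> r \<chi> (twp 1 (c r) * s0) A' M (\<lambda>m. poly (twp M (L m)) \<theta>)"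
  proof (unfold_locales, goal_cases)
    case (1 i)
    show ?case by (rule \<chi>ent)
  next
    case (2 p i)
    have K: "(\<Sum>m<r. p m * h m i) \<in> Kt" if "i < l" for i using 2(1) hK[OF that] by (intro Kt_sum Kt_mult) auto
    have "(\<Sum>m<r. p m * h m i) = 0" if "i < l" for i
      by (rule ind[OF K _ that]) (use 2(2) in \<open>auto simp: comb\<close>)
    hence "rel r p" using 2(1) by (auto simp: rel_def h_def)
    thus ?case using min 2(3) by blast
  next
    case 3
    show ?case using cK[of r] by (intro Kt_mult Kt_twp s0K) auto
  next
    case (4 i j)
    show ?case using cK[of r] cK[of j] 4 unfolding A'_def by (auto intro!: Kt_twp Kt_uminus)
  next
    case (5 i)
    have base: "fps_of_poly (twp 1 (c r) * s0) * \<chi> i = fps_of_poly (twp 1 (c r)) * tw 1 (\<chi> (Suc i))"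
      using chi_Suc[of i] by (simp add: \<chi>_def fps_of_poly_mult mult.assoc)
    show ?case
    proof (cases "Suc i < r")
      case True
      have "(\<Sum>j<r. fps_of_poly (A' i j) * tw 1 (\<chi> j)) = (\<Sum>j<r. if j = Suc i then fps_of_poly (twp 1 (c r)) * tw 1 (\<chi> j) else 0)"
        using True by (intro sum.cong) (auto simp: A'_def)
      also have "\<dots> = fps_of_poly (twp 1 (c r)) * tw 1 (\<chi> (Suc i))" using True by simp
      finally show ?thesis using base by simp
    next
      case False
      hence ri: "Suc i = r" using 5 by simp
      have "(\<Sum>m<Suc r. fps_of_poly (c m) * \<chi> m) = 0" unfolding comb using crel by simp
      hence "tw 1 (\<Sum>m<Suc r. fps_of_poly (c m) * \<chi> m) = 0" by simp
      hence "(\<Sum>m<Suc r. fps_of_poly (twp 1 (c m)) * tw 1 (\<chi> m)) = 0" unfolding tw_sum tw_mult fps_of_twp .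
      hence "fps_of_poly (twp 1 (c r)) * tw 1 (\<chi> r) = - (\<Sum>m<r. fps_of_poly (twp 1 (c m)) * tw 1 (\<chi> m))"
        by (simp add: eq_neg_iff_add_eq_0 add.commute)
      also have "\<dots> = (\<Sum>j<r. fps_of_poly (A' i j) * tw 1 (\<chi> j))"
        using False by (simp add: A'_def sum_negf fps_of_poly_uminus)
      finally show ?thesis using base ri by simp
    qed
  next
    case (6 n' v i)
    have "n' \<ge> N" using 6(1) by (simp add: M_def k_def)
    hence nz: "poly (twp (Suc n') (c 0)) \<theta> \<noteq> 0" "poly (twp (Suc n') (c r)) \<theta> \<noteq> 0" using N by auto
    have row: "(\<Sum>a<r. v a * poly (twp n' (A' a b)) \<theta>)
        = (if b = 0 then 0 else v (b - 1) * poly (twp (Suc n') (c r)) \<theta>) - v (r - 1) * poly (twp (Suc n') (c b)) \<theta>" if b: "b < r" for b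
    proof -
      obtain r' where r': "r = Suc r'" using r0 by (cases r) auto
      have A1: "poly (twp n' (A' a b)) \<theta> = (if b = Suc a then poly (twp (Suc n') (c r)) \<theta> else 0)" if "a < r'" for a
        using that by (simp add: A'_def r' twp_twp)
      have A2: "poly (twp n' (A' r' b)) \<theta> = - poly (twp (Suc n') (c b)) \<theta>"
        by (simp add: A'_def r' twp_twp twp_uminus)
      have "(\<Sum>a<r. v a * poly (twp n' (A' a b)) \<theta>)
          = (\<Sum>a<r'. v a * (if b = Suc a then poly (twp (Suc n') (c r)) \<theta> else 0)) - v r' * poly (twp (Suc n') (c b)) \<theta>"
        using A1 A2 unfolding r' sum.lessThan_Suc by simp
      also have "(\<Sum>a<r'. v a * (if b = Suc a then poly (twp (Suc n') (c r)) \<theta> else 0))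
          = (if b = 0 then 0 else v (b - 1) * poly (twp (Suc n') (c r)) \<theta>)"
      proof (cases b)
        case (Suc b')
        have "(\<Sum>a<r'. v a * (if b = Suc a then poly (twp (Suc n') (c r)) \<theta> else 0))
            = (\<Sum>a<r'. if a = b' then v a * poly (twp (Suc n') (c r)) \<theta> else 0)"
          by (intro sum.cong) (auto simp: Suc)
        also have "\<dots> = v b' * poly (twp (Suc n') (c r)) \<theta>" using b by (simp add: Suc r')
        finally show ?thesis by (simp add: Suc)
      qed auto
      finally show ?thesis by (simp add: r')
    qed
    have "v (r - 1) * poly (twp (Suc n') (c 0)) \<theta> = 0" using 6(2)[OF r0] row[OF r0] by simp
    hence vl: "v (r - 1) = 0" using nz by simp
    show "v i = 0"
    proof (cases "Suc i < r")
      case True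
      have "v i * poly (twp (Suc n') (c r)) \<theta> = 0" using 6(2)[OF True] row[OF True] vl by simp
      thus ?thesis using nz by simp
    next
      case False
      hence "i = r - 1" using 6(3) by simp
      thus ?thesis using vl by simp
    qed
  next
    case (7 i)
    show ?case using good 7 unfolding good_def by (intro Kt_poly Kt_twp kbar_theta) auto
  next
    case 8
    show ?case by (rule Lnz)
  next
    case 9
    have "(\<Sum>m<r. poly (twp M (L m)) \<theta> * fev (tw M (\<chi> m)) \<theta>) = (\<Sum>m<r. fev (tw M (fps_of_poly (L m) * \<chi> m)) \<theta>)"
      by (simp add: fev_tw_poly_mult \<chi>ent)
    also have "\<dots> = fev (tw M (\<Sum>m<r. fps_of_poly (L m) * \<chi> m)) \<theta>"
      unfolding tw_sum by (rule efev_sum[symmetric]) (auto intro!: entire_tw entire_mult \<chi>ent)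
    also have "(\<Sum>m<r. fps_of_poly (L m) * \<chi> m) = (\<Sum>i<l. fps_of_poly (\<kappa> * h k i) * \<psi> i)"
      unfolding comb using good by (intro sum.cong) (auto simp: good_def)
    also have "\<dots> = (\<Sum>i<l. fps_of_poly \<kappa> * (fps_of_poly (h k i) * \<psi> i))" by (simp add: fps_of_poly_mult mult.assoc)
    also have "fev (tw M \<dots>) \<theta> = (\<Sum>i<l. fev (tw M (fps_of_poly \<kappa> * (fps_of_poly (h k i) * \<psi> i))) \<theta>)"
      unfolding tw_sum using ent by (intro efev_sum) (auto intro!: entire_tw entire_mult)
    also have "\<dots> = (\<Sum>i<l. poly (twp M \<kappa>) \<theta> * (poly (twp M (h k i)) \<theta> * fev (tw M (\<psi> i)) \<theta>))"
      using ent by (intro sum.cong) (auto simp: fev_tw_poly_mult entire_mult)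
    also have "\<dots> = (\<Sum>i<l. poly (twp M \<kappa>) \<theta> * \<mu> * (Q (n - n0 + k) i * fev (tw M (\<psi> i)) \<theta>))"
      by (intro sum.cong refl) (simp add: val M_def mult_ac)
    also have "\<dots> = poly (twp M \<kappa>) \<theta> * \<mu> * (\<Sum>i<l. Q (n - n0 + k) i * fev (tw M (\<psi> i)) \<theta>)" by (simp add: sum_distrib_left)
    also have "(\<Sum>i<l. Q (n - n0 + k) i * fev (tw M (\<psi> i)) \<theta>) = 0"
      using Q_rel[of "n - n0 + k"] n(1) by (simp add: M_def)
    finally show ?case by simp
  qed
  thus ?thesis by (intro exI)
qed

end

end

section \<open>Polynomials with coefficients of bounded size\<close>

context C_infinity
begin

definition psz :: "nat \<Rightarrow> (nat \<Rightarrow> 'c) \<Rightarrow> nat \<Rightarrow> 'c poly set"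
  where "psz d e H = {p. \<forall>i. coeff p i \<in> sized d e H}"

lemma psz_0 [simp]: "0 \<in> psz d e H" by (simp add: psz_def)
lemma psz_1: "1 \<in> psz d e H" by (auto simp: psz_def sized_1)
lemma psz_add: "x \<in> psz d e H \<Longrightarrow> y \<in> psz d e H \<Longrightarrow> x + y \<in> psz d e H"
  by (auto simp: psz_def sized_add)
lemma psz_uminus: "x \<in> psz d e H \<Longrightarrow> - x \<in> psz d e H" by (auto simp: psz_def sized_uminus)
lemma psz_mono: "x \<in> psz d e H \<Longrightarrow> H \<le> H' \<Longrightarrow> x \<in> psz d e H'"
  by (auto simp: psz_def intro: sized_mono)
lemma psz_sum: "(\<And>i. i \<in> I \<Longrightarrow> f i \<in> psz d e H) \<Longrightarrow> sum f I \<in> psz d e H"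
  by (induction I rule: infinite_finite_induct) (auto intro: psz_add)
lemma psz_mult: "x \<in> psz d e H \<Longrightarrow> y \<in> psz d e H' \<Longrightarrow> x * y \<in> psz d e (H + H')"
  by (auto simp: psz_def coeff_mult intro!: sized_sum sized_mult)
lemma psz_prod: "finite I \<Longrightarrow> (\<And>i. i \<in> I \<Longrightarrow> f i \<in> psz d e H) \<Longrightarrow> prod f I \<in> psz d e (card I * H)"
  by (induction I rule: finite_induct) (auto intro: psz_1 dest: psz_mult)
lemma psz_twp: "x \<in> psz d e H \<Longrightarrow> twp n x \<in> psz d e (q ^ n * H)"
  by (auto simp: psz_def intro: sized_power)

lemma psz_eval:
  assumes "p \<in> psz d e H" "x \<in> sized d e B" "degree p \<le> D"
  shows "poly p x \<in> sized d e (H + D * B)" unfolding poly_altdef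
proof (rule sized_sum)
  fix i assume "i \<in> {..degree p}"
  hence "H + i * B \<le> H + D * B" using assms(3) by simp
  moreover have "coeff p i * x ^ i \<in> sized d e (H + i * B)"
    using assms(1,2) by (intro sized_mult sized_power) (auto simp: psz_def)
  ultimately show "coeff p i * x ^ i \<in> sized d e (H + D * B)" by (rule sized_mono[rotated])
qed

lemma bnd_psz:
  assumes "order_base d e" "p \<in> psz d e H" shows "bnd 1 (fps_of_poly p) (real q ^ H)"
  unfolding bnd_def using assms absv_sized_le by (auto simp: psz_def)

lemma psz_det:
  assumes "M \<in> carrier_mat n n" "\<And>i j. i < n \<Longrightarrow> j < n \<Longrightarrow> M $$ (i, j) \<in> psz d e H"
  shows "det M \<in> psz d e (n * H)" unfolding det_def'[OF assms(1)]
proof (rule psz_sum)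
  fix p assume "p \<in> {p. p permutes {0..<n}}"
  hence p: "p permutes {0..<n}" by simp
  have "(\<Prod>i = 0..<n. M $$ (i, p i)) \<in> psz d e (card {0..<n} * H)"
    using p assms(2) permutes_in_image[OF p] by (intro psz_prod) auto
  moreover have "signof p = 1 \<or> signof p = (- 1 :: 'c poly)" by (simp add: sign_def)
  ultimately show "signof p * (\<Prod>i = 0..<n. M $$ (i, p i)) \<in> psz d e (n * H)" by (auto intro: psz_uminus)
qed

end

text \<open>The data after multiplication by a common denominator (done in
  \<open>abp_vanishing\<close>): A and P lie in one order and obey a common size bound C.\<close>

locale abp_sized = abp_data \<iota> l \<psi> s0 A n0 P
  for \<iota> :: "'f::{finite,field} fls alg_closure \<Rightarrow> 'c::{nonarchimedean_field,complete_space}"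
    and l \<psi> s0 A n0 P +
  fixes d :: nat and e :: "nat \<Rightarrow> 'c" and C :: nat
  assumes order: "order_base d e"
    and eK: "\<And>i. i < d \<Longrightarrow> e i \<in> kbar \<iota>"
    and eC: "\<And>i. i < d \<Longrightarrow> e i \<in> sized d e C"
    and AC: "\<And>i j. i < l \<Longrightarrow> j < l \<Longrightarrow> A i j \<in> psz d e C"
    and PC: "\<And>i. i < l \<Longrightarrow> P i \<in> sized d e C"
begin

lemma l_pos: "l > 0" using Pn by auto

lemma Q_size: "\<exists>K. \<forall>k i. i < l \<longrightarrow> Q k i \<in> sized d e (K * q ^ (n0 + k))"
proof -
  obtain \<delta> where \<delta>: "\<And>i j. i < l \<Longrightarrow> j < l \<Longrightarrow> degree (A i j) \<le> \<delta>"
  proof -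
    have "finite ((\<lambda>(i, j). degree (A i j)) ` ({..<l} \<times> {..<l}))" by simp
    then obtain \<delta> where \<delta>: "\<forall>x \<in> (\<lambda>(i, j). degree (A i j)) ` ({..<l} \<times> {..<l}). x \<le> \<delta>"
      using finite_nat_set_iff_bounded_le by blast
    show ?thesis by (rule that[of \<delta>], rule \<delta>[THEN bspec]) auto
  qed
  define K where "K = C + \<delta>"
  have "\<forall>i<l. Q k i \<in> sized d e (K * q ^ (n0 + k))" for k
  proof (induction k)
    case 0
    have "C \<le> K * q ^ (n0 + 0)" using mult_le_mono[of C K 1 "q ^ (n0 + 0)"] by (simp add: K_def)
    thus ?case using PC by (auto intro: sized_mono)
  next
    case (Suc k)
    show ?case
    proof (intro allI impI)
      fix j assume j: "j < l"
      have "Q k i * poly (twp (n0 + k) (A i j)) \<theta> \<in> sized d e (K * q ^ (n0 + Suc k))" if i: "i < l" for i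
      proof -
        have "poly (twp (n0 + k) (A i j)) \<theta> \<in> sized d e (q ^ (n0 + k) * C + \<delta> * 1)"
          using \<delta>[OF i j] by (intro psz_eval psz_twp AC i j sized_theta) simp
        hence "Q k i * poly (twp (n0 + k) (A i j)) \<theta> \<in> sized d e (K * q ^ (n0 + k) + (q ^ (n0 + k) * C + \<delta> * 1))"
          using Suc i by (intro sized_mult) auto
        \<comment> \<open>A twist multiplies sizes by q, and the new factor costs no more than the
          bound already accumulated; 2 \<le> q leaves room for both.\<close>
        moreover have "K * q ^ (n0 + k) + (q ^ (n0 + k) * C + \<delta> * 1) \<le> K * q ^ (n0 + Suc k)"
        proof -
          have "\<delta> * 1 \<le> \<delta> * q ^ (n0 + k)" by (intro mult_le_mono) auto
          hence "q ^ (n0 + k) * C + \<delta> * 1 \<le> K * q ^ (n0 + k)" by (simp add: K_def algebra_simps)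
          hence "K * q ^ (n0 + k) + (q ^ (n0 + k) * C + \<delta> * 1) \<le> 2 * (K * q ^ (n0 + k))" by simp
          also have "\<dots> \<le> q * (K * q ^ (n0 + k))" using q_ge_2 by (intro mult_le_mono) auto
          finally show ?thesis by (simp add: mult_ac)
        qed
        ultimately show ?thesis by (rule sized_mono)
      qed
      thus "Q (Suc k) j \<in> sized d e (K * q ^ (n0 + Suc k))" by (auto intro!: sized_sum)
    qed
  qed
  thus ?thesis by blast
qed

lemma geometric_sum_le: "(\<Sum>j<N. q ^ j) \<le> q ^ N"
proof (induction N)
  case (Suc N)
  have "(\<Sum>j<Suc N. q ^ j) \<le> 2 * q ^ N" using Suc by simp
  also have "\<dots> \<le> q * q ^ N" using q_ge_2 by (intro mult_le_mono) auto
  finally show ?case by simp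
qed auto

lemma sized_kbar: assumes "x \<in> sized d e H" shows "x \<in> kbar \<iota>"
proof -
  obtain k where k: "k < d" "e k \<noteq> 0" using order_max[OF order] by blast
  obtain m where "acts d e x m" using assms by (auto simp: sized_def)
  hence "x * e k = (\<Sum>j<d. evA (m k j) * e j)" using k(1) by (simp add: acts_def)
  hence "x = (\<Sum>j<d. evA (m k j) * e j) * inverse (e k)" using k(2) by (simp add: field_simps)
  also have "\<dots> \<in> kbar \<iota>"
    using k(1) eK by (intro kbar_mult kbar_inverse subr_sum[OF subr_kbar] kbar_evA) auto
  finally show ?thesis .
qed

lemma psz_Kt: "p \<in> psz d e H \<Longrightarrow> p \<in> Kt" using sized_kbar by (auto simp: psz_def polys_over_def)

text \<open>There are 2 l T points and l polynomials with D = (2 l - 1) T coefficients each. The (l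
  - 1) 2 l T conditions leave a surplus of l T unknowns, and D is small enough that a nonzero g_i
  cannot vanish at all points.\<close>

definition aux_row :: "nat \<Rightarrow> nat \<Rightarrow> (nat \<Rightarrow> 'c poly) \<Rightarrow> bool"
  where "aux_row h1 T g \<longleftrightarrow> (\<forall>i<l. g i \<in> psz d e (h1 * q ^ (2 * l * T + n0))) \<and>
     (\<forall>i<l. \<forall>m\<ge>(2 * l - 1) * T. coeff (g i) m = 0) \<and> (\<exists>i<l. g i \<noteq> 0) \<and>
     (\<forall>j<2 * l * T. \<exists>\<mu>. \<forall>i<l. poly (g i) (\<theta> ^ (q ^ j)) = \<mu> * Q (2 * l * T - j) i ^ (q ^ j))"

definition small_row :: "nat \<Rightarrow> real \<Rightarrow> nat \<Rightarrow> (nat \<Rightarrow> 'c poly) \<Rightarrow> bool"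
  where "small_row h1 K1 T h0 \<longleftrightarrow> (\<forall>i<l. h0 i \<in> Kt \<and> twp (2 * l * T + n0) (h0 i) \<in> psz d e (h1 * q ^ (2 * l * T + n0))) \<and>
     bnd 1 (chi h0 0) (K1 / real q ^ T) \<and>
     (\<exists>n \<mu>. n0 \<le> n \<and> \<mu> \<noteq> 0 \<and> (\<forall>i<l. poly (twp n (h0 i)) \<theta> = \<mu> * Q (n - n0) i))"

text \<open>Siegel's lemma, applied to the condition that the vector of values at \<open>\<theta>\<^bsup>q^j\<^esup>\<close> be proportional to the
  relation vector \<open>Q\<close>, raised to the power \<open>q\<^sup>j\<close>: there are \<open>l - 1\<close> equations for each \<open>j\<close>.\<close>

lemma auxiliary_polys:
  "\<exists>h1. \<forall>T\<ge>1. \<exists>g. aux_row h1 T g"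
proof -
  obtain K where K: "\<And>k i. i < l \<Longrightarrow> Q k i \<in> sized d e (K * q ^ (n0 + k))" using Q_size by blast
  \<comment> \<open>Makes H = h0 q^V exceed 2 l (C + K + 1) q^V, which is what the sizes of the
    equations demand from the surplus of l T unknowns.\<close>
  define h0 where "h0 = 2 * l * (C + K + 3)"
  have "\<exists>g. aux_row (h0 + C) T g"
    if T: "T \<ge> 1" for T
  proof -
    define N D where "N = 2 * l * T" and "D = (2 * l - 1) * T"
    define V where "V = N + n0"
    define H where "H = h0 * q ^ V"
    define Qj where "Qj j i = Q (N - j) i ^ (q ^ j)" for j i
    have "\<forall>j. \<exists>i. i < l \<and> Q (N - j) i \<noteq> 0" using Q_nonzero by blast
    from choice[OF this] obtain pv where pv: "\<And>j. pv j < l" "\<And>j. Q (N - j) (pv j) \<noteq> 0" by blast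
    \<comment> \<open>The proportionality in cross-multiplied form, with the nonzero entry
      \<open>pv j\<close> of the relation as pivot.\<close>
    define \<beta> where "\<beta> j i' i = (if i = i' then Qj j (pv j) else if i = pv j then - Qj j i' else 0)" for j i' i
    define \<alpha> where "\<alpha> ji im = (case ji of (j, i') \<Rightarrow> case im of (i, m) \<Rightarrow> \<beta> j i' i * \<theta> ^ (q ^ j * m))"
      for ji :: "nat \<times> nat" and im :: "nat \<times> nat"
    define hh where "hh ji = (case ji of (j, i') \<Rightarrow> K * q ^ V + q ^ j * D)" for ji :: "nat \<times> nat"
    define I where "I = {..<l} \<times> {..<D}"
    define J where "J = (SIGMA j:{..<N}. {..<l} - {pv j})"
    have Qs: "Qj j i \<in> sized d e (K * q ^ V)" if "i < l" "j < N" for i j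
    proof -
      have "Qj j i \<in> sized d e (q ^ j * (K * q ^ (n0 + (N - j))))"
        unfolding Qj_def by (rule sized_power[OF K[OF that(1)]])
      moreover have "q ^ j * (K * q ^ (n0 + (N - j))) = K * q ^ (j + (n0 + (N - j)))" by (simp add: power_add)
      moreover have "j + (n0 + (N - j)) = V" using that by (simp add: V_def)
      ultimately show ?thesis by simp
    qed
    have \<alpha>s: "\<alpha> ji im \<in> sized d e (hh ji)" if J: "ji \<in> J" and I: "im \<in> I" for ji im
    proof -
      obtain j i' where ji: "ji = (j, i')" "j < N" "i' < l" using J by (auto simp: J_def)
      obtain i m where im: "im = (i, m)" "i < l" "m < D" using I by (auto simp: I_def)
      have "\<beta> j i' i \<in> sized d e (K * q ^ V)"
        using Qs ji im pv(1) by (auto simp: \<beta>_def intro: sized_uminus)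
      moreover have "\<theta> ^ (q ^ j * m) \<in> sized d e (q ^ j * D)"
        by (rule sized_mono[OF sized_power[OF sized_theta]]) (use im in simp)
      ultimately show ?thesis by (simp add: \<alpha>_def hh_def ji im sized_mult)
    qed
    have fin: "finite I" "finite J" by (auto simp: I_def J_def)
    have count: "(\<Sum>ji\<in>J. Suc (H + C + hh ji)) < Suc H * card I"
    proof -
      obtain l' where l': "l = Suc l'" using l_pos by (cases l) auto
      have card: "card ({..<l} - {pv j}) = l'" for j using pv(1)[of j] by (simp add: l')
      have "(\<Sum>ji\<in>J. Suc (H + C + hh ji)) = (\<Sum>j<N. \<Sum>i'\<in>{..<l} - {pv j}. Suc (H + C + (K * q ^ V + q ^ j * D)))"
        unfolding J_def by (subst sum.Sigma) (auto simp: hh_def intro!: sum.cong)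
      also have "\<dots> = (\<Sum>j<N. l' * (Suc H + (C + K * q ^ V)) + l' * D * q ^ j)"
        by (simp only: sum_constant card) (simp add: algebra_simps)
      also have "\<dots> = l' * (N * Suc H) + l' * (N * (C + K * q ^ V) + D * (\<Sum>j<N. q ^ j))"
        by (simp add: sum.distrib sum_distrib_left algebra_simps)
      also have "\<dots> < l' * (N * Suc H) + l * T * Suc H"
      proof -
        have one: "1 \<le> q ^ V" by simp
        have "C + K * q ^ V \<le> (C + K) * q ^ V" using one by (simp add: add_mult_distrib)
        hence 1: "N * (C + K * q ^ V) \<le> 2 * l * T * ((C + K) * q ^ V)" unfolding N_def by (rule mult_le_mono2)
        have "(\<Sum>j<N. q ^ j) \<le> q ^ V"
          using geometric_sum_le[of N] by (rule order_trans) (use q_gt_1 in \<open>simp add: V_def power_increasing\<close>)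
        moreover have "D \<le> 2 * l * T" unfolding D_def by (intro mult_le_mono) auto
        ultimately have 2: "D * (\<Sum>j<N. q ^ j) \<le> 2 * l * T * q ^ V" by (intro mult_le_mono)
        have "l' * (N * (C + K * q ^ V) + D * (\<Sum>j<N. q ^ j)) \<le> l * (2 * l * T * ((C + K) * q ^ V) + 2 * l * T * q ^ V)"
          using l' by (intro mult_le_mono add_mono[OF 1 2]) simp
        also have "\<dots> = l * T * (2 * l * (C + K + 1) * q ^ V)" by (simp add: algebra_simps)
        also have "\<dots> < l * T * Suc H"
        proof -
          have "2 * l * (C + K + 1) * q ^ V \<le> H" unfolding H_def h0_def by (intro mult_le_mono) auto
          hence "2 * l * (C + K + 1) * q ^ V < Suc H" by simp
          moreover have "0 < l * T" using l_pos T by simp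
          ultimately show ?thesis by (simp only: mult_less_cancel1 nat_mult_less_cancel1)
        qed
        finally show ?thesis by simp
      qed
      also have "\<dots> = Suc H * card I"
      proof -
        have "card I = l * ((2 * l - 1) * T)" by (simp add: I_def D_def)
        moreover have "l' * N + l * T = l * ((2 * l - 1) * T)" by (simp add: N_def l' algebra_simps)
        ultimately have "card I = l' * N + l * T" by simp
        thus ?thesis by (simp only: algebra_simps)
      qed
      finally show ?thesis .
    qed
    obtain x where x: "\<And>i. i \<in> I \<Longrightarrow> x i \<in> sized d e (H + C)" "\<exists>i\<in>I. x i \<noteq> 0"
      "\<And>ji. ji \<in> J \<Longrightarrow> (\<Sum>i\<in>I. \<alpha> ji i * x i) = 0"
      using siegel[of d e C I J \<alpha> hh H] order eC fin \<alpha>s count by blast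
    define g where "g i = (\<Sum>m<D. monom (x (i, m)) m)" for i
    have coeff: "coeff (g i) m = (if m < D then x (i, m) else 0)" for i m
      by (simp add: g_def coeff_sum sum.delta coeff_monom)
    have HC: "H + C \<le> (h0 + C) * q ^ V" by (simp add: H_def add_mult_distrib)
    have g1: "g i \<in> psz d e ((h0 + C) * q ^ V)" if "i < l" for i
      using that sized_mono[OF x(1) HC] by (auto simp: psz_def coeff I_def)
    have g2: "\<exists>i<l. g i \<noteq> 0"
    proof -
      obtain i m where "i < l" "m < D" "x (i, m) \<noteq> 0" using x(2) by (auto simp: I_def)
      moreover from this have "coeff (g i) m \<noteq> 0" by (simp add: coeff)
      ultimately show ?thesis by force
    qed
    have g3: "\<exists>\<mu>. \<forall>i<l. poly (g i) (\<theta> ^ (q ^ j)) = \<mu> * Qj j i" if j: "j < N" for j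
    proof -
      have nz: "Qj j (pv j) \<noteq> 0" using pv by (simp add: Qj_def)
      have ev: "poly (g i) (\<theta> ^ (q ^ j)) = (\<Sum>m<D. x (i, m) * \<theta> ^ (q ^ j * m))" for i
        by (simp add: g_def poly_sum poly_monom power_mult)
      have "Qj j (pv j) * poly (g i') (\<theta> ^ (q ^ j)) = Qj j i' * poly (g (pv j)) (\<theta> ^ (q ^ j))" if i': "i' < l" for i'
      proof (cases "i' = pv j")
        case False
        hence "(j, i') \<in> J" using i' j by (simp add: J_def)
        hence "0 = (\<Sum>im\<in>I. \<alpha> (j, i') im * x im)" by (simp add: x(3))
        also have "\<dots> = (\<Sum>i<l. \<Sum>m<D. \<beta> j i' i * \<theta> ^ (q ^ j * m) * x (i, m))"
          unfolding I_def by (subst sum.cartesian_product) (auto simp: \<alpha>_def intro!: sum.cong)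
        also have "\<dots> = (\<Sum>i<l. \<beta> j i' i * poly (g i) (\<theta> ^ (q ^ j)))"
          by (simp add: ev sum_distrib_left mult_ac)
        also have "\<dots> = (\<Sum>i\<in>{i', pv j}. \<beta> j i' i * poly (g i) (\<theta> ^ (q ^ j)))"
          using i' pv(1) by (intro sum.mono_neutral_right) (auto simp: \<beta>_def)
        also have "\<dots> = Qj j (pv j) * poly (g i') (\<theta> ^ (q ^ j)) - Qj j i' * poly (g (pv j)) (\<theta> ^ (q ^ j))"
          using False by (simp add: \<beta>_def)
        finally show ?thesis by simp
      qed simp
      thus ?thesis using nz
        by (intro exI[of _ "poly (g (pv j)) (\<theta> ^ (q ^ j)) / Qj j (pv j)"]) (simp add: field_simps)
    qed
    show ?thesis using g1 g2 g3 unfolding aux_row_def Qj_def V_def N_def D_def[symmetric]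
      by (intro exI[of _ g]) (auto simp: coeff)
  qed
  thus ?thesis by blast
qed

end

context C_infinity
begin

lemma twp_surj_Kt: "\<exists>h. \<forall>i\<in>I. g i \<in> Kt \<longrightarrow> h i \<in> Kt \<and> twp n (h i) = g i"
proof -
  have "\<forall>i. \<exists>h. g i \<in> Kt \<longrightarrow> h \<in> Kt \<and> twp n h = g i" using Kt_untwist by blast
  from choice[OF this] show ?thesis by blast
qed

lemma absv_theta_qn: "absv (\<theta> ^ (q ^ j)) = real q ^ (q ^ j)" by (simp add: absv_power absv_theta)

lemma theta_qn_eq_iff: "\<theta> ^ (q ^ i) = \<theta> ^ (q ^ j) \<longleftrightarrow> i = j"
proof
  assume "\<theta> ^ (q ^ i) = \<theta> ^ (q ^ j)"
  hence "absv (\<theta> ^ (q ^ i)) = absv (\<theta> ^ (q ^ j))" by simp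
  hence "real q ^ (q ^ i) = real q ^ (q ^ j)" by (simp only: absv_theta_qn)
  thus "i = j" using q_gt_1 by (simp add: power_inject_exp)
qed simp

lemma bnd_tw_iff:
  assumes "bnd 1 (tw n f) (B ^ (q ^ n))" "B \<ge> 0" shows "bnd 1 f B" unfolding bnd_def
proof
  fix i
  have "absv (fps_nth f i) ^ (q ^ n) \<le> B ^ (q ^ n)" using bndD[OF assms(1), of i] by (simp add: absv_power)
  hence "absv (fps_nth f i) \<le> B" using assms(2) by (subst (asm) power_mono_iff) auto
  thus "absv (fps_nth f i) * 1 ^ i \<le> B" by simp
qed

end

context abp_sized
begin

text \<open>The proportionality makes \<open>\<Sum> g\<^sub>i \<psi>\<^sub>i\<^bsup>(V)\<^esup>\<close> vanish at the points \<open>\<theta>\<^bsup>q^j\<^esup>\<close>, so it is small by the Schwarz lemma;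
  the gain \<open>q\<^bsup>-T\<^esup>\<close> survives since the radii \<open>q\<^bsup>q^V\<^esup>\<close> and \<open>q\<^bsup>(2l+1) q^V\<^esup>\<close> are used.\<close>

lemma small_linear_form:
  "\<exists>h1. \<exists>K1>0. \<forall>T\<ge>1. \<exists>h0. small_row h1 K1 T h0"
proof -
  obtain h1 where h1: "\<forall>T\<ge>1. \<exists>g. aux_row h1 T g" using auxiliary_polys by blast
  \<comment> \<open>Enlarging the radius costs \<rho> D through the degree and gains 2 l for each of
    the N zeros. Since (2 l + 1)(2 l - 1) T + T = 2 l (2 l T), the gain exceeds the cost by exactly
    T.\<close>
  define \<rho> where "\<rho> = 2 * l + 1"
  have "\<exists>B. bnd (real q ^ \<rho>) (\<psi> i) B" if "i < l" for i
    using entireD[OF ent[OF that], of "real q ^ \<rho>"] conv_imp_bnd by fastforce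
  hence "\<exists>B. B \<ge> 1 \<and> (\<forall>i<l. bnd (real q ^ \<rho>) (\<psi> i) B)"
    by (rule finite_bound) (assumption, erule (1) bnd_mono)
  then obtain B where Bpos: "B \<ge> 1" and B: "\<And>i. i < l \<Longrightarrow> bnd (real q ^ \<rho>) (\<psi> i) B" by blast
  define K1 where "K1 = real q ^ h1 * B"
  have K1: "K1 > 0" using Bpos q_gt_1 by (simp add: K1_def)
  have "\<exists>h0. small_row h1 K1 T h0" if T: "T \<ge> 1" for T
  proof -
    define N D where "N = 2 * l * T" and "D = (2 * l - 1) * T"
    \<comment> \<open>At this level the value of \<psi>^(V) at \<theta>^(q^j) is the q^j-th power of
      the value of \<psi>^(n0 + N - j) at \<theta>, to which \<open>Q (N - j)\<close>
      applies.\<close>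
    define V where "V = N + n0"
    obtain g where g: "\<And>i. i < l \<Longrightarrow> g i \<in> psz d e (h1 * q ^ V)"
      "\<And>i m. i < l \<Longrightarrow> m \<ge> D \<Longrightarrow> coeff (g i) m = 0" "\<exists>i<l. g i \<noteq> 0"
      "\<forall>j<N. \<exists>\<mu>. \<forall>i<l. poly (g i) (\<theta> ^ (q ^ j)) = \<mu> * Q (N - j) i ^ (q ^ j)"
      using h1[THEN spec[of _ T], THEN mp, OF T] unfolding aux_row_def N_def D_def V_def by blast
    obtain h0 where "\<forall>i\<in>{..<l}. g i \<in> Kt \<longrightarrow> h0 i \<in> Kt \<and> twp V (h0 i) = g i"
      using twp_surj_Kt[of "{..<l}" g V] by blast
    hence h0: "\<And>i. i < l \<Longrightarrow> h0 i \<in> Kt" "\<And>i. i < l \<Longrightarrow> twp V (h0 i) = g i" using psz_Kt[OF g(1)] by auto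
    define Z Y where "Z = (real q ^ \<rho>) ^ (q ^ V)" and "Y = real q ^ (q ^ V)"
    define G where "G = (\<Sum>i<l. fps_of_poly (g i) * tw V (\<psi> i))"
    have G: "G = tw V (chi h0 0)" using h0 by (simp add: G_def chi_def tw_sum tw_mult fps_of_twp[symmetric])
    have entG: "entire G" unfolding G_def using ent by (intro entire_sum entire_mult entire_tw) auto
    have zero: "fev G (\<theta> ^ (q ^ j)) = 0" if j: "j < N" for j
    proof -
      obtain \<mu> where \<mu>: "\<And>i. i < l \<Longrightarrow> poly (g i) (\<theta> ^ (q ^ j)) = \<mu> * Q (N - j) i ^ (q ^ j)" using g(4) j by blast
      have V: "V = j + (n0 + (N - j))" using j by (simp add: V_def)
      have "fev G (\<theta> ^ (q ^ j)) = (\<Sum>i<l. poly (g i) (\<theta> ^ (q ^ j)) * fev (tw V (\<psi> i)) (\<theta> ^ (q ^ j)))"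
        unfolding G_def using ent by (subst efev_sum) (auto intro!: entire_mult entire_tw sum.cong simp: efev_mult entire_tw)
      also have "\<dots> = (\<Sum>i<l. \<mu> * (Q (N - j) i * fev (tw (n0 + (N - j)) (\<psi> i)) \<theta>) ^ (q ^ j))"
      proof (intro sum.cong refl)
        fix i assume "i \<in> {..<l}"
        hence i: "i < l" by simp
        have "fev (tw V (\<psi> i)) (\<theta> ^ (q ^ j)) = fev (tw j (tw (n0 + (N - j)) (\<psi> i))) (\<theta> ^ (q ^ j))"
          unfolding tw_tw V[symmetric] ..
        also have "\<dots> = fev (tw (n0 + (N - j)) (\<psi> i)) \<theta> ^ (q ^ j)" using ent[OF i] by (intro efev_tw entire_tw)
        finally show "poly (g i) (\<theta> ^ (q ^ j)) * fev (tw V (\<psi> i)) (\<theta> ^ (q ^ j)) = \<mu> * (Q (N - j) i * fev (tw (n0 + (N - j)) (\<psi> i)) \<theta>) ^ (q ^ j)"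
          using \<mu>[OF i] by (simp add: power_mult_distrib)
      qed
      also have "\<dots> = \<mu> * (\<Sum>i<l. Q (N - j) i * fev (tw (n0 + (N - j)) (\<psi> i)) \<theta>) ^ (q ^ j)"
        by (simp add: sum_pow_qn sum_distrib_left)
      also have "\<dots> = 0" by (simp add: Q_rel)
      finally show ?thesis .
    qed
    have q1: "real q \<ge> 1" using q_gt_1 by simp
    have Z1: "Z \<ge> 1" and Y1: "Y \<ge> 1" unfolding Z_def Y_def using q1 by (auto intro!: one_le_power)
    have YZ: "Y \<le> Z"
    proof -
      have "real q \<le> real q ^ \<rho>" unfolding \<rho>_def using self_le_power[of "real q"] q1 by auto
      thus ?thesis unfolding Y_def Z_def using q1 by (intro power_mono) auto
    qed
    have gb: "bnd Z (fps_of_poly (g i)) (real q ^ (h1 * q ^ V) * Z ^ D)" if i: "i < l" for i unfolding bnd_def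
    proof
      fix m
      show "absv (fps_nth (fps_of_poly (g i)) m) * Z ^ m \<le> real q ^ (h1 * q ^ V) * Z ^ D"
      proof (cases "m \<ge> D")
        case True
        thus ?thesis using g(2)[OF i True] Z1 by simp
      next
        case False
        have "absv (coeff (g i) m) \<le> real q ^ (h1 * q ^ V)"
          using absv_sized_le[OF order] g(1)[OF i] by (auto simp: psz_def)
        moreover have "Z ^ m \<le> Z ^ D" using Z1 False by (intro power_increasing) auto
        ultimately show ?thesis using Z1 by (auto intro!: mult_mono)
      qed
    qed
    have "bnd Z G (real q ^ (h1 * q ^ V) * Z ^ D * B ^ (q ^ V))" unfolding G_def
    proof (rule bnd_sum)
      fix i assume "i \<in> {..<l}"
      hence i: "i < l" by simp
      have "bnd Z (tw V (\<psi> i)) (B ^ (q ^ V))" unfolding Z_def by (rule bnd_tw[OF B[OF i]]) simp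
      thus "bnd Z (fps_of_poly (g i) * tw V (\<psi> i)) (real q ^ (h1 * q ^ V) * Z ^ D * B ^ (q ^ V))"
        using gb[OF i] Z1 by (intro bnd_mult) auto
    qed (use Z1 Bpos in auto)
    moreover have "conv Z G" using entG Z1 by (intro entireD) auto
    ultimately have "bnd Y G ((Y / Z) ^ card ((\<lambda>j. \<theta> ^ (q ^ j)) ` {..<N}) * (real q ^ (h1 * q ^ V) * Z ^ D * B ^ (q ^ V)))"
    proof (intro schwarz)
      fix x assume "x \<in> (\<lambda>j. \<theta> ^ (q ^ j)) ` {..<N}"
      then obtain j where j: "x = \<theta> ^ (q ^ j)" "j < N" by blast
      have "q ^ j \<le> q ^ V" using j(2) q_gt_1 by (intro power_increasing) (auto simp: V_def)
      thus "absv x \<le> Y \<and> fev G x = 0"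
        using zero[OF j(2)] q1 by (auto simp: j(1) absv_theta_qn Y_def intro: power_increasing)
    qed (use Y1 YZ in auto)
    moreover have "card ((\<lambda>j. \<theta> ^ (q ^ j)) ` {..<N}) = N"
      by (subst card_image) (auto simp: inj_on_def theta_qn_eq_iff)
    moreover have "(Y / Z) ^ N * (real q ^ (h1 * q ^ V) * Z ^ D * B ^ (q ^ V)) = (K1 / real q ^ T) ^ (q ^ V)"
    proof -
      have YZ': "Y / Z = (1 / real q ^ (2 * l)) ^ (q ^ V)"
        unfolding Y_def Z_def \<rho>_def using q_gt_1 by (simp add: power_divide power_mult_distrib)
      have "(Y / Z) ^ N * (real q ^ (h1 * q ^ V) * Z ^ D * B ^ (q ^ V))
          = ((1 / real q ^ (2 * l)) ^ N * (real q ^ h1 * (real q ^ \<rho>) ^ D * B)) ^ (q ^ V)"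
        unfolding YZ' unfolding Z_def by (simp only: power_mult_distrib power_mult[symmetric] mult.commute mult.assoc mult.left_commute)
      also have "(1 / real q ^ (2 * l)) ^ N * (real q ^ h1 * (real q ^ \<rho>) ^ D * B) = K1 * ((real q ^ \<rho>) ^ D / (real q ^ (2 * l)) ^ N)"
        by (simp add: K1_def power_one_over)
      also have "(real q ^ \<rho>) ^ D / (real q ^ (2 * l)) ^ N = 1 / real q ^ T"
      proof -
        have "\<rho> * D + T = 2 * l * N"
        proof -
          obtain l' where "l = Suc l'" using l_pos by (cases l) auto
          thus ?thesis unfolding \<rho>_def D_def N_def by (simp add: algebra_simps)
        qed
        hence "(real q ^ (2 * l)) ^ N = (real q ^ \<rho>) ^ D * real q ^ T" by (simp flip: power_mult power_add)
        thus ?thesis using q_gt_1 by simp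
      qed
      finally show ?thesis by simp
    qed
    ultimately have "bnd Y G ((K1 / real q ^ T) ^ (q ^ V))" by simp
    hence "bnd 1 (tw V (chi h0 0)) ((K1 / real q ^ T) ^ (q ^ V))"
      unfolding G by (rule bnd_mono_radius) (use Y1 in auto)
    hence small: "bnd 1 (chi h0 0) (K1 / real q ^ T)" by (rule bnd_tw_iff) (use K1 in simp)
    \<comment> \<open>A nonzero g_i has degree below D \<le> N and cannot vanish at all N points; at
      one of them the factor of proportionality is therefore nonzero.\<close>
    have "\<exists>j<N. \<exists>i<l. poly (g i) (\<theta> ^ (q ^ j)) \<noteq> 0"
    proof (rule ccontr)
      assume no: "\<not> ?thesis"
      obtain i where i: "i < l" "g i \<noteq> 0" using g(3) by blast
      have "(\<lambda>j. \<theta> ^ (q ^ j)) ` {..<N} \<subseteq> {x. poly (g i) x = 0}" using no i(1) by auto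
      hence "card ((\<lambda>j. \<theta> ^ (q ^ j)) ` {..<N}) \<le> card {x. poly (g i) x = 0}"
        using poly_roots_finite[OF i(2)] by (intro card_mono)
      also have "\<dots> \<le> degree (g i)" by (rule card_poly_roots_bound[OF i(2)])
      also have "\<dots> < D" using g(2)[OF i(1)] i(2) by (metis leading_coeff_0_iff not_le)
      finally have "N < D" by (subst (asm) card_image) (auto simp: inj_on_def theta_qn_eq_iff)
      moreover have "D \<le> N" unfolding N_def D_def by (intro mult_le_mono) auto
      ultimately show False by simp
    qed
    then obtain j i0 where j: "j < N" "i0 < l" "poly (g i0) (\<theta> ^ (q ^ j)) \<noteq> 0" by blast
    obtain \<mu> where \<mu>: "\<And>i. i < l \<Longrightarrow> poly (g i) (\<theta> ^ (q ^ j)) = \<mu> * Q (N - j) i ^ (q ^ j)" using g(4) j(1) by blast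
    have Q0: "\<mu> \<noteq> 0" "Q (N - j) i0 \<noteq> 0" using \<mu>[OF j(2)] j(3) by auto
    define n where "n = n0 + (N - j)"
    \<comment> \<open>The q^j-th root of \<mu>, obtained as a quotient. Level n arises by untwisting
      the point \<theta>^(q^j) back to \<theta>.\<close>
    define \<kappa> where "\<kappa> = poly (twp n (h0 i0)) \<theta> / Q (N - j) i0"
    have ev: "poly (twp n (h0 i)) \<theta> ^ (q ^ j) = \<mu> * Q (N - j) i ^ (q ^ j)" if "i < l" for i
    proof -
      have "poly (twp n (h0 i)) \<theta> ^ (q ^ j) = poly (twp j (twp n (h0 i))) (\<theta> ^ (q ^ j))" by (simp add: poly_twp)
      also have "twp j (twp n (h0 i)) = g i" using h0(2)[OF that] j(1) by (simp add: twp_twp n_def V_def add.commute)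
      finally show ?thesis using \<mu>[OF that] by simp
    qed
    have \<kappa>\<mu>: "\<kappa> ^ (q ^ j) = \<mu>" using ev[OF j(2)] Q0(2) by (simp add: \<kappa>_def power_divide)
    have "poly (twp n (h0 i)) \<theta> = \<kappa> * Q (n - n0) i" if "i < l" for i
    proof -
      have "poly (twp n (h0 i)) \<theta> ^ (q ^ j) = (\<kappa> * Q (n - n0) i) ^ (q ^ j)"
        using ev[OF that] \<kappa>\<mu> by (simp add: power_mult_distrib n_def)
      thus ?thesis by (simp only: pow_qn_eq_iff)
    qed
    moreover have "\<kappa> \<noteq> 0"
    proof
      assume "\<kappa> = 0"
      hence "\<mu> = 0" using \<kappa>\<mu> by (metis zero_pow_qn)
      thus False using Q0 by simp
    qed
    ultimately have "\<exists>n \<mu>. n0 \<le> n \<and> \<mu> \<noteq> 0 \<and> (\<forall>i<l. poly (twp n (h0 i)) \<theta> = \<mu> * Q (n - n0) i)"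
      by (intro exI[of _ n] exI[of _ \<kappa>]) (auto simp: n_def)
    moreover have "\<forall>i<l. h0 i \<in> Kt \<and> twp (2 * l * T + n0) (h0 i) \<in> psz d e (h1 * q ^ (2 * l * T + n0))"
      using h0 g(1) by (simp add: V_def N_def)
    ultimately show ?thesis unfolding small_row_def using small by blast
  qed
  thus ?thesis using K1 by blast
qed

end

context C_infinity
begin

lemma subdegree_tw: "subdegree (tw n f) = subdegree f"
proof (cases "f = 0")
  case False
  show ?thesis
  proof (rule subdegreeI)
    show "fps_nth (tw n f) (subdegree f) \<noteq> 0" using False by simp
    show "fps_nth (tw n f) i = 0" if "i < subdegree f" for i using nth_less_subdegree_zero[OF that] by simp
  qed
qed simp

end

context abp_sized
begin

lemma tw_chi:
  assumes "\<And>i. i < l \<Longrightarrow> h0 i \<in> Kt"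
  shows "tw k (chi h0 k) = (\<Prod>j<k. tw j (fps_of_poly s0)) * chi h0 0"
proof (induction k)
  case (Suc k)
  have "tw (Suc k) (chi h0 (Suc k)) = tw k (tw 1 (chi h0 (Suc k)))" by (simp add: tw_tw)
  also have "\<dots> = tw k (fps_of_poly s0) * tw k (chi h0 k)" by (simp only: chi_Suc[OF assms] tw_mult)
  also have "\<dots> = (\<Prod>j<Suc k. tw j (fps_of_poly s0)) * chi h0 0" by (simp add: Suc mult_ac)
  finally show ?case .
qed simp

text \<open>By \<open>tw_chi\<close> the passage from \<chi>_0 to \<chi>_k only multiplies by twists
  of s0, so one constant serves all starting rows, and hence all T.\<close>

lemma bnd_chi:
  "\<exists>\<kappa>>0. \<forall>h0 k \<beta>. (\<forall>i<l. h0 i \<in> Kt) \<longrightarrow> k < l \<longrightarrow> bnd 1 (chi h0 0) \<beta> \<longrightarrow> bnd 1 (tw k (chi h0 k)) (\<kappa> * \<beta>)"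
proof -
  have "\<exists>B. bnd 1 (\<Prod>j<k. tw j (fps_of_poly s0)) B" for k
  proof -
    have "entire (\<Prod>j<k. tw j (fps_of_poly s0))" by (induction k) (auto intro!: entire_mult entire_tw)
    thus ?thesis by (intro conv_imp_bnd entireD) auto
  qed
  hence "\<exists>\<kappa>. \<kappa> \<ge> 1 \<and> (\<forall>k<l. bnd 1 (\<Prod>j<k. tw j (fps_of_poly s0)) \<kappa>)"
    by (rule finite_bound) (erule (1) bnd_mono)
  then obtain \<kappa> where \<kappa>: "\<kappa> \<ge> 1" "\<And>k. k < l \<Longrightarrow> bnd 1 (\<Prod>j<k. tw j (fps_of_poly s0)) \<kappa>" by blast
  have "bnd 1 (tw k (chi h0 k)) (\<kappa> * \<beta>)" if "\<forall>i<l. h0 i \<in> Kt" "k < l" "bnd 1 (chi h0 0) \<beta>" for h0 k \<beta>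
    by (subst tw_chi) (use that \<kappa>(2) in \<open>auto intro: bnd_mult\<close>)
  moreover have "\<kappa> > 0" using \<kappa>(1) by simp
  ultimately show ?thesis by blast
qed

text \<open>The rows themselves have coefficients outside the order; after V + k twists they lie in
  it.\<close>

lemma hr_size:
  assumes "\<And>i. i < l \<Longrightarrow> h0 i \<in> Kt" "\<And>i. i < l \<Longrightarrow> twp V (h0 i) \<in> psz d e (h1 * q ^ V)"
  shows "i < l \<Longrightarrow> twp (V + k) (hr h0 k i) \<in> psz d e ((h1 + C * k) * q ^ (V + k))"
proof (induction k arbitrary: i)
  case 0
  thus ?case using assms(2) by simp
next
  case (Suc k)
  have "twp (V + Suc k) (hr h0 (Suc k) i) = twp (V + k) (twp 1 (hr h0 (Suc k) i))" by (simp add: twp_twp)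
  also have "\<dots> = (\<Sum>j<l. twp (V + k) (hr h0 k j) * twp (V + k) (A j i))"
    by (simp only: hr_Suc[OF assms(1) Suc.prems] twp_sum twp_mult)
  also have "\<dots> \<in> psz d e ((h1 + C * k) * q ^ (V + k) + q ^ (V + k) * C)"
    using Suc by (intro psz_sum psz_mult psz_twp AC) auto
  finally show ?case
  proof (rule psz_mono)
    have "(h1 + C * k) * q ^ (V + k) + q ^ (V + k) * C = (h1 + C * Suc k) * q ^ (V + k)" by (simp add: algebra_simps)
    also have "\<dots> \<le> (h1 + C * Suc k) * q ^ (V + Suc k)" using q_gt_1 by (intro mult_le_mono power_increasing) auto
    finally show "(h1 + C * k) * q ^ (V + k) + q ^ (V + k) * C \<le> (h1 + C * Suc k) * q ^ (V + Suc k)" .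
  qed
qed

text \<open>The rows are independent over kbar[t], whereas a kernel vector v may have arbitrary
  polynomial entries. Adjoining each unit vector as a further row gives a dependence over kbar[t]
  that involves it, and this forces the corresponding entry of v to vanish.\<close>

lemma det_nonzero:
  assumes h0: "\<And>i. i < l \<Longrightarrow> h0 i \<in> Kt" and ind: "\<And>c. rel h0 l c \<Longrightarrow> \<forall>k<l. c k = 0"
  shows "det (mat l l (\<lambda>(k, i). twp W (hr h0 k i))) \<noteq> 0"
proof
  define M where "M = mat l l (\<lambda>(k, i). twp W (hr h0 k i))"
  assume "det (mat l l (\<lambda>(k, i). twp W (hr h0 k i))) = 0"
  then obtain v where v: "v \<in> carrier_vec l" "v \<noteq> 0\<^sub>v l" "M *\<^sub>v v = 0\<^sub>v l"
    using det_0_iff_vec_prod_zero[of M l] by (auto simp: M_def)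
  have Mv: "(\<Sum>i<l. twp W (hr h0 k i) * v $ i) = 0" if "k < l" for k
  proof -
    have "(M *\<^sub>v v) $ k = 0" using v(3) that by simp
    thus ?thesis using that v(1) by (simp add: M_def scalar_prod_def lessThan_atLeast0)
  qed
  have "v $ i0 = 0" if i0: "i0 < l" for i0
  proof -
    define w where "w k i = (if k < l then hr h0 k i else if i = i0 then 1 else 0)" for k i
    have "\<exists>c. (\<forall>k\<in>{..<Suc l}. c k \<in> Kt) \<and> (\<exists>k\<in>{..<Suc l}. c k \<noteq> 0) \<and> (\<forall>i\<in>{..<l}. (\<Sum>k\<in>{..<Suc l}. c k * w k i) = 0)"
      by (rule subring_dependence) (use hr_K[OF h0] in \<open>auto simp: w_def subr_Kt\<close>)
    then obtain c where "\<forall>k\<in>{..<Suc l}. c k \<in> Kt" "\<exists>k\<in>{..<Suc l}. c k \<noteq> 0"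
      "\<forall>i\<in>{..<l}. (\<Sum>k\<in>{..<Suc l}. c k * w k i) = 0" by blast
    hence c: "\<And>k. k < Suc l \<Longrightarrow> c k \<in> Kt" "\<exists>k<Suc l. c k \<noteq> 0"
      "\<And>i. i < l \<Longrightarrow> (\<Sum>k\<in>{..<Suc l}. c k * w k i) = 0" by blast+
    have c': "(\<Sum>k<l. c k * hr h0 k i) + (if i = i0 then c l else 0) = 0" if "i < l" for i
      using c(3)[OF that] by (cases "i = i0") (simp_all add: w_def)
    have cl: "c l \<noteq> 0"
    proof
      assume z: "c l = 0"
      have "(\<Sum>k<l. c k * hr h0 k i) = 0" if "i < l" for i using c'[OF that] unfolding z by (cases "i = i0") auto
      hence "rel h0 l c" using c(1) c' z h0 by (subst rel_def) auto
      hence "\<forall>k<l. c k = 0" by (rule ind)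
      thus False using c(2) z by (auto simp: less_Suc_eq)
    qed
    have "0 = (\<Sum>i<l. twp W ((\<Sum>k<l. c k * hr h0 k i) + (if i = i0 then c l else 0)) * v $ i)"
      using c' by simp
    also have "\<dots> = (\<Sum>i<l. \<Sum>k<l. twp W (c k) * (twp W (hr h0 k i) * v $ i)) + (\<Sum>i<l. (if i = i0 then twp W (c l) * v $ i else 0))"
      unfolding sum.distrib[symmetric]
      by (intro sum.cong refl) (auto simp: twp_add twp_sum twp_mult distrib_right sum_distrib_right mult.assoc)
    also have "(\<Sum>i<l. \<Sum>k<l. twp W (c k) * (twp W (hr h0 k i) * v $ i)) = (\<Sum>k<l. twp W (c k) * (\<Sum>i<l. twp W (hr h0 k i) * v $ i))"
      by (subst sum.swap) (simp add: sum_distrib_left)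
    also have "\<dots> = 0" using Mv by simp
    also have "(\<Sum>i<l. (if i = i0 then twp W (c l) * v $ i else 0)) = twp W (c l) * v $ i0"
      using i0 by (simp add: sum.delta)
    finally show ?thesis using cl by simp
  qed
  hence "v = 0\<^sub>v l" using v(1) by (intro eq_vecI) auto
  thus False using v(2) by simp
qed

text \<open>If \<open>h\<^sub>0, \<dots>, h\<^sub>l\<^sub>-\<^sub>1\<close> are independent, their twisted matrix expresses \<open>det \<cdot> \<psi>\<^sub>0\<close> by the small \<open>\<chi>\<^sub>k\<close>.
  The lowest coefficient of the determinant is bounded below by Liouville's inequality, which contradicts the
  smallness as \<open>T\<close> grows.\<close>

lemma no_sized_data:
  assumes IH: "\<And>r \<psi>' s0' A' n0' P'. r < l \<Longrightarrow> \<not> abp_data \<iota> r \<psi>' s0' A' n0' P'"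
  shows False
proof -
  obtain h1 K1 where K1: "K1 > 0" and h1: "\<forall>T\<ge>1. \<exists>h0. small_row h1 K1 T h0"
    using small_linear_form by blast
  obtain \<kappa> where \<kappa>: "\<kappa> > 0" and bc: "\<forall>h0 k \<beta>. (\<forall>i<l. h0 i \<in> Kt) \<longrightarrow> k < l \<longrightarrow> bnd 1 (chi h0 0) \<beta> \<longrightarrow> bnd 1 (tw k (chi h0 k)) (\<kappa> * \<beta>)"
    using bnd_chi by blast
  define K2 where "K2 = \<kappa> * K1"
  have K2: "K2 > 0" using K1 \<kappa> by (simp add: K2_def)
  have \<psi>0: "\<psi> 0 \<noteq> 0"
  proof
    assume z: "\<psi> 0 = 0"
    have "(\<Sum>i<l. fps_of_poly (if i = 0 then 1 else 0) * \<psi> i) = 0"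
      by (intro sum.neutral ballI) (use z in auto)
    hence "(if (0::nat) = 0 then 1 else 0 :: 'c poly) = 0" by (rule ind[rotated]) (use l_pos in auto)
    thus False by simp
  qed
  define b where "b = fps_nth (\<psi> 0) (subdegree (\<psi> 0))"
  have b: "b \<noteq> 0" using \<psi>0 by (simp add: b_def)
  define h2 where "h2 = h1 + C * l"
  \<comment> \<open>Collects the exponents l S of the adjugate and l S d of Liouville's inequality,
    where S = h2 q^W, after division by q^(W - l).\<close>
  define m where "m = l * h2 * (d + 1) * q ^ l"
  have key: "absv b ^ (q ^ l) * real q ^ T \<le> real q ^ m * K2" if T: "T \<ge> 1" "K2 \<le> real q ^ T" for T
  proof -
    \<comment> \<open>W is a common level for all rows, since row k is in the order after V + k
      \<le> W twists.\<close>
    define V W where "V = 2 * l * T + n0" and "W = V + l"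
    obtain h0 n \<mu> where h0: "\<And>i. i < l \<Longrightarrow> h0 i \<in> Kt" "\<And>i. i < l \<Longrightarrow> twp V (h0 i) \<in> psz d e (h1 * q ^ V)"
      and sm: "bnd 1 (chi h0 0) (K1 / real q ^ T)"
      and n: "n0 \<le> n" "\<mu> \<noteq> 0" "\<And>i. i < l \<Longrightarrow> poly (twp n (h0 i)) \<theta> = \<mu> * Q (n - n0) i"
      using h1[THEN spec[of _ T], THEN mp, OF T(1)] unfolding small_row_def V_def by blast
    have indep: "\<forall>k<l. c k = 0" if c: "rel h0 l c" for c
    proof (rule ccontr)
      assume nz: "\<not> (\<forall>k<l. c k = 0)"
      \<comment> \<open>The least r for which h_0, ..., h_r are dependent supplies the minimality
        that \<open>rank_reduction\<close> requires, and r < l contradicts the induction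
        hypothesis.\<close>
      define good where "good r \<longleftrightarrow> (\<exists>c. rel h0 (Suc r) c \<and> (\<exists>k\<le>r. c k \<noteq> 0))" for r
      have "good (l - 1)"
      proof -
        obtain k where "k < l" "c k \<noteq> 0" using nz by blast
        hence "k \<le> l - 1" "Suc (l - 1) = l" by auto
        thus ?thesis unfolding good_def using c \<open>c k \<noteq> 0\<close> by auto
      qed
      define r where "r = (LEAST r. good r)"
      have r: "good r" "r \<le> l - 1" unfolding r_def using \<open>good (l - 1)\<close> by (auto intro: LeastI Least_le)
      have "\<forall>k<r. c k = 0" if "rel h0 r c" for c
      proof (cases r)
        case (Suc r')
        have "\<not> good r'" using Suc not_less_Least[of r' good] by (simp add: r_def)
        thus ?thesis using that Suc by (auto simp: good_def less_Suc_eq_le)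
      qed simp
      moreover obtain c' where "rel h0 (Suc r) c'" "\<exists>k\<le>r. c' k \<noteq> 0" using r(1) unfolding good_def by blast
      ultimately have "\<exists>\<psi>' s0' A' n0' P'. abp_data \<iota> r \<psi>' s0' A' n0' P'"
        using rank_reduction[of h0 n \<mu> r c'] h0(1) n by blast
      moreover have "r < l" using r(2) l_pos by linarith
      ultimately show False using IH by blast
    qed
    define M where "M = mat l l (\<lambda>(k, i). twp W (hr h0 k i))"
    have M: "M \<in> carrier_mat l l" by (simp add: M_def)
    have dnz: "det M \<noteq> 0" unfolding M_def by (rule det_nonzero[OF h0(1) indep])
    define S where "S = h2 * q ^ W"
    have entry: "twp W (hr h0 k i) \<in> psz d e S" if "k < l" "i < l" for k i
    proof -
      have "twp (V + k) (hr h0 k i) \<in> psz d e ((h1 + C * k) * q ^ (V + k))"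
        by (rule hr_size) (use h0 that in auto)
      hence "twp (l - k) (twp (V + k) (hr h0 k i)) \<in> psz d e (q ^ (l - k) * ((h1 + C * k) * q ^ (V + k)))"
        by (rule psz_twp)
      moreover have "q ^ (l - k) * ((h1 + C * k) * q ^ (V + k)) = (h1 + C * k) * q ^ W"
      proof -
        have "W = (l - k) + (V + k)" using that by (simp add: W_def)
        thus ?thesis by (simp add: power_add)
      qed
      moreover have "(h1 + C * k) * q ^ W \<le> S" unfolding S_def h2_def using that by (intro mult_le_mono add_mono) auto
      moreover have "(l - k) + (V + k) = W" using that by (simp add: W_def)
      ultimately show ?thesis by (metis psz_mono twp_twp)
    qed
    have detS: "det M \<in> psz d e (l * S)" using entry by (intro psz_det[OF M]) (auto simp: M_def)
    have adjS: "adj_mat M $$ (i, k) \<in> psz d e (l * S)" if "i < l" "k < l" for i k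
    proof -
      have "det (mat_delete M k i) \<in> psz d e ((l - 1) * S)"
      proof (rule psz_det)
        show "mat_delete M k i \<in> carrier_mat (l - 1) (l - 1)" using M by (rule mat_delete_carrier)
        show "mat_delete M k i $$ (a, b) \<in> psz d e S" if "a < l - 1" "b < l - 1" for a b
          using that entry by (auto simp: mat_delete_def M_def simp del: hr.simps)
      qed
      hence "det (mat_delete M k i) \<in> psz d e (l * S)" by (rule psz_mono) simp
      moreover have "(-1) ^ (k + i) = (1 :: 'c poly) \<or> (-1) ^ (k + i) = (- 1 :: 'c poly)" by (cases "even (k + i)") auto
      ultimately have "cofactor M k i \<in> psz d e (l * S)" by (auto simp: cofactor_def intro: psz_uminus)
      thus ?thesis using that by (simp add: adj_mat_def M_def)
    qed
    have chiW: "tw W (chi h0 k) = (\<Sum>i<l. fps_of_poly (M $$ (k, i)) * tw W (\<psi> i))" if "k < l" for k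
      using that by (simp add: chi_def tw_sum tw_mult fps_of_twp M_def)
    have inv_eq: "fps_of_poly (det M) * tw W (\<psi> 0) = (\<Sum>k<l. fps_of_poly (adj_mat M $$ (0, k)) * tw W (chi h0 k))"
    proof -
      have delta: "(\<Sum>k<l. adj_mat M $$ (0, k) * M $$ (k, i)) = (if i = 0 then det M else 0)" if i: "i < l" for i
      proof -
        have "(adj_mat M * M) $$ (0, i) = (det M \<cdot>\<^sub>m 1\<^sub>m l) $$ (0, i)" using adj_mat(3)[OF M] by simp
        thus ?thesis using i l_pos adj_mat(1)[OF M] M by (simp add: scalar_prod_def lessThan_atLeast0)
      qed
      have "(\<Sum>k<l. fps_of_poly (adj_mat M $$ (0, k)) * tw W (chi h0 k))
          = (\<Sum>k<l. \<Sum>i<l. fps_of_poly (adj_mat M $$ (0, k) * M $$ (k, i)) * tw W (\<psi> i))"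
        by (intro sum.cong refl) (simp add: chiW sum_distrib_left fps_of_poly_mult mult.assoc)
      also have "\<dots> = (\<Sum>i<l. fps_of_poly (\<Sum>k<l. adj_mat M $$ (0, k) * M $$ (k, i)) * tw W (\<psi> i))"
        by (subst sum.swap) (simp add: fps_of_poly_sum sum_distrib_right)
      also have "\<dots> = (\<Sum>i<l. if i = 0 then fps_of_poly (det M) * tw W (\<psi> i) else 0)"
        by (intro sum.cong refl) (simp add: delta)
      also have "\<dots> = fps_of_poly (det M) * tw W (\<psi> 0)" using l_pos by (simp add: sum.delta)
      finally show ?thesis ..
    qed
    define B where "B = (K2 / real q ^ T) ^ (q ^ (W - l))"
    have ratio: "0 \<le> K2 / real q ^ T" "K2 / real q ^ T \<le> 1" using K2 T(2) q_gt_1 by auto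
    have B0: "B \<ge> 0" using ratio by (simp add: B_def)
    have chib: "bnd 1 (tw W (chi h0 k)) B" if k: "k < l" for k
    proof -
      have "bnd 1 (tw k (chi h0 k)) (\<kappa> * (K1 / real q ^ T))" using bc h0(1) k sm by blast
      hence "bnd (1 ^ (q ^ (W - k))) (tw (W - k) (tw k (chi h0 k))) ((\<kappa> * (K1 / real q ^ T)) ^ (q ^ (W - k)))"
        by (rule bnd_tw) simp
      hence "bnd 1 (tw W (chi h0 k)) ((K2 / real q ^ T) ^ (q ^ (W - k)))" using k by (simp add: tw_tw W_def K2_def)
      thus ?thesis
      proof (rule bnd_mono)
        have "q ^ (W - l) \<le> q ^ (W - k)" using k q_gt_1 by (intro power_increasing) auto
        thus "(K2 / real q ^ T) ^ (q ^ (W - k)) \<le> B" unfolding B_def using ratio by (rule power_decreasing)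
      qed
    qed
    have rhs: "bnd 1 (fps_of_poly (det M) * tw W (\<psi> 0)) (real q ^ (l * S) * B)" unfolding inv_eq
      by (intro bnd_sum bnd_mult bnd_psz[OF order] adjS chib) (use l_pos B0 in auto)
    define f where "f = fps_of_poly (det M)"
    define \<delta> where "\<delta> = coeff (det M) (subdegree f)"
    have \<delta>: "\<delta> = fps_nth f (subdegree f)" by (simp add: \<delta>_def f_def)
    have f0: "f \<noteq> 0" using dnz by (simp add: f_def)
    have d0: "\<delta> \<noteq> 0" unfolding \<delta> using f0 by simp
    have "1 \<le> absv \<delta> * real q ^ (l * S * d)"
      using detS d0 by (intro liouville[OF order]) (auto simp: psz_def \<delta>_def)
    moreover have "absv \<delta> * absv b ^ (q ^ W) \<le> real q ^ (l * S) * B"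
    proof -
      have "fps_nth (f * tw W (\<psi> 0)) (subdegree f + subdegree (tw W (\<psi> 0))) = \<delta> * b ^ (q ^ W)"
        unfolding nth_subdegree_mult \<delta> by (simp add: b_def subdegree_tw)
      thus ?thesis using bndD[OF rhs, of "subdegree f + subdegree (tw W (\<psi> 0))"]
        by (simp add: f_def[symmetric] absv_mult absv_power)
    qed
    ultimately have "absv b ^ (q ^ W) \<le> real q ^ (l * S) * B * real q ^ (l * S * d)"
    proof -
      assume a: "1 \<le> absv \<delta> * real q ^ (l * S * d)" and c: "absv \<delta> * absv b ^ (q ^ W) \<le> real q ^ (l * S) * B"
      have "absv b ^ (q ^ W) * 1 \<le> absv b ^ (q ^ W) * (absv \<delta> * real q ^ (l * S * d))"
        using a by (intro mult_left_mono) auto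
      also have "\<dots> = (absv \<delta> * absv b ^ (q ^ W)) * real q ^ (l * S * d)" by (simp add: mult_ac)
      also have "\<dots> \<le> real q ^ (l * S) * B * real q ^ (l * S * d)" using c by (intro mult_right_mono) auto
      finally show ?thesis by simp
    qed
    \<comment> \<open>All exponents are multiples of q^(W - l). Taking this root removes W and
      leaves an estimate in T alone.\<close>
    also have "\<dots> = (real q ^ m * (K2 / real q ^ T)) ^ (q ^ (W - l))"
    proof -
      have "l * S + l * S * d = m * q ^ (W - l)"
      proof -
        have "q ^ W = q ^ l * q ^ (W - l)" by (simp add: W_def add.commute flip: power_add)
        thus ?thesis by (simp add: S_def m_def algebra_simps)
      qed
      hence E: "real q ^ (l * S) * real q ^ (l * S * d) = (real q ^ m) ^ (q ^ (W - l))"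
        by (simp flip: power_add power_mult)
      have "real q ^ (l * S) * B * real q ^ (l * S * d) = (real q ^ (l * S) * real q ^ (l * S * d)) * B"
        by (rule mult.assoc[THEN trans]) (simp add: mult.commute)
      thus ?thesis unfolding E by (simp only: B_def power_mult_distrib)
    qed
    also have "absv b ^ (q ^ W) = (absv b ^ (q ^ l)) ^ (q ^ (W - l))"
      by (simp add: W_def add.commute flip: power_mult power_add)
    finally have "absv b ^ (q ^ l) \<le> real q ^ m * (K2 / real q ^ T)"
      using ratio by (subst (asm) power_mono_iff) (auto intro!: mult_nonneg_nonneg simp del: times_divide_eq_right)
    thus ?thesis using q_gt_1 by (simp add: field_simps)
  qed
  define c where "c = absv b ^ (q ^ l)"
  have c: "c > 0" using b by (simp add: c_def)
  obtain T where T: "real q ^ T > max (max K2 (real q)) (real q ^ m * K2 / c)"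
    using real_arch_pow[of "real q" "max (max K2 (real q)) (real q ^ m * K2 / c)"] q_gt_1 by auto
  have "T \<ge> 1"
  proof (rule ccontr)
    assume "\<not> T \<ge> 1"
    hence "T = 0" by simp
    thus False using T q_gt_1 by simp
  qed
  hence "c * real q ^ T \<le> real q ^ m * K2" using key[of T] T by (simp add: c_def)
  moreover have "real q ^ m * K2 < c * real q ^ T" using T c by (simp add: field_simps)
  ultimately show False by linarith
qed

end

subsection \<open>The vanishing theorem\<close>

context C_infinity
begin

lemma common_order:
  assumes "finite S" "\<And>x. x \<in> S \<Longrightarrow> x \<in> kbar \<iota>"
  shows "\<exists>d e a C. order_base d e \<and> (\<forall>i<d. e i \<in> kbar \<iota> \<and> e i \<in> sized d e C) \<and> a \<noteq> 0 \<and>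
    (\<forall>x\<in>S. evA a * x \<in> sized d e C)"
proof -
  obtain d e a where de: "order_base d e" "\<forall>i<d. e i \<in> kbar \<iota>" "a \<noteq> 0"
    and ex: "\<forall>x\<in>S. \<exists>m. acts d e (evA a * x) m" using order_exists[OF assms] by blast
  define Y where "Y = e ` {..<d} \<union> (\<lambda>x. evA a * x) ` S"
  have "\<exists>C. y \<in> sized d e C" if "y \<in> Y" for y
  proof -
    have "\<exists>m. acts d e y m" using that de(1) ex by (auto simp: Y_def order_base_def)
    then obtain m where "acts d e y m" ..
    moreover obtain C where "\<forall>z\<in>(\<lambda>(i, j). degree (m i j)) ` ({..<d} \<times> {..<d}). z \<le> C"
      using finite_nat_set_iff_bounded_le[of "(\<lambda>(i, j). degree (m i j)) ` ({..<d} \<times> {..<d})"] by auto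
    ultimately show ?thesis by (auto simp: sized_def)
  qed
  hence "\<forall>y. \<exists>C. y \<in> Y \<longrightarrow> y \<in> sized d e C" by blast
  from choice[OF this] obtain C where C: "\<And>y. y \<in> Y \<Longrightarrow> y \<in> sized d e (C y)" by blast
  have "y \<in> sized d e (sum C Y)" if "y \<in> Y" for y
    by (rule sized_mono[OF C[OF that]]) (use that assms(1) in \<open>auto simp: Y_def intro: member_le_sum\<close>)
  thus ?thesis using de by (intro exI[of _ d] exI[of _ e] exI[of _ a] exI[of _ "sum C Y"]) (auto simp: Y_def)
qed

text \<open>Induction on l as used in \<open>no_sized_data\<close>. Scaling s0, A and P by one
  nonzero element of A clears denominators and preserves the equation, the relation and the
  invertibility.\<close>

lemma abp_vanishing: "\<not> abp_data \<iota> l \<psi> s0 A n0 P"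
proof (induction l arbitrary: \<psi> s0 A n0 P rule: less_induct)
  case (less l)
  show ?case
  proof
    assume D: "abp_data \<iota> l \<psi> s0 A n0 P"
    interpret D: abp_data \<iota> l \<psi> s0 A n0 P by (rule D)
    define S where "S = (\<Union>i<l. \<Union>j<l. set (coeffs (A i j))) \<union> P ` {..<l}"
    have "finite S" by (auto simp: S_def)
    moreover have "x \<in> kbar \<iota>" if "x \<in> S" for x
    proof -
      have "set (coeffs (A i j)) \<subseteq> kbar \<iota>" if "i < l" "j < l" for i j
        using D.AK[OF that] by (auto simp: polys_over_def coeffs_def)
      thus ?thesis using that D.PK by (auto simp: S_def)
    qed
    ultimately have "\<exists>d e a C. order_base d e \<and> (\<forall>i<d. e i \<in> kbar \<iota> \<and> e i \<in> sized d e C) \<and> a \<noteq> 0 \<and>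
      (\<forall>x\<in>S. evA a * x \<in> sized d e C)" by (rule common_order)
    then obtain d e a C where de: "order_base d e" "\<forall>i<d. e i \<in> kbar \<iota> \<and> e i \<in> sized d e C" "a \<noteq> 0"
      "\<forall>x\<in>S. evA a * x \<in> sized d e C" by blast
    define b where "b = evA a"
    have b: "b \<noteq> 0" "b \<in> kbar \<iota>" using de(3) by (auto simp: b_def evA_eq_0_iff kbar_evA)
    interpret E: abp_sized \<iota> l \<psi> "Polynomial.smult b s0" "\<lambda>i j. Polynomial.smult b (A i j)" n0 "\<lambda>i. b * P i" d e C
    proof (unfold_locales, goal_cases)
      case (1 i) thus ?case by (rule D.ent)
    next
      case (2 p i) thus ?case by (rule D.ind)
    next
      case 3 show ?case using D.s0K b by (intro Kt_smult)
    next
      case (4 i j) thus ?case using D.AK b by (intro Kt_smult)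
    next
      case (5 i)
      thus ?case using D.eq[of i] by (simp add: fps_of_poly_smult sum_distrib_left mult.assoc)
    next
      case (6 n v i)
      show ?case
      proof (rule D.ns[OF 6(1) _ 6(3)])
        fix j assume "j < l"
        hence "0 = (\<Sum>i<l. v i * poly (twp n (Polynomial.smult b (A i j))) \<theta>)" using 6(2) by simp
        also have "\<dots> = b ^ (q ^ n) * (\<Sum>i<l. v i * poly (twp n (A i j)) \<theta>)"
          by (simp add: twp_smult sum_distrib_left mult_ac)
        finally show "(\<Sum>i<l. v i * poly (twp n (A i j)) \<theta>) = 0" using b(1) by simp
      qed
    next
      case (7 i) thus ?case using D.PK b by (intro kbar_mult)
    next
      case 8 show ?case using D.Pn b(1) by simp
    next
      case 9
      show ?case using D.Pr by (simp add: mult.assoc flip: sum_distrib_left)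
    next
      case 10 show ?case by (rule de(1))
    next
      case (11 i) thus ?case using de(2) by simp
    next
      case (12 i) thus ?case using de(2) by simp
    next
      case (13 i j)
      have "b * coeff (A i j) m \<in> sized d e C" for m
      proof (cases "coeff (A i j) m = 0")
        case False
        hence "coeff (A i j) m \<in> set (coeffs (A i j))"
          using coeff_in_coeffs[of "A i j" m] le_degree[of "A i j" m] by force
        hence "coeff (A i j) m \<in> S" using 13 by (auto simp: S_def)
        thus ?thesis using de(4) by (simp add: b_def)
      qed simp
      thus ?case by (simp add: psz_def)
    next
      case (14 i)
      hence "P i \<in> S" by (auto simp: S_def)
      thus ?case using de(4) by (simp add: b_def)
    qed
    show False by (rule E.no_sized_data) (rule less)
  qed
qed

section \<open>Rational values and the dual system\<close>

text \<open>Indices are counted from 0: \<open>wt s r c\<close> is the exponent w_(c+1) of the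
  overview.\<close>

definition wt :: "(nat \<Rightarrow> nat) \<Rightarrow> nat \<Rightarrow> nat \<Rightarrow> nat"
  where "wt s r c = (\<Sum>l=Suc c..r. s l)"

definition Psi :: "(nat \<Rightarrow> nat) \<Rightarrow> (nat \<Rightarrow> 'c) \<Rightarrow> nat \<Rightarrow> nat \<Rightarrow> 'c fps"
  where "Psi s u r i = Omega ^ wt s r i * Tser s u i"

abbreviation Lp :: "'c poly" where "Lp \<equiv> [:- (\<theta> ^ q), 1:]"

text \<open>Indices are counted from 0: \<delta> c is the \<delta>_(c+1) of the overview, and the
  last entry \<delta> r is the constant a.\<close>

definition dual_system :: "(nat \<Rightarrow> nat) \<Rightarrow> (nat \<Rightarrow> 'c) \<Rightarrow> nat \<Rightarrow> 'f poly \<Rightarrow> (nat \<Rightarrow> 'c poly) \<Rightarrow> bool"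
  where "dual_system s u r a \<delta> \<longleftrightarrow> \<delta> r = map_poly cst a \<and>
    (\<forall>c<r. \<delta> c \<in> Kt \<and> twp 1 (\<delta> c) = Lp ^ wt s r c * (\<delta> c + [:u (Suc c):] * \<delta> (Suc c)))"

lemma wt_self [simp]: "wt s r r = 0" by (simp add: wt_def)
lemma wt_Suc: "c < r \<Longrightarrow> wt s r c = s (Suc c) + wt s r (Suc c)"
  by (simp add: wt_def sum.atLeast_Suc_atMost)
lemma wt_pos:
  assumes "c < r" "\<And>i. 1 \<le> i \<Longrightarrow> i \<le> r \<Longrightarrow> s i \<ge> 1" shows "wt s r c > 0"
  using assms(2)[of "Suc c"] assms(1) by (simp add: wt_Suc)

lemma Lp_fps: "fps_of_poly Lp = fps_X - fps_const (\<theta> ^ q)" by (simp add: fps_of_poly_pCons)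

lemma Omega_power: "Omega ^ n = fps_of_poly (Lp ^ n) * tw 1 Omega ^ n"
  by (subst Omega_eq) (simp add: power_mult_distrib Lp_fps fps_of_poly_power)

lemma entire_Psi: "small s u r \<Longrightarrow> i \<le> r \<Longrightarrow> entire (Psi s u r i)"
  unfolding Psi_def by (intro entire_mult entire_power entire_Omega entire_Tser) (auto intro: small_mono)

lemma Psi_0: "Psi s u r 0 = fps_of_poly (Lp ^ wt s r 0) * tw 1 (Psi s u r 0)"
  unfolding Psi_def tw_mult tw_power by (simp add: Omega_power)

lemma Psi_Suc:
  assumes "small s u r" "i < r"
  shows "Psi s u r (Suc i) = fps_of_poly (Lp ^ wt s r (Suc i)) * tw 1 (Psi s u r (Suc i)) +
    fps_of_poly ([:u (Suc i):] * Lp ^ wt s r i) * tw 1 (Psi s u r i)"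
proof -
  have "small s u (Suc i)" using assms by (auto intro: small_mono)
  note T = Tser_eq[OF this]
  have "Psi s u r (Suc i) = Omega ^ wt s r (Suc i) * tw 1 (Tser s u (Suc i))
      + fps_const (u (Suc i)) * Omega ^ wt s r i * tw 1 (Tser s u i)"
    unfolding Psi_def by (subst T) (simp only: wt_Suc[OF assms(2)] power_add distrib_left mult_ac add_ac)
  also have "\<dots> = fps_of_poly (Lp ^ wt s r (Suc i)) * tw 1 (Psi s u r (Suc i)) +
    fps_of_poly ([:u (Suc i):] * Lp ^ wt s r i) * tw 1 (Psi s u r i)"
    unfolding Psi_def tw_mult tw_power by (simp add: Omega_power fps_of_poly_mult mult.assoc)
  finally show ?thesis .
qed

lemma evA_pow_theta_qn: "poly (map_poly cst a) (\<theta> ^ (q ^ n)) = evA a ^ (q ^ n)"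
  using poly_twp[of n "map_poly cst a" \<theta>] by (simp add: twp_const_cst evA_def)

lemma fev_Psi_zero:
  assumes "small s u r" "i < r" "\<And>i. 1 \<le> i \<Longrightarrow> i \<le> r \<Longrightarrow> s i \<ge> 1"
  shows "fev (Psi s u r i) (\<theta> ^ (q ^ Suc n)) = 0"
proof -
  have "small s u i" using assms by (auto intro: small_mono)
  thus ?thesis unfolding Psi_def using wt_pos[OF assms(2,3)]
    by (simp add: efev_mult entire_power entire_Omega entire_Tser efev_power Omega_zero del: power_Suc)
qed

lemma dual_system_imp_value:
  assumes "small s u r" "\<And>i. 1 \<le> i \<Longrightarrow> i \<le> r \<Longrightarrow> s i \<ge> 1" "dual_system s u r a \<delta>"
  shows "\<exists>p. evA a * fev (Tser s u r) \<theta> = evA p"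
proof -
  define c where "c = (\<Sum>i\<le>r. fps_of_poly (\<delta> i) * Psi s u r i)"
  have \<delta>r: "\<delta> r = map_poly cst a" and \<delta>: "\<And>c. c < r \<Longrightarrow> twp 1 (\<delta> c) = Lp ^ wt s r c * (\<delta> c + [:u (Suc c):] * \<delta> (Suc c))"
    using assms(3) by (auto simp: dual_system_def)
  have ent: "entire c" unfolding c_def using entire_Psi[OF assms(1)] by (auto intro!: entire_sum entire_mult)
  \<comment> \<open>D and E are the contributions of the diagonal and the subdiagonal of the
    difference system. Grouped by the twisted function they contain, they form the right side of the
    dual system.\<close>
  define D where "D i = fps_of_poly (\<delta> i * Lp ^ wt s r i) * tw 1 (Psi s u r i)" for i
  define E where "E i = fps_of_poly (Lp ^ wt s r i * ([:u (Suc i):] * \<delta> (Suc i))) * tw 1 (Psi s u r i)" for i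
  have "c = (\<Sum>i\<le>r. D i) + (\<Sum>i<r. E i)"
  proof (cases r)
    case 0
    show ?thesis unfolding c_def D_def using Psi_0[of s u r] by (simp add: 0 fps_of_poly_mult mult.assoc)
  next
    case (Suc r')
    have "c = fps_of_poly (\<delta> 0) * Psi s u r 0 + (\<Sum>i<r. fps_of_poly (\<delta> (Suc i)) * Psi s u r (Suc i))"
      unfolding c_def lessThan_Suc_atMost[symmetric] by (subst sum.lessThan_Suc_shift) simp
    also have "fps_of_poly (\<delta> 0) * Psi s u r 0 = D 0"
      unfolding D_def by (subst Psi_0) (simp add: fps_of_poly_mult mult.assoc)
    also have "(\<Sum>i<r. fps_of_poly (\<delta> (Suc i)) * Psi s u r (Suc i)) = (\<Sum>i<r. D (Suc i) + E i)"
    proof (intro sum.cong refl)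
      fix i assume "i \<in> {..<r}"
      hence i: "i < r" by simp
      show "fps_of_poly (\<delta> (Suc i)) * Psi s u r (Suc i) = D (Suc i) + E i"
        by (subst Psi_Suc[OF assms(1) i]) (simp only: D_def E_def fps_of_poly_mult distrib_left mult_ac)
    qed
    also have "D 0 + \<dots> = (D 0 + (\<Sum>i<r. D (Suc i))) + (\<Sum>i<r. E i)" by (simp add: sum.distrib add.assoc)
    also have "D 0 + (\<Sum>i<r. D (Suc i)) = (\<Sum>i\<le>r. D i)"
      unfolding lessThan_Suc_atMost[symmetric] by (subst sum.lessThan_Suc_shift) simp
    finally show ?thesis .
  qed
  also have "(\<Sum>i\<le>r. D i) = (\<Sum>i<r. D i) + D r" by (simp flip: lessThan_Suc_atMost)
  also have "(\<Sum>i<r. D i) + D r + (\<Sum>i<r. E i) = (\<Sum>i<r. D i + E i) + D r" by (simp add: sum.distrib)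
  also have "(\<Sum>i<r. D i + E i) = (\<Sum>i<r. tw 1 (fps_of_poly (\<delta> i) * Psi s u r i))"
  proof (intro sum.cong refl)
    fix i assume "i \<in> {..<r}"
    hence i: "i < r" by simp
    show "D i + E i = tw 1 (fps_of_poly (\<delta> i) * Psi s u r i)"
      unfolding tw_mult fps_of_twp[symmetric] \<delta>[OF i] D_def E_def distrib_right[symmetric] fps_of_poly_add[symmetric]
      by (simp only: distrib_left distrib_right mult_ac)
  qed
  also have "D r = tw 1 (fps_of_poly (\<delta> r) * Psi s u r r)"
    by (simp add: D_def tw_mult \<delta>r twp_const_cst flip: fps_of_twp)
  also have "(\<Sum>i<r. tw 1 (fps_of_poly (\<delta> i) * Psi s u r i)) + \<dots> = tw 1 c"
    by (simp only: c_def lessThan_Suc_atMost[symmetric] sum.lessThan_Suc tw_add tw_sum)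
  finally have "tw 1 c = c" by simp
  moreover have "conv 1 c" using ent by (rule entireD) simp
  ultimately obtain p where p: "c = fps_of_poly (map_poly cst p)" using tw_fixed_imp_poly by blast
  have "evA p ^ q = fev c (\<theta> ^ (q ^ 1))" using evA_pow_theta_qn[of p 1] by (simp add: p)
  also have "\<dots> = (\<Sum>i\<le>r. fev (fps_of_poly (\<delta> i) * Psi s u r i) (\<theta> ^ (q ^ 1)))"
    unfolding c_def using entire_Psi[OF assms(1)] by (intro efev_sum) (auto intro: entire_mult)
  also have "\<dots> = (\<Sum>i\<in>{r}. fev (fps_of_poly (\<delta> i) * Psi s u r i) (\<theta> ^ (q ^ 1)))"
  proof (rule sum.mono_neutral_right)
    show "\<forall>i\<in>{..r} - {r}. fev (fps_of_poly (\<delta> i) * Psi s u r i) (\<theta> ^ (q ^ 1)) = 0"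
    proof
      fix i assume "i \<in> {..r} - {r}"
      hence i: "i < r" by auto
      thus "fev (fps_of_poly (\<delta> i) * Psi s u r i) (\<theta> ^ (q ^ 1)) = 0"
        using entire_Psi[OF assms(1), of i] fev_Psi_zero[OF assms(1) i assms(2), of 0] by (simp add: efev_mult)
    qed
  qed auto
  also have "\<dots> = poly (\<delta> r) (\<theta> ^ (q ^ 1)) * fev (Tser s u r) (\<theta> ^ (q ^ 1))"
    using entire_Tser[OF assms(1)] by (simp add: Psi_def efev_mult)
  also have "\<dots> = evA a ^ (q ^ 1) * fev (Tser s u r) \<theta> ^ (q ^ 1)"
    by (simp only: \<delta>r evA_pow_theta_qn Tser_theta_qN[OF assms(1,2)])
  finally have "evA p ^ q = (evA a * fev (Tser s u r) \<theta>) ^ q" by (simp add: power_mult_distrib)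
  thus ?thesis by (metis pow_q_eq_iff)
qed

text \<open>Take the largest k with p_k \<noteq> 0 and divide by the common power of \<Omega>. At
  \<theta>^(q^(n+1)) the terms below k vanish with \<Omega>, while T_k takes the nonzero value
  T_k(\<theta>)^(q^(n+1)); so p_k has infinitely many zeros.\<close>

lemma Psi_independent:
  assumes small: "small s u r" and s: "\<And>i. 1 \<le> i \<Longrightarrow> i \<le> r \<Longrightarrow> s i \<ge> 1"
    and nz: "\<And>j. j < r \<Longrightarrow> fev (Tser s u j) \<theta> \<noteq> 0"
    and rel: "(\<Sum>i<r. fps_of_poly (p i) * Psi s u r i) = 0" and "i < r"
  shows "p i = 0"
proof (rule ccontr)
  assume "p i \<noteq> 0"
  define S where "S = {i. i < r \<and> p i \<noteq> 0}"
  define k where "k = Max S"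
  have S: "finite S" "i \<in> S" using \<open>p i \<noteq> 0\<close> \<open>i < r\<close> by (auto simp: S_def)
  hence "k \<in> S" unfolding k_def by (intro Max_in) auto
  hence k: "k < r" "p k \<noteq> 0" by (auto simp: S_def)
  have zero: "p j = 0" if "k < j" "j < r" for j
  proof (rule ccontr)
    assume "p j \<noteq> 0"
    hence "j \<in> S" using that by (simp add: S_def)
    hence "j \<le> k" unfolding k_def by (rule Max_ge[OF S(1)])
    thus False using that by simp
  qed
  have w: "wt s r j = wt s k j + wt s r k" if "j \<le> k" for j
  proof -
    have "{Suc j..r} = {Suc j..k} \<union> {Suc k..r}" using that k by auto
    thus ?thesis unfolding wt_def by (subst sum.union_disjoint[symmetric]) auto
  qed
  define F where "F = (\<Sum>j\<le>k. fps_of_poly (p j) * (Omega ^ wt s k j * Tser s u j))"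
  have "0 = (\<Sum>j\<in>{..k}. fps_of_poly (p j) * Psi s u r j)"
    unfolding rel[symmetric] using k zero by (intro sum.mono_neutral_right) (auto simp: not_le)
  also have "\<dots> = (\<Sum>j\<le>k. Omega ^ wt s r k * (fps_of_poly (p j) * (Omega ^ wt s k j * Tser s u j)))"
  proof (intro sum.cong refl)
    fix j assume "j \<in> {..k}"
    hence jk: "j \<le> k" by simp
    show "fps_of_poly (p j) * Psi s u r j = Omega ^ wt s r k * (fps_of_poly (p j) * (Omega ^ wt s k j * Tser s u j))"
      unfolding Psi_def w[OF jk] power_add by (simp only: mult_ac)
  qed
  also have "\<dots> = Omega ^ wt s r k * F" by (simp only: F_def sum_distrib_left)
  finally have "F = 0" using Omega_theta_nonzero by auto
  have sk: "small s u j" if "j \<le> k" for j using small_mono[OF small] that k by simp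
  have "poly (p k) (\<theta> ^ (q ^ Suc n)) = 0" for n
  proof -
    have "0 = fev F (\<theta> ^ (q ^ Suc n))" unfolding \<open>F = 0\<close> using fev_const[of 0] by simp
    also have "\<dots> = (\<Sum>j\<le>k. fev (fps_of_poly (p j) * (Omega ^ wt s k j * Tser s u j)) (\<theta> ^ (q ^ Suc n)))"
      unfolding F_def by (intro efev_sum entire_mult entire_power entire_Omega entire_Tser sk) auto
    also have "\<dots> = (\<Sum>j\<in>{k}. fev (fps_of_poly (p j) * (Omega ^ wt s k j * Tser s u j)) (\<theta> ^ (q ^ Suc n)))"
    proof (rule sum.mono_neutral_right)
      show "\<forall>j\<in>{..k} - {k}. fev (fps_of_poly (p j) * (Omega ^ wt s k j * Tser s u j)) (\<theta> ^ (q ^ Suc n)) = 0"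
      proof
        fix j assume "j \<in> {..k} - {k}"
        hence j: "j < k" by auto
        have "wt s k j > 0" by (rule wt_pos[OF j]) (use s k in auto)
        thus "fev (fps_of_poly (p j) * (Omega ^ wt s k j * Tser s u j)) (\<theta> ^ (q ^ Suc n)) = 0" using sk[of j] j
          by (simp add: efev_mult entire_mult entire_power entire_Omega entire_Tser efev_power Omega_zero del: power_Suc)
      qed
    qed auto
    also have "\<dots> = poly (p k) (\<theta> ^ (q ^ Suc n)) * fev (Tser s u k) \<theta> ^ (q ^ Suc n)"
      using entire_Tser[OF sk[of k]] Tser_theta_qN[OF sk[of k], of "Suc n"] s k
      by (simp add: efev_mult del: power_Suc)
    finally have "poly (p k) (\<theta> ^ (q ^ Suc n)) * fev (Tser s u k) \<theta> ^ (q ^ Suc n) = 0" by (rule sym)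
    thus ?thesis using nz[OF k(1)] by simp
  qed
  hence "range (\<lambda>n. \<theta> ^ (q ^ Suc n)) \<subseteq> {x. poly (p k) x = 0}" by (intro image_subsetI CollectI)
  hence "finite (range (\<lambda>n. \<theta> ^ (q ^ Suc n)))" by (rule finite_subset) (rule poly_roots_finite[OF k(2)])
  moreover have "inj (\<lambda>n. \<theta> ^ (q ^ Suc n))" by (intro injI) (simp only: theta_qn_eq_iff nat.inject)
  ultimately have "finite (UNIV :: nat set)" by (rule finite_imageD)
  thus False by simp
qed

lemma cst_sum: "cst (sum f I) = (\<Sum>i\<in>I. cst (f i))"
  by (induction I rule: infinite_finite_induct) (auto simp: cst_add)

lemma map_poly_cst_mult: "map_poly cst (a * b) = map_poly cst a * map_poly cst b"
  by (rule poly_eqI) (simp add: coeff_map_poly coeff_mult cst_mult cst_sum)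

lemma twp_fixed_imp_cst:
  assumes "twp 1 p = p" shows "\<exists>a. p = map_poly cst a"
proof -
  have "tw 1 (fps_of_poly p) = fps_of_poly p" unfolding fps_of_twp[symmetric] assms ..
  from tw_fixed_imp_poly[OF this conv_poly] obtain a where "fps_of_poly p = fps_of_poly (map_poly cst a)" ..
  hence "p = map_poly cst a" unfolding fps_of_poly_eq_iff .
  thus ?thesis ..
qed

lemma bidiagonal_column_sum:
  fixes B :: "nat \<Rightarrow> nat \<Rightarrow> 'a::comm_ring_1"
  assumes "\<And>i j. i \<noteq> j \<Longrightarrow> i \<noteq> Suc j \<Longrightarrow> B i j = 0" "j \<le> r"
  shows "(\<Sum>i<Suc r. v i * B i j) = v j * B j j + (if j < r then v (Suc j) * B (Suc j) j else 0)"
proof -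
  have "(\<Sum>i<Suc r. v i * B i j) = (\<Sum>i\<in>(if j < r then {j, Suc j} else {j}). v i * B i j)"
    by (rule sum.mono_neutral_right) (use assms in auto)
  thus ?thesis by simp
qed

lemma bidiagonal_row_sum:
  fixes B :: "nat \<Rightarrow> nat \<Rightarrow> 'a::comm_ring_1"
  assumes "\<And>i j. i \<noteq> j \<Longrightarrow> i \<noteq> Suc j \<Longrightarrow> B i j = 0" "i \<le> r"
  shows "(\<Sum>j<Suc r. B i j * v j) = B i i * v i + (case i of 0 \<Rightarrow> 0 | Suc j \<Rightarrow> B i j * v j)"
proof (cases i)
  case 0
  have "(\<Sum>j<Suc r. B i j * v j) = (\<Sum>j\<in>{0}. B i j * v j)"
    by (rule sum.mono_neutral_right) (use assms 0 in auto)
  thus ?thesis using 0 by simp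
next
  case (Suc i')
  have "(\<Sum>j<Suc r. B i j * v j) = (\<Sum>j\<in>{i, i'}. B i j * v j)"
    by (rule sum.mono_neutral_right) (use assms Suc in auto)
  thus ?thesis using Suc by simp
qed

lemma twp_Lp_theta_nonzero: "poly (twp n (Lp ^ w)) \<theta> \<noteq> 0"
proof -
  have "\<theta> ^ (q ^ 0) \<noteq> \<theta> ^ (q ^ Suc n)" unfolding theta_qn_eq_iff by simp
  moreover have "(\<theta> ^ q) ^ (q ^ n) = \<theta> ^ (q ^ Suc n)" by (simp flip: power_mult)
  ultimately show ?thesis by (simp add: twp_power twp_pCons minus_pow_qn)
qed

lemma Kt_Lp: "Lp ^ w \<in> Kt" by (intro Kt_power Kt_pCons kbar_uminus subr_power[OF subr_kbar]) auto

lemma value_imp_dual_system: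
  assumes small: "small s u r" and s: "\<And>i. 1 \<le> i \<Longrightarrow> i \<le> r \<Longrightarrow> s i \<ge> 1"
    and u: "\<And>i. 1 \<le> i \<Longrightarrow> i \<le> r \<Longrightarrow> u i \<in> kbar \<iota>"
    and nz: "\<And>j. j < r \<Longrightarrow> fev (Tser s u j) \<theta> \<noteq> 0"
    and b: "b \<noteq> 0" and val: "evA b * fev (Tser s u r) \<theta> = evA c"
  shows "\<exists>a \<delta>. a \<noteq> 0 \<and> dual_system s u r a \<delta>"
proof -
  \<comment> \<open>Scales the last function, so that \<psi>_r = b T_r - c vanishes at \<theta> and
    the system keeps polynomial entries.\<close>
  define \<beta> where "\<beta> i = (if i = r then map_poly cst b else 1)" for i
  define \<psi> where "\<psi> i = fps_of_poly (\<beta> i) * Psi s u r i - (if i = r then fps_of_poly (map_poly cst c) else 0)" for i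
  define A where "A i j = (if i = j then Lp ^ wt s r i else if i = Suc j then \<beta> i * ([:u i:] * Lp ^ wt s r j) else 0)" for i j
  have A0: "A i j = 0" if "i \<noteq> j" "i \<noteq> Suc j" for i j using that by (simp add: A_def)
  have \<beta>K: "\<beta> i \<in> Kt" for i by (simp add: \<beta>_def Kt_cst)
  have AK: "A i j \<in> Kt" if "i < Suc r" for i j
    using that u[of i] by (auto simp: A_def intro!: Kt_mult \<beta>K Kt_Lp Kt_pCons Kt_smult)
  have \<psi>_less: "\<psi> i = Psi s u r i" if "i < r" for i using that by (simp add: \<psi>_def \<beta>_def)
  have ent: "entire (\<psi> i)" if "i < Suc r" for i
    unfolding \<psi>_def using that by (intro entire_diff entire_mult entire_poly entire_Psi[OF small]) auto
  have tw\<psi>: "tw 1 (\<psi> i) = fps_of_poly (\<beta> i) * tw 1 (Psi s u r i) - (if i = r then fps_of_poly (map_poly cst c) else 0)" for i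
    by (simp add: \<psi>_def \<beta>_def tw_diff tw_mult twp_const_cst flip: fps_of_twp)
  have eq: "\<psi> i = (\<Sum>j<Suc r. fps_of_poly (A i j) * tw 1 (\<psi> j))" if i: "i < Suc r" for i
  proof -
    have sum: "(\<Sum>j<Suc r. fps_of_poly (A i j) * tw 1 (\<psi> j)) = fps_of_poly (A i i) * tw 1 (\<psi> i) +
        (case i of 0 \<Rightarrow> 0 | Suc j \<Rightarrow> fps_of_poly (A i j) * tw 1 (\<psi> j))"
      by (rule bidiagonal_row_sum) (use A0 i in auto)
    have diag: "fps_of_poly (A i i) * tw 1 (\<psi> i) = fps_of_poly (\<beta> i) * (fps_of_poly (Lp ^ wt s r i) * tw 1 (Psi s u r i))
        - (if i = r then fps_of_poly (map_poly cst c) else 0)"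
      unfolding tw\<psi> A_def by (cases "i = r") (simp_all add: right_diff_distrib mult.left_commute)
    show ?thesis
    proof (cases i)
      case 0
      show ?thesis unfolding sum diag using Psi_0[of s u r] by (simp add: 0 \<psi>_def)
    next
      case (Suc j)
      hence j: "j < r" using i by simp
      have "fps_of_poly (A i j) * tw 1 (\<psi> j) = fps_of_poly (\<beta> i) * (fps_of_poly ([:u (Suc j):] * Lp ^ wt s r j) * tw 1 (Psi s u r j))"
        unfolding \<psi>_less[OF j] by (simp add: A_def Suc fps_of_poly_mult mult.assoc)
      moreover have "\<psi> i = fps_of_poly (\<beta> i) * (fps_of_poly (Lp ^ wt s r i) * tw 1 (Psi s u r i))
          + fps_of_poly (\<beta> i) * (fps_of_poly ([:u (Suc j):] * Lp ^ wt s r j) * tw 1 (Psi s u r j))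
          - (if i = r then fps_of_poly (map_poly cst c) else 0)"
        unfolding \<psi>_def Suc by (subst Psi_Suc[OF small j]) (simp only: distrib_left)
      ultimately show ?thesis unfolding sum diag by (simp add: Suc)
    qed
  qed
  define Rl where "Rl p \<longleftrightarrow> (\<forall>i<Suc r. p i \<in> Kt) \<and> (\<Sum>i<Suc r. fps_of_poly (p i) * \<psi> i) = 0" for p
  \<comment> \<open>A relation that omits \<psi>_r is trivial, so the last coefficient controls the
    whole relation.\<close>
  have Rl0: "p i = 0" if p: "Rl p" "p r = 0" and i: "i < Suc r" for p i
  proof (cases "i = r")
    case False
    have "(\<Sum>i<r. fps_of_poly (p i) * Psi s u r i) = 0" using p by (simp add: Rl_def \<psi>_less)
    moreover have "i < r" using i False by simp
    ultimately show ?thesis by (intro Psi_independent[of s u r p i] small s nz)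
  qed (use p in simp)
  have "\<exists>p. Rl p \<and> p r \<noteq> 0"
  proof (rule ccontr)
    assume "\<not> ?thesis"
    hence Rlr: "Rl p \<Longrightarrow> p r = 0" for p by blast
    \<comment> \<open>The given relation is \<psi>_r(\<theta>) = 0, hence P is the last unit vector
      and n0 = 0. The matrix is triangular with powers of t - \<theta>^q on the diagonal, whose
      twists never vanish at \<theta>; this yields \<open>ns\<close>.\<close>
    have "abp_data \<iota> (Suc r) \<psi> 1 A 0 (\<lambda>i. if i = r then 1 else 0)"
    proof (unfold_locales, goal_cases)
      case (1 i) thus ?case by (rule ent)
    next
      case (2 p i)
      hence "Rl p" by (simp add: Rl_def)
      thus ?case using Rl0 Rlr 2(3) by blast
    next
      case 3 show ?case by simp
    next
      case (4 i j) thus ?case by (intro AK)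
    next
      case (5 i)
      have "fps_of_poly 1 * \<psi> i = \<psi> i" by simp
      also note eq[OF 5]
      finally show ?case .
    next
      case (6 n v i)
      have rec: "v j * poly (twp n (Lp ^ wt s r j)) \<theta> + (if j < r then v (Suc j) * poly (twp n (A (Suc j) j)) \<theta> else 0) = 0"
        if "j \<le> r" for j
        using bidiagonal_column_sum[of "\<lambda>i j. poly (twp n (A i j)) \<theta>" j r v] A0 that 6(2)[of j]
        by (simp add: A_def)
      have "v j = 0" if "j \<le> r" for j using that
      proof (induction rule: inc_induct)
        case base
        show ?case using rec[of r] twp_Lp_theta_nonzero[of n 0] by simp
      next
        case (step j)
        thus ?case using rec[of j] twp_Lp_theta_nonzero[of n "wt s r j"] by simp
      qed
      thus ?case using 6(3) by simp
    next
      case (7 i) show ?case by simp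
    next
      case 8 show ?case by (intro exI[of _ r]) auto
    next
      case 9
      have "(\<Sum>i<Suc r. (if i = r then 1 else 0) * fev (tw 0 (\<psi> i)) \<theta>) = fev (\<psi> r) \<theta>"
        by (subst sum.mono_neutral_right[of _ "{r}"]) auto
      also have "\<dots> = evA b * fev (Tser s u r) \<theta> - evA c" unfolding \<psi>_def using entire_Tser[OF small]
        by (simp add: efev_diff efev_mult Psi_def \<beta>_def entire_mult evA_def)
      finally show ?case using val by simp
    qed
    thus False using abp_vanishing by blast
  qed
  hence ex: "\<exists>p. Rl p \<and> p r \<noteq> 0" .
  obtain p0 where p0: "Rl p0 \<and> p0 r \<noteq> 0"
    and least: "\<And>p. Rl p \<and> p r \<noteq> 0 \<Longrightarrow> degree (p0 r) \<le> degree (p r)"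
    using ex_has_least_nat[of "\<lambda>p. Rl p \<and> p r \<noteq> 0" _ "\<lambda>p. degree (p r)"] ex by blast
  define k where "k = inverse (lead_coeff (p0 r))"
  define p where "p i = Polynomial.smult k (p0 i)" for i
  have k: "k \<noteq> 0" "k \<in> kbar \<iota>" using p0 by (auto simp: k_def Rl_def intro!: kbar_inverse Kt_coeff)
  have p: "Rl p"
    using p0 k by (auto simp: Rl_def p_def fps_of_poly_smult mult.assoc sum_distrib_left[symmetric] intro!: Kt_smult simp del: sum.lessThan_Suc)
  have mon: "lead_coeff (p r) = 1" "degree (p r) = degree (p0 r)" using p0 k by (auto simp: p_def k_def)
  \<comment> \<open>From \<psi> = A \<psi>^(1), the relation p gives p A as a relation of
    \<psi>^(1), and untwisting returns a relation p' of \<psi>.\<close>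
  define p' where "p' j = untw (\<Sum>i<Suc r. p i * A i j)" for j
  have pA: "(\<Sum>i<Suc r. p i * A i j) \<in> Kt" for j using p by (intro Kt_sum Kt_mult AK) (auto simp: Rl_def)
  have p'K: "p' j \<in> Kt" and p'tw: "twp 1 (p' j) = (\<Sum>i<Suc r. p i * A i j)" for j
    unfolding p'_def using pA by (rule untw)+
  have col: "(\<Sum>i<Suc r. p i * A i j) = p j * A j j + (if j < r then p (Suc j) * A (Suc j) j else 0)" if "j \<le> r" for j
    by (rule bidiagonal_column_sum) (use A0 that in auto)
  have p'r: "twp 1 (p' r) = p r" unfolding p'tw using col[of r] by (simp add: A_def)
  have Rlp': "Rl p'"
  proof -
    have "tw 1 (\<Sum>j<Suc r. fps_of_poly (p' j) * \<psi> j) = (\<Sum>j<Suc r. fps_of_poly (twp 1 (p' j)) * tw 1 (\<psi> j))"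
      unfolding tw_sum tw_mult fps_of_twp ..
    also have "\<dots> = (\<Sum>j<Suc r. \<Sum>i<Suc r. fps_of_poly (p i) * (fps_of_poly (A i j) * tw 1 (\<psi> j)))"
      unfolding p'tw by (intro sum.cong refl) (simp only: fps_of_poly_sum fps_of_poly_mult sum_distrib_right mult.assoc)
    also have "\<dots> = (\<Sum>i<Suc r. fps_of_poly (p i) * (\<Sum>j<Suc r. fps_of_poly (A i j) * tw 1 (\<psi> j)))"
      by (subst sum.swap) (simp only: sum_distrib_left)
    also have "\<dots> = (\<Sum>i<Suc r. fps_of_poly (p i) * \<psi> i)"
    proof (intro sum.cong refl)
      fix i assume "i \<in> {..<Suc r}"
      hence "i < Suc r" by simp
      show "fps_of_poly (p i) * (\<Sum>j<Suc r. fps_of_poly (A i j) * tw 1 (\<psi> j)) = fps_of_poly (p i) * \<psi> i"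
        unfolding eq[OF \<open>i < Suc r\<close>, symmetric] ..
    qed
    also have "\<dots> = 0" using p by (simp add: Rl_def)
    finally have "(\<Sum>j<Suc r. fps_of_poly (p' j) * \<psi> j) = 0" by (simp only: tw_eq_0_iff)
    thus ?thesis using p'K by (simp add: Rl_def)
  qed
  \<comment> \<open>Both last coefficients are monic of the same degree, so their difference has
    smaller degree and must vanish by the choice of p0. By \<open>Rl0\<close> the whole difference
    vanishes.\<close>
  define e where "e i = p i - p' i" for i
  have Rle: "Rl e"
  proof -
    have "(\<Sum>i<Suc r. fps_of_poly (e i) * \<psi> i) = (\<Sum>i<Suc r. fps_of_poly (p i) * \<psi> i) - (\<Sum>i<Suc r. fps_of_poly (p' i) * \<psi> i)"
      unfolding e_def fps_of_poly_diff left_diff_distrib by (rule sum_subtractf)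
    thus ?thesis using p Rlp' p'K unfolding Rl_def e_def by (auto intro: Kt_diff)
  qed
  have "e r = 0"
  proof (rule ccontr)
    assume er: "e r \<noteq> 0"
    define D where "D = degree (p r)"
    have D': "degree (p' r) = D" unfolding D_def p'r[symmetric] by (rule degree_twp[symmetric])
    have "coeff (p' r) D ^ (q ^ 1) = 1 ^ (q ^ 1)"
      using mon(1) twp_coeff[of 1 "p' r" D] unfolding p'r by (simp add: D_def)
    hence "coeff (p' r) D = 1" unfolding pow_qn_eq_iff .
    hence c0: "coeff (e r) D = 0" using mon(1) by (simp add: e_def D_def)
    have "degree (e r) \<le> D" unfolding e_def by (rule degree_diff_le) (auto simp: D_def D'[unfolded D_def])
    moreover have "degree (e r) \<noteq> D" using c0 er leading_coeff_0_iff by blast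
    ultimately have "degree (e r) < degree (p0 r)" using mon(2) by (simp add: D_def)
    thus False using least[of e] Rle er by linarith
  qed
  hence e0: "p i = p' i" if "i < Suc r" for i using Rl0[OF Rle _ that] by (simp add: e_def)
  have "twp 1 (p r) = p r" using p'r e0[of r] by simp
  then obtain a' where a': "p r = map_poly cst a'" using twp_fixed_imp_cst by blast
  define \<delta> where "\<delta> i = \<beta> i * p i" for i
  have "dual_system s u r (b * a') \<delta>" unfolding dual_system_def
  proof (intro conjI allI impI)
    show "\<delta> r = map_poly cst (b * a')" by (simp add: \<delta>_def \<beta>_def a' map_poly_cst_mult)
    fix j assume j: "j < r"
    show "\<delta> j \<in> Kt" using p j by (auto simp: \<delta>_def Rl_def intro!: Kt_mult \<beta>K)
    have "twp 1 (p j) = p j * A j j + p (Suc j) * A (Suc j) j" using p'tw[of j] col[of j] e0[of j] j by simp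
    also have "\<dots> = Lp ^ wt s r j * (\<delta> j + [:u (Suc j):] * \<delta> (Suc j))"
      using j by (simp only: A_def \<delta>_def if_True distrib_left) (simp add: \<beta>_def mult_ac)
    finally show "twp 1 (\<delta> j) = Lp ^ wt s r j * (\<delta> j + [:u (Suc j):] * \<delta> (Suc j))"
      using j by (simp add: \<delta>_def \<beta>_def)
  qed
  moreover have "b * a' \<noteq> 0"
  proof -
    have "p r \<noteq> 0" using mon(1) by force
    thus ?thesis using b a' by auto
  qed
  ultimately show ?thesis by blast
qed

lemma field_k_mult_evA_iff:
  assumes "a \<noteq> 0" shows "evA a * x \<in> field_k \<iota> \<longleftrightarrow> x \<in> field_k \<iota>"
proof
  assume "x \<in> field_k \<iota>"
  then obtain b c where "b \<noteq> 0" "evA b * x = evA c" by (auto simp: field_k_iff')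
  hence "evA b * (evA a * x) = evA (a * c)" by (simp add: evA_mult mult.left_commute)
  thus "evA a * x \<in> field_k \<iota>" unfolding field_k_iff' using \<open>b \<noteq> 0\<close> by blast
next
  assume "evA a * x \<in> field_k \<iota>"
  then obtain b c where "b \<noteq> 0" "evA b * (evA a * x) = evA c" by (auto simp: field_k_iff')
  hence "evA (a * b) * x = evA c" "a * b \<noteq> 0" using assms by (simp_all add: evA_mult mult_ac)
  thus "x \<in> field_k \<iota>" unfolding field_k_iff' by blast
qed

lemma sum_list_seg: "sum_list (seg s 1 r) = (\<Sum>l<r. s (Suc l))"
proof -
  have "sum_list (seg s 1 r) = (\<Sum>l = 1..<Suc r. s l)"
    unfolding seg_def by (simp only: interv_sum_list_conv_sum_set_nat set_upt)
  also have "\<dots> = (\<Sum>l<r. s (Suc l))" by (simp only: One_nat_def sum.shift_bounds_Suc_ivl lessThan_atLeast0)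
  finally show ?thesis .
qed

lemma Li_quotient_iff:
  assumes "fundamental_period \<iota> \<pi>" "small s u r"
  shows "Li \<iota> (seg s 1 r) (seg u 1 r) / \<pi> ^ sum_list (seg s 1 r) \<in> field_k \<iota> \<longleftrightarrow> fev (Tser s u r) \<theta> \<in> field_k \<iota>"
proof -
  define w where "w = (\<Sum>l<r. s (Suc l))"
  obtain p where p: "p \<noteq> 0" "\<pi> * fev Omega \<theta> = evA p" using period_Omega[OF assms(1)] by blast
  have \<pi>: "\<pi> \<noteq> 0" using assms(1) by (rule period_nonzero)
  have pw: "evA (p ^ w) = evA p ^ w" for w by (induction w) (auto simp: evA_mult)
  have "fev (Tser s u r) \<theta> = (evA p / \<pi>) ^ w * Li \<iota> (seg s 1 r) (seg u 1 r)"
    unfolding Li_eq[OF assms(2)] p(2)[symmetric] w_def using \<pi> by simp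
  hence "fev (Tser s u r) \<theta> = evA (p ^ w) * (Li \<iota> (seg s 1 r) (seg u 1 r) / \<pi> ^ w)"
    by (simp add: pw power_divide)
  thus ?thesis unfolding sum_list_seg w_def[symmetric] using field_k_mult_evA_iff[of "p ^ w"] p(1) by (simp del: times_divide_eq_right)
qed

lemma value_in_k_iff:
  assumes "small s u r" "\<And>i. 1 \<le> i \<Longrightarrow> i \<le> r \<Longrightarrow> s i \<ge> 1"
    and "\<And>i. 1 \<le> i \<Longrightarrow> i \<le> r \<Longrightarrow> u i \<in> kbar \<iota>"
    and "\<And>j. j < r \<Longrightarrow> fev (Tser s u j) \<theta> \<noteq> 0"
  shows "fev (Tser s u r) \<theta> \<in> field_k \<iota> \<longleftrightarrow> (\<exists>a \<delta>. a \<noteq> 0 \<and> dual_system s u r a \<delta>)"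
proof
  assume "fev (Tser s u r) \<theta> \<in> field_k \<iota>"
  then obtain b c where "b \<noteq> 0" "evA b * fev (Tser s u r) \<theta> = evA c" by (auto simp: field_k_iff')
  thus "\<exists>a \<delta>. a \<noteq> 0 \<and> dual_system s u r a \<delta>" by (intro value_imp_dual_system assms)
next
  assume "\<exists>a \<delta>. a \<noteq> 0 \<and> dual_system s u r a \<delta>"
  then obtain a \<delta> where a: "a \<noteq> 0" "dual_system s u r a \<delta>" by blast
  have "\<exists>p. evA a * fev (Tser s u r) \<theta> = evA p"
    by (rule dual_system_imp_value[OF assms(1) _ a(2)]) (rule assms(2))
  thus "fev (Tser s u r) \<theta> \<in> field_k \<iota>" using a(1) by (auto simp: field_k_iff')
qed

text \<open>The exponent \<open>wt\<close> at c only sees indices above c, so what remains after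
  dropping the first p equations is the dual system of the segment.\<close>

lemma dual_system_shift:
  assumes "dual_system s u (p + k) a \<delta>"
  shows "dual_system (\<lambda>i. s (p + i)) (\<lambda>i. u (p + i)) k a (\<lambda>c. \<delta> (p + c))"
proof -
  have "wt (\<lambda>i. s (p + i)) k c = wt s (p + k) (p + c)" for c
    unfolding wt_def using sum.shift_bounds_cl_nat_ivl[of s "Suc c" p k] by (simp add: add.commute)
  thus ?thesis using assms by (simp add: dual_system_def)
qed

lemma kbar_t_simps [simp]:
  "carrier (kbar_t \<iota>) = Kt" "\<zero>\<^bsub>kbar_t \<iota>\<^esub> = 0" "\<one>\<^bsub>kbar_t \<iota>\<^esub> = 1"
  "x \<oplus>\<^bsub>kbar_t \<iota>\<^esub> y = x + y" "x \<otimes>\<^bsub>kbar_t \<iota>\<^esub> y = x * y"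
  by (simp_all add: kbar_t_def ring_of_type_algebra_def)

lemma Fq_t_simps [simp]:
  "carrier (Fq_t \<iota>) = range (map_poly cst)" "\<zero>\<^bsub>Fq_t \<iota>\<^esub> = 0"
  by (simp_all add: Fq_t_def ring_of_type_algebra_def polys_over_Fq)

lemma cring_kbar_t: "cring (kbar_t \<iota>)"
proof (rule cringI)
  show "abelian_group (kbar_t \<iota>)"
  proof (rule abelian_groupI)
    fix x assume "x \<in> carrier (kbar_t \<iota>)"
    thus "\<exists>y\<in>carrier (kbar_t \<iota>). y \<oplus>\<^bsub>kbar_t \<iota>\<^esub> x = \<zero>\<^bsub>kbar_t \<iota>\<^esub>"
      by (intro bexI[of _ "- x"]) (auto intro: Kt_uminus)
  qed (auto intro: Kt_add simp: algebra_simps)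
  show "Group.comm_monoid (kbar_t \<iota>)" by unfold_locales (auto intro: Kt_mult simp: algebra_simps)
qed (auto simp: algebra_simps)

section \<open>Frobenius modules\<close>

lemma qroot_pow: assumes "x \<in> kbar \<iota>" shows "qroot \<iota> x ^ q = x" "qroot \<iota> x \<in> kbar \<iota>"
proof -
  obtain y where y: "y \<in> kbar \<iota>" "y ^ q = x" using kbar_root[OF assms, of 1] by auto
  have "qroot \<iota> x = y" unfolding qroot_def q_of_def[symmetric, where \<iota> = \<iota>]
    using y(2) pow_q_eq_iff by (intro the_equality) (auto simp: card_eq_q)
  thus "qroot \<iota> x ^ q = x" "qroot \<iota> x \<in> kbar \<iota>" using y by simp_all
qed

lemma qroot_0 [simp]: "qroot \<iota> 0 = 0" using qroot_pow(1)[of 0] q_gt_1 by simp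

lemma twp_twist: "f \<in> Kt \<Longrightarrow> twp 1 (twist \<iota> f) = f"
  by (rule poly_eqI) (simp add: twist_def coeff_map_poly qroot_pow Kt_coeff)

lemma twist_K [simp]: "f \<in> Kt \<Longrightarrow> twist \<iota> f \<in> Kt"
  by (simp add: twist_def polys_over_def coeff_map_poly qroot_pow)

text \<open>Facts about \<open>twist\<close> are transferred from \<open>twp 1\<close>, which is
  defined for all polynomials and whose inverse it is on kbar[t].\<close>

lemma twist_eqI: "f \<in> Kt \<Longrightarrow> twp 1 g = f \<Longrightarrow> twist \<iota> f = g"
  using twp_twist[of f] twp_eq_iff[of 1 "twist \<iota> f" g] by (simp del: twp_eq_iff)

lemma twist_add: "f \<in> Kt \<Longrightarrow> g \<in> Kt \<Longrightarrow> twist \<iota> (f + g) = twist \<iota> f + twist \<iota> g"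
  by (intro twist_eqI Kt_add) (simp_all only: twp_add twp_twist)
lemma twist_mult: "f \<in> Kt \<Longrightarrow> g \<in> Kt \<Longrightarrow> twist \<iota> (f * g) = twist \<iota> f * twist \<iota> g"
  by (intro twist_eqI Kt_mult) (simp_all only: twp_mult twp_twist)
lemma twist_0 [simp]: "twist \<iota> 0 = 0" by (intro twist_eqI) auto
lemma twist_1 [simp]: "twist \<iota> 1 = 1" by (intro twist_eqI) auto
lemma twist_cst [simp]: "twist \<iota> (map_poly cst a) = map_poly cst a" by (intro twist_eqI Kt_cst twp_const_cst)

subsection \<open>Linear combinations\<close>

definition lin :: "('c poly, 'm) frob_module \<Rightarrow> ('c poly, 'n) frob_module \<Rightarrow> ('m \<Rightarrow> 'n) \<Rightarrow> bool"
  where "lin M N f \<longleftrightarrow> f \<in> carrier M \<rightarrow> carrier N \<and>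
    (\<forall>x\<in>carrier M. \<forall>y\<in>carrier M. f (x \<oplus>\<^bsub>M\<^esub> y) = f x \<oplus>\<^bsub>N\<^esub> f y) \<and>
    (\<forall>a\<in>Kt. \<forall>x\<in>carrier M. f (a \<odot>\<^bsub>M\<^esub> x) = a \<odot>\<^bsub>N\<^esub> f x)"

lemma frob_hom_iff: "frob_hom \<iota> M N f \<longleftrightarrow> lin M N f \<and> (\<forall>x\<in>carrier M. f (frob M x) = frob N (f x))"
  by (auto simp: frob_hom_def lin_def)

lemma lin_closed: "lin M N f \<Longrightarrow> x \<in> carrier M \<Longrightarrow> f x \<in> carrier N"
  by (auto simp: lin_def)

definition kmod :: "('c poly, 'm) frob_module \<Rightarrow> bool" where "kmod M \<longleftrightarrow> module (kbar_t \<iota>) M"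

lemma lin_comb_0 [simp]: "kmod M \<Longrightarrow> lin_comb M 0 y c = \<zero>\<^bsub>M\<^esub>"
proof -
  assume "kmod M"
  then interpret module "kbar_t \<iota>" M by (simp add: kmod_def)
  show ?thesis by (simp add: lin_comb_def)
qed

lemma lin_comb_closed [intro]:
  assumes "kmod M" "\<And>i. i < n \<Longrightarrow> y i \<in> carrier M" "\<And>i. i < n \<Longrightarrow> c i \<in> Kt"
  shows "lin_comb M n y c \<in> carrier M"
proof -
  interpret module "kbar_t \<iota>" M using assms(1) by (simp add: kmod_def)
  show ?thesis unfolding lin_comb_def using assms by (intro M.finsum_closed) auto
qed

lemma lin_comb_Suc:
  assumes "kmod M" "\<And>i. i < Suc n \<Longrightarrow> y i \<in> carrier M" "\<And>i. i < Suc n \<Longrightarrow> c i \<in> Kt"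
  shows "lin_comb M (Suc n) y c = lin_comb M n y c \<oplus>\<^bsub>M\<^esub> c n \<odot>\<^bsub>M\<^esub> y n"
proof -
  interpret module "kbar_t \<iota>" M using assms(1) by (simp add: kmod_def)
  have "lin_comb M (Suc n) y c = c n \<odot>\<^bsub>M\<^esub> y n \<oplus>\<^bsub>M\<^esub> lin_comb M n y c"
    unfolding lin_comb_def lessThan_Suc using assms by (intro M.finsum_insert) auto
  thus ?thesis using assms by (simp add: M.a_comm lin_comb_closed)
qed

lemma lin_comb_cong:
  assumes "\<And>i. i < n \<Longrightarrow> y i = y' i" "\<And>i. i < n \<Longrightarrow> c i = c' i"
    and "kmod M" "\<And>i. i < n \<Longrightarrow> y i \<in> carrier M" "\<And>i. i < n \<Longrightarrow> c i \<in> Kt"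
  shows "lin_comb M n y c = lin_comb M n y' c'" using assms
proof (induction n)
  case (Suc n)
  have "lin_comb M (Suc n) y c = lin_comb M n y c \<oplus>\<^bsub>M\<^esub> c n \<odot>\<^bsub>M\<^esub> y n"
    by (rule lin_comb_Suc) (use Suc.prems in auto)
  moreover have "lin_comb M (Suc n) y' c' = lin_comb M n y' c' \<oplus>\<^bsub>M\<^esub> c' n \<odot>\<^bsub>M\<^esub> y' n"
    by (rule lin_comb_Suc) (use Suc.prems in force)+
  moreover have "lin_comb M n y c = lin_comb M n y' c'" by (rule Suc.IH) (use Suc.prems in auto)
  ultimately show ?case using Suc.prems(1,2)[of n] by simp
qed (simp)

lemma lin_lin_comb:
  assumes "kmod M" "kmod N" "lin M N f"
    and "\<And>i. i < n \<Longrightarrow> y i \<in> carrier M" "\<And>i. i < n \<Longrightarrow> c i \<in> Kt"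
  shows "f (lin_comb M n y c) = lin_comb N n (\<lambda>i. f (y i)) c" using assms(4,5)
proof (induction n)
  case 0
  interpret M: module "kbar_t \<iota>" M using assms(1) by (simp add: kmod_def)
  interpret N: module "kbar_t \<iota>" N using assms(2) by (simp add: kmod_def)
  have "f (0 \<odot>\<^bsub>M\<^esub> \<zero>\<^bsub>M\<^esub>) = 0 \<odot>\<^bsub>N\<^esub> f \<zero>\<^bsub>M\<^esub>"
    using assms(3) M.zero_closed Kt_0 unfolding lin_def by blast
  moreover have "0 \<odot>\<^bsub>M\<^esub> \<zero>\<^bsub>M\<^esub> = \<zero>\<^bsub>M\<^esub>" using M.smult_l_null[of "\<zero>\<^bsub>M\<^esub>"] by simp
  moreover have "0 \<odot>\<^bsub>N\<^esub> f \<zero>\<^bsub>M\<^esub> = \<zero>\<^bsub>N\<^esub>"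
    using N.smult_l_null[of "f \<zero>\<^bsub>M\<^esub>"] lin_closed[OF assms(3) M.zero_closed] by simp
  ultimately show ?case using assms(1,2) by simp
next
  case (Suc n)
  interpret M: module "kbar_t \<iota>" M using assms(1) by (simp add: kmod_def)
  have cl: "lin_comb M n y c \<in> carrier M" "c n \<odot>\<^bsub>M\<^esub> y n \<in> carrier M"
    using Suc.prems assms(1) by (auto intro!: lin_comb_closed)
  have "f (lin_comb M (Suc n) y c) = f (lin_comb M n y c) \<oplus>\<^bsub>N\<^esub> f (c n \<odot>\<^bsub>M\<^esub> y n)"
    using lin_comb_Suc[OF assms(1) Suc.prems] assms(3) cl by (simp add: lin_def)
  also have "f (c n \<odot>\<^bsub>M\<^esub> y n) = c n \<odot>\<^bsub>N\<^esub> f (y n)" using assms(3) Suc.prems by (simp add: lin_def)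
  also have "f (lin_comb M n y c) = lin_comb N n (\<lambda>i. f (y i)) c" by (rule Suc.IH) (use Suc.prems in auto)
  also have "lin_comb N n (\<lambda>i. f (y i)) c \<oplus>\<^bsub>N\<^esub> c n \<odot>\<^bsub>N\<^esub> f (y n) = lin_comb N (Suc n) (\<lambda>i. f (y i)) c"
    using Suc.prems lin_closed[OF assms(3)] by (intro lin_comb_Suc[symmetric] assms(2)) auto
  finally show ?case .
qed

lemma lin_comb_add:
  assumes "kmod M" "\<And>i. i < n \<Longrightarrow> y i \<in> carrier M" "\<And>i. i < n \<Longrightarrow> c i \<in> Kt" "\<And>i. i < n \<Longrightarrow> d i \<in> Kt"
  shows "lin_comb M n y (\<lambda>i. c i + d i) = lin_comb M n y c \<oplus>\<^bsub>M\<^esub> lin_comb M n y d"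
proof -
  interpret M: module "kbar_t \<iota>" M using assms(1) by (simp add: kmod_def)
  have "lin_comb M n y (\<lambda>i. c i + d i) = (\<Oplus>\<^bsub>M\<^esub>i\<in>{..<n}. c i \<odot>\<^bsub>M\<^esub> y i \<oplus>\<^bsub>M\<^esub> d i \<odot>\<^bsub>M\<^esub> y i)"
    unfolding lin_comb_def using assms M.smult_l_distr by (intro M.finsum_cong') (auto intro!: M.a_closed)
  also have "\<dots> = lin_comb M n y c \<oplus>\<^bsub>M\<^esub> lin_comb M n y d"
    unfolding lin_comb_def using assms by (intro M.finsum_addf) auto
  finally show ?thesis .
qed

lemma lin_comb_smult:
  assumes "kmod M" "\<And>i. i < n \<Longrightarrow> y i \<in> carrier M" "\<And>i. i < n \<Longrightarrow> c i \<in> Kt" "a \<in> Kt"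
  shows "lin_comb M n y (\<lambda>i. a * c i) = a \<odot>\<^bsub>M\<^esub> lin_comb M n y c"
proof -
  interpret M: module "kbar_t \<iota>" M using assms(1) by (simp add: kmod_def)
  have "lin_comb M n y (\<lambda>i. a * c i) = (\<Oplus>\<^bsub>M\<^esub>i\<in>{..<n}. a \<odot>\<^bsub>M\<^esub> (c i \<odot>\<^bsub>M\<^esub> y i))"
    unfolding lin_comb_def using assms M.smult_assoc1[of a] by (intro M.finsum_cong') (auto intro!: M.smult_closed)
  also have "\<dots> = a \<odot>\<^bsub>M\<^esub> lin_comb M n y c"
    unfolding lin_comb_def using assms by (intro M.finsum_smult_ldistr[symmetric]) auto
  finally show ?thesis .
qed

lemma lin_comb_unit:
  assumes "kmod M" "\<And>i. i < n \<Longrightarrow> y i \<in> carrier M" "i < n"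
  shows "lin_comb M n y (\<lambda>j. if j = i then 1 else 0) = y i"
proof -
  interpret M: module "kbar_t \<iota>" M using assms(1) by (simp add: kmod_def)
  have "lin_comb M n y (\<lambda>j. if j = i then 1 else 0) = (\<Oplus>\<^bsub>M\<^esub>j\<in>{..<n}. if i = j then y j else \<zero>\<^bsub>M\<^esub>)"
    unfolding lin_comb_def using assms M.smult_one M.smult_l_null by (intro M.finsum_cong') auto
  also have "\<dots> = y i" using assms by (intro M.finsum_singleton) auto
  finally show ?thesis .
qed

subsection \<open>Coordinates\<close>

lemma frobenius_module_kmod: "frobenius_module \<iota> M \<Longrightarrow> kmod M"
  by (simp add: frobenius_module_def kmod_def)

lemma frob_add: "frobenius_module \<iota> M \<Longrightarrow> x \<in> carrier M \<Longrightarrow> y \<in> carrier M \<Longrightarrow>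
    frob M (x \<oplus>\<^bsub>M\<^esub> y) = frob M x \<oplus>\<^bsub>M\<^esub> frob M y"
  and frob_smult: "frobenius_module \<iota> M \<Longrightarrow> f \<in> Kt \<Longrightarrow> x \<in> carrier M \<Longrightarrow>
    frob M (f \<odot>\<^bsub>M\<^esub> x) = twist \<iota> f \<odot>\<^bsub>M\<^esub> frob M x"
  and frob_closed: "frobenius_module \<iota> M \<Longrightarrow> x \<in> carrier M \<Longrightarrow> frob M x \<in> carrier M"
  by (auto simp: frobenius_module_def)

lemma frob_lin_comb:
  assumes "frobenius_module \<iota> M" "\<And>i. i < n \<Longrightarrow> y i \<in> carrier M" "\<And>i. i < n \<Longrightarrow> c i \<in> Kt"
  shows "frob M (lin_comb M n y c) = lin_comb M n (\<lambda>i. frob M (y i)) (\<lambda>i. twist \<iota> (c i))"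
  using assms(2,3)
proof (induction n)
  case 0
  have k: "kmod M" using assms(1) by (rule frobenius_module_kmod)
  interpret M: module "kbar_t \<iota>" M using k by (simp add: kmod_def)
  have "frob M (0 \<odot>\<^bsub>M\<^esub> \<zero>\<^bsub>M\<^esub>) = twist \<iota> 0 \<odot>\<^bsub>M\<^esub> frob M \<zero>\<^bsub>M\<^esub>"
    using frob_smult[OF assms(1) Kt_0 M.zero_closed] .
  moreover have "0 \<odot>\<^bsub>M\<^esub> \<zero>\<^bsub>M\<^esub> = \<zero>\<^bsub>M\<^esub>" using M.smult_l_null[of "\<zero>\<^bsub>M\<^esub>"] by simp
  moreover have "0 \<odot>\<^bsub>M\<^esub> frob M \<zero>\<^bsub>M\<^esub> = \<zero>\<^bsub>M\<^esub>"
    using M.smult_l_null[of "frob M \<zero>\<^bsub>M\<^esub>"] frob_closed[OF assms(1) M.zero_closed] by simp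
  ultimately show ?case using k by simp
next
  case (Suc n)
  have k: "kmod M" using assms(1) by (rule frobenius_module_kmod)
  interpret M: module "kbar_t \<iota>" M using k by (simp add: kmod_def)
  have cl: "lin_comb M n y c \<in> carrier M" "c n \<odot>\<^bsub>M\<^esub> y n \<in> carrier M"
    using Suc.prems k by (auto intro!: lin_comb_closed)
  have "frob M (lin_comb M (Suc n) y c) = frob M (lin_comb M n y c) \<oplus>\<^bsub>M\<^esub> twist \<iota> (c n) \<odot>\<^bsub>M\<^esub> frob M (y n)"
    using lin_comb_Suc[OF k Suc.prems] frob_add[OF assms(1) cl] frob_smult[OF assms(1), of "c n" "y n"] Suc.prems by simp
  also have "frob M (lin_comb M n y c) = lin_comb M n (\<lambda>i. frob M (y i)) (\<lambda>i. twist \<iota> (c i))"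
    by (rule Suc.IH) (use Suc.prems in auto)
  also have "\<dots> \<oplus>\<^bsub>M\<^esub> twist \<iota> (c n) \<odot>\<^bsub>M\<^esub> frob M (y n) = lin_comb M (Suc n) (\<lambda>i. frob M (y i)) (\<lambda>i. twist \<iota> (c i))"
    using Suc.prems frob_closed[OF assms(1)] by (intro lin_comb_Suc[symmetric] k) auto
  finally show ?case .
qed

lemma is_basisD:
  assumes "is_basis (kbar_t \<iota>) M n b"
  shows "i < n \<Longrightarrow> b i \<in> carrier M" using assms by (auto simp: is_basis_def)

lemma lin_comb_restrict:
  assumes "kmod M" "\<And>i. i < n \<Longrightarrow> y i \<in> carrier M" "\<And>i. i < n \<Longrightarrow> c i \<in> Kt"
  shows "lin_comb M n y (\<lambda>i\<in>{..<n}. c i) = lin_comb M n y c" by (rule lin_comb_cong) (use assms in auto)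

lemma coords:
  assumes "kmod M" "is_basis (kbar_t \<iota>) M n b" "x \<in> carrier M"
  shows "i < n \<Longrightarrow> coords (kbar_t \<iota>) M n b x i \<in> Kt" "lin_comb M n b (coords (kbar_t \<iota>) M n b x) = x"
proof -
  have "\<exists>!c. c \<in> {..<n} \<rightarrow>\<^sub>E carrier (kbar_t \<iota>) \<and> x = lin_comb M n b c"
    using assms by (auto simp: is_basis_def)
  from theI'[OF this] show "lin_comb M n b (coords (kbar_t \<iota>) M n b x) = x"
    and "i < n \<Longrightarrow> coords (kbar_t \<iota>) M n b x i \<in> Kt" by (auto simp: coords_def)
qed

lemma coords_lin_comb:
  assumes "kmod M" "is_basis (kbar_t \<iota>) M n b" "\<And>i. i < n \<Longrightarrow> c i \<in> Kt" "i < n"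
  shows "coords (kbar_t \<iota>) M n b (lin_comb M n b c) i = c i"
proof -
  define x where "x = lin_comb M n b c"
  have x: "x \<in> carrier M" unfolding x_def using assms is_basisD[OF assms(2)] by (intro lin_comb_closed) auto
  have "\<exists>!c. c \<in> {..<n} \<rightarrow>\<^sub>E carrier (kbar_t \<iota>) \<and> x = lin_comb M n b c"
    using assms(2) x by (auto simp: is_basis_def)
  hence "coords (kbar_t \<iota>) M n b x = (\<lambda>i\<in>{..<n}. c i)" unfolding coords_def
    by (rule the1_equality) (use assms is_basisD[OF assms(2)] in \<open>auto simp: lin_comb_restrict x_def\<close>)
  thus ?thesis using assms(4) by (simp add: x_def)
qed

lemma lin_comb_eq_iff:
  assumes "kmod M" "is_basis (kbar_t \<iota>) M n b" "\<And>i. i < n \<Longrightarrow> c i \<in> Kt" "\<And>i. i < n \<Longrightarrow> d i \<in> Kt"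
  shows "lin_comb M n b c = lin_comb M n b d \<longleftrightarrow> (\<forall>i<n. c i = d i)"
proof
  assume "lin_comb M n b c = lin_comb M n b d"
  thus "\<forall>i<n. c i = d i" using coords_lin_comb[OF assms(1,2)] assms(3,4) by metis
next
  assume "\<forall>i<n. c i = d i"
  thus "lin_comb M n b c = lin_comb M n b d" using assms is_basisD[OF assms(2)] by (intro lin_comb_cong) auto
qed

lemma basis_cases:
  assumes "kmod M" "is_basis (kbar_t \<iota>) M n b" "x \<in> carrier M"
  obtains c where "\<And>i. i < n \<Longrightarrow> c i \<in> Kt" "x = lin_comb M n b c"
  using coords[OF assms] that[of "coords (kbar_t \<iota>) M n b x"] by metis

definition lin_ext :: "('c poly, 'm) frob_module \<Rightarrow> ('c poly, 'n) frob_module \<Rightarrow> nat \<Rightarrow> (nat \<Rightarrow> 'm) \<Rightarrow> (nat \<Rightarrow> 'n) \<Rightarrow> 'm \<Rightarrow> 'n"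
  where "lin_ext M N n b y x = lin_comb N n y (coords (kbar_t \<iota>) M n b x)"

lemma lin_ext_lin_comb:
  assumes "kmod M" "kmod N" "is_basis (kbar_t \<iota>) M n b" "\<And>i. i < n \<Longrightarrow> y i \<in> carrier N" "\<And>i. i < n \<Longrightarrow> c i \<in> Kt"
  shows "lin_ext M N n b y (lin_comb M n b c) = lin_comb N n y c" unfolding lin_ext_def
  by (rule lin_comb_cong[symmetric]) (use assms coords_lin_comb[OF assms(1,3)] in auto)

lemma lin_ext_basis:
  assumes "kmod M" "kmod N" "is_basis (kbar_t \<iota>) M n b" "\<And>i. i < n \<Longrightarrow> y i \<in> carrier N" "i < n"
  shows "lin_ext M N n b y (b i) = y i"
proof -
  have "b i = lin_comb M n b (\<lambda>j. if j = i then 1 else 0)"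
    using assms is_basisD[OF assms(3)] by (intro lin_comb_unit[symmetric]) auto
  moreover have "lin_ext M N n b y (lin_comb M n b (\<lambda>j. if j = i then 1 else 0)) = lin_comb N n y (\<lambda>j. if j = i then 1 else 0)"
    by (rule lin_ext_lin_comb) (use assms in auto)
  ultimately have "lin_ext M N n b y (b i) = lin_comb N n y (\<lambda>j. if j = i then 1 else 0)" by simp
  also have "\<dots> = y i" using assms by (intro lin_comb_unit) auto
  finally show ?thesis .
qed

lemma lin_lin_ext:
  assumes "kmod M" "kmod N" "is_basis (kbar_t \<iota>) M n b" "\<And>i. i < n \<Longrightarrow> y i \<in> carrier N"
  shows "lin M N (lin_ext M N n b y)" unfolding lin_def
proof (intro conjI ballI funcsetI)
  note L = lin_ext_lin_comb[OF assms(1-3), of y, OF assms(4)]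
  fix x assume x: "x \<in> carrier M"
  then obtain c where c: "\<And>i. i < n \<Longrightarrow> c i \<in> Kt" "x = lin_comb M n b c" using basis_cases[OF assms(1,3)] by metis
  have bc: "\<And>i. i < n \<Longrightarrow> b i \<in> carrier M" using is_basisD[OF assms(3)] .
  show "lin_ext M N n b y x \<in> carrier N" unfolding c(2) using L[of c] c assms by (auto intro: lin_comb_closed)
  {
    fix x' assume "x' \<in> carrier M"
    then obtain d where d: "\<And>i. i < n \<Longrightarrow> d i \<in> Kt" "x' = lin_comb M n b d" using basis_cases[OF assms(1,3)] by metis
    have "x \<oplus>\<^bsub>M\<^esub> x' = lin_comb M n b (\<lambda>i. c i + d i)"
      unfolding c(2) d(2) using c d bc by (intro lin_comb_add[symmetric] assms(1)) auto
    hence "lin_ext M N n b y (x \<oplus>\<^bsub>M\<^esub> x') = lin_comb N n y (\<lambda>i. c i + d i)"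
      using L[of "\<lambda>i. c i + d i"] c d by (simp add: Kt_add)
    also have "\<dots> = lin_comb N n y c \<oplus>\<^bsub>N\<^esub> lin_comb N n y d" using c d assms by (intro lin_comb_add) auto
    finally show "lin_ext M N n b y (x \<oplus>\<^bsub>M\<^esub> x') = lin_ext M N n b y x \<oplus>\<^bsub>N\<^esub> lin_ext M N n b y x'"
      using L[of c] L[of d] c d by simp
  }
  fix a assume a: "a \<in> Kt"
  have "a \<odot>\<^bsub>M\<^esub> x = lin_comb M n b (\<lambda>i. a * c i)"
    unfolding c(2) using c a bc by (intro lin_comb_smult[symmetric] assms(1)) auto
  hence "lin_ext M N n b y (a \<odot>\<^bsub>M\<^esub> x) = lin_comb N n y (\<lambda>i. a * c i)"
    using L[of "\<lambda>i. a * c i"] c a by (simp add: Kt_mult)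
  also have "\<dots> = a \<odot>\<^bsub>N\<^esub> lin_comb N n y c" using c a assms by (intro lin_comb_smult) auto
  finally show "lin_ext M N n b y (a \<odot>\<^bsub>M\<^esub> x) = a \<odot>\<^bsub>N\<^esub> lin_ext M N n b y x" using L[of c] c by simp
qed

text \<open>Both composites with \<sigma> are semilinear for the same twist, so agreement on a basis
  suffices.\<close>

lemma lin_frob_homI:
  assumes "frobenius_module \<iota> M" "frobenius_module \<iota> N" "is_basis (kbar_t \<iota>) M n b" "lin M N f"
    and "\<And>i. i < n \<Longrightarrow> f (frob M (b i)) = frob N (f (b i))"
  shows "frob_hom \<iota> M N f" unfolding frob_hom_iff
proof (intro conjI ballI assms(4))
  note k = assms(1,2)[THEN frobenius_module_kmod]
  fix x assume x: "x \<in> carrier M"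
  obtain c where c: "\<And>i. i < n \<Longrightarrow> c i \<in> Kt" "x = lin_comb M n b c" using basis_cases[OF k(1) assms(3) x] by metis
  have bc: "\<And>i. i < n \<Longrightarrow> b i \<in> carrier M" using is_basisD[OF assms(3)] .
  have "f (frob M x) = f (lin_comb M n (\<lambda>i. frob M (b i)) (\<lambda>i. twist \<iota> (c i)))"
    unfolding c(2) using c bc by (subst frob_lin_comb[OF assms(1)]) auto
  also have "\<dots> = lin_comb N n (\<lambda>i. f (frob M (b i))) (\<lambda>i. twist \<iota> (c i))"
    using c bc frob_closed[OF assms(1)] by (intro lin_lin_comb[OF k assms(4)]) auto
  also have "\<dots> = lin_comb N n (\<lambda>i. frob N (f (b i))) (\<lambda>i. twist \<iota> (c i))"
    using c bc assms(5) frob_closed[OF assms(1)] frob_closed[OF assms(2)] lin_closed[OF assms(4)] by (intro lin_comb_cong k) auto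
  also have "\<dots> = frob N (lin_comb N n (\<lambda>i. f (b i)) c)"
    using c bc lin_closed[OF assms(4)] by (intro frob_lin_comb[symmetric] assms(2)) auto
  also have "\<dots> = frob N (f x)" unfolding c(2) using c bc by (subst lin_lin_comb[OF k assms(4)]) auto
  finally show "f (frob M x) = frob N (f x)" .
qed

subsection \<open>Standard modules\<close>

text \<open>The module defined by F, realised in the type in which \<open>ext_class\<close> collects
  middle terms; \<sigma> is the twisted row vector times F.\<close>

definition std_module :: "nat \<Rightarrow> (nat \<Rightarrow> nat \<Rightarrow> 'c poly) \<Rightarrow> ('c poly, nat \<Rightarrow> 'c poly) frob_module"
  where "std_module n F = \<lparr>carrier = {x. (\<forall>i. x i \<in> Kt) \<and> (\<forall>i\<ge>n. x i = 0)},
    monoid.mult = undefined, one = undefined, ring.zero = (\<lambda>_. 0), add = (\<lambda>x y i. x i + y i),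
    module.smult = (\<lambda>f x i. f * x i), frob = (\<lambda>x j. if j < n then \<Sum>i<n. twist \<iota> (x i) * F i j else 0)\<rparr>"

definition std_basis :: "nat \<Rightarrow> nat \<Rightarrow> 'c poly"
  where "std_basis i = (\<lambda>j. if j = i then 1 else 0)"

lemma std_module_simps [simp]:
  "x \<in> carrier (std_module n F) \<longleftrightarrow> (\<forall>i. x i \<in> Kt) \<and> (\<forall>i\<ge>n. x i = 0)"
  "\<zero>\<^bsub>std_module n F\<^esub> = (\<lambda>_. 0)"
  "x \<oplus>\<^bsub>std_module n F\<^esub> y = (\<lambda>i. x i + y i)"
  "f \<odot>\<^bsub>std_module n F\<^esub> x = (\<lambda>i. f * x i)"
  "frob (std_module n F) x = (\<lambda>j. if j < n then \<Sum>i<n. twist \<iota> (x i) * F i j else 0)"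
  by (simp_all add: std_module_def)

lemma kmod_std_module: "kmod (std_module n F)" unfolding kmod_def
proof (rule moduleI[OF cring_kbar_t])
  show "abelian_group (std_module n F)"
  proof (rule abelian_groupI)
    fix x assume "x \<in> carrier (std_module n F)"
    thus "\<exists>y\<in>carrier (std_module n F). y \<oplus>\<^bsub>std_module n F\<^esub> x = \<zero>\<^bsub>std_module n F\<^esub>"
      by (intro bexI[of _ "\<lambda>i. - x i"]) (auto intro: Kt_uminus)
  qed (auto intro: Kt_add simp: algebra_simps)
qed (auto intro: Kt_mult simp: algebra_simps)

lemma lin_comb_std_module:
  assumes "\<And>i. i < k \<Longrightarrow> y i \<in> carrier (std_module n F)" "\<And>i. i < k \<Longrightarrow> c i \<in> Kt"
  shows "lin_comb (std_module n F) k y c = (\<lambda>j. \<Sum>i<k. c i * y i j)" using assms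
proof (induction k)
  case 0
  show ?case by (simp add: kmod_std_module)
next
  case (Suc k)
  have "lin_comb (std_module n F) (Suc k) y c
      = lin_comb (std_module n F) k y c \<oplus>\<^bsub>std_module n F\<^esub> c k \<odot>\<^bsub>std_module n F\<^esub> y k"
    by (rule lin_comb_Suc[OF kmod_std_module Suc.prems])
  also have "lin_comb (std_module n F) k y c = (\<lambda>j. \<Sum>i<k. c i * y i j)"
    by (rule Suc.IH) (use Suc.prems in auto)
  finally show ?case by simp
qed

lemma lin_comb_std_basis:
  assumes "\<And>i. i < k \<Longrightarrow> c i \<in> Kt" "k \<le> n"
  shows "lin_comb (std_module n F) k std_basis c = (\<lambda>j. if j < k then c j else 0)"
proof -
  have "lin_comb (std_module n F) k std_basis c = (\<lambda>j. \<Sum>i<k. c i * std_basis i j)"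
    by (rule lin_comb_std_module) (use assms in \<open>auto simp: std_basis_def\<close>)
  also have "\<dots> = (\<lambda>j. if j < k then c j else 0)"
    by (rule ext) (auto simp: std_basis_def if_distrib[of "(*) _"] cong: if_cong)
  finally show ?thesis .
qed

lemma is_basis_std_module: "is_basis (kbar_t \<iota>) (std_module n F) n std_basis" unfolding is_basis_def
proof (intro conjI ballI)
  show "std_basis ` {..<n} \<subseteq> carrier (std_module n F)" by (auto simp: std_basis_def)
  fix x assume x: "x \<in> carrier (std_module n F)"
  show "\<exists>!c. c \<in> {..<n} \<rightarrow>\<^sub>E carrier (kbar_t \<iota>) \<and> x = lin_comb (std_module n F) n std_basis c"
  proof (rule ex1I[of _ "\<lambda>i\<in>{..<n}. x i"])
    have "lin_comb (std_module n F) n std_basis (\<lambda>i\<in>{..<n}. x i) = (\<lambda>j. if j < n then (\<lambda>i\<in>{..<n}. x i) j else 0)"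
      by (rule lin_comb_std_basis) (use x in auto)
    also have "\<dots> = x" using x by (auto simp: fun_eq_iff not_less)
    finally show "(\<lambda>i\<in>{..<n}. x i) \<in> {..<n} \<rightarrow>\<^sub>E carrier (kbar_t \<iota>) \<and> x = lin_comb (std_module n F) n std_basis (\<lambda>i\<in>{..<n}. x i)"
      using x by auto
  next
    fix c assume c: "c \<in> {..<n} \<rightarrow>\<^sub>E carrier (kbar_t \<iota>) \<and> x = lin_comb (std_module n F) n std_basis c"
    have "lin_comb (std_module n F) n std_basis c = (\<lambda>j. if j < n then c j else 0)"
      by (rule lin_comb_std_basis) (use c in auto)
    thus "c = (\<lambda>i\<in>{..<n}. x i)" using c by (auto simp: fun_eq_iff PiE_def extensional_def)
  qed
qed

lemma frobenius_std_module:
  assumes "\<And>i j. i < n \<Longrightarrow> j < n \<Longrightarrow> F i j \<in> Kt"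
  shows "frobenius_module \<iota> (std_module n F)" unfolding frobenius_module_def
proof (intro conjI ballI)
  show "module (kbar_t \<iota>) (std_module n F)" using kmod_std_module by (simp add: kmod_def)
  show "frob (std_module n F) \<in> carrier (std_module n F) \<rightarrow> carrier (std_module n F)"
    using assms by (auto intro!: Kt_sum Kt_mult)
  show "\<exists>n' b. is_basis (kbar_t \<iota>) (std_module n F) n' b" using is_basis_std_module by blast
next
  fix x y assume "x \<in> carrier (std_module n F)" "y \<in> carrier (std_module n F)"
  thus "frob (std_module n F) (x \<oplus>\<^bsub>std_module n F\<^esub> y) = frob (std_module n F) x \<oplus>\<^bsub>std_module n F\<^esub> frob (std_module n F) y"
    by (auto simp: twist_add distrib_right sum.distrib fun_eq_iff)
next
  fix f x assume "f \<in> carrier (kbar_t \<iota>)" "x \<in> carrier (std_module n F)"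
  thus "frob (std_module n F) (f \<odot>\<^bsub>std_module n F\<^esub> x) = twist \<iota> f \<odot>\<^bsub>std_module n F\<^esub> frob (std_module n F) x"
    by (auto simp: twist_mult sum_distrib_left mult.assoc fun_eq_iff)
qed

lemma frob_std_basis:
  assumes "i < n" "\<And>j. j < n \<Longrightarrow> F i j \<in> Kt"
  shows "frob (std_module n F) (std_basis i) = lin_comb (std_module n F) n std_basis (F i)"
proof -
  have "(\<Sum>k<n. twist \<iota> (std_basis i k) * F k j) = F i j" for j
  proof -
    have "(\<Sum>k<n. twist \<iota> (std_basis i k) * F k j) = (\<Sum>k\<in>{i}. twist \<iota> (std_basis i k) * F k j)"
      by (rule sum.mono_neutral_right) (use assms(1) in \<open>auto simp: std_basis_def\<close>)
    thus ?thesis by (simp add: std_basis_def)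
  qed
  thus ?thesis using assms by (subst lin_comb_std_basis) auto
qed

subsection \<open>The unit module\<close>

lemma unit_module_simps [simp]:
  "carrier (unit_module \<iota>) = Kt" "\<zero>\<^bsub>unit_module \<iota>\<^esub> = 0"
  "x \<oplus>\<^bsub>unit_module \<iota>\<^esub> y = x + y" "x \<odot>\<^bsub>unit_module \<iota>\<^esub> y = x * y" "frob (unit_module \<iota>) = twist \<iota>"
  by (simp_all add: unit_module_def)

lemma kmod_unit_module: "kmod (unit_module \<iota>)" unfolding kmod_def
proof (rule moduleI[OF cring_kbar_t])
  show "abelian_group (unit_module \<iota>)"
  proof (rule abelian_groupI)
    fix x assume "x \<in> carrier (unit_module \<iota>)"
    thus "\<exists>y\<in>carrier (unit_module \<iota>). y \<oplus>\<^bsub>unit_module \<iota>\<^esub> x = \<zero>\<^bsub>unit_module \<iota>\<^esub>"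
      by (intro bexI[of _ "- x"]) (auto intro: Kt_uminus)
  qed (auto intro: Kt_add simp: algebra_simps)
qed (auto intro: Kt_mult simp: algebra_simps)

lemma lin_comb_unit_module:
  assumes "\<And>i. i < k \<Longrightarrow> y i \<in> Kt" "\<And>i. i < k \<Longrightarrow> c i \<in> Kt"
  shows "lin_comb (unit_module \<iota>) k y c = (\<Sum>i<k. c i * y i)" using assms
proof (induction k)
  case (Suc k)
  have "lin_comb (unit_module \<iota>) (Suc k) y c
      = lin_comb (unit_module \<iota>) k y c \<oplus>\<^bsub>unit_module \<iota>\<^esub> c k \<odot>\<^bsub>unit_module \<iota>\<^esub> y k"
    by (rule lin_comb_Suc[OF kmod_unit_module]) (use Suc.prems in auto)
  also have "lin_comb (unit_module \<iota>) k y c = (\<Sum>i<k. c i * y i)" by (rule Suc.IH) (use Suc.prems in auto)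
  finally show ?case by simp
qed (simp add: kmod_unit_module)

lemma is_basis_unit_module: "is_basis (kbar_t \<iota>) (unit_module \<iota>) (Suc 0) (\<lambda>_. 1)"
  unfolding is_basis_def
proof (intro conjI ballI)
  fix x assume x: "x \<in> carrier (unit_module \<iota>)"
  show "\<exists>!c. c \<in> {..<Suc 0} \<rightarrow>\<^sub>E carrier (kbar_t \<iota>) \<and> x = lin_comb (unit_module \<iota>) (Suc 0) (\<lambda>_. 1) c"
  proof (rule ex1I[of _ "\<lambda>i\<in>{..<Suc 0}. x"])
    show "(\<lambda>i\<in>{..<Suc 0}. x) \<in> {..<Suc 0} \<rightarrow>\<^sub>E carrier (kbar_t \<iota>) \<and> x = lin_comb (unit_module \<iota>) (Suc 0) (\<lambda>_. 1) (\<lambda>i\<in>{..<Suc 0}. x)"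
      using x by (auto simp: lin_comb_unit_module)
  next
    fix c assume c: "c \<in> {..<Suc 0} \<rightarrow>\<^sub>E carrier (kbar_t \<iota>) \<and> x = lin_comb (unit_module \<iota>) (Suc 0) (\<lambda>_. 1) c"
    hence "lin_comb (unit_module \<iota>) (Suc 0) (\<lambda>_. 1) c = (\<Sum>i<Suc 0. c i * 1)"
      by (intro lin_comb_unit_module) auto
    thus "c = (\<lambda>i\<in>{..<Suc 0}. x)" using c by (auto simp: fun_eq_iff PiE_def extensional_def)
  qed
qed auto

lemma frobenius_unit_module: "frobenius_module \<iota> (unit_module \<iota>)" unfolding frobenius_module_def
proof (intro conjI)
  show "module (kbar_t \<iota>) (unit_module \<iota>)" using kmod_unit_module by (simp add: kmod_def)
  show "\<exists>n b. is_basis (kbar_t \<iota>) (unit_module \<iota>) n b" using is_basis_unit_module by blast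
qed (auto simp: twist_add twist_mult)

end

subsection \<open>Block extensions\<close>

text \<open>The block shape alone: F stands for \<Phi>' and v for the last row. \<open>M\<close> may
  live in any type, so that the given module and its standard models are treated alike.\<close>

locale block_data = C_infinity \<iota>
  for \<iota> :: "'f::{finite,field} fls alg_closure \<Rightarrow> 'c::{nonarchimedean_field,complete_space}" +
  fixes r :: nat and M' :: "('c poly, 'n) frob_module" and m' :: "nat \<Rightarrow> 'n"
    and M :: "('c poly, 'm) frob_module" and m :: "nat \<Rightarrow> 'm"
    and F :: "nat \<Rightarrow> nat \<Rightarrow> 'c poly" and v :: "nat \<Rightarrow> 'c poly"
  assumes M': "frobenius_module \<iota> M'" and m': "is_basis (kbar_t \<iota>) M' r m'"
    and M: "frobenius_module \<iota> M" and m: "is_basis (kbar_t \<iota>) M (Suc r) m"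
    and FK: "\<And>i j. i < r \<Longrightarrow> j < r \<Longrightarrow> F i j \<in> polys_over (kbar \<iota>)"
    and vK: "\<And>j. j < r \<Longrightarrow> v j \<in> polys_over (kbar \<iota>)"
    and frob_m': "\<And>i. i < r \<Longrightarrow> frob M' (m' i) = lin_comb M' r m' (F i)"
    and frob_m: "\<And>i. i < r \<Longrightarrow> frob M (m i) = lin_comb M r m (F i)"
    and frob_last: "frob M (m r) = lin_comb M r m v \<oplus>\<^bsub>M\<^esub> m r"
begin

abbreviation E0 where "E0 \<equiv> block_extension \<iota> r M' m' M m"

lemma kM: "kmod M" and kM': "kmod M'" using M M' by (auto intro: frobenius_module_kmod)

lemma m'_carrier: "i < r \<Longrightarrow> m' i \<in> carrier M'" and m_carrier: "i < Suc r \<Longrightarrow> m i \<in> carrier M"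
  using is_basisD[OF m'] is_basisD[OF m] by auto

lemma middle_E0 [simp]: "middle E0 = M" by (simp add: block_extension_def)

lemma incl_E0: "incl E0 = lin_ext M' M r m' m" by (simp add: block_extension_def lin_ext_def fun_eq_iff)

lemma incl_lin_comb: "(\<And>i. i < r \<Longrightarrow> c i \<in> Kt) \<Longrightarrow> incl E0 (lin_comb M' r m' c) = lin_comb M r m c"
  unfolding incl_E0 by (rule lin_ext_lin_comb[OF kM' kM m']) (auto intro: m_carrier)

lemma incl_m': "i < r \<Longrightarrow> incl E0 (m' i) = m i"
  unfolding incl_E0 by (rule lin_ext_basis[OF kM' kM m']) (auto intro: m_carrier)

lemma proj_lin_comb: "(\<And>i. i < Suc r \<Longrightarrow> c i \<in> Kt) \<Longrightarrow> proj E0 (lin_comb M (Suc r) m c) = c r"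
  by (simp add: block_extension_def coords_lin_comb[OF kM m])

lemma lin_comb_extend:
  assumes "\<And>i. i < r \<Longrightarrow> c i \<in> Kt"
  shows "lin_comb M r m c = lin_comb M (Suc r) m (\<lambda>i. if i < r then c i else 0)"
proof -
  interpret M: module "kbar_t \<iota>" M using kM by (simp add: kmod_def)
  have "lin_comb M (Suc r) m (\<lambda>i. if i < r then c i else 0)
      = lin_comb M r m (\<lambda>i. if i < r then c i else 0) \<oplus>\<^bsub>M\<^esub> (if r < r then c r else 0) \<odot>\<^bsub>M\<^esub> m r"
    by (rule lin_comb_Suc[OF kM]) (use assms in \<open>auto intro: m_carrier\<close>)
  also have "lin_comb M r m (\<lambda>i. if i < r then c i else 0) = lin_comb M r m c"
    by (rule lin_comb_cong) (use assms in \<open>auto intro: m_carrier kM\<close>)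
  also have "(if r < r then c r else 0) \<odot>\<^bsub>M\<^esub> m r = \<zero>\<^bsub>M\<^esub>"
    using M.smult_l_null[OF m_carrier[of r]] by simp
  finally show ?thesis using lin_comb_closed[OF kM, of r m c] assms m_carrier by simp
qed

lemma proj_m: "i < Suc r \<Longrightarrow> proj E0 (m i) = (if i = r then 1 else 0)"
  using proj_lin_comb[of "\<lambda>j. if j = i then 1 else 0"] lin_comb_unit[OF kM, of "Suc r" m i] m_carrier by simp

lemma lin_proj: "lin M (unit_module \<iota>) (proj E0)"
proof -
  have eq: "proj E0 x = lin_ext M (unit_module \<iota>) (Suc r) m (\<lambda>i. if i = r then 1 else 0) x" if x: "x \<in> carrier M" for x
  proof -
    obtain c where c: "\<And>i. i < Suc r \<Longrightarrow> c i \<in> Kt" "x = lin_comb M (Suc r) m c" using basis_cases[OF kM m x] by metis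
    have "lin_ext M (unit_module \<iota>) (Suc r) m (\<lambda>i. if i = r then 1 else 0) x
        = lin_comb (unit_module \<iota>) (Suc r) (\<lambda>i. if i = r then 1 else 0) c"
      unfolding c(2) by (rule lin_ext_lin_comb[OF kM kmod_unit_module m]) (use c in auto)
    also have "\<dots> = (\<Sum>i<Suc r. c i * (if i = r then 1 else 0))" by (rule lin_comb_unit_module) (use c in auto)
    also have "\<dots> = c r" by simp
    finally show ?thesis using proj_lin_comb[of c] c by simp
  qed
  have L: "lin M (unit_module \<iota>) (lin_ext M (unit_module \<iota>) (Suc r) m (\<lambda>i. if i = r then 1 else 0))"
    by (rule lin_lin_ext[OF kM kmod_unit_module m]) auto
  interpret M: module "kbar_t \<iota>" M using kM by (simp add: kmod_def)
  show ?thesis using L unfolding lin_def Pi_iff by (simp add: eq)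
qed

lemma frob_hom_incl: "frob_hom \<iota> M' M (incl E0)"
proof (rule lin_frob_homI[OF M' M m'])
  show "lin M' M (incl E0)" unfolding incl_E0 by (rule lin_lin_ext[OF kM' kM m']) (auto intro: m_carrier)
  show "incl E0 (frob M' (m' i)) = frob M (incl E0 (m' i))" if "i < r" for i
    using that FK by (simp add: frob_m' frob_m incl_m' incl_lin_comb)
qed

lemma frob_hom_proj: "frob_hom \<iota> M (unit_module \<iota>) (proj E0)"
proof (rule lin_frob_homI[OF M frobenius_unit_module m lin_proj])
  fix i assume i: "i < Suc r"
  have z: "proj E0 (lin_comb M r m c) = 0" if "\<And>i. i < r \<Longrightarrow> c i \<in> Kt" for c
    using lin_comb_extend[of c] proj_lin_comb[of "\<lambda>i. if i < r then c i else 0"] that by simp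
  show "proj E0 (frob M (m i)) = frob (unit_module \<iota>) (proj E0 (m i))"
  proof (cases "i = r")
    case True
    have "lin_comb M r m v \<in> carrier M" using vK by (intro lin_comb_closed kM m_carrier) auto
    hence "proj E0 (frob M (m r)) = proj E0 (lin_comb M r m v) + proj E0 (m r)"
      using lin_proj m_carrier[of r] by (simp add: frob_last lin_def)
    thus ?thesis using True z[OF vK] by (simp add: proj_m)
  next
    case False
    hence "i < r" using i by simp
    thus ?thesis using z[of "F i"] FK i False by (simp add: frob_m proj_m)
  qed
qed

lemma is_extension_E0: "is_extension \<iota> M' E0" unfolding is_extension_def middle_E0
proof (intro conjI M M' frob_hom_incl frob_hom_proj)
  have inj: "inj_on (incl E0) (carrier M')"
  proof (rule inj_onI)
    fix x y assume xy: "x \<in> carrier M'" "y \<in> carrier M'" "incl E0 x = incl E0 y"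
    obtain c where c: "\<And>i. i < r \<Longrightarrow> c i \<in> Kt" "x = lin_comb M' r m' c" using basis_cases[OF kM' m' xy(1)] by metis
    obtain d where d: "\<And>i. i < r \<Longrightarrow> d i \<in> Kt" "y = lin_comb M' r m' d" using basis_cases[OF kM' m' xy(2)] by metis
    have "lin_comb M (Suc r) m (\<lambda>i. if i < r then c i else 0) = lin_comb M (Suc r) m (\<lambda>i. if i < r then d i else 0)"
      using xy(3) c d by (simp add: incl_lin_comb lin_comb_extend)
    hence "\<forall>i<Suc r. (if i < r then c i else 0) = (if i < r then d i else 0)"
      by (subst (asm) lin_comb_eq_iff[OF kM m]) (use c d in auto)
    hence "\<forall>i<r. c i = d i" by (metis less_SucI)
    thus "x = y" unfolding c(2) d(2) by (subst lin_comb_eq_iff[OF kM' m']) (use c d in auto)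
  qed
  thus "inj_on (incl E0) (carrier M')" .
  show "incl E0 ` carrier M' = {x \<in> carrier M. proj E0 x = 0}"
  proof (intro equalityI subsetI)
    fix y assume "y \<in> incl E0 ` carrier M'"
    then obtain x where x: "x \<in> carrier M'" "y = incl E0 x" by blast
    obtain c where c: "\<And>i. i < r \<Longrightarrow> c i \<in> Kt" "x = lin_comb M' r m' c" using basis_cases[OF kM' m' x(1)] by metis
    have "y = lin_comb M (Suc r) m (\<lambda>i. if i < r then c i else 0)"
      using c by (simp add: x(2) incl_lin_comb lin_comb_extend)
    moreover from this have "proj E0 y = 0" using proj_lin_comb[of "\<lambda>i. if i < r then c i else 0"] c by simp
    moreover have "y \<in> carrier M" unfolding x(2) using frob_hom_incl x(1) by (auto simp: frob_hom_def)
    ultimately show "y \<in> {x \<in> carrier M. proj E0 x = 0}" by simp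
  next
    fix y assume y: "y \<in> {x \<in> carrier M. proj E0 x = 0}"
    then obtain c where c: "\<And>i. i < Suc r \<Longrightarrow> c i \<in> Kt" "y = lin_comb M (Suc r) m c" using basis_cases[OF kM m, of y] by blast
    have c0: "c r = 0" using y proj_lin_comb[of c] c by simp
    have "y = lin_comb M (Suc r) m (\<lambda>i. if i < r then c i else 0)"
      unfolding c(2) by (rule lin_comb_cong) (use c c0 in \<open>auto intro: m_carrier kM simp: less_Suc_eq\<close>)
    also have "\<dots> = incl E0 (lin_comb M' r m' c)" using c by (simp add: incl_lin_comb lin_comb_extend)
    finally show "y \<in> incl E0 ` carrier M'" using c by (auto intro!: imageI lin_comb_closed kM' m'_carrier)
  qed
  show "proj E0 ` carrier M = carrier (unit_module \<iota>)"
  proof (intro equalityI subsetI)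
    show "y \<in> carrier (unit_module \<iota>)" if "y \<in> proj E0 ` carrier M" for y
      using that lin_closed[OF lin_proj] by auto
    fix f assume f: "f \<in> carrier (unit_module \<iota>)"
    have "f = proj E0 (f \<odot>\<^bsub>M\<^esub> m r)" using lin_proj f m_carrier[of r] by (simp add: lin_def proj_m)
    moreover have "f \<odot>\<^bsub>M\<^esub> m r \<in> carrier M"
    proof -
      interpret M: module "kbar_t \<iota>" M using kM by (simp add: kmod_def)
      show ?thesis using f m_carrier[of r] by (intro M.smult_closed) auto
    qed
    ultimately show "f \<in> proj E0 ` carrier M" by blast
  qed
qed

end

section \<open>Morphisms, equivalence and splitting of extensions\<close>

context C_infinity
begin

lemma frob_hom_closed: "frob_hom \<iota> M N f \<Longrightarrow> x \<in> carrier M \<Longrightarrow> f x \<in> carrier N"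
  by (auto simp: frob_hom_def)

lemma frob_hom_comp:
  assumes "frob_hom \<iota> M N f" "frob_hom \<iota> N P g" shows "frob_hom \<iota> M P (\<lambda>x. g (f x))"
  using assms frob_hom_closed[OF assms(1)] unfolding frob_hom_def Pi_iff by simp

lemma frob_hom_inv:
  assumes M: "frobenius_module \<iota> M" and f: "frob_hom \<iota> M N f" and bij: "bij_betw f (carrier M) (carrier N)"
  shows "frob_hom \<iota> N M (inv_into (carrier M) f)"
proof -
  interpret M: module "kbar_t \<iota>" M using M by (simp add: frobenius_module_def)
  define g where "g = inv_into (carrier M) f"
  have g: "g y \<in> carrier M" "f (g y) = y" if "y \<in> carrier N" for y
    using bij that by (auto simp: g_def bij_betw_def inv_into_into f_inv_into_f)
  have gI: "g y = x" if "x \<in> carrier M" "f x = y" for x y using bij that by (auto simp: g_def bij_betw_def)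
  have add: "g (x \<oplus>\<^bsub>N\<^esub> y) = g x \<oplus>\<^bsub>M\<^esub> g y" if "x \<in> carrier N" "y \<in> carrier N" for x y
    using f g that by (intro gI) (auto simp: frob_hom_def)
  have sm: "g (a \<odot>\<^bsub>N\<^esub> x) = a \<odot>\<^bsub>M\<^esub> g x" if "a \<in> Kt" "x \<in> carrier N" for a x
    using f g that M.smult_closed[of a "g x"] by (intro gI) (auto simp: frob_hom_def)
  have fr: "g (frob N x) = frob M (g x)" if "x \<in> carrier N" for x
    using f g that frob_closed[OF M] by (intro gI) (auto simp: frob_hom_def)
  show ?thesis unfolding g_def[symmetric] frob_hom_def using g add sm fr by auto
qed

lemma ext_morphism_comp:
  assumes "ext_morphism \<iota> S (\<lambda>x. x) E1 E2 \<phi>" "ext_morphism \<iota> S \<alpha> E2 E3 \<chi>"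
  shows "ext_morphism \<iota> S \<alpha> E1 E3 (\<lambda>x. \<chi> (\<phi> x))"
  using assms frob_hom_comp frob_hom_closed unfolding ext_morphism_def by fastforce

lemma ext_morphism_inv:
  assumes E: "is_extension \<iota> M' E1" and \<phi>: "ext_morphism \<iota> (carrier M') (\<lambda>x. x) E1 E2 \<phi>"
    and bij: "bij_betw \<phi> (carrier (middle E1)) (carrier (middle E2))"
  shows "ext_morphism \<iota> (carrier M') (\<lambda>x. x) E2 E1 (inv_into (carrier (middle E1)) \<phi>)"
proof -
  have incl: "incl E1 x \<in> carrier (middle E1)" if "x \<in> carrier M'" for x
    using E that by (auto simp: is_extension_def frob_hom_def)
  have inv1: "inv_into (carrier (middle E1)) \<phi> (incl E2 x) = incl E1 x" if x: "x \<in> carrier M'" for x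
  proof -
    have "incl E2 x = \<phi> (incl E1 x)" using \<phi> x by (simp add: ext_morphism_def)
    thus ?thesis using bij incl[OF x] by (simp add: bij_betw_def)
  qed
  have inv2: "proj E1 (inv_into (carrier (middle E1)) \<phi> y) = proj E2 y" if y: "y \<in> carrier (middle E2)" for y
  proof -
    obtain x where x: "x \<in> carrier (middle E1)" "y = \<phi> x" using bij y by (auto simp: bij_betw_def)
    thus ?thesis using bij \<phi> by (simp add: bij_betw_def ext_morphism_def)
  qed
  have "frob_hom \<iota> (middle E2) (middle E1) (inv_into (carrier (middle E1)) \<phi>)"
    using E \<phi> bij by (intro frob_hom_inv) (auto simp: is_extension_def ext_morphism_def)
  thus ?thesis using inv1 inv2 by (simp add: ext_morphism_def)
qed

lemma ext_equiv_sym: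
  assumes "is_extension \<iota> M' E1" "ext_equiv \<iota> M' E1 E2" shows "ext_equiv \<iota> M' E2 E1"
  using assms ext_morphism_inv bij_betw_inv_into unfolding ext_equiv_def by blast

lemma ext_equiv_trans:
  assumes "ext_equiv \<iota> M' E1 E2" "ext_equiv \<iota> M' E2 E3" shows "ext_equiv \<iota> M' E1 E3"
proof -
  obtain \<phi> \<chi> where "ext_morphism \<iota> (carrier M') (\<lambda>x. x) E1 E2 \<phi>" "ext_morphism \<iota> (carrier M') (\<lambda>x. x) E2 E3 \<chi>"
    and "bij_betw \<phi> (carrier (middle E1)) (carrier (middle E2))" "bij_betw \<chi> (carrier (middle E2)) (carrier (middle E3))"
    using assms by (auto simp: ext_equiv_def)
  thus ?thesis unfolding ext_equiv_def
    using ext_morphism_comp[of "carrier M'" E1 E2 \<phi> "\<lambda>x. x" E3 \<chi>] bij_betw_trans[of \<phi> _ _ \<chi>]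
    by (intro exI[of _ "\<lambda>x. \<chi> (\<phi> x)"]) (auto simp: o_def)
qed

text \<open>The unit module is generated by 1, which \<sigma> fixes, so a section amounts to a fixed
  vector above 1.\<close>

lemma ext_split_iff:
  assumes "is_extension \<iota> M' E"
  shows "ext_split \<iota> E \<longleftrightarrow> (\<exists>e\<in>carrier (middle E). frob (middle E) e = e \<and> proj E e = 1)"
proof
  assume "ext_split \<iota> E"
  then obtain \<psi> where \<psi>: "frob_hom \<iota> (unit_module \<iota>) (middle E) \<psi>" "\<And>f. f \<in> Kt \<Longrightarrow> proj E (\<psi> f) = f"
    by (auto simp: ext_split_def)
  have "frob (middle E) (\<psi> 1) = \<psi> (frob (unit_module \<iota>) 1)"
    using \<psi>(1) Kt_1 unfolding frob_hom_def by (metis unit_module_simps(1))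
  hence "frob (middle E) (\<psi> 1) = \<psi> 1" by simp
  thus "\<exists>e\<in>carrier (middle E). frob (middle E) e = e \<and> proj E e = 1"
    using \<psi>(2)[of 1] frob_hom_closed[OF \<psi>(1), of 1] by (intro bexI[of _ "\<psi> 1"]) auto
next
  assume "\<exists>e\<in>carrier (middle E). frob (middle E) e = e \<and> proj E e = 1"
  then obtain e where e: "e \<in> carrier (middle E)" "frob (middle E) e = e" "proj E e = 1" by blast
  have fm: "frobenius_module \<iota> (middle E)" and pr: "frob_hom \<iota> (middle E) (unit_module \<iota>) (proj E)"
    using assms by (auto simp: is_extension_def)
  interpret M: module "kbar_t \<iota>" "middle E" using fm by (simp add: frobenius_module_def)
  have "frob_hom \<iota> (unit_module \<iota>) (middle E) (\<lambda>f. f \<odot>\<^bsub>middle E\<^esub> e)"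
    unfolding frob_hom_def using e M.smult_closed M.smult_l_distr M.smult_assoc1 frob_smult[OF fm _ e(1)] by auto
  moreover have "proj E (f \<odot>\<^bsub>middle E\<^esub> e) = f" if "f \<in> Kt" for f
    using pr e that by (simp add: frob_hom_def)
  ultimately show "ext_split \<iota> E" unfolding ext_split_def by auto
qed

lemma frob_hom_smult:
  assumes "frobenius_module \<iota> M" "a \<in> Kt" "twist \<iota> a = a"
  shows "frob_hom \<iota> M M (\<lambda>x. a \<odot>\<^bsub>M\<^esub> x)"
proof -
  interpret M: module "kbar_t \<iota>" M using assms(1) by (simp add: frobenius_module_def)
  have "a \<odot>\<^bsub>M\<^esub> (f \<odot>\<^bsub>M\<^esub> x) = f \<odot>\<^bsub>M\<^esub> (a \<odot>\<^bsub>M\<^esub> x)" if "f \<in> Kt" "x \<in> carrier M" for f x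
    using M.smult_assoc1[of a f x] M.smult_assoc1[of f a x] that assms(2) by (simp add: mult.commute)
  thus ?thesis unfolding frob_hom_def using assms M.smult_closed M.smult_r_distr frob_smult[OF assms(1,2)] by auto
qed

end

section \<open>Torsion classes and fixed vectors\<close>

context block_data
begin

text \<open>The cocycle of the extension: \<sigma> moves m_r by the image of w.\<close>

definition w where "w = lin_comb M' r m' v"

lemma w_carrier: "w \<in> carrier M'" unfolding w_def using vK by (intro lin_comb_closed kM' m'_carrier) auto

lemma frob_last': "frob M (m r) = incl E0 w \<oplus>\<^bsub>M\<^esub> m r"
  using vK by (simp add: w_def frob_last incl_lin_comb)

lemma block_hom:
  assumes N: "frobenius_module \<iota> N" and y: "\<And>i. i < Suc r \<Longrightarrow> y i \<in> carrier N"
    and fy: "\<And>i. i < r \<Longrightarrow> frob N (y i) = lin_comb N r y (F i)"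
    and fl: "frob N (y r) = lin_comb N r y v \<oplus>\<^bsub>N\<^esub> y r"
  shows "frob_hom \<iota> M N (lin_ext M N (Suc r) m y)"
proof -
  define g where "g = lin_ext M N (Suc r) m y"
  have kN: "kmod N" using N by (rule frobenius_module_kmod)
  have g: "lin M N g" unfolding g_def by (rule lin_lin_ext[OF kM kN m y])
  have gm: "g (m i) = y i" if "i < Suc r" for i unfolding g_def by (rule lin_ext_basis[OF kM kN m y that])
  have gl: "g (lin_comb M r m c) = lin_comb N r y c" if "\<And>i. i < r \<Longrightarrow> c i \<in> Kt" for c
  proof -
    have "g (lin_comb M r m c) = lin_comb N r (\<lambda>i. g (m i)) c"
      using that by (intro lin_lin_comb[OF kM kN g] m_carrier) auto
    also have "\<dots> = lin_comb N r y c" using that gm y by (intro lin_comb_cong kN) auto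
    finally show ?thesis .
  qed
  have "frob_hom \<iota> M N g"
  proof (rule lin_frob_homI[OF M N m g])
    fix i assume i: "i < Suc r"
    show "g (frob M (m i)) = frob N (g (m i))"
    proof (cases "i = r")
      case True
      have "lin_comb M r m v \<in> carrier M" using vK by (intro lin_comb_closed kM m_carrier) auto
      hence "g (frob M (m r)) = g (lin_comb M r m v) \<oplus>\<^bsub>N\<^esub> g (m r)"
        using g m_carrier[of r] by (simp add: frob_last lin_def)
      also have "\<dots> = frob N (g (m r))" using gl[of v] vK by (simp add: gm fl)
      finally show ?thesis using True by simp
    next
      case False
      hence "i < r" using i by simp
      thus ?thesis using gl[of "F i"] FK by (simp add: frob_m gm fy)
    qed
  qed
  thus ?thesis by (simp add: g_def)
qed

lemma block_hom_incl:
  assumes "kmod N" "\<And>i. i < Suc r \<Longrightarrow> y i \<in> carrier N" "\<And>i. i < r \<Longrightarrow> c i \<in> Kt"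
  shows "lin_ext M N (Suc r) m y (incl E0 (lin_comb M' r m' c)) = lin_comb N r y c"
proof -
  have g: "lin M N (lin_ext M N (Suc r) m y)" by (rule lin_lin_ext[OF kM assms(1) m assms(2)])
  have "lin_ext M N (Suc r) m y (incl E0 (lin_comb M' r m' c)) = lin_ext M N (Suc r) m y (lin_comb M r m c)"
    using assms(3) by (simp add: incl_lin_comb)
  also have "\<dots> = lin_comb N r (\<lambda>i. lin_ext M N (Suc r) m y (m i)) c"
    using assms(3) by (intro lin_lin_comb[OF kM assms(1) g] m_carrier) auto
  also have "\<dots> = lin_comb N r y c"
    using assms lin_ext_basis[OF kM assms(1) m assms(2)] by (intro lin_comb_cong) auto
  finally show ?thesis .
qed

lemma block_hom_proj:
  assumes E: "is_extension \<iota> M' E" and y: "\<And>i. i < Suc r \<Longrightarrow> y i \<in> carrier (middle E)"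
    and p: "\<And>i. i < Suc r \<Longrightarrow> proj E (y i) = (if i = r then 1 else 0)" and x: "x \<in> carrier M"
  shows "proj E (lin_ext M (middle E) (Suc r) m y x) = proj E0 x"
proof -
  obtain c where c: "\<And>i. i < Suc r \<Longrightarrow> c i \<in> Kt" "x = lin_comb M (Suc r) m c" using basis_cases[OF kM m x] by metis
  have kN: "kmod (middle E)" using E by (auto simp: is_extension_def intro: frobenius_module_kmod)
  have lp: "lin (middle E) (unit_module \<iota>) (proj E)" using E by (simp add: is_extension_def frob_hom_iff)
  have "proj E (lin_ext M (middle E) (Suc r) m y x) = proj E (lin_comb (middle E) (Suc r) y c)"
    unfolding c(2) using lin_ext_lin_comb[OF kM kN m y c(1)] by simp
  also have "\<dots> = lin_comb (unit_module \<iota>) (Suc r) (\<lambda>i. proj E (y i)) c"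
    by (rule lin_lin_comb[OF kN kmod_unit_module lp y c(1)])
  also have "\<dots> = (\<Sum>i<Suc r. c i * proj E (y i))" using c(1) p by (intro lin_comb_unit_module) auto
  also have "\<dots> = c r" using p by (simp add: sum.neutral)
  also have "\<dots> = proj E0 x" unfolding c(2) using proj_lin_comb[of c] c(1) by simp
  finally show ?thesis .
qed

text \<open>Splittings of a pushout correspond to Frobenius fixed points over \<open>1\<close>, and these to solutions in \<open>M'\<close>.\<close>

lemma fixed_iff:
  assumes E: "is_extension \<iota> M' E" and f: "ext_morphism \<iota> (carrier M') (\<lambda>x. a \<odot>\<^bsub>M'\<^esub> x) E0 E f"
    and a: "a \<in> Kt" and x: "x \<in> carrier M'"
  shows "frob (middle E) (f (m r) \<oplus>\<^bsub>middle E\<^esub> incl E x) = f (m r) \<oplus>\<^bsub>middle E\<^esub> incl E x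
    \<longleftrightarrow> x = frob M' x \<oplus>\<^bsub>M'\<^esub> a \<odot>\<^bsub>M'\<^esub> w"
proof -
  let ?N = "middle E"
  have N: "frobenius_module \<iota> ?N" and inc: "frob_hom \<iota> M' ?N (incl E)" and inj: "inj_on (incl E) (carrier M')"
    using E by (auto simp: is_extension_def)
  have fh: "frob_hom \<iota> M ?N f" and fi: "\<And>x. x \<in> carrier M' \<Longrightarrow> f (incl E0 x) = incl E (a \<odot>\<^bsub>M'\<^esub> x)"
    using f by (auto simp: ext_morphism_def)
  interpret N: module "kbar_t \<iota>" ?N using N by (simp add: frobenius_module_def)
  interpret M': module "kbar_t \<iota>" M' using M' by (simp add: frobenius_module_def)
  have aw: "a \<odot>\<^bsub>M'\<^esub> w \<in> carrier M'" using a w_carrier by (intro M'.smult_closed) auto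
  have fx: "frob M' x \<in> carrier M'" by (rule frob_closed[OF M' x])
  have c: "f (m r) \<in> carrier ?N" using frob_hom_closed[OF fh] m_carrier by simp
  have i: "incl E z \<in> carrier ?N" if "z \<in> carrier M'" for z using frob_hom_closed[OF inc that] .
  have ifx: "frob ?N (incl E x) = incl E (frob M' x)" using inc x by (simp add: frob_hom_def)
  have "frob ?N (f (m r)) = f (frob M (m r))" using fh m_carrier[of r] by (simp add: frob_hom_def)
  also have "\<dots> = incl E (a \<odot>\<^bsub>M'\<^esub> w) \<oplus>\<^bsub>?N\<^esub> f (m r)"
    using fh m_carrier[of r] w_carrier frob_hom_closed[OF frob_hom_incl w_carrier] by (simp add: frob_last' frob_hom_def fi)
  finally have fm: "frob ?N (f (m r)) = incl E (a \<odot>\<^bsub>M'\<^esub> w) \<oplus>\<^bsub>?N\<^esub> f (m r)" .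
  have "frob ?N (f (m r) \<oplus>\<^bsub>?N\<^esub> incl E x) = frob ?N (f (m r)) \<oplus>\<^bsub>?N\<^esub> frob ?N (incl E x)"
    by (rule frob_add[OF N c i[OF x]])
  also have "\<dots> = (incl E (a \<odot>\<^bsub>M'\<^esub> w) \<oplus>\<^bsub>?N\<^esub> f (m r)) \<oplus>\<^bsub>?N\<^esub> incl E (frob M' x)" unfolding fm ifx ..
  also have "\<dots> = f (m r) \<oplus>\<^bsub>?N\<^esub> (incl E (frob M' x) \<oplus>\<^bsub>?N\<^esub> incl E (a \<odot>\<^bsub>M'\<^esub> w))"
    using i[OF aw] c i[OF fx] by (simp add: N.a_ac)
  also have "incl E (frob M' x) \<oplus>\<^bsub>?N\<^esub> incl E (a \<odot>\<^bsub>M'\<^esub> w) = incl E (frob M' x \<oplus>\<^bsub>M'\<^esub> a \<odot>\<^bsub>M'\<^esub> w)"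
    using inc fx aw by (simp add: frob_hom_def)
  finally have eq: "frob ?N (f (m r) \<oplus>\<^bsub>?N\<^esub> incl E x) = f (m r) \<oplus>\<^bsub>?N\<^esub> incl E (frob M' x \<oplus>\<^bsub>M'\<^esub> a \<odot>\<^bsub>M'\<^esub> w)" .
  have cl: "frob M' x \<oplus>\<^bsub>M'\<^esub> a \<odot>\<^bsub>M'\<^esub> w \<in> carrier M'" using fx aw by (rule M'.a_closed)
  have "frob ?N (f (m r) \<oplus>\<^bsub>?N\<^esub> incl E x) = f (m r) \<oplus>\<^bsub>?N\<^esub> incl E x
      \<longleftrightarrow> incl E (frob M' x \<oplus>\<^bsub>M'\<^esub> a \<odot>\<^bsub>M'\<^esub> w) = incl E x"
    unfolding eq using c i[OF cl] i[OF x] by (metis N.add.l_cancel)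
  also have "\<dots> \<longleftrightarrow> x = frob M' x \<oplus>\<^bsub>M'\<^esub> a \<odot>\<^bsub>M'\<^esub> w"
    using inj_on_eq_iff[OF inj cl x] by auto
  finally show ?thesis .
qed

definition block_matrix :: "(nat \<Rightarrow> 'c poly) \<Rightarrow> nat \<Rightarrow> nat \<Rightarrow> 'c poly"
  where "block_matrix v' i j = (if i < r then if j < r then F i j else 0 else if j < r then v' j else 1)"

abbreviation std where "std v' \<equiv> std_module (Suc r) (block_matrix v')"

lemma std_block_data:
  assumes "\<And>j. j < r \<Longrightarrow> v' j \<in> Kt"
  shows "block_data \<iota> r M' m' (std v') std_basis F v'"
proof (unfold_locales, goal_cases)
  case 1 show ?case by (rule M')
next
  case 2 show ?case by (rule m')
next
  case 3 show ?case using assms FK by (intro frobenius_std_module) (auto simp: block_matrix_def)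
next
  case 4 show ?case by (rule is_basis_std_module)
next
  case (5 i j) thus ?case by (rule FK)
next
  case (6 j) thus ?case by (rule assms)
next
  case (7 i) thus ?case by (rule frob_m')
next
  case (8 i)
  hence "frob (std v') (std_basis i) = lin_comb (std v') (Suc r) std_basis (block_matrix v' i)"
    by (intro frob_std_basis) (auto simp: block_matrix_def FK)
  also have "\<dots> = (\<lambda>j. if j < Suc r then block_matrix v' i j else 0)"
    using 8 by (intro lin_comb_std_basis) (auto simp: block_matrix_def FK)
  also have "\<dots> = (\<lambda>j. if j < r then F i j else 0)" using 8 by (auto simp: block_matrix_def fun_eq_iff)
  also have "\<dots> = lin_comb (std v') r std_basis (F i)"
    using 8 by (intro lin_comb_std_basis[symmetric]) (auto simp: FK)
  finally show ?case .
next
  case 9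
  have "frob (std v') (std_basis r) = lin_comb (std v') (Suc r) std_basis (block_matrix v' r)"
    by (intro frob_std_basis) (auto simp: block_matrix_def assms)
  also have "\<dots> = (\<lambda>j. if j < Suc r then block_matrix v' r j else 0)"
    by (intro lin_comb_std_basis) (auto simp: block_matrix_def assms)
  also have "\<dots> = (\<lambda>j. (if j < r then v' j else 0) + std_basis r j)"
    by (auto simp: block_matrix_def std_basis_def fun_eq_iff)
  also have "\<dots> = lin_comb (std v') r std_basis v' \<oplus>\<^bsub>std v'\<^esub> std_basis r"
    using assms by (subst lin_comb_std_basis) auto
  finally show ?case .
qed

text \<open>Supplies a representative in the type used by \<open>ext_class\<close>; this is what
  places the class of the given extension in the carrier of \<open>Ext1\<close>.\<close>

lemma std_equiv: "ext_equiv \<iota> M' E0 (block_extension \<iota> r M' m' (std v) std_basis)"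
proof -
  let ?S = "std v"
  interpret S: block_data \<iota> r M' m' ?S std_basis F v by (rule std_block_data[OF vK])
  define \<phi> where "\<phi> = lin_ext M ?S (Suc r) m std_basis"
  have c: "\<And>i. i < Suc r \<Longrightarrow> std_basis i \<in> carrier ?S" by (rule S.m_carrier)
  have hom: "frob_hom \<iota> M ?S \<phi>" unfolding \<phi>_def by (rule block_hom[OF S.M c S.frob_m S.frob_last])
  have L: "\<phi> (lin_comb M (Suc r) m c) = lin_comb ?S (Suc r) std_basis c" if "\<And>i. i < Suc r \<Longrightarrow> c i \<in> Kt" for c
    unfolding \<phi>_def by (rule lin_ext_lin_comb[OF kM S.kM m S.m_carrier that])
  have incl: "\<phi> (incl E0 x) = incl (block_extension \<iota> r M' m' ?S std_basis) x" if x: "x \<in> carrier M'" for x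
  proof -
    obtain c where c: "\<And>i. i < r \<Longrightarrow> c i \<in> Kt" "x = lin_comb M' r m' c" using basis_cases[OF kM' m' x] by metis
    have "\<phi> (incl E0 x) = lin_comb ?S r std_basis c"
      unfolding c(2) \<phi>_def by (rule block_hom_incl[OF S.kM]) (use S.m_carrier c(1) in auto)
    also have "\<dots> = incl (block_extension \<iota> r M' m' ?S std_basis) x"
      unfolding c(2) by (rule S.incl_lin_comb[symmetric]) (rule c(1))
    finally show ?thesis .
  qed
  have proj: "proj (block_extension \<iota> r M' m' ?S std_basis) (\<phi> y) = proj E0 y" if y: "y \<in> carrier M" for y
  proof -
    obtain c where c: "\<And>i. i < Suc r \<Longrightarrow> c i \<in> Kt" "y = lin_comb M (Suc r) m c" using basis_cases[OF kM m y] by metis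
    show ?thesis unfolding c(2) by (simp add: L c(1) S.proj_lin_comb proj_lin_comb)
  qed
  have "bij_betw \<phi> (carrier M) (carrier ?S)"
  proof (rule bij_betwI')
    fix x y assume "x \<in> carrier M" "y \<in> carrier M"
    then obtain c d where c: "\<And>i. i < Suc r \<Longrightarrow> c i \<in> Kt" "x = lin_comb M (Suc r) m c"
      and d: "\<And>i. i < Suc r \<Longrightarrow> d i \<in> Kt" "y = lin_comb M (Suc r) m d" using basis_cases[OF kM m] by metis
    show "(\<phi> x = \<phi> y) = (x = y)"
      unfolding c(2) d(2) by (simp add: L c(1) d(1) lin_comb_eq_iff[OF kM m] lin_comb_eq_iff[OF S.kM S.m])
  next
    fix x assume "x \<in> carrier M"
    thus "\<phi> x \<in> carrier ?S" by (rule frob_hom_closed[OF hom])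
  next
    fix y assume "y \<in> carrier ?S"
    then obtain c where c: "\<And>i. i < Suc r \<Longrightarrow> c i \<in> Kt" "y = lin_comb ?S (Suc r) std_basis c" using basis_cases[OF S.kM S.m] by metis
    show "\<exists>x\<in>carrier M. y = \<phi> x"
      by (rule bexI[of _ "lin_comb M (Suc r) m c"]) (use c L[OF c(1)] in \<open>auto intro: lin_comb_closed kM m_carrier\<close>)
  qed
  thus ?thesis using hom incl proj unfolding ext_equiv_def ext_morphism_def middle_E0 S.middle_E0 by blast
qed

text \<open>The multiple of a class is a pushout and the zero class is the set of split extensions.
  A split pushout has a fixed vector above 1, and its difference from the image of m_r is the
  solution x in M'.\<close>

lemma torsion_iff:
  "torsion_element (Fq_t \<iota>) (Ext1 \<iota> M') (ext_class \<iota> M' E0) \<longleftrightarrow>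
    (\<exists>a. a \<noteq> 0 \<and> (\<exists>x\<in>carrier M'. x = frob M' x \<oplus>\<^bsub>M'\<^esub> map_poly cst a \<odot>\<^bsub>M'\<^esub> w))"
proof -
  let ?C = "ext_class \<iota> M' E0"
  let ?E1 = "block_extension \<iota> r M' m' (std v) std_basis"
  let ?E2 = "block_extension \<iota> r M' m' (std (\<lambda>_. 0)) std_basis"
  interpret S: block_data \<iota> r M' m' "std v" std_basis F v by (rule std_block_data[OF vK])
  interpret T: block_data \<iota> r M' m' "std (\<lambda>_. 0)" std_basis F "\<lambda>_. 0" by (rule std_block_data) simp
  interpret M': module "kbar_t \<iota>" M' using M' by (simp add: frobenius_module_def)
  have eq1: "?C = ext_class \<iota> M' ?E1"
  proof -
    have "ext_equiv \<iota> M' E0 E2 \<longleftrightarrow> ext_equiv \<iota> M' ?E1 E2" for E2 :: "('c poly, 'n, nat \<Rightarrow> 'c poly) extension"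
      using std_equiv ext_equiv_sym[OF is_extension_E0 std_equiv] by (blast intro: ext_equiv_trans)
    thus ?thesis by (simp add: ext_class_def)
  qed
  have in_carrier: "?C \<in> carrier (Ext1 \<iota> M')" unfolding eq1 Ext1_def using S.is_extension_E0 by auto
  have E1_in: "?E1 \<in> ?C" using S.is_extension_E0 std_equiv by (simp add: ext_class_def)
  have key: "ext_smult \<iota> M' (map_poly cst a) (?C) = \<zero>\<^bsub>Ext1 \<iota> M'\<^esub> \<longleftrightarrow>
      (\<exists>x\<in>carrier M'. x = frob M' x \<oplus>\<^bsub>M'\<^esub> map_poly cst a \<odot>\<^bsub>M'\<^esub> w)" for a
  proof
    let ?a = "map_poly cst a"
    have aK: "?a \<in> Kt" by (rule Kt_cst)
    assume smult: "ext_smult \<iota> M' ?a (?C) = \<zero>\<^bsub>Ext1 \<iota> M'\<^esub>"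
    have std_r: "std_basis r \<in> carrier (std (\<lambda>_. 0))" by (rule T.m_carrier) simp
    have fe: "frob (std (\<lambda>_. 0)) (std_basis r) = std_basis r"
    proof -
      have "lin_comb (std (\<lambda>_. 0)) r std_basis (\<lambda>_. 0) = (\<lambda>j. if j < r then 0 else 0)"
        by (rule lin_comb_std_basis) auto
      hence "lin_comb (std (\<lambda>_. 0)) r std_basis (\<lambda>_. 0) = (\<lambda>j. 0)" by simp
      thus ?thesis unfolding T.frob_last by simp
    qed
    \<comment> \<open>With last row 0 the vector \<open>std_basis r\<close> is fixed. This extension
      lies in the zero class, which the hypothesis identifies with the set of pushouts.\<close>
    have "ext_split \<iota> ?E2" unfolding ext_split_iff[OF T.is_extension_E0]
      using std_r fe T.proj_m[of r] by (intro bexI[of _ "std_basis r"]) auto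
    hence "?E2 \<in> \<zero>\<^bsub>Ext1 \<iota> M'\<^esub>" using T.is_extension_E0 by (simp add: Ext1_def)
    hence "?E2 \<in> ext_smult \<iota> M' ?a (?C)" by (simp only: smult)
    then obtain E \<phi> where E: "E \<in> ?C" and \<phi>: "ext_morphism \<iota> (carrier M') (\<lambda>x. ?a \<odot>\<^bsub>M'\<^esub> x) E ?E2 \<phi>"
      unfolding ext_smult_def by blast
    obtain \<chi> where \<chi>: "ext_morphism \<iota> (carrier M') (\<lambda>x. x) E0 E \<chi>" using E by (auto simp: ext_class_def ext_equiv_def)
    define f where "f = (\<lambda>x. \<phi> (\<chi> x))"
    have f: "ext_morphism \<iota> (carrier M') (\<lambda>x. ?a \<odot>\<^bsub>M'\<^esub> x) E0 ?E2 f" unfolding f_def by (rule ext_morphism_comp[OF \<chi> \<phi>])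
    interpret N: module "kbar_t \<iota>" "std (\<lambda>_. 0)" using T.M by (simp add: frobenius_module_def)
    have fm: "f (m r) \<in> carrier (std (\<lambda>_. 0))"
      using f frob_hom_closed[of M "std (\<lambda>_. 0)" f "m r"] m_carrier[of r] by (auto simp: ext_morphism_def)
    \<comment> \<open>Lies over 0, because both vectors lie over 1, and therefore comes from
      M'.\<close>
    define z where "z = std_basis r \<ominus>\<^bsub>std (\<lambda>_. 0)\<^esub> f (m r)"
    have z: "z \<in> carrier (std (\<lambda>_. 0))" unfolding z_def using std_r fm by (rule N.minus_closed)
    have fz: "f (m r) \<oplus>\<^bsub>std (\<lambda>_. 0)\<^esub> z = std_basis r"
    proof -
      have "z \<oplus>\<^bsub>std (\<lambda>_. 0)\<^esub> f (m r) = std_basis r"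
        unfolding z_def a_minus_def using std_r fm N.a_inv_closed[OF fm] N.a_assoc N.l_neg[OF fm] N.r_zero by metis
      thus ?thesis using N.a_comm[OF fm z] by simp
    qed
    have "proj ?E2 (f (m r) \<oplus>\<^bsub>std (\<lambda>_. 0)\<^esub> z) = proj ?E2 (f (m r)) + proj ?E2 z"
      using T.lin_proj fm z unfolding lin_def by (metis unit_module_simps(3))
    moreover have "proj ?E2 (f (m r)) = 1" using f m_carrier[of r] proj_m[of r] by (simp add: ext_morphism_def)
    ultimately have "proj ?E2 z = 0" using T.proj_m[of r] unfolding fz by simp
    hence "z \<in> incl ?E2 ` carrier M'" using T.is_extension_E0 z unfolding is_extension_def T.middle_E0 by blast
    then obtain x where x: "x \<in> carrier M'" "z = incl ?E2 x" by blast
    have "x = frob M' x \<oplus>\<^bsub>M'\<^esub> ?a \<odot>\<^bsub>M'\<^esub> w"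
      using fixed_iff[OF T.is_extension_E0 f aK x(1)] fe fz unfolding T.middle_E0 x(2)[symmetric] by metis
    thus "\<exists>x\<in>carrier M'. x = frob M' x \<oplus>\<^bsub>M'\<^esub> ?a \<odot>\<^bsub>M'\<^esub> w" using x(1) by blast
  next
    let ?a = "map_poly cst a"
    have aK: "?a \<in> Kt" by (rule Kt_cst)
    assume "\<exists>x\<in>carrier M'. x = frob M' x \<oplus>\<^bsub>M'\<^esub> ?a \<odot>\<^bsub>M'\<^esub> w"
    then obtain x where x: "x \<in> carrier M'" "x = frob M' x \<oplus>\<^bsub>M'\<^esub> ?a \<odot>\<^bsub>M'\<^esub> w" by blast
    \<comment> \<open>Two sets of extensions have to agree: every pushout splits, and every split
      extension has to be exhibited as a pushout.\<close>
    have mem: "E \<in> ext_smult \<iota> M' ?a (?C) \<longleftrightarrow> E \<in> \<zero>\<^bsub>Ext1 \<iota> M'\<^esub>" for E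
    proof
      assume "E \<in> ext_smult \<iota> M' ?a (?C)"
      then obtain E' \<phi> where E: "is_extension \<iota> M' E" and E': "E' \<in> ?C"
        and \<phi>: "ext_morphism \<iota> (carrier M') (\<lambda>x. ?a \<odot>\<^bsub>M'\<^esub> x) E' E \<phi>"
        unfolding ext_smult_def by blast
      obtain \<chi> where \<chi>: "ext_morphism \<iota> (carrier M') (\<lambda>x. x) E0 E' \<chi>" using E' by (auto simp: ext_class_def ext_equiv_def)
      define f where "f = (\<lambda>x. \<phi> (\<chi> x))"
      have f: "ext_morphism \<iota> (carrier M') (\<lambda>x. ?a \<odot>\<^bsub>M'\<^esub> x) E0 E f" unfolding f_def by (rule ext_morphism_comp[OF \<chi> \<phi>])
      have N: "frobenius_module \<iota> (middle E)" and inc: "frob_hom \<iota> M' (middle E) (incl E)"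
        and pr: "lin (middle E) (unit_module \<iota>) (proj E)"
        and ker: "incl E ` carrier M' = {x \<in> carrier (middle E). proj E x = 0}"
        using E by (auto simp: is_extension_def frob_hom_iff)
      interpret N: module "kbar_t \<iota>" "middle E" using N by (simp add: frobenius_module_def)
      have fm: "f (m r) \<in> carrier (middle E)"
        using f frob_hom_closed[of M "middle E" f "m r"] m_carrier[of r] by (auto simp: ext_morphism_def)
      have ix: "incl E x \<in> carrier (middle E)" by (rule frob_hom_closed[OF inc x(1)])
      have "frob (middle E) (f (m r) \<oplus>\<^bsub>middle E\<^esub> incl E x) = f (m r) \<oplus>\<^bsub>middle E\<^esub> incl E x"
        using fixed_iff[OF E f aK x(1)] x(2) by blast
      moreover have "proj E (f (m r) \<oplus>\<^bsub>middle E\<^esub> incl E x) = 1"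
      proof -
        have "proj E (incl E x) = 0" using ker x(1) by blast
        moreover have "proj E (f (m r)) = 1" using f m_carrier[of r] proj_m[of r] by (simp add: ext_morphism_def)
        ultimately show ?thesis using pr fm ix by (simp add: lin_def)
      qed
      ultimately have "ext_split \<iota> E" unfolding ext_split_iff[OF E]
        by (intro bexI[OF _ N.a_closed[OF fm ix]] conjI)
      thus "E \<in> \<zero>\<^bsub>Ext1 \<iota> M'\<^esub>" using E by (simp add: Ext1_def)
    next
      assume "E \<in> \<zero>\<^bsub>Ext1 \<iota> M'\<^esub>"
      hence E: "is_extension \<iota> M' E" and "ext_split \<iota> E" by (auto simp: Ext1_def)
      then obtain e where e: "e \<in> carrier (middle E)" "frob (middle E) e = e" "proj E e = 1"
        by (auto simp: ext_split_iff)
      have N: "frobenius_module \<iota> (middle E)" and inc: "frob_hom \<iota> M' (middle E) (incl E)"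
        and pr: "lin (middle E) (unit_module \<iota>) (proj E)"
        and ker: "incl E ` carrier M' = {x \<in> carrier (middle E). proj E x = 0}"
        using E by (auto simp: is_extension_def frob_hom_iff)
      have kN: "kmod (middle E)" using N by (rule frobenius_module_kmod)
      interpret N: module "kbar_t \<iota>" "middle E" using N by (simp add: frobenius_module_def)
      define h where "h = (\<lambda>z. incl E (?a \<odot>\<^bsub>M'\<^esub> z))"
      have h: "frob_hom \<iota> M' (middle E) h"
        unfolding h_def by (rule frob_hom_comp[OF frob_hom_smult[OF M' aK] inc]) simp
      have hl: "lin M' (middle E) h" using h by (simp add: frob_hom_iff)
      have pi: "proj E (incl E z) = 0" if "z \<in> carrier M'" for z using ker that by blast
      \<comment> \<open>In a split extension with fixed vector e, the image y of m_r can be taken as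
        e - x: from x = \<sigma> x + a w it follows that \<sigma> y = a w + y.\<close>
      define x' where "x' = \<ominus>\<^bsub>M'\<^esub> x"
      have x': "x' \<in> carrier M'" unfolding x'_def using x(1) by (rule M'.a_inv_closed)
      have ix': "incl E x' \<in> carrier (middle E)" by (rule frob_hom_closed[OF inc x'])
      have aw: "?a \<odot>\<^bsub>M'\<^esub> w \<in> carrier M'" using aK w_carrier by (intro M'.smult_closed) auto
      have fx': "frob M' x' = ?a \<odot>\<^bsub>M'\<^esub> w \<oplus>\<^bsub>M'\<^esub> x'"
      proof -
        have sum0: "x \<oplus>\<^bsub>M'\<^esub> x' = \<zero>\<^bsub>M'\<^esub>" unfolding x'_def using x(1) by (rule M'.r_neg)
        have f0: "frob M' \<zero>\<^bsub>M'\<^esub> = \<zero>\<^bsub>M'\<^esub>"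
          using frob_lin_comb[OF M', of 0] kM' by simp
        have fx: "frob M' x \<in> carrier M'" and fxc: "frob M' x' \<in> carrier M'" using frob_closed[OF M'] x(1) x' by auto
        have "frob M' x \<oplus>\<^bsub>M'\<^esub> frob M' x' = \<zero>\<^bsub>M'\<^esub>" using frob_add[OF M' x(1) x'] sum0 f0 by simp
        also have "\<zero>\<^bsub>M'\<^esub> = (frob M' x \<oplus>\<^bsub>M'\<^esub> ?a \<odot>\<^bsub>M'\<^esub> w) \<oplus>\<^bsub>M'\<^esub> x'" unfolding x(2)[symmetric] sum0 ..
        also have "\<dots> = frob M' x \<oplus>\<^bsub>M'\<^esub> (?a \<odot>\<^bsub>M'\<^esub> w \<oplus>\<^bsub>M'\<^esub> x')" using fx aw x' by (rule M'.a_assoc)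
        finally show ?thesis using fx fxc M'.a_closed[OF aw x'] by (metis M'.add.l_cancel)
      qed
      define y where "y i = (if i < r then h (m' i) else e \<oplus>\<^bsub>middle E\<^esub> incl E x')" for i
      have y: "y i \<in> carrier (middle E)" if "i < Suc r" for i
        using e(1) ix' lin_closed[OF hl] m'_carrier by (auto simp: y_def)
      have hcomb: "h (lin_comb M' r m' c) = lin_comb (middle E) r y c" if "\<And>i. i < r \<Longrightarrow> c i \<in> Kt" for c
      proof -
        have "h (lin_comb M' r m' c) = lin_comb (middle E) r (\<lambda>i. h (m' i)) c"
          by (rule lin_lin_comb[OF kM' kN hl]) (use m'_carrier that in auto)
        also have "\<dots> = lin_comb (middle E) r y c"
          by (rule lin_comb_cong) (use m'_carrier that lin_closed[OF hl] kN in \<open>auto simp: y_def\<close>)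
        finally show ?thesis .
      qed
      have fy: "frob (middle E) (y i) = lin_comb (middle E) r y (F i)" if i: "i < r" for i
      proof -
        have "frob (middle E) (y i) = h (frob M' (m' i))" using h m'_carrier[OF i] i by (simp add: y_def frob_hom_def)
        thus ?thesis using hcomb[of "F i"] FK i by (simp add: frob_m')
      qed
      have fl: "frob (middle E) (y r) = lin_comb (middle E) r y v \<oplus>\<^bsub>middle E\<^esub> y r"
      proof -
        have "frob (middle E) (y r) = frob (middle E) e \<oplus>\<^bsub>middle E\<^esub> frob (middle E) (incl E x')"
          using frob_add[OF N e(1) ix'] by (simp add: y_def)
        also have "frob (middle E) (incl E x') = incl E (frob M' x')" using inc x' by (simp add: frob_hom_def)
        also have "\<dots> = incl E (?a \<odot>\<^bsub>M'\<^esub> w) \<oplus>\<^bsub>middle E\<^esub> incl E x'"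
          using inc aw x' by (simp add: fx' frob_hom_def)
        also have "incl E (?a \<odot>\<^bsub>M'\<^esub> w) = lin_comb (middle E) r y v" using hcomb[of v] vK by (simp add: h_def w_def)
        also have "frob (middle E) e \<oplus>\<^bsub>middle E\<^esub> (lin_comb (middle E) r y v \<oplus>\<^bsub>middle E\<^esub> incl E x')
            = lin_comb (middle E) r y v \<oplus>\<^bsub>middle E\<^esub> y r"
        proof -
          have "lin_comb (middle E) r y v \<in> carrier (middle E)"
            by (rule lin_comb_closed[OF kN]) (use y vK in auto)
          moreover have "y r = e \<oplus>\<^bsub>middle E\<^esub> incl E x'" by (simp add: y_def)
          ultimately show ?thesis unfolding e(2) using e(1) ix' by (simp only: N.a_lcomm)
        qed
        finally show ?thesis .
      qed
      define g where "g = lin_ext M (middle E) (Suc r) m y"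
      have "ext_morphism \<iota> (carrier M') (\<lambda>z. ?a \<odot>\<^bsub>M'\<^esub> z) E0 E g"
        unfolding ext_morphism_def middle_E0
      proof (intro conjI ballI)
        show "frob_hom \<iota> M (middle E) g" unfolding g_def by (rule block_hom[OF N y fy fl])
        fix z assume "z \<in> carrier M'"
        then obtain c where c: "\<And>i. i < r \<Longrightarrow> c i \<in> Kt" "z = lin_comb M' r m' c" using basis_cases[OF kM' m'] by metis
        show "g (incl E0 z) = incl E (?a \<odot>\<^bsub>M'\<^esub> z)"
        proof -
          have "g (incl E0 z) = lin_comb (middle E) r y c"
            unfolding g_def c(2) by (rule block_hom_incl[OF kN]) (use y c(1) in auto)
          also have "\<dots> = h z" unfolding c(2) by (rule hcomb[symmetric]) (rule c(1))
          finally show ?thesis by (simp add: h_def)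
        qed
      next
        fix z assume z: "z \<in> carrier M"
        have py: "proj E (y i) = (if i = r then 1 else 0)" if "i < Suc r" for i
        proof (cases "i = r")
          case True
          thus ?thesis using pr e ix' pi[OF x'] by (simp add: y_def lin_def)
        next
          case False
          hence "i < r" using that by simp
          thus ?thesis using pi[of "?a \<odot>\<^bsub>M'\<^esub> m' i"] m'_carrier[of i] aK M'.smult_closed[of ?a "m' i"]
            by (simp add: y_def h_def)
        qed
        show "proj E (g z) = proj E0 z" unfolding g_def by (rule block_hom_proj[OF E]) (use y py z in auto)
      qed
      moreover obtain \<chi> where "ext_morphism \<iota> (carrier M') (\<lambda>x. x) ?E1 E0 \<chi>"
        using ext_equiv_sym[OF is_extension_E0 std_equiv] by (auto simp: ext_equiv_def)
      ultimately have "ext_morphism \<iota> (carrier M') (\<lambda>z. ?a \<odot>\<^bsub>M'\<^esub> z) ?E1 E (\<lambda>z. g (\<chi> z))"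
        by (rule ext_morphism_comp[rotated])
      thus "E \<in> ext_smult \<iota> M' ?a (?C)" unfolding ext_smult_def using E E1_in by blast
    qed
    show "ext_smult \<iota> M' ?a (?C) = \<zero>\<^bsub>Ext1 \<iota> M'\<^esub>" by (rule Set.set_eqI) (rule mem)
  qed
  have sm: "a \<odot>\<^bsub>Ext1 \<iota> M'\<^esub> x = ext_smult \<iota> M' a x" for a x by (simp add: Ext1_def)
  have nz: "map_poly cst a \<noteq> 0 \<longleftrightarrow> a \<noteq> 0" for a by (simp add: poly_eq_iff coeff_map_poly)
  have "torsion_element (Fq_t \<iota>) (Ext1 \<iota> M') (?C) \<longleftrightarrow>
      (\<exists>a. map_poly cst a \<noteq> 0 \<and> ext_smult \<iota> M' (map_poly cst a) (?C) = \<zero>\<^bsub>Ext1 \<iota> M'\<^esub>)"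
    unfolding torsion_element_def Fq_t_simps sm by (simp only: in_carrier simp_thms bex_simps bex_UNIV)
  thus ?thesis unfolding key nz .
qed

end

section \<open>The fixed-vector equation in coordinates\<close>

context C_infinity
begin

lemma lin_comb_zero:
  assumes "kmod M" "\<And>i. i < n \<Longrightarrow> y i \<in> carrier M"
  shows "lin_comb M n y (\<lambda>_. 0) = \<zero>\<^bsub>M\<^esub>"
proof -
  interpret M: module "kbar_t \<iota>" M using assms(1) by (simp add: kmod_def)
  have "lin_comb M n y (\<lambda>_. 0 * 0) = 0 \<odot>\<^bsub>M\<^esub> lin_comb M n y (\<lambda>_. 0)"
    by (rule lin_comb_smult) (use assms in auto)
  thus ?thesis using M.smult_l_null[OF lin_comb_closed[OF assms(1), of n y "\<lambda>_. 0"]] assms(2) by simp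
qed

lemma lin_comb_lin_comb:
  assumes "kmod M" "\<And>j. j < k \<Longrightarrow> b j \<in> carrier M"
    and "\<And>i. i < n \<Longrightarrow> c i \<in> Kt" "\<And>i j. i < n \<Longrightarrow> j < k \<Longrightarrow> F i j \<in> Kt"
  shows "lin_comb M n (\<lambda>i. lin_comb M k b (F i)) c = lin_comb M k b (\<lambda>j. \<Sum>i<n. c i * F i j)"
  using assms(3,4)
proof (induction n)
  case 0
  show ?case using assms(1,2) by (simp add: lin_comb_zero)
next
  case (Suc n)
  have cl: "lin_comb M k b (F i) \<in> carrier M" if "i < Suc n" for i
    using assms(1,2) Suc.prems(2)[OF that] by (intro lin_comb_closed) auto
  have "lin_comb M (Suc n) (\<lambda>i. lin_comb M k b (F i)) c
      = lin_comb M n (\<lambda>i. lin_comb M k b (F i)) c \<oplus>\<^bsub>M\<^esub> c n \<odot>\<^bsub>M\<^esub> lin_comb M k b (F n)"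
    by (rule lin_comb_Suc[OF assms(1)]) (use cl Suc.prems in auto)
  also have "lin_comb M n (\<lambda>i. lin_comb M k b (F i)) c = lin_comb M k b (\<lambda>j. \<Sum>i<n. c i * F i j)"
    by (rule Suc.IH) (use Suc.prems in auto)
  also have "c n \<odot>\<^bsub>M\<^esub> lin_comb M k b (F n) = lin_comb M k b (\<lambda>j. c n * F n j)"
    by (rule lin_comb_smult[symmetric]) (use assms Suc.prems in auto)
  also have "lin_comb M k b (\<lambda>j. \<Sum>i<n. c i * F i j) \<oplus>\<^bsub>M\<^esub> lin_comb M k b (\<lambda>j. c n * F n j)
      = lin_comb M k b (\<lambda>j. (\<Sum>i<n. c i * F i j) + c n * F n j)"
    by (rule lin_comb_add[symmetric]) (use assms Suc.prems in \<open>auto intro!: Kt_sum Kt_mult\<close>)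
  finally show ?case by simp
qed

lemma twp_Phi_entry:
  assumes "\<And>i. 1 \<le> i \<Longrightarrow> i \<le> r \<Longrightarrow> u i \<in> kbar \<iota>" "j < r"
  shows "twp 1 (Phi_entry \<iota> r s u (Suc j) (Suc j)) = Lp ^ wt s r j"
    and "twp 1 (Phi_entry \<iota> r s u (Suc (Suc j)) (Suc j)) = [:u (Suc j):] * Lp ^ wt s r j"
proof -
  have L: "twp 1 ([:- \<theta>, 1:] ^ w) = Lp ^ w" for w
    using twp_pCons[of 1 "- \<theta>" "[:1:]"] minus_pow_qn[of \<theta> 1] by (simp add: twp_power twp_pCons)
  have q: "twp 1 [:qroot \<iota> (u (Suc j)):] = [:u (Suc j):]"
    using qroot_pow(1)[of "u (Suc j)"] assms by (simp add: twp_pCons)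
  show "twp 1 (Phi_entry \<iota> r s u (Suc j) (Suc j)) = Lp ^ wt s r j"
    using assms(2) unfolding wt_def by (simp add: Phi_entry_def L[unfolded One_nat_def])
  show "twp 1 (Phi_entry \<iota> r s u (Suc (Suc j)) (Suc j)) = [:u (Suc j):] * Lp ^ wt s r j"
  proof -
    have "Phi_entry \<iota> r s u (Suc (Suc j)) (Suc j) = [:qroot \<iota> (u (Suc j)):] * [:- \<theta>, 1:] ^ wt s r j"
      using assms(2) by (simp add: Phi_entry_def wt_def)
    thus ?thesis by (simp only: L q twp_mult)
  qed
qed

lemma Phi_entry_zero: "i \<noteq> j \<Longrightarrow> i \<noteq> Suc j \<Longrightarrow> Phi_entry \<iota> r s u (Suc i) (Suc j) = 0"
  by (auto simp: Phi_entry_def)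

definition fixed_row :: "(nat \<Rightarrow> nat) \<Rightarrow> (nat \<Rightarrow> 'c) \<Rightarrow> nat \<Rightarrow> 'f poly \<Rightarrow> (nat \<Rightarrow> 'c poly) \<Rightarrow> bool"
  where "fixed_row s u r a \<delta> \<longleftrightarrow> (\<forall>j<r. \<delta> j \<in> Kt) \<and>
    (\<forall>j<r. \<delta> j = (\<Sum>i<r. twist \<iota> (\<delta> i) * Phi_entry \<iota> r s u (Suc i) (Suc j))
      + map_poly cst a * Phi_entry \<iota> r s u (Suc r) (Suc j))"

text \<open>One twist removes the roots: t - \<theta> becomes t - \<theta>^q, the q-th root of u_j
  becomes u_j, and \<open>twist\<close> is undone. The column sums have two terms, as \<Phi> is
  bidiagonal.\<close>

lemma dual_system_iff_fixed_row:
  assumes u: "\<And>i. 1 \<le> i \<Longrightarrow> i \<le> r \<Longrightarrow> u i \<in> kbar \<iota>" and \<delta>: "\<delta> r = map_poly cst a"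
  shows "dual_system s u r a \<delta> \<longleftrightarrow> fixed_row s u r a \<delta>"
proof -
  have key: "\<delta> j = (\<Sum>i<r. twist \<iota> (\<delta> i) * Phi_entry \<iota> r s u (Suc i) (Suc j)) + map_poly cst a * Phi_entry \<iota> r s u (Suc r) (Suc j)
      \<longleftrightarrow> twp 1 (\<delta> j) = Lp ^ wt s r j * (\<delta> j + [:u (Suc j):] * \<delta> (Suc j))"
    (is "_ = ?S \<longleftrightarrow> _") if K: "\<forall>j<r. \<delta> j \<in> Kt" and j: "j < r" for j
  proof -
    have \<delta>K: "\<delta> j \<in> Kt" if "j \<le> r" for j using that K \<delta> Kt_cst[of a] by (cases "j = r") auto
    have "?S = (\<Sum>i<Suc r. twist \<iota> (\<delta> i) * Phi_entry \<iota> r s u (Suc i) (Suc j))" by (simp add: \<delta>)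
    also have "\<dots> = twist \<iota> (\<delta> j) * Phi_entry \<iota> r s u (Suc j) (Suc j)
        + (if j < r then twist \<iota> (\<delta> (Suc j)) * Phi_entry \<iota> r s u (Suc (Suc j)) (Suc j) else 0)"
      by (rule bidiagonal_column_sum) (use Phi_entry_zero j in auto)
    finally have S: "?S = twist \<iota> (\<delta> j) * Phi_entry \<iota> r s u (Suc j) (Suc j)
        + twist \<iota> (\<delta> (Suc j)) * Phi_entry \<iota> r s u (Suc (Suc j)) (Suc j)" using j by simp
    have "twp 1 (twist \<iota> (\<delta> j)) = \<delta> j" "twp 1 (twist \<iota> (\<delta> (Suc j))) = \<delta> (Suc j)"
      using j by (intro twp_twist \<delta>K, simp)+
    moreover have "twp 1 (Phi_entry \<iota> r s u (Suc j) (Suc j)) = Lp ^ wt s r j"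
      "twp 1 (Phi_entry \<iota> r s u (Suc (Suc j)) (Suc j)) = [:u (Suc j):] * Lp ^ wt s r j"
      by (intro twp_Phi_entry u j; assumption)+
    ultimately have "twp 1 ?S = \<delta> j * Lp ^ wt s r j + \<delta> (Suc j) * ([:u (Suc j):] * Lp ^ wt s r j)"
      by (simp only: S twp_add twp_mult)
    also have "\<dots> = Lp ^ wt s r j * (\<delta> j + [:u (Suc j):] * \<delta> (Suc j))"
      by (simp only: distrib_left distrib_right mult_ac)
    finally have "twp 1 ?S = Lp ^ wt s r j * (\<delta> j + [:u (Suc j):] * \<delta> (Suc j))" .
    from this[symmetric] show ?thesis by (simp only: twp_eq_iff)
  qed
  show ?thesis
  proof (cases "\<forall>j<r. \<delta> j \<in> Kt")
    case True
    have "(\<forall>j<r. \<delta> j = (\<Sum>i<r. twist \<iota> (\<delta> i) * Phi_entry \<iota> r s u (Suc i) (Suc j)) + map_poly cst a * Phi_entry \<iota> r s u (Suc r) (Suc j))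
        \<longleftrightarrow> (\<forall>j<r. twp 1 (\<delta> j) = Lp ^ wt s r j * (\<delta> j + [:u (Suc j):] * \<delta> (Suc j)))"
      by (intro all_cong1 imp_cong refl key True)
    with True \<delta> show ?thesis by (simp only: dual_system_def fixed_row_def simp_thms imp_conjR all_conj_distrib)
  next
    case False
    hence "\<not> dual_system s u r a \<delta>" "\<not> fixed_row s u r a \<delta>" by (auto simp: dual_system_def fixed_row_def)
    thus ?thesis by (simp only:)
  qed
qed

end

context block_data
begin

lemma fixed_coordinates:
  assumes a: "a \<in> Kt"
  shows "(\<exists>x\<in>carrier M'. x = frob M' x \<oplus>\<^bsub>M'\<^esub> a \<odot>\<^bsub>M'\<^esub> w) \<longleftrightarrow>
    (\<exists>\<delta>. (\<forall>j<r. \<delta> j \<in> Kt) \<and> (\<forall>j<r. \<delta> j = (\<Sum>i<r. twist \<iota> (\<delta> i) * F i j) + a * v j))"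
proof -
  have eq: "lin_comb M' r m' \<delta> = frob M' (lin_comb M' r m' \<delta>) \<oplus>\<^bsub>M'\<^esub> a \<odot>\<^bsub>M'\<^esub> w \<longleftrightarrow>
      (\<forall>j<r. \<delta> j = (\<Sum>i<r. twist \<iota> (\<delta> i) * F i j) + a * v j)" if \<delta>: "\<And>j. j < r \<Longrightarrow> \<delta> j \<in> Kt" for \<delta>
  proof -
    have "frob M' (lin_comb M' r m' \<delta>) = lin_comb M' r (\<lambda>i. frob M' (m' i)) (\<lambda>i. twist \<iota> (\<delta> i))"
      using \<delta> m'_carrier by (intro frob_lin_comb M') auto
    also have "\<dots> = lin_comb M' r (\<lambda>i. lin_comb M' r m' (F i)) (\<lambda>i. twist \<iota> (\<delta> i))"
      using \<delta> frob_m' m'_carrier FK by (intro lin_comb_cong kM') (auto intro!: lin_comb_closed kM')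
    also have "\<dots> = lin_comb M' r m' (\<lambda>j. \<Sum>i<r. twist \<iota> (\<delta> i) * F i j)"
      using \<delta> m'_carrier FK by (intro lin_comb_lin_comb kM') auto
    finally have 1: "frob M' (lin_comb M' r m' \<delta>) = lin_comb M' r m' (\<lambda>j. \<Sum>i<r. twist \<iota> (\<delta> i) * F i j)" .
    have 2: "a \<odot>\<^bsub>M'\<^esub> w = lin_comb M' r m' (\<lambda>j. a * v j)"
      unfolding w_def using a vK m'_carrier by (intro lin_comb_smult[symmetric] kM') auto
    have sK: "(\<Sum>i<r. twist \<iota> (\<delta> i) * F i j) \<in> Kt" if "j < r" for j
      using \<delta> FK that by (intro Kt_sum Kt_mult twist_K) auto
    have 3: "frob M' (lin_comb M' r m' \<delta>) \<oplus>\<^bsub>M'\<^esub> a \<odot>\<^bsub>M'\<^esub> w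
        = lin_comb M' r m' (\<lambda>j. (\<Sum>i<r. twist \<iota> (\<delta> i) * F i j) + a * v j)"
      unfolding 1 2 using sK a vK m'_carrier by (intro lin_comb_add[symmetric] kM') (auto intro: Kt_mult)
    show ?thesis unfolding 3
      by (rule lin_comb_eq_iff[OF kM' m']) (use \<delta> sK a vK in \<open>auto intro!: Kt_add[OF _ Kt_mult]\<close>)
  qed
  show ?thesis
  proof
    assume "\<exists>x\<in>carrier M'. x = frob M' x \<oplus>\<^bsub>M'\<^esub> a \<odot>\<^bsub>M'\<^esub> w"
    then obtain x where x: "x \<in> carrier M'" "x = frob M' x \<oplus>\<^bsub>M'\<^esub> a \<odot>\<^bsub>M'\<^esub> w" by blast
    obtain \<delta> where \<delta>: "\<And>i. i < r \<Longrightarrow> \<delta> i \<in> Kt" "x = lin_comb M' r m' \<delta>" using basis_cases[OF kM' m' x(1)] by metis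
    have "\<forall>j<r. \<delta> j = (\<Sum>i<r. twist \<iota> (\<delta> i) * F i j) + a * v j"
      using eq[of \<delta>, OF \<delta>(1)] x(2) unfolding \<delta>(2) by blast
    thus "\<exists>\<delta>. (\<forall>j<r. \<delta> j \<in> Kt) \<and> (\<forall>j<r. \<delta> j = (\<Sum>i<r. twist \<iota> (\<delta> i) * F i j) + a * v j)"
      using \<delta>(1) by (intro exI[of _ \<delta>] conjI) auto
  next
    assume "\<exists>\<delta>. (\<forall>j<r. \<delta> j \<in> Kt) \<and> (\<forall>j<r. \<delta> j = (\<Sum>i<r. twist \<iota> (\<delta> i) * F i j) + a * v j)"
    then obtain \<delta> where \<delta>: "\<And>j. j < r \<Longrightarrow> \<delta> j \<in> Kt" "\<forall>j<r. \<delta> j = (\<Sum>i<r. twist \<iota> (\<delta> i) * F i j) + a * v j" by blast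
    have "lin_comb M' r m' \<delta> = frob M' (lin_comb M' r m' \<delta>) \<oplus>\<^bsub>M'\<^esub> a \<odot>\<^bsub>M'\<^esub> w"
      using eq[of \<delta>] \<delta> by blast
    moreover have "lin_comb M' r m' \<delta> \<in> carrier M'" using \<delta>(1) m'_carrier by (intro lin_comb_closed kM') auto
    ultimately show "\<exists>x\<in>carrier M'. x = frob M' x \<oplus>\<^bsub>M'\<^esub> a \<odot>\<^bsub>M'\<^esub> w" by blast
  qed
qed

end

context C_infinity
begin

lemma Phi_block_data:
  assumes M: "defined_by \<iota> M m (Phi \<iota> r s u)" and M': "defined_by \<iota> M' m' (Phi' \<iota> r s u)"
  shows "block_data \<iota> r M' m' M m (\<lambda>i j. Phi_entry \<iota> r s u (Suc i) (Suc j)) (\<lambda>j. Phi_entry \<iota> r s u (Suc r) (Suc j))"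
proof -
  let ?F = "\<lambda>i j. Phi_entry \<iota> r s u (Suc i) (Suc j)"
  have fM: "frobenius_module \<iota> M" and elM: "elements_mat (Phi \<iota> r s u) \<subseteq> Kt" and bM: "is_basis (kbar_t \<iota>) M (Suc r) m"
    and frM: "\<And>i. i < Suc r \<Longrightarrow> frob M (m i) = lin_comb M (Suc r) m (\<lambda>j. Phi \<iota> r s u $$ (i, j))"
    using M by (auto simp: defined_by_def Phi_def)
  have fM': "frobenius_module \<iota> M'" and bM': "is_basis (kbar_t \<iota>) M' r m'"
    and frM': "\<And>i. i < r \<Longrightarrow> frob M' (m' i) = lin_comb M' r m' (\<lambda>j. Phi' \<iota> r s u $$ (i, j))"
    using M' by (auto simp: defined_by_def Phi'_def)
  have kM: "kmod M" and kM': "kmod M'" using fM fM' by (auto intro: frobenius_module_kmod)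
  have mc: "m i \<in> carrier M" if "i < Suc r" for i using is_basisD[OF bM that] .
  have m'c: "m' i \<in> carrier M'" if "i < r" for i using is_basisD[OF bM' that] .
  have K: "?F i j \<in> Kt" if "i < Suc r" "j < Suc r" for i j
  proof -
    have "Phi \<iota> r s u $$ (i, j) \<in> elements_mat (Phi \<iota> r s u)" using that by (intro elements_matI[of _ "Suc r" "Suc r" i j]) (auto simp: Phi_def)
    thus ?thesis using that elM by (auto simp: Phi_def)
  qed
  interpret M: module "kbar_t \<iota>" M using kM by (simp add: kmod_def)
  have row: "frob M (m i) = lin_comb M r m (?F i) \<oplus>\<^bsub>M\<^esub> ?F i r \<odot>\<^bsub>M\<^esub> m r" if i: "i < Suc r" for i
  proof -
    have "frob M (m i) = lin_comb M (Suc r) m (?F i)"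
      unfolding frM[OF i] by (rule lin_comb_cong) (use i mc kM K in \<open>auto simp: Phi_def\<close>)
    also have "\<dots> = lin_comb M r m (?F i) \<oplus>\<^bsub>M\<^esub> ?F i r \<odot>\<^bsub>M\<^esub> m r"
      by (rule lin_comb_Suc[OF kM]) (use mc K i in auto)
    finally show ?thesis .
  qed
  show "block_data \<iota> r M' m' M m ?F (\<lambda>j. Phi_entry \<iota> r s u (Suc r) (Suc j))"
  proof (unfold_locales, goal_cases)
    case 1 show ?case by (rule fM')
  next
    case 2 show ?case by (rule bM')
  next
    case 3 show ?case by (rule fM)
  next
    case 4 show ?case by (rule bM)
  next
    case (5 i j) thus ?case by (intro K) auto
  next
    case (6 j) thus ?case by (intro K) auto
  next
    case (7 i)
    show ?case unfolding frM'[OF 7] by (rule lin_comb_cong) (use 7 m'c kM' K in \<open>auto simp: Phi'_def\<close>)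
  next
    case (8 i)
    hence "?F i r = 0" by (intro Phi_entry_zero) auto
    moreover have "lin_comb M r m (?F i) \<in> carrier M" using 8 mc K by (intro lin_comb_closed kM) auto
    ultimately show ?case using row[of i] 8 M.smult_l_null[OF mc[of r]] by simp
  next
    case 9
    have "?F r r = 1" by (simp add: Phi_entry_def)
    thus ?case using row[of r] M.smult_one[OF mc[of r]] by simp
  qed
qed

lemma torsion_iff_dual_system:
  assumes M: "defined_by \<iota> M m (Phi \<iota> r s u)" and M': "defined_by \<iota> M' m' (Phi' \<iota> r s u)"
    and u: "\<And>i. 1 \<le> i \<Longrightarrow> i \<le> r \<Longrightarrow> u i \<in> kbar \<iota>"
  shows "torsion_element (Fq_t \<iota>) (Ext1 \<iota> M') (ext_class \<iota> M' (block_extension \<iota> r M' m' M m)) \<longleftrightarrow>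
    (\<exists>a \<delta>. a \<noteq> 0 \<and> dual_system s u r a \<delta>)"
proof -
  interpret B: block_data \<iota> r M' m' M m "\<lambda>i j. Phi_entry \<iota> r s u (Suc i) (Suc j)" "\<lambda>j. Phi_entry \<iota> r s u (Suc r) (Suc j)"
    by (rule Phi_block_data[OF M M'])
  have "(\<exists>\<delta>. fixed_row s u r a \<delta>) \<longleftrightarrow> (\<exists>\<delta>. dual_system s u r a \<delta>)" for a
  proof
    assume "\<exists>\<delta>. fixed_row s u r a \<delta>"
    then obtain \<delta> where "fixed_row s u r a \<delta>" by blast
    \<comment> \<open>\<open>fixed_row\<close> reads \<delta> only below r, so the last entry can be
      set to the value that \<open>dual_system\<close> prescribes.\<close>
    moreover have "fixed_row s u r a (\<delta>(r := map_poly cst a)) \<longleftrightarrow> fixed_row s u r a \<delta>"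
      unfolding fixed_row_def
      by (intro conj_cong all_cong1 imp_cong refl arg_cong2[where f = "(=)"] arg_cong2[where f = "(+)"] sum.cong) auto
    ultimately have "dual_system s u r a (\<delta>(r := map_poly cst a))" using u by (subst dual_system_iff_fixed_row) auto
    thus "\<exists>\<delta>. dual_system s u r a \<delta>" by (rule exI[of _ "\<delta>(r := map_poly cst a)"])
  next
    assume "\<exists>\<delta>. dual_system s u r a \<delta>"
    then obtain \<delta> where \<delta>: "dual_system s u r a \<delta>" by blast
    hence "\<delta> r = map_poly cst a" by (simp add: dual_system_def)
    hence "fixed_row s u r a \<delta>" using u \<delta> by (subst (asm) dual_system_iff_fixed_row) auto
    thus "\<exists>\<delta>. fixed_row s u r a \<delta>" by (rule exI[of _ \<delta>])
  qed
  thus ?thesis unfolding B.torsion_iff B.fixed_coordinates[OF Kt_cst] fixed_row_def[symmetric] by blast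
qed

lemma seg_shift: "seg (\<lambda>i. x (p + i)) a b = seg x (p + a) (p + b)"
  unfolding seg_def by (rule nth_equalityI) (auto simp: add.assoc simp del: upt_Suc)

lemma seg_subset: "(\<And>i. a \<le> i \<Longrightarrow> i \<le> b \<Longrightarrow> x i \<in> S) \<Longrightarrow> set (seg x a b) \<subseteq> S"
  by (auto simp: seg_def less_Suc_eq_le simp del: upt_Suc)

text \<open>Bundled for two uses: the given tuple and its final segments in part (b).\<close>

lemma eulerian_conditions:
  assumes \<pi>: "fundamental_period \<iota> \<pi>"
    and s: "\<And>i. 1 \<le> i \<Longrightarrow> i \<le> r \<Longrightarrow> s i \<ge> 1"
    and u: "\<And>i. 1 \<le> i \<Longrightarrow> i \<le> r \<Longrightarrow> u i \<in> kbar \<iota> \<and> u i \<noteq> 0"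
    and dom: "\<And>i j. 1 \<le> i \<Longrightarrow> i \<le> j \<Longrightarrow> j \<le> r \<Longrightarrow> seg u i j \<in> Li_domain \<iota> (seg s i j)"
    and nz: "\<And>i j. 1 \<le> i \<Longrightarrow> i < j \<Longrightarrow> j \<le> r \<Longrightarrow> Li \<iota> (seg s i j) (seg u i j) \<noteq> 0"
    and r: "r \<ge> 1"
  shows "small s u r" "\<And>j. j < r \<Longrightarrow> fev (Tser s u j) \<theta> \<noteq> 0" "Li \<iota> (seg s 1 r) (seg u 1 r) \<noteq> 0"
    "eulerian \<iota> \<pi> (seg s 1 r) (seg u 1 r) \<longleftrightarrow> fev (Tser s u r) \<theta> \<in> field_k \<iota>"
proof -
  show small: "small s u r" unfolding small_def
  proof (intro allI impI)
    fix i assume i: "1 \<le> i \<and> i \<le> r"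
    have seg1: "seg x i i = [x i]" for x :: "nat \<Rightarrow> 'z" by (simp add: seg_def)
    show "absv (u i) * b\<Omega> ^ s i < 1" using dom[of i i] i by (intro Li_domain_small) (simp add: seg1)
  qed
  have T: "fev (Tser s u j) \<theta> \<noteq> 0" if j: "1 \<le> j" "j \<le> r" for j
  proof (cases "j = 1")
    case True
    thus ?thesis using Tser_1_theta_nonzero[of s u] small_mono[OF small, of 1] u[of 1] r by simp
  next
    case False
    hence "Li \<iota> (seg s 1 j) (seg u 1 j) \<noteq> 0" using j by (intro nz) auto
    thus ?thesis unfolding Li_eq[OF small_mono[OF small j(2)]] using Omega_theta_nonzero by simp
  qed
  show "fev (Tser s u j) \<theta> \<noteq> 0" if "j < r" for j using T[of j] that by (cases j) auto
  show Li: "Li \<iota> (seg s 1 r) (seg u 1 r) \<noteq> 0" using T[of r] r unfolding Li_eq[OF small] by auto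
  have "set (seg u 1 r) \<subseteq> kbar \<iota>" using u by (intro seg_subset) auto
  thus "eulerian \<iota> \<pi> (seg s 1 r) (seg u 1 r) \<longleftrightarrow> fev (Tser s u r) \<theta> \<in> field_k \<iota>"
    unfolding eulerian_def Li_quotient_iff[OF \<pi> small] using Li dom[of 1 r] r by simp
qed

end

theorem theorem4p3p2:
  fixes \<iota> :: "'f::{finite,field} fls alg_closure \<Rightarrow> 'c::{nonarchimedean_field,complete_space}"
    and \<pi> :: 'c
    and r :: nat and s :: "nat \<Rightarrow> nat" and u :: "nat \<Rightarrow> 'c"
    and M :: "('c poly, 'm) frob_module" and m :: "nat \<Rightarrow> 'm"
    and M' :: "('c poly, 'n) frob_module" and m' :: "nat \<Rightarrow> 'n"
  assumes "C_infinity \<iota>"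
    and "fundamental_period \<iota> \<pi>"
    and "r \<ge> 1"
    and "\<And>i. 1 \<le> i \<Longrightarrow> i \<le> r \<Longrightarrow> s i \<ge> 1"
    and "\<And>i. 1 \<le> i \<Longrightarrow> i \<le> r \<Longrightarrow> u i \<in> kbar \<iota> \<and> u i \<noteq> 0"
    and "seg u 1 r \<in> Li_domain \<iota> (seg s 1 r)"
    and "Li \<iota> (seg s 1 r) (seg u 1 r) \<noteq> 0"
    and "defined_by \<iota> M m (Phi \<iota> r s u)"
    and "defined_by \<iota> M' m' (Phi' \<iota> r s u)"
    and "\<And>i j. 1 \<le> i \<Longrightarrow> i \<le> j \<Longrightarrow> j \<le> r \<Longrightarrow> seg u i j \<in> Li_domain \<iota> (seg s i j)"
    and "\<And>i j. 1 \<le> i \<Longrightarrow> i < j \<Longrightarrow> j \<le> r \<Longrightarrow> Li \<iota> (seg s i j) (seg u i j) \<noteq> 0"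
  shows "(eulerian \<iota> \<pi> (seg s 1 r) (seg u 1 r) \<longleftrightarrow>
            torsion_element (Fq_t \<iota>) (Ext1 \<iota> M') (ext_class \<iota> M' (block_extension \<iota> r M' m' M m))) \<and>
         (eulerian \<iota> \<pi> (seg s 1 r) (seg u 1 r) \<longrightarrow>
            (\<forall>i\<in>{2..r}. eulerian \<iota> \<pi> (seg s i r) (seg u i r)))"
proof -
  interpret C_infinity \<iota> by (rule assms(1))
  have small: "small s u r" by (rule eulerian_conditions(1)[of \<pi> r s u]; fact assms)
  have nz: "fev (Tser s u j) \<theta> \<noteq> 0" if "j < r" for j
    by (rule eulerian_conditions(2)[of \<pi> r s u]; fact assms that)
  have eul: "eulerian \<iota> \<pi> (seg s 1 r) (seg u 1 r) \<longleftrightarrow> fev (Tser s u r) \<theta> \<in> field_k \<iota>"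
    by (rule eulerian_conditions(4)[of \<pi> r s u]; fact assms)
  have dual: "eulerian \<iota> \<pi> (seg s 1 r) (seg u 1 r) \<longleftrightarrow> (\<exists>a \<delta>. a \<noteq> 0 \<and> dual_system s u r a \<delta>)"
    unfolding eul using assms(4,5) by (intro value_in_k_iff small nz) auto
  have "eulerian \<iota> \<pi> (seg s i r) (seg u i r)"
    if E: "eulerian \<iota> \<pi> (seg s 1 r) (seg u 1 r)" and i: "i \<in> {2..r}" for i
  proof -
    \<comment> \<open>The final segment from i on becomes a tuple of length k after the shift by p,
      so the results for segments starting at 1 apply to it.\<close>
    define p k where "p = i - 1" and "k = r - p"
    have pk: "i = Suc p" "r = p + k" "k \<ge> 1" using i by (auto simp: p_def k_def)
    define s' u' where "s' = (\<lambda>x. s (p + x))" and "u' = (\<lambda>x. u (p + x))"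
    have seg': "seg s' a b = seg s (p + a) (p + b)" "seg u' a b = seg u (p + a) (p + b)" for a b
      by (simp_all only: s'_def u'_def seg_shift)
    have ec': "small s' u' k" "eulerian \<iota> \<pi> (seg s' 1 k) (seg u' 1 k) \<longleftrightarrow> fev (Tser s' u' k) \<theta> \<in> field_k \<iota>"
    proof -
      have h: "s' x \<ge> 1" "u' x \<in> kbar \<iota> \<and> u' x \<noteq> 0" if "1 \<le> x" "x \<le> k" for x
        using assms(4,5)[of "p + x"] that pk by (auto simp: s'_def u'_def)
      have d: "seg u' a b \<in> Li_domain \<iota> (seg s' a b)" if "1 \<le> a" "a \<le> b" "b \<le> k" for a b
        unfolding seg' using that pk by (intro assms(10)) auto
      have n: "Li \<iota> (seg s' a b) (seg u' a b) \<noteq> 0" if "1 \<le> a" "a < b" "b \<le> k" for a b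
        unfolding seg' using that pk by (intro assms(11)) auto
      show "small s' u' k" by (rule eulerian_conditions(1)[of \<pi> k s' u']; fact assms(2) h d n pk(3))
      show "eulerian \<iota> \<pi> (seg s' 1 k) (seg u' 1 k) \<longleftrightarrow> fev (Tser s' u' k) \<theta> \<in> field_k \<iota>"
        by (rule eulerian_conditions(4)[of \<pi> k s' u']; fact assms(2) h d n pk(3))
    qed
    obtain a \<delta> where a: "a \<noteq> 0" "dual_system s u r a \<delta>" using E unfolding dual by blast
    have "dual_system s' u' k a (\<lambda>c. \<delta> (p + c))"
      unfolding s'_def u'_def by (rule dual_system_shift) (use a(2) pk(2) in simp)
    hence "\<exists>c. evA a * fev (Tser s' u' k) \<theta> = evA c"
      using assms(4) pk by (intro dual_system_imp_value ec'(1)) (auto simp: s'_def)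
    hence "fev (Tser s' u' k) \<theta> \<in> field_k \<iota>" using a(1) by (auto simp: field_k_iff')
    thus ?thesis using ec'(2) unfolding seg' pk(2)[symmetric] by (simp add: pk(1))
  qed
  moreover have "torsion_element (Fq_t \<iota>) (Ext1 \<iota> M') (ext_class \<iota> M' (block_extension \<iota> r M' m' M m)) \<longleftrightarrow>
      (\<exists>a \<delta>. a \<noteq> 0 \<and> dual_system s u r a \<delta>)"
    using assms(5) by (intro torsion_iff_dual_system assms(8,9)) auto
  ultimately show ?thesis unfolding dual by (intro conjI impI ballI) simp_all
qed

end
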